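(* Let $\Omega$ be a smooth bounded domain of $\mathbb{R}^d$, $d\in\{2,3\}$, and let $(\varrho,v)$ be the solution to the inhomogeneous incompressible Navier-Stokes system given by the known global well-posedness theorem recalled in the context, with data $0\le\varrho_0\le\varrho^*$, $v_0\in H^1_0(\Omega)$, $\operatorname{div}v_0=0$ (and the smallness condition recalled there if $d=3$). Then $$\forall t\ge0,\qquad \int_\Omega\varrho(t)|v(t)|^2\,dx\le e^{-\beta_1t}\int_\Omega\varrho_0|v_0|^2\,dx,\qquad\text{where}\quad \beta_1=\frac{2\mu}{\varrho^*C_P^2}.$$
   Context: $C_P$ is the constant in the Poincaré inequality $\|v\|_2\le C_P\|\nabla v\|_2$ for $v\in H^1_0(\Omega)$; $\|\cdot\|_p$ is the norm of $L_p=L_p(\Omega)$; $\varrho^*>0$. System: on $\mathbb{R}_+\times\Omega$, with viscosity $\mu>0$, $$\varrho_t+v\cdot\nabla\varrho=0,\qquad \varrho v_t+\varrho v\cdot\nabla v-\mu\Delta v+\nabla P=0,\qquad \operatorname{div}v=0,$$ with $\varrho|_{t=0}=\varrho_0$, $v|_{t=0}=v_0$ and $v|_{\partial\Omega}=0$. Known global well-posedness theorem (Danchin-Mucha): let $0\le\varrho_0\le\varrho^*$, $v_0\in H^1_0(\Omega)$, $\operatorname{div}v_0=0$. If $d=3$, assume in addition $(\varrho^* )^{3/2}\|\sqrt{\varrho_0}v_0\|_2\|\nabla v_0\|_2\le c\mu^2$, where $c>0$ is the (small) constant whose existence is asserted by that theorem. Then the system has a unique solution $(\varrho,v,P)$ such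 that $\varrho\in L_\infty(\mathbb{R}_+;L_\infty)$, $v\in L_\infty(\mathbb{R}_+;H^1)$, $\sqrt\varrho v_t,\nabla^2v,\nabla P\in L_2(\mathbb{R}_+;L_2)$, $\nabla v\in L_{1,loc}(\mathbb{R}_+;L_\infty)$, $\sqrt\varrho v\in\mathcal{C}(\mathbb{R}_+;L_2)$, $\varrho\in\mathcal{C}(\mathbb{R}_+;L_p)$ for all $1\le p<\infty$. Moreover for every finite $T>0$, $s<1/2$ and $1\le p<\infty$: $v\in H^s(0,T;L_p)$, $\sqrt{t\varrho}\,v_t\in L_\infty(0,T;L_2)$, $\nabla v_t\in L_2(0,T;L_2)$ [as printed in the theorem], and $\nabla(\sqrt tP),\nabla^2(\sqrt tv)\in L_\infty(0,T;L_r)\cap L_2(0,T;L_m)$ for all $1\le r<2$, $1\le m<\infty$ if $d=2$, respectively in $L_\infty(0,T;L_2)\cap L_2(0,T;L_6)$ if $d=3$. *)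

theory Defs
  imports "HOL-Probability.Essential_Supremum"
begin

section \<open>Smooth functions, test functions, smooth domains\<close>

text \<open>For open \<open>U\<close>: continuity of all partial derivatives of order at most \<open>k\<close>.\<close>

primrec Ck_on :: "nat \<Rightarrow> 'a::euclidean_space set \<Rightarrow> ('a \<Rightarrow> 'b::real_normed_vector) \<Rightarrow> bool" where
  "Ck_on 0 U f = continuous_on U f"
| "Ck_on (Suc k) U f =
     ((\<forall>x\<in>U. f differentiable (at x)) \<and>
      (\<forall>b\<in>Basis. Ck_on k U (\<lambda>x. frechet_derivative f (at x) b)))"

definition smooth_on :: "'a::euclidean_space set \<Rightarrow> ('a \<Rightarrow> 'b::real_normed_vector) \<Rightarrow> bool" where
  "smooth_on U f \<longleftrightarrow> (\<forall>k. Ck_on k U f)"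

definition test_fun :: "'a::euclidean_space set \<Rightarrow> ('a \<Rightarrow> 'b::real_normed_vector) \<Rightarrow> bool" where
  "test_fun U \<phi> \<longleftrightarrow>
     smooth_on UNIV \<phi> \<and> (\<exists>K. compact K \<and> K \<subseteq> U \<and> (\<forall>x. x \<notin> K \<longrightarrow> \<phi> x = 0))"

text \<open>Smoothness of the boundary is expressed by local defining functions with nonvanishing
  differential.\<close>

definition smooth_bounded_domain :: "'a::euclidean_space set \<Rightarrow> bool" where
  "smooth_bounded_domain \<Omega> \<longleftrightarrow>
     open \<Omega> \<and> connected \<Omega> \<and> \<Omega> \<noteq> {} \<and> bounded \<Omega> \<and>
     (\<forall>x\<in>frontier \<Omega>. \<exists>U (g :: 'a \<Rightarrow> real).
        open U \<and> x \<in> U \<and> smooth_on U g \<and>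
        (\<forall>y\<in>U. frechet_derivative g (at y) \<noteq> (\<lambda>_. 0)) \<and>
        \<Omega> \<inter> U = {y \<in> U. g y < 0})"

section \<open>Lebesgue spaces\<close>

definition Lp_norm :: "ennreal \<Rightarrow> 'a measure \<Rightarrow> ('a \<Rightarrow> 'b::real_normed_vector) \<Rightarrow> ennreal" where
  "Lp_norm p M f =
     (if p = \<infinity> then esssup M (\<lambda>x. ennreal (norm (f x)))
      else (let r = enn2real p; J = (\<integral>\<^sup>+x. ennreal (norm (f x) powr r) \<partial>M)
            in if J = \<infinity> then \<infinity> else ennreal (enn2real J powr (1 / r))))"

definition in_Lp :: "ennreal \<Rightarrow> 'a measure \<Rightarrow> ('a \<Rightarrow> 'b::real_normed_vector) \<Rightarrow> bool" where
  "in_Lp p M f \<longleftrightarrow> f \<in> borel_measurable M \<and> Lp_norm p M f < \<infinity>"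

text \<open>\<open>f \<in> L\<^sub>q(I; L\<^sub>p(\<Omega>))\<close>. Measurability is joint measurability in \<open>(t, x)\<close>; for \<open>p = \<infinity>\<close>, where
  \<open>L\<^sub>p\<close> is not separable, this is the usual weak-* sense.\<close>

definition in_LqLp ::
  "ennreal \<Rightarrow> ennreal \<Rightarrow> real set \<Rightarrow> 'a::euclidean_space set \<Rightarrow>
     (real \<Rightarrow> 'a \<Rightarrow> 'b::real_normed_vector) \<Rightarrow> bool" where
  "in_LqLp q p I \<Omega> f \<longleftrightarrow>
     (\<lambda>(t, x). f t x) \<in> borel_measurable (lebesgue_on (I \<times> \<Omega>)) \<and>
     (AE t in lebesgue_on I. in_Lp p (lebesgue_on \<Omega>) (f t)) \<and>
     Lp_norm q (lebesgue_on I) (\<lambda>t. enn2real (Lp_norm p (lebesgue_on \<Omega>) (f t))) < \<infinity>"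

definition cont_Lp ::
  "ennreal \<Rightarrow> real set \<Rightarrow> 'a::euclidean_space set \<Rightarrow>
     (real \<Rightarrow> 'a \<Rightarrow> 'b::real_normed_vector) \<Rightarrow> bool" where
  "cont_Lp p I \<Omega> f \<longleftrightarrow>
     (\<forall>t\<in>I. in_Lp p (lebesgue_on \<Omega>) (f t)) \<and>
     (\<forall>t\<in>I. ((\<lambda>s. Lp_norm p (lebesgue_on \<Omega>) (\<lambda>x. f s x - f t x)) \<longlongrightarrow> 0) (at t within I))"

section \<open>Weak derivatives and Sobolev spaces\<close>

definition locally_integrable :: "'a::euclidean_space set \<Rightarrow> ('a \<Rightarrow> 'b::euclidean_space) \<Rightarrow> bool" where
  "locally_integrable U f \<longleftrightarrow> (\<forall>K. compact K \<longrightarrow> K \<subseteq> U \<longrightarrow> f absolutely_integrable_on K)"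

text \<open>\<open>g\<close> is the weak derivative of \<open>f\<close> in direction \<open>e\<close> on the open set \<open>U\<close>.\<close>

definition weak_deriv ::
  "'a::euclidean_space set \<Rightarrow> 'a \<Rightarrow> ('a \<Rightarrow> 'b::euclidean_space) \<Rightarrow> ('a \<Rightarrow> 'b) \<Rightarrow> bool" where
  "weak_deriv U e f g \<longleftrightarrow>
     locally_integrable U f \<and> locally_integrable U g \<and>
     (\<forall>\<phi> :: 'a \<Rightarrow> real. test_fun U \<phi> \<longrightarrow>
        (\<integral>x. frechet_derivative \<phi> (at x) e *\<^sub>R f x \<partial>lebesgue_on U)
          = - (\<integral>x. \<phi> x *\<^sub>R g x \<partial>lebesgue_on U))"

text \<open>A gradient is stored as the vector of its partial derivatives: \<open>D x $ j = \<partial>\<^sub>j u x\<close>. The norm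
  of the resulting vectors of vectors is the Frobenius norm.\<close>

definition weak_grad ::
  "(real^'n) set \<Rightarrow> (real^'n \<Rightarrow> 'b::euclidean_space) \<Rightarrow> (real^'n \<Rightarrow> 'b^'n) \<Rightarrow> bool" where
  "weak_grad \<Omega> u D \<longleftrightarrow> (\<forall>j. weak_deriv \<Omega> (axis j 1) u (\<lambda>x. D x $ j))"

definition grad :: "(real^'n \<Rightarrow> 'b::real_normed_vector) \<Rightarrow> real^'n \<Rightarrow> 'b^'n" where
  "grad \<phi> x = (\<chi> j. frechet_derivative \<phi> (at x) (axis j 1))"

text \<open>\<open>H\<^sup>1\<^sub>0(\<Omega>)\<close>: the closure of the test functions in \<open>H\<^sup>1(\<Omega>)\<close>.\<close>

definition H10 :: "(real^'n) set \<Rightarrow> (real^'n \<Rightarrow> 'b::euclidean_space) set" where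
  "H10 \<Omega> = {u. in_Lp 2 (lebesgue_on \<Omega>) u \<and>
     (\<exists>D. weak_grad \<Omega> u D \<and> in_Lp 2 (lebesgue_on \<Omega>) D \<and>
       (\<exists>\<phi> :: nat \<Rightarrow> real^'n \<Rightarrow> 'b. (\<forall>k. test_fun \<Omega> (\<phi> k)) \<and>
          (\<lambda>k. Lp_norm 2 (lebesgue_on \<Omega>) (\<lambda>x. \<phi> k x - u x)) \<longlonglongrightarrow> 0 \<and>
          (\<lambda>k. Lp_norm 2 (lebesgue_on \<Omega>) (\<lambda>x. grad (\<phi> k) x - D x)) \<longlonglongrightarrow> 0))}"

definition poincare_constant :: "(real^'n) set \<Rightarrow> real \<Rightarrow> bool" where
  "poincare_constant \<Omega> C \<longleftrightarrow> 0 < C \<and>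
     (\<forall>u :: real^'n \<Rightarrow> real^'n. \<forall>D. u \<in> H10 \<Omega> \<longrightarrow> weak_grad \<Omega> u D \<longrightarrow>
        Lp_norm 2 (lebesgue_on \<Omega>) u \<le> ennreal C * Lp_norm 2 (lebesgue_on \<Omega>) D)"

section \<open>The inhomogeneous incompressible Navier-Stokes system\<close>

text \<open>In the next two definitions, \<open>Dv0\<close> is the weak gradient of \<open>v0\<close>.\<close>

definition INS_data ::
  "(real^'n) set \<Rightarrow> real \<Rightarrow> (real^'n \<Rightarrow> real) \<Rightarrow> (real^'n \<Rightarrow> real^'n) \<Rightarrow>
     (real^'n \<Rightarrow> real^'n^'n) \<Rightarrow> bool" where
  "INS_data \<Omega> \<rho>s \<rho>0 v0 Dv0 \<longleftrightarrow>
     \<rho>0 \<in> borel_measurable (lebesgue_on \<Omega>) \<and>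
     (AE x in lebesgue_on \<Omega>. 0 \<le> \<rho>0 x \<and> \<rho>0 x \<le> \<rho>s) \<and>
     v0 \<in> H10 \<Omega> \<and> weak_grad \<Omega> v0 Dv0 \<and>
     (AE x in lebesgue_on \<Omega>. trace (Dv0 x) = 0)"

definition INS_small ::
  "(real^'n) set \<Rightarrow> real \<Rightarrow> real \<Rightarrow> real \<Rightarrow> (real^'n \<Rightarrow> real) \<Rightarrow> (real^'n \<Rightarrow> real^'n) \<Rightarrow>
     (real^'n \<Rightarrow> real^'n^'n) \<Rightarrow> bool" where
  "INS_small \<Omega> c \<mu> \<rho>s \<rho>0 v0 Dv0 \<longleftrightarrow>
     ennreal (\<rho>s powr (3/2))
       * Lp_norm 2 (lebesgue_on \<Omega>) (\<lambda>x. sqrt (\<rho>0 x) *\<^sub>R v0 x)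
       * Lp_norm 2 (lebesgue_on \<Omega>) Dv0
     \<le> ennreal (c * \<mu>\<^sup>2)"

text \<open>Conventions in the definition of a solution:
  \<^item> \<open>vt\<close>, \<open>Dv\<close>, \<open>D2v\<close>, \<open>DP\<close> stand for \<open>v\<^sub>t\<close>, \<open>\<nabla>v\<close>, \<open>\<nabla>\<^sup>2v\<close>, \<open>\<nabla>P\<close>; thus \<open>\<Delta>v = (\<Sum>j. D2v $ j $ j)\<close>
    and \<open>v \<cdot> \<nabla>v = (\<Sum>j. v $ j *\<^sub>R Dv $ j)\<close>. That \<open>v\<^sub>t\<close> is a function (locally integrable on
    \<open>(0,\<infinity>) \<times> \<Omega>\<close>) is what gives a meaning to \<open>\<surd>\<rho> v\<^sub>t\<close>.
  \<^item> \<open>\<rho>\<close> is merely bounded, so \<open>\<rho>\<^sub>t + v \<cdot> \<nabla>\<rho> = 0\<close> is read in the sense of distributions, with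
    \<open>v \<cdot> \<nabla>\<rho> = div (\<rho> v)\<close> because \<open>div v = 0\<close>: the derivative of the test function \<open>\<phi>\<close> in the
    direction \<open>(1, v)\<close> is \<open>\<phi>\<^sub>t + v \<cdot> \<nabla>\<phi>\<close>. All terms of the momentum equation are functions.
  \<^item> \<open>v\<close> is a representative for which \<open>t \<mapsto> \<surd>\<rho>(t) v(t)\<close> is continuous on \<open>[0,\<infinity>)\<close> with values in
    \<open>L\<^sub>2\<close>, which gives a meaning to \<open>\<integral> \<rho>(t) \<bar>v(t)\<bar>\<^sup>2\<close> for every \<open>t \<ge> 0\<close>.
  \<^item> No sign and no upper bound is imposed on \<open>\<rho>\<close>: both follow from the transport equation.\<close>

definition INS_solution ::
  "(real^'n) set \<Rightarrow> real \<Rightarrow> (real^'n \<Rightarrow> real) \<Rightarrow> (real^'n \<Rightarrow> real^'n) \<Rightarrow>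
     (real \<Rightarrow> real^'n \<Rightarrow> real) \<Rightarrow> (real \<Rightarrow> real^'n \<Rightarrow> real^'n) \<Rightarrow> (real \<Rightarrow> real^'n \<Rightarrow> real) \<Rightarrow> bool" where
  "INS_solution \<Omega> \<mu> \<rho>0 v0 \<rho> v P \<longleftrightarrow>
    (\<exists>(vt :: real \<Rightarrow> real^'n \<Rightarrow> real^'n) (Dv :: real \<Rightarrow> real^'n \<Rightarrow> real^'n^'n)
      (D2v :: real \<Rightarrow> real^'n \<Rightarrow> real^'n^'n^'n) (DP :: real \<Rightarrow> real^'n \<Rightarrow> real^'n).
      \<comment> \<open>derivatives and boundary condition\<close>
      weak_deriv ({0<..} \<times> \<Omega>) (1, 0) (\<lambda>(t, x). v t x) (\<lambda>(t, x). vt t x) \<and>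
      (AE t in lebesgue_on {0..}. weak_grad \<Omega> (v t) (Dv t)) \<and>
      (AE t in lebesgue_on {0..}. weak_grad \<Omega> (Dv t) (D2v t)) \<and>
      (\<lambda>(t, x). P t x) \<in> borel_measurable (lebesgue_on ({0..} \<times> \<Omega>)) \<and>
      (AE t in lebesgue_on {0..}. in_Lp 2 (lebesgue_on \<Omega>) (P t) \<and> weak_grad \<Omega> (P t) (DP t)) \<and>
      (AE t in lebesgue_on {0..}. v t \<in> H10 \<Omega>) \<and>
      \<comment> \<open>regularity\<close>
      in_LqLp \<infinity> \<infinity> {0..} \<Omega> \<rho> \<and>
      in_LqLp \<infinity> 2 {0..} \<Omega> v \<and> in_LqLp \<infinity> 2 {0..} \<Omega> Dv \<and>
      in_LqLp 2 2 {0..} \<Omega> (\<lambda>t x. sqrt (\<rho> t x) *\<^sub>R vt t x) \<and>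
      in_LqLp 2 2 {0..} \<Omega> D2v \<and> in_LqLp 2 2 {0..} \<Omega> DP \<and>
      (\<forall>T>0. in_LqLp 1 \<infinity> {0..T} \<Omega> Dv) \<and>
      cont_Lp 2 {0..} \<Omega> (\<lambda>t x. sqrt (\<rho> t x) *\<^sub>R v t x) \<and>
      (\<forall>p. 1 \<le> p \<and> p < \<infinity> \<longrightarrow> cont_Lp p {0..} \<Omega> \<rho>) \<and>
      \<comment> \<open>mass equation, momentum equation, incompressibility\<close>
      (\<forall>\<phi> :: real \<times> (real^'n) \<Rightarrow> real. test_fun ({0<..} \<times> \<Omega>) \<phi> \<longrightarrow>
         (\<integral>z. (case z of (t, x) \<Rightarrow> \<rho> t x * frechet_derivative \<phi> (at (t, x)) (1, v t x))
            \<partial>lebesgue_on ({0<..} \<times> \<Omega>)) = 0) \<and>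
      (AE z in lebesgue_on ({0<..} \<times> \<Omega>). case z of (t, x) \<Rightarrow>
         \<rho> t x *\<^sub>R vt t x + \<rho> t x *\<^sub>R (\<Sum>j\<in>UNIV. (v t x $ j) *\<^sub>R (Dv t x $ j))
           - \<mu> *\<^sub>R (\<Sum>j\<in>UNIV. D2v t x $ j $ j) + DP t x = 0) \<and>
      (AE z in lebesgue_on ({0<..} \<times> \<Omega>). case z of (t, x) \<Rightarrow> trace (Dv t x) = 0) \<and>
      \<comment> \<open>initial conditions\<close>
      (AE x in lebesgue_on \<Omega>. \<rho> 0 x = \<rho>0 x) \<and>
      (AE x in lebesgue_on \<Omega>. v 0 x = v0 x))"

text \<open>\<open>c\<close> is a constant for which the global well-posedness theorem in dimension three holds on
  \<open>\<Omega>\<close>: data that are small with respect to \<open>c\<close> have exactly one solution, where \<open>P\<close> is unique up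
  to functions of time.\<close>

definition well_posedness_constant :: "(real^'n) set \<Rightarrow> real \<Rightarrow> bool" where
  "well_posedness_constant \<Omega> c \<longleftrightarrow> 0 < c \<and>
     (\<forall>\<mu> \<rho>s \<rho>0 v0 Dv0.
        0 < \<mu> \<longrightarrow> 0 < \<rho>s \<longrightarrow> INS_data \<Omega> \<rho>s \<rho>0 v0 Dv0 \<longrightarrow> INS_small \<Omega> c \<mu> \<rho>s \<rho>0 v0 Dv0 \<longrightarrow>
        (\<exists>\<rho> v P. INS_solution \<Omega> \<mu> \<rho>0 v0 \<rho> v P) \<and>
        (\<forall>\<rho> v P \<rho>' v' P'.
           INS_solution \<Omega> \<mu> \<rho>0 v0 \<rho> v P \<longrightarrow> INS_solution \<Omega> \<mu> \<rho>0 v0 \<rho>' v' P' \<longrightarrow>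
           (AE t in lebesgue_on {0..}. AE x in lebesgue_on \<Omega>. \<rho> t x = \<rho>' t x \<and> v t x = v' t x) \<and>
           (AE t in lebesgue_on {0..}. \<exists>k. AE x in lebesgue_on \<Omega>. P t x = P' t x + k)))"

end

theory Submission
  imports Defs
begin

text \<open>Formally the estimate is the energy identity. Testing the momentum equation with \<open>v\<close> gives
  \<open>d/dt \<integral> \<rho> \<bar>v\<bar>\<^sup>2 = - 2 \<mu> \<integral> \<bar>\<nabla>v\<bar>\<^sup>2\<close>: the mass equation turns \<open>\<rho> (v\<^sub>t + v \<cdot> \<nabla>v) \<cdot> v\<close> into half of the derivative
  of the kinetic energy, the boundary condition and \<open>div v = 0\<close> remove the pressure, and integration
  by parts turns \<open>\<mu> \<Delta>v \<cdot> v\<close> into the dissipation. If \<open>0 \<le> \<rho> \<le> \<rho>\<^sub>s\<close>, the Poincare inequality bounds the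
  dissipation below by \<open>\<beta>\<^sub>1 \<integral> \<rho> \<bar>v\<bar>\<^sup>2\<close>, and Gronwall's lemma concludes.

  Three of these steps need work at the given regularity.

  \<^item> The bounds on \<open>\<rho>\<close> for positive times follow from the transport equation, which holds only in the
    sense of distributions. They come from the conservation of \<open>\<integral> \<beta>(\<rho>)\<close> for smooth \<open>\<beta>\<close>
    (\<open>renormalization\<close>, \<open>density_bounds\<close>), proved by the method of DiPerna and Lions: mollification in
    space creates a commutator, which vanishes in the limit because the velocity is Lipschitz with a
    constant that is integrable in time (\<open>commutator_estimate\<close>).

  \<^item> The test functions of the mass equation have compact support in \<open>\<Omega>\<close>, so that a cutoff near the
    boundary has to be inserted and removed. Its gradient is large, but \<open>v\<close> decays linearly at
    the boundary (\<open>h10_boundary_decay\<close>) and compensates this (\<open>cutoff_flow_bound\<close>). The decay holds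
    since \<open>v\<close>, extended by zero, is Lipschitz, and since every point of the complement is a limit of
    exterior points (\<open>smooth_domain_exterior\<close>).

  \<^item> The function \<open>\<bar>v\<bar>\<^sup>2\<close> is not smooth and not bounded. The mass equation is tested with a bounded
    smooth function of the mollified velocity instead (\<open>localized_balance\<close>); afterwards the cutoff
    and the truncation are removed together (\<open>energy_balance\<close>).

  The Gronwall argument is carried out with test functions in time (\<open>energy_decay\<close>). The continuity of
  \<open>t \<mapsto> \<surd>\<rho> v\<close> in \<open>L\<^sub>2\<close> gives the result for every time and identifies the initial energy.\<close>

section \<open>Calculus of smooth functions\<close>

abbreviation "fderiv f x \<equiv> frechet_derivative f (at x)"

lemma Ck_on_imp_continuous_on: "Ck_on k U f \<Longrightarrow> continuous_on U f"
  by (cases k) (auto intro!: differentiable_imp_continuous_on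
      simp: differentiable_on_def differentiable_at_withinI)

lemma Ck_on_SucD: "Ck_on (Suc k) U f \<Longrightarrow> Ck_on k U f"
proof (induction k arbitrary: f)
  case 0 then show ?case using Ck_on_imp_continuous_on[OF 0] by simp
next
  case (Suc k) then show ?case by simp
qed

lemma Ck_on_SucI:
  assumes "\<And>x. (f has_derivative f' x) (at x)" "\<And>b. b \<in> Basis \<Longrightarrow> Ck_on k UNIV (\<lambda>x. f' x b)"
  shows "Ck_on (Suc k) UNIV f"
proof -
  have "fderiv f x = f' x" for x
    using frechet_derivative_at[OF assms(1)] by simp
  then show ?thesis using assms by (auto simp: differentiable_def)
qed

lemma Ck_on_Suc_has_derivative:
  "Ck_on (Suc k) UNIV f \<Longrightarrow> (f has_derivative fderiv f x) (at x)"
  by (simp add: frechet_derivative_works[symmetric])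

lemma Ck_on_const: "Ck_on k UNIV (\<lambda>x::'a::euclidean_space. c::real)"
proof (induction k arbitrary: c)
  case (Suc k)
  show ?case by (rule Ck_on_SucI[of _ "\<lambda>x h. 0"]) (auto intro: Suc)
qed simp

lemma Ck_on_add:
  fixes f g :: "'a::euclidean_space \<Rightarrow> real"
  shows "Ck_on k UNIV f \<Longrightarrow> Ck_on k UNIV g \<Longrightarrow> Ck_on k UNIV (\<lambda>x. f x + g x)"
proof (induction k arbitrary: f g)
  case 0 then show ?case by (auto intro: continuous_intros)
next
  case (Suc k)
  show ?case
    by (rule Ck_on_SucI[OF has_derivative_add[OF Ck_on_Suc_has_derivative[OF Suc(2)]
              Ck_on_Suc_has_derivative[OF Suc(3)]]]) (use Suc in auto)
qed

lemma Ck_on_mult: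
  fixes f g :: "'a::euclidean_space \<Rightarrow> real"
  shows "Ck_on k UNIV f \<Longrightarrow> Ck_on k UNIV g \<Longrightarrow> Ck_on k UNIV (\<lambda>x. f x * g x)"
proof (induction k arbitrary: f g)
  case 0 then show ?case by (auto intro: continuous_intros)
next
  case (Suc k)
  show ?case
    by (rule Ck_on_SucI[OF has_derivative_mult[OF Ck_on_Suc_has_derivative[OF Suc(2)]
              Ck_on_Suc_has_derivative[OF Suc(3)]]])
      (use Suc Ck_on_SucD[OF Suc(2)] Ck_on_SucD[OF Suc(3)] in \<open>auto intro!: Ck_on_add\<close>)
qed

lemma Ck_on_sum:
  fixes f :: "'i \<Rightarrow> 'a::euclidean_space \<Rightarrow> real"
  assumes "finite I" "\<And>i. i \<in> I \<Longrightarrow> Ck_on k UNIV (f i)"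
  shows "Ck_on k UNIV (\<lambda>x. \<Sum>i\<in>I. f i x)"
  using assms by (induction I rule: finite_induct) (auto intro: Ck_on_const Ck_on_add)

lemma Ck_on_prod:
  fixes f :: "'i \<Rightarrow> 'a::euclidean_space \<Rightarrow> real"
  assumes "finite I" "\<And>i. i \<in> I \<Longrightarrow> Ck_on k UNIV (f i)"
  shows "Ck_on k UNIV (\<lambda>x. \<Prod>i\<in>I. f i x)"
  using assms by (induction I rule: finite_induct) (auto intro: Ck_on_const Ck_on_mult)

lemma Ck_on_inverse:
  fixes f :: "'a::euclidean_space \<Rightarrow> real"
  assumes "Ck_on k UNIV f" "\<And>x. f x \<noteq> 0"
  shows "Ck_on k UNIV (\<lambda>x. inverse (f x))"
  using assms(1)
proof (induction k)
  case 0 then show ?case using assms(2) by (auto intro: continuous_intros)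
next
  case (Suc k)
  have "Ck_on k UNIV (\<lambda>x. inverse (f x))" using Suc Ck_on_SucD by blast
  moreover have "Ck_on k UNIV (\<lambda>x. fderiv f x b)" if "b \<in> Basis" for b
    using Suc(2) that by simp
  ultimately have "Ck_on k UNIV (\<lambda>x. (-1) * (inverse (f x) * fderiv f x b * inverse (f x)))"
    if "b \<in> Basis" for b using that by (intro Ck_on_mult Ck_on_const) auto
  then show ?case
    by (intro Ck_on_SucI[OF Deriv.has_derivative_inverse[OF assms(2) Ck_on_Suc_has_derivative[OF Suc(2)]]]) simp
qed

lemma Ck_on_affine:
  fixes f :: "'b::euclidean_space \<Rightarrow> real" and L :: "'a::euclidean_space \<Rightarrow> 'b"
  assumes "bounded_linear L"
  shows "Ck_on k UNIV f \<Longrightarrow> Ck_on k UNIV (\<lambda>x. f (c + L x))"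
proof (induction k arbitrary: f)
  case 0 then show ?case
    using linear_continuous_on[OF assms, of UNIV]
    by (auto intro!: continuous_on_compose2[of UNIV f] continuous_intros)
next
  case (Suc k)
  let ?f = "\<lambda>z. fderiv f z"
  have lin: "bounded_linear (?f z)" for z
    using Ck_on_Suc_has_derivative[OF Suc(2)] has_derivative_bounded_linear by blast
  have d: "((\<lambda>x. f (c + L x)) has_derivative (\<lambda>h. ?f (c + L x) (L h))) (at x)" for x
    using has_derivative_compose[OF _ Ck_on_Suc_has_derivative[OF Suc(2)], of "\<lambda>x. c + L x" L x UNIV]
      has_derivative_add[OF has_derivative_const bounded_linear_imp_has_derivative[OF assms]] by simp
  have e: "?f z h = (\<Sum>i\<in>Basis. (h \<bullet> i) * ?f z i)" for z h
    by (subst euclidean_representation[of h, symmetric])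
      (simp add: linear_sum[OF bounded_linear.linear[OF lin]]
        linear_cmul[OF bounded_linear.linear[OF lin]])
  have "Ck_on k UNIV (\<lambda>x. \<Sum>i\<in>Basis. (L b \<bullet> i) * ?f (c + L x) i)" for b
    using Suc by (intro Ck_on_sum Ck_on_mult Ck_on_const) auto
  then show ?case
    by (intro Ck_on_SucI[OF d]) (simp add: e[symmetric])
qed

lemma Ck_on_exp: "Ck_on k UNIV (\<lambda>t::real. exp (a * t))"
proof (induction k)
  case 0 show ?case by (auto intro: continuous_intros)
next
  case (Suc k)
  show ?case
    by (rule Ck_on_SucI[of _ "\<lambda>t h. (a * h) * exp (a * t)"])
      (auto intro!: derivative_eq_intros Ck_on_mult Ck_on_const Suc)
qed

text \<open>The functions \<open>x\<^sup>-\<^sup>n e\<^sup>-\<^sup>1\<^sup>/\<^sup>x\<close>, extended by zero. The derivative of each is a linear combination of two others,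
  which turns smoothness into an induction.\<close>

definition flat :: "nat \<Rightarrow> real \<Rightarrow> real" where
  "flat n x = (if 0 < x then (1/x)^n * exp (- (1/x)) else 0)"

lemma flat_tendsto_0: "(flat n \<longlongrightarrow> 0) (at 0)"
proof -
  have "((\<lambda>x. x ^ n / exp x) \<longlongrightarrow> (0::real)) at_top" by (rule tendsto_power_div_exp_0)
  then have "((\<lambda>x. inverse x ^ n / exp (inverse x)) \<longlongrightarrow> (0::real)) (at_right 0)"
    by (rule filterlim_compose[OF _ filterlim_inverse_at_top_right])
  then have "(flat n \<longlongrightarrow> 0) (at_right 0)"
    by (rule Lim_transform_eventually)
      (auto simp: flat_def eventually_at_filter exp_minus field_simps)
  moreover have "(flat n \<longlongrightarrow> 0) (at_left 0)"
    by (rule Lim_transform_eventually[of "\<lambda>_. 0"]) (auto simp: flat_def eventually_at_filter)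
  ultimately show ?thesis by (rule filterlim_split_at[rotated])
qed

lemma flat_has_derivative:
  "(flat n has_real_derivative (flat (n + 2) x - n * flat (n + 1) x)) (at x)"
proof (cases x "0::real" rule: linorder_cases)
  case less
  have "((\<lambda>_. 0) has_real_derivative (flat (n + 2) x - n * flat (n + 1) x)) (at x)"
    using less by (simp add: flat_def)
  then show ?thesis
    by (rule has_field_derivative_transform_within_open[of _ _ _ "{..<0}"])
      (use less in \<open>auto simp: flat_def\<close>)
next
  case greater
  have "((\<lambda>x. (1/x)^n * exp (- (1/x))) has_real_derivative (flat (n + 2) x - n * flat (n + 1) x)) (at x)"
    using greater
    by (auto intro!: derivative_eq_intros simp: flat_def field_simps power2_eq_square)
       (cases n; simp add: field_simps power2_eq_square)
  then show ?thesis
    by (rule has_field_derivative_transform_within_open[of _ _ _ "{0<..}"])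
      (use greater in \<open>auto simp: flat_def\<close>)
next
  case equal
  have "((\<lambda>y. (flat n y - flat n 0) / (y - 0)) \<longlongrightarrow> 0) (at 0)"
    using flat_tendsto_0[of "n + 1"]
    by (rule Lim_transform_eventually) (auto simp: flat_def eventually_at_filter)
  then show ?thesis using equal
    by (simp add: has_field_derivative_iff flat_def)
qed

lemma Ck_on_flat: "Ck_on k UNIV (flat n)"
proof (induction k arbitrary: n)
  case 0
  show ?case using flat_has_derivative
    by (auto intro!: DERIV_isCont simp: continuous_on_eq_continuous_at)
next
  case (Suc k)
  have d: "(flat n has_derivative (\<lambda>h. (flat (n + 2) x + (- real n) * flat (n + 1) x) * h)) (at x)" for x
    using flat_has_derivative[of n x] by (simp add: has_field_derivative_def)
  show ?case
    by (rule Ck_on_SucI[OF d]) (intro Ck_on_mult Ck_on_add Ck_on_const Suc)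
qed

text \<open>Each factor pair is nonzero exactly if the coordinate of \<open>z\<close> is smaller than \<open>1 / DIM('a)\<close> in absolute
  value, so that the support lies in the unit ball.\<close>

definition bump :: "'a::euclidean_space \<Rightarrow> real" where
  "bump z = (\<Prod>b\<in>Basis. flat 0 (1 + (real DIM('a) *\<^sub>R b) \<bullet> z) * flat 0 (1 + (- real DIM('a) *\<^sub>R b) \<bullet> z))"

lemma Ck_on_bump: "Ck_on k UNIV (bump :: 'a::euclidean_space \<Rightarrow> real)"
  unfolding bump_def
  by (intro Ck_on_prod Ck_on_mult Ck_on_affine Ck_on_flat bounded_linear_inner_right) auto

lemma bump_nonneg: "0 \<le> bump z"
  by (auto simp: bump_def flat_def intro!: prod_nonneg)

lemma bump_0: "0 < bump 0"
  by (auto simp: bump_def flat_def intro!: prod_pos)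

lemma bump_eq_0:
  fixes z :: "'a::euclidean_space"
  assumes "1 \<le> norm z"
  shows "bump z = 0"
proof (rule ccontr)
  assume "bump z \<noteq> 0"
  then have "\<bar>z \<bullet> b\<bar> < 1 / DIM('a)" if "b \<in> Basis" for b
    using that by (auto simp: bump_def flat_def inner_commute abs_if field_simps split: if_splits)
  then have "(\<Sum>b\<in>Basis. \<bar>z \<bullet> b\<bar>) < (\<Sum>b\<in>(Basis::'a set). 1 / DIM('a))"
    by (intro sum_strict_mono) auto
  then show False using norm_le_l1[of z] assms by simp
qed

section \<open>Test functions\<close>

lemma test_fun_Ck: "test_fun U \<phi> \<Longrightarrow> Ck_on k UNIV \<phi>"
  by (simp add: test_fun_def smooth_on_def)

lemma test_fun_has_derivative:
  "test_fun U \<phi> \<Longrightarrow> (\<phi> has_derivative fderiv \<phi> x) (at x)"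
  using Ck_on_Suc_has_derivative[OF test_fun_Ck[of U \<phi> "Suc 0"]] by simp

lemma test_fun_continuous: "test_fun U \<phi> \<Longrightarrow> continuous_on UNIV \<phi>"
  using test_fun_Ck[of U \<phi> 0] by simp

lemma test_fun_measurable: "test_fun U \<phi> \<Longrightarrow> \<phi> \<in> borel_measurable borel"
  by (intro borel_measurable_continuous_onI test_fun_continuous)

lemma test_fun_support: "test_fun U \<phi> \<Longrightarrow> x \<notin> U \<Longrightarrow> \<phi> x = 0"
  by (auto simp: test_fun_def)

lemma test_fun_mono: "test_fun U \<phi> \<Longrightarrow> U \<subseteq> V \<Longrightarrow> test_fun V \<phi>"
  unfolding test_fun_def by blast

lemma frechet_derivative_outside_support:
  assumes "closed K" "\<And>x. x \<notin> K \<Longrightarrow> \<phi> x = 0" "x \<notin> K"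
  shows "(\<phi> has_derivative (\<lambda>h. 0)) (at x)" "fderiv \<phi> x = (\<lambda>h. 0)"
proof -
  show "(\<phi> has_derivative (\<lambda>h. 0)) (at x)"
    by (rule has_derivative_transform_within_open[of "\<lambda>_. 0" _ _ _ "- K"]) (use assms in auto)
  then show "fderiv \<phi> x = (\<lambda>h. 0)"
    by (metis frechet_derivative_at)
qed

lemma frechet_derivative_Basis:
  assumes "(\<phi> has_derivative D) (at x)"
  shows "D h = (\<Sum>i\<in>Basis. (h \<bullet> i) *\<^sub>R D i)"
proof -
  have "linear D" using assms has_derivative_linear by blast
  then show ?thesis
    by (subst euclidean_representation[of h, symmetric]) (simp add: linear_sum linear_cmul)
qed

lemma test_fun_deriv:
  fixes \<phi> :: "'a::euclidean_space \<Rightarrow> real"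
  assumes "test_fun U \<phi>"
  shows "test_fun U (\<lambda>x. fderiv \<phi> x e)"
proof -
  obtain K where K: "compact K" "K \<subseteq> U" "\<And>x. x \<notin> K \<Longrightarrow> \<phi> x = 0"
    using assms by (auto simp: test_fun_def)
  have "Ck_on k UNIV (\<lambda>x. fderiv \<phi> x e)" for k
  proof -
    have "Ck_on k UNIV (\<lambda>x. \<Sum>i\<in>Basis. (e \<bullet> i) * fderiv \<phi> x i)"
      using test_fun_Ck[OF assms, of "Suc k"] by (intro Ck_on_sum Ck_on_mult Ck_on_const) auto
    moreover have "(\<lambda>x. fderiv \<phi> x e) = (\<lambda>x. \<Sum>i\<in>Basis. (e \<bullet> i) * fderiv \<phi> x i)"
      by (intro ext, subst frechet_derivative_Basis[OF test_fun_has_derivative[OF assms], of _ e]) simp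
    ultimately show ?thesis by simp
  qed
  then show ?thesis
    using K frechet_derivative_outside_support(2)[OF compact_imp_closed[OF K(1)] K(3)]
    by (auto simp: test_fun_def smooth_on_def intro!: exI[of _ K])
qed

lemma compact_support_bounded:
  fixes \<phi> :: "'a::euclidean_space \<Rightarrow> 'b::real_normed_vector"
  assumes "continuous_on UNIV \<phi>" "compact K" "\<And>x. x \<notin> K \<Longrightarrow> \<phi> x = 0"
  shows "\<exists>B>0. \<forall>x. norm (\<phi> x) \<le> B"
proof -
  have "compact (\<phi> ` K)" using assms by (intro compact_continuous_image) (auto intro: continuous_on_subset)
  then obtain B where B: "\<And>x. x \<in> K \<Longrightarrow> norm (\<phi> x) \<le> B"
    using compact_imp_bounded bounded_iff by (metis imageI)
  have "norm (\<phi> x) \<le> max B 1" for x using B[of x] assms(3)[of x] by (cases "x \<in> K") auto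
  then show ?thesis by (intro exI[of _ "max B 1"]) auto
qed

lemma test_fun_bounded:
  assumes "test_fun U \<phi>"
  shows "\<exists>B>0. \<forall>x. norm (\<phi> x) \<le> B"
proof -
  obtain K where K: "compact K" "\<And>x. x \<notin> K \<Longrightarrow> \<phi> x = 0" using assms by (auto simp: test_fun_def)
  show ?thesis by (rule compact_support_bounded[OF test_fun_continuous[OF assms] K])
qed

lemma test_fun_deriv_bounded:
  fixes \<phi> :: "'a::euclidean_space \<Rightarrow> real"
  assumes "test_fun U \<phi>"
  shows "\<exists>B>0. \<forall>x h. \<bar>fderiv \<phi> x h\<bar> \<le> B * norm h"
proof -
  have "\<exists>B. 0 < B \<and> (\<forall>x. \<bar>fderiv \<phi> x i\<bar> \<le> B)" for i
    using test_fun_bounded[OF test_fun_deriv[OF assms, of i]] by simp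
  then have "\<exists>B. \<forall>i. 0 < B i \<and> (\<forall>x. \<bar>fderiv \<phi> x i\<bar> \<le> B i)"
    by (intro choice allI)
  then obtain B where "\<forall>i. 0 < B i \<and> (\<forall>x. \<bar>fderiv \<phi> x i\<bar> \<le> B i)" ..
  then have B: "\<And>i. 0 < B i" "\<And>i x. \<bar>fderiv \<phi> x i\<bar> \<le> B i" by auto
  show ?thesis
  proof (intro exI[of _ "\<Sum>i\<in>(Basis::'a set). B i"] conjI allI)
    show "0 < (\<Sum>i\<in>(Basis::'a set). B i)" using B(1) by (intro sum_pos) auto
    fix x h
    have "\<bar>fderiv \<phi> x h\<bar> \<le> (\<Sum>i\<in>Basis. \<bar>(h \<bullet> i) * fderiv \<phi> x i\<bar>)"
      by (subst frechet_derivative_Basis[OF test_fun_has_derivative[OF assms], of x h])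
        (simp add: sum_abs)
    also have "\<dots> \<le> (\<Sum>i\<in>Basis. norm h * B i)"
      using B(2) Basis_le_norm by (auto intro!: sum_mono mult_mono simp: abs_mult)
    finally show "\<bar>fderiv \<phi> x h\<bar> \<le> (\<Sum>i\<in>Basis. B i) * norm h"
      by (simp add: sum_distrib_left mult.commute)
  qed
qed

lemma integrable_compact_support:
  fixes \<phi> :: "'a::euclidean_space \<Rightarrow> 'b::{banach, second_countable_topology}"
  assumes "continuous_on UNIV \<phi>" "compact K" "\<And>x. x \<notin> K \<Longrightarrow> \<phi> x = 0"
  shows "integrable lborel \<phi>"
proof -
  have "integrable lborel (\<lambda>x. indicator K x *\<^sub>R \<phi> x)"
    using borel_integrable_compact[OF assms(2), of \<phi>] assms(1) continuous_on_subset by blast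
  moreover have "(\<lambda>x. indicator K x *\<^sub>R \<phi> x) = \<phi>" using assms(3) by (auto simp: indicator_def)
  ultimately show ?thesis by simp
qed

lemma test_fun_integrable:
  fixes \<phi> :: "'a::euclidean_space \<Rightarrow> 'b::{banach, second_countable_topology}"
  assumes "test_fun U \<phi>"
  shows "integrable lborel \<phi>"
proof -
  obtain K where K: "compact K" "\<And>x. x \<notin> K \<Longrightarrow> \<phi> x = 0" using assms by (auto simp: test_fun_def)
  show ?thesis by (rule integrable_compact_support[OF test_fun_continuous[OF assms] K])
qed

lemma compact_support_uniformly_continuous:
  fixes \<phi> :: "'a::euclidean_space \<Rightarrow> 'b::real_normed_vector"
  assumes c: "continuous_on UNIV \<phi>" and K: "compact K" "\<And>x. x \<notin> K \<Longrightarrow> \<phi> x = 0"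
  shows "uniformly_continuous_on UNIV \<phi>"
proof -
  define K' where "K' = {x + y | x y. x \<in> K \<and> y \<in> cball 0 1}"
  have "compact K'" unfolding K'_def using K by (intro compact_sums) auto
  then have u: "uniformly_continuous_on K' \<phi>"
    using c continuous_on_subset compact_uniformly_continuous by blast
  have K': "y \<in> K'" if "x \<in> K" "dist y x \<le> 1" for x y
    unfolding K'_def mem_Collect_eq using that
    by (intro exI[of _ x] exI[of _ "y - x"]) (auto simp: dist_norm norm_minus_commute)
  show ?thesis unfolding uniformly_continuous_on_def
  proof (intro allI impI)
    fix e :: real assume "0 < e"
    then obtain d where d: "0 < d" "\<And>x x'. x \<in> K' \<Longrightarrow> x' \<in> K' \<Longrightarrow> dist x' x < d \<Longrightarrow> dist (\<phi> x') (\<phi> x) < e"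
      using u unfolding uniformly_continuous_on_def by metis
    have "dist (\<phi> y) (\<phi> x) < e" if "dist y x < min d 1" for x y
      using that d(2)[of x y] K'[of x x] K'[of x y] K'[of y x] K'[of y y] K(2)[of x] K(2)[of y] \<open>0 < e\<close>
      by (cases "x \<in> K \<or> y \<in> K") (auto simp: dist_commute)
    then show "\<exists>d>0. \<forall>x\<in>UNIV. \<forall>y\<in>UNIV. dist y x < d \<longrightarrow> dist (\<phi> y) (\<phi> x) < e"
      using \<open>0 < d\<close> by (intro exI[of _ "min d 1"]) auto
  qed
qed

lemma test_fun_uniformly_continuous:
  assumes "test_fun U \<phi>"
  shows "uniformly_continuous_on UNIV \<phi>"
proof -
  obtain K where K: "compact K" "\<And>x. x \<notin> K \<Longrightarrow> \<phi> x = 0" using assms by (auto simp: test_fun_def)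
  show ?thesis by (rule compact_support_uniformly_continuous[OF test_fun_continuous[OF assms] K])
qed

text \<open>The modulus of continuity of the differential controls the remainder of the first order
  expansion, uniformly in the base point.\<close>

lemma test_fun_uniformly_differentiable:
  fixes \<phi> :: "'a::euclidean_space \<Rightarrow> real"
  assumes "test_fun U \<phi>" "0 < e"
  shows "\<exists>d>0. \<forall>z h. norm h < d \<longrightarrow> \<bar>\<phi> (z + h) - \<phi> z - fderiv \<phi> z h\<bar> \<le> e * norm h"
proof -
  let ?D = "\<lambda>z. fderiv \<phi> z"
  let ?N = "real DIM('a)"
  note hd = test_fun_has_derivative[OF assms(1)]
  have "\<exists>d>0. \<forall>x y. dist y x < d \<longrightarrow> dist (?D y i) (?D x i) < e / ?N" for i
    using test_fun_uniformly_continuous[OF test_fun_deriv[OF assms(1), of i]] assms(2)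
    unfolding uniformly_continuous_on_def by (metis DIM_positive UNIV_I divide_pos_pos of_nat_0_less_iff)
  then have "\<exists>d. \<forall>i. 0 < d i \<and> (\<forall>x y. dist y x < d i \<longrightarrow> dist (?D y i) (?D x i) < e / ?N)"
    by (intro choice allI)
  then obtain d where "\<forall>i. 0 < d i \<and> (\<forall>x y. dist y x < d i \<longrightarrow> dist (?D y i) (?D x i) < e / ?N)" ..
  then have d: "\<And>i. 0 < d i" "\<And>i x y. dist y x < d i \<Longrightarrow> dist (?D y i) (?D x i) < e / ?N"
    by auto
  define \<delta> where "\<delta> = Min (d ` (Basis :: 'a set))"
  have \<delta>: "0 < \<delta>" "\<And>i. i \<in> Basis \<Longrightarrow> \<delta> \<le> d i" using d(1) by (auto simp: \<delta>_def)
  have on: "onorm (\<lambda>h. ?D y h - ?D x h) \<le> e" if "dist y x < \<delta>" for x y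
  proof (rule onorm_le)
    fix h
    have "\<bar>?D y h - ?D x h\<bar> = \<bar>\<Sum>i\<in>Basis. (h \<bullet> i) * (?D y i - ?D x i)\<bar>"
      unfolding frechet_derivative_Basis[OF hd, of y h] frechet_derivative_Basis[OF hd, of x h]
      by (simp add: sum_subtractf right_diff_distrib)
    also have "\<dots> \<le> (\<Sum>i\<in>(Basis::'a set). norm h * (e / ?N))"
    proof (rule order.trans[OF sum_abs], rule sum_mono)
      fix i :: 'a assume i: "i \<in> Basis"
      have "\<bar>?D y i - ?D x i\<bar> \<le> e / ?N"
        using d(2)[of y x i] \<delta>(2)[OF i] that by (simp add: dist_real_def)
      then show "\<bar>h \<bullet> i * (?D y i - ?D x i)\<bar> \<le> norm h * (e / ?N)"
        unfolding abs_mult by (intro mult_mono Basis_le_norm[OF i]) auto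
    qed
    finally show "norm (?D y h - ?D x h) \<le> e * norm h" by (simp add: mult.commute)
  qed
  show ?thesis
  proof (intro exI[of _ \<delta>] conjI allI impI)
    fix z h :: 'a assume h: "norm h < \<delta>"
    have "norm (\<phi> (z + h) - \<phi> z - ?D z (z + h - z)) \<le> norm (z + h - z) * e"
    proof (rule differentiable_bound_linearization[of _ _ "ball z \<delta>"])
      fix t :: real assume "t \<in> {0..1}"
      then have "\<bar>t\<bar> * norm h \<le> 1 * norm h" by (intro mult_right_mono) auto
      then show "z + t *\<^sub>R (z + h - z) \<in> ball z \<delta>" using h by (simp add: dist_norm)
    next
      fix x assume "x \<in> ball z \<delta>"
      then show "onorm (?D x - ?D z) \<le> e"
        using on[of x z] by (simp add: fun_diff_def dist_commute)
    qed (use hd \<delta>(1) in \<open>auto intro: has_derivative_at_withinI\<close>)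
    then show "\<bar>\<phi> (z + h) - \<phi> z - ?D z h\<bar> \<le> e * norm h" by (simp add: mult.commute)
  qed (rule \<delta>)
qed

section \<open>Affine substitutions\<close>

lemma lborel_affine_integrable:
  fixes f :: "'a::euclidean_space \<Rightarrow> 'b::{banach, second_countable_topology}"
  assumes "c \<noteq> 0" "integrable lborel f"
  shows "integrable lborel (\<lambda>x. f (t + c *\<^sub>R x))"
    and "(LBINT x. f (t + c *\<^sub>R x)) = (1 / \<bar>c\<bar> ^ DIM('a)) *\<^sub>R (LBINT x. f x)"
proof -
  have "f \<in> borel_measurable borel" using assms(2) borel_measurable_integrable by simp
  note [measurable] = this
  have e: "lborel = density (distr lborel borel (\<lambda>x::'a. t + c *\<^sub>R x)) (\<lambda>_. ennreal (\<bar>c\<bar> ^ DIM('a)))"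
    using lborel_affine[OF assms(1), of t] by simp
  have "integrable (density (distr lborel borel (\<lambda>x::'a. t + c *\<^sub>R x)) (\<lambda>_. ennreal (\<bar>c\<bar> ^ DIM('a)))) f"
    using assms(2) e by metis
  then have 1: "integrable lborel (\<lambda>x. \<bar>c\<bar> ^ DIM('a) *\<^sub>R f (t + c *\<^sub>R x))"
    by (subst (asm) integrable_density) (auto simp: integrable_distr_eq)
  then have "integrable lborel (\<lambda>x. (1 / \<bar>c\<bar> ^ DIM('a)) *\<^sub>R (\<bar>c\<bar> ^ DIM('a) *\<^sub>R f (t + c *\<^sub>R x)))"
    by (rule integrable_scaleR_right)
  then show "integrable lborel (\<lambda>x. f (t + c *\<^sub>R x))" using assms(1) by simp
  have "(LBINT x. f x) = (\<integral>x. f x \<partial>density (distr lborel borel (\<lambda>x::'a. t + c *\<^sub>R x)) (\<lambda>_. ennreal (\<bar>c\<bar> ^ DIM('a))))"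
    using e by metis
  also have "\<dots> = (LBINT x. \<bar>c\<bar> ^ DIM('a) *\<^sub>R f (t + c *\<^sub>R x))"
    by (subst integral_density) (auto simp: integral_distr)
  finally show "(LBINT x. f (t + c *\<^sub>R x)) = (1 / \<bar>c\<bar> ^ DIM('a)) *\<^sub>R (LBINT x. f x)"
    using assms(1) by simp
qed

lemma lborel_shift:
  fixes f :: "'a::euclidean_space \<Rightarrow> 'b::{banach, second_countable_topology}"
  assumes "integrable lborel f"
  shows "integrable lborel (\<lambda>x. f (x + t))" "(LBINT x. f (x + t)) = (LBINT x. f x)"
    "integrable lborel (\<lambda>x. f (x - t))" "(LBINT x. f (x - t)) = (LBINT x. f x)"
    "integrable lborel (\<lambda>x. f (t - x))" "(LBINT x. f (t - x)) = (LBINT x. f x)"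
  using lborel_affine_integrable[OF _ assms, of 1 t] lborel_affine_integrable[OF _ assms, of 1 "- t"]
    lborel_affine_integrable[OF _ assms, of "-1" t] by (simp_all add: add.commute)

section \<open>Convolution with a test function\<close>

definition conv :: "('a::euclidean_space \<Rightarrow> real) \<Rightarrow> ('a \<Rightarrow> 'b::euclidean_space) \<Rightarrow> 'a \<Rightarrow> 'b" where
  "conv \<phi> f x = (LBINT y. \<phi> (x - y) *\<^sub>R f y)"

lemma integrable_bounded_mult:
  fixes f :: "'a \<Rightarrow> 'b::{banach, second_countable_topology}"
  assumes "integrable M f" "g \<in> borel_measurable M" "\<And>x. \<bar>g x\<bar> \<le> B"
  shows "integrable M (\<lambda>x. g x *\<^sub>R f x)"
proof (rule Bochner_Integration.integrable_bound)
  show "integrable M (\<lambda>x. B * norm (f x))" using assms(1) by auto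
  show "AE x in M. norm (g x *\<^sub>R f x) \<le> norm (B * norm (f x))"
    using assms(3) by (auto intro!: AE_I2 mult_right_mono simp: abs_mult intro: order_trans[OF _ abs_ge_self])
qed (use assms in auto)

lemma conv_integrable:
  fixes f :: "'a::euclidean_space \<Rightarrow> 'b::{banach, second_countable_topology}"
  assumes "test_fun U \<phi>" "integrable lborel f"
  shows "integrable lborel (\<lambda>y. \<phi> (x - y) *\<^sub>R f y)"
proof -
  obtain B where B: "0 < B" "\<And>x. norm (\<phi> x) \<le> B" using test_fun_bounded[OF assms(1)] by blast
  have [measurable]: "\<phi> \<in> borel_measurable borel" by (rule test_fun_measurable[OF assms(1)])
  show ?thesis using B(2) by (intro integrable_bounded_mult[OF assms(2), of _ B]) auto
qed

lemma conv_has_derivative: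
  fixes f :: "'a::euclidean_space \<Rightarrow> 'b::euclidean_space"
  assumes \<phi>: "test_fun U \<phi>" and f: "integrable lborel f"
  shows "(conv \<phi> f has_derivative (\<lambda>h. conv (\<lambda>z. fderiv \<phi> z h) f x)) (at x)"
  unfolding has_derivative_at_alt
proof (intro conjI allI impI)
  let ?D = "\<lambda>z. fderiv \<phi> z"
  note int = conv_integrable[OF \<phi> f] conv_integrable[OF test_fun_deriv[OF \<phi>] f]
  have lin: "linear (?D z)" for z
    using test_fun_has_derivative[OF \<phi>] has_derivative_linear by blast
  have "linear (\<lambda>h. conv (\<lambda>z. ?D z h) f x)"
    using int(2)
    by (intro linearI) (simp_all add: conv_def linear_add[OF lin] linear_cmul[OF lin] scaleR_add_left
        flip: scaleR_scaleR)
  then show "bounded_linear (\<lambda>h. conv (\<lambda>z. ?D z h) f x)" by (simp add: linear_conv_bounded_linear)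
  fix e :: real assume "0 < e"
  define C where "C = (LBINT y. norm (f y))"
  have C: "0 \<le> C" by (simp add: C_def)
  have "0 < e / (C + 1)" using \<open>0 < e\<close> C by simp
  then obtain d where d: "0 < d"
    "\<And>z h. norm h < d \<Longrightarrow> \<bar>\<phi> (z + h) - \<phi> z - ?D z h\<bar> \<le> e / (C + 1) * norm h"
    using test_fun_uniformly_differentiable[OF \<phi>] by meson
  show "\<exists>d>0. \<forall>y. norm (y - x) < d \<longrightarrow>
      norm (conv \<phi> f y - conv \<phi> f x - conv (\<lambda>z. ?D z (y - x)) f x) \<le> e * norm (y - x)"
  proof (intro exI[of _ d] conjI allI impI)
    fix y assume y: "norm (y - x) < d"
    have "conv \<phi> f y - conv \<phi> f x - conv (\<lambda>z. ?D z (y - x)) f x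
        = (LBINT w. (\<phi> (y - w) - \<phi> (x - w) - ?D (x - w) (y - x)) *\<^sub>R f w)"
      using int by (simp add: conv_def scaleR_diff_left)
    also have "norm \<dots> \<le> (LBINT w. (e / (C + 1) * norm (y - x)) * norm (f w))"
    proof (rule Bochner_Integration.integral_norm_bound_integral)
      show "norm ((\<phi> (y - w) - \<phi> (x - w) - ?D (x - w) (y - x)) *\<^sub>R f w) \<le> (e / (C + 1) * norm (y - x)) * norm (f w)" for w
        using mult_right_mono[OF d(2)[OF y, of "x - w"], of "norm (f w)"] by simp
    qed (use int f in \<open>auto simp: scaleR_diff_left\<close>)
    also have "\<dots> = (C / (C + 1)) * (e * norm (y - x))" by (simp add: C_def)
    also have "\<dots> \<le> 1 * (e * norm (y - x))"
      using C \<open>0 < e\<close> by (intro mult_right_mono) (auto simp: field_simps)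
    finally show "norm (conv \<phi> f y - conv \<phi> f x - conv (\<lambda>z. ?D z (y - x)) f x) \<le> e * norm (y - x)" by simp
  qed (rule d)
qed

lemma frechet_derivative_conv:
  assumes "test_fun U \<phi>" "integrable lborel f"
  shows "fderiv (conv \<phi> f) x h = conv (\<lambda>z. fderiv \<phi> z h) f x"
  using frechet_derivative_at[OF conv_has_derivative[OF assms]] by metis

lemma Ck_on_conv:
  assumes "test_fun U \<phi>" "integrable lborel f"
  shows "Ck_on k UNIV (conv \<phi> f)"
  using assms(1)
proof (induction k arbitrary: \<phi>)
  case 0
  have "continuous (at x) (conv \<phi> f)" for x
    by (rule has_derivative_continuous[OF conv_has_derivative[OF 0 assms(2)]])
  then show ?case by (simp add: continuous_on_eq_continuous_at)
next
  case (Suc k)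
  show ?case
    by (rule Ck_on_SucI[OF conv_has_derivative[OF Suc(2) assms(2)]])
      (rule Suc(1)[OF test_fun_deriv[OF Suc(2)]])
qed

section \<open>Mollifiers\<close>

definition mollifier :: "real \<Rightarrow> 'a::euclidean_space \<Rightarrow> real" where
  "mollifier \<kappa> z = bump ((1 / \<kappa>) *\<^sub>R z) / (\<kappa> ^ DIM('a) * (\<integral>x. bump x \<partial>(lborel :: 'a measure)))"

lemma test_fun_bump: "test_fun UNIV (bump :: 'a::euclidean_space \<Rightarrow> real)"
  unfolding test_fun_def smooth_on_def
  by (auto intro!: exI[of _ "cball 0 1"] Ck_on_bump bump_eq_0)

lemma integral_bump_pos: "0 < (\<integral>x. bump x \<partial>(lborel :: 'a::euclidean_space measure))"
proof -
  let ?S = "{x. bump x \<noteq> (0::real)} :: 'a set"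
  have "continuous_on UNIV (bump :: 'a \<Rightarrow> real)" using test_fun_continuous[OF test_fun_bump] .
  then have "open ?S" by (intro open_Collect_neq continuous_on_const) simp_all
  moreover have "(0::'a) \<in> ?S" using bump_0[where 'a='a] by simp
  ultimately have "\<not> negligible ?S" using open_not_negligible by blast
  moreover have "negligible ?S" if "AE x in lborel. bump (x::'a) = 0"
  proof -
    have "?S \<in> sets lborel" using \<open>open ?S\<close> by simp
    then have "?S \<in> null_sets lborel" using that AE_iff_null_sets[of ?S lborel] by simp
    then show ?thesis by (simp add: negligible_iff_null_sets null_sets_completionI)
  qed
  ultimately have "\<not> (AE x in lborel. bump (x::'a) = 0)" by blast
  then have "(\<integral>x. bump x \<partial>(lborel :: 'a measure)) \<noteq> 0"
    using integral_nonneg_eq_0_iff_AE[OF test_fun_integrable[OF test_fun_bump]] bump_nonneg by auto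
  moreover have "0 \<le> (\<integral>x. bump x \<partial>(lborel :: 'a measure))" by (simp add: bump_nonneg)
  ultimately show ?thesis by simp
qed

context
  fixes \<kappa> :: real
  assumes \<kappa>: "0 < \<kappa>"
begin

lemma mollifier_nonneg: "0 \<le> mollifier \<kappa> z"
  using \<kappa> by (simp add: mollifier_def bump_nonneg)

lemma mollifier_eq_0: "\<kappa> \<le> norm z \<Longrightarrow> mollifier \<kappa> z = 0"
  using \<kappa> by (simp add: mollifier_def bump_eq_0)

lemma test_fun_mollifier: "test_fun UNIV (mollifier \<kappa> :: 'a::euclidean_space \<Rightarrow> real)"
proof -
  have "Ck_on k UNIV (\<lambda>z::'a. inverse (\<kappa> ^ DIM('a) * (\<integral>x. bump x \<partial>(lborel :: 'a measure))) * bump (0 + (1 / \<kappa>) *\<^sub>R z))" for k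
    by (intro Ck_on_mult Ck_on_const Ck_on_affine Ck_on_bump bounded_linear_scaleR_right)
  then have "Ck_on k UNIV (mollifier \<kappa> :: 'a \<Rightarrow> real)" for k
    by (rule back_subst[where P = "Ck_on k UNIV"]) (auto simp: mollifier_def fun_eq_iff field_simps)
  then show ?thesis unfolding test_fun_def smooth_on_def
    by (auto intro!: exI[of _ "cball 0 \<kappa>"] mollifier_eq_0)
qed

lemma mollifier_integral: "(\<integral>x. mollifier \<kappa> x \<partial>(lborel :: 'a::euclidean_space measure)) = 1"
proof -
  have "(\<integral>x. bump (0 + (1 / \<kappa>) *\<^sub>R x) \<partial>(lborel :: 'a measure)) = \<kappa> ^ DIM('a) * (\<integral>x. bump x \<partial>(lborel :: 'a measure))"
    using \<kappa> by (subst lborel_affine_integrable(2)[OF _ test_fun_integrable[OF test_fun_bump]])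
      (auto simp: power_divide)
  then show ?thesis
    using integral_bump_pos[where 'a='a] \<kappa> by (simp add: mollifier_def)
qed

lemma mollifier_deriv:
  "fderiv (mollifier \<kappa>) (z::'a::euclidean_space) h
    = fderiv bump ((1/\<kappa>) *\<^sub>R z) h / (\<kappa> ^ (DIM('a) + 1) * (\<integral>x. bump x \<partial>(lborel :: 'a measure)))"
proof -
  let ?I = "\<integral>x. bump x \<partial>(lborel :: 'a measure)"
  let ?D = "fderiv bump ((1/\<kappa>) *\<^sub>R z)"
  have lin: "linear ?D" using test_fun_has_derivative[OF test_fun_bump] has_derivative_linear by blast
  have "((\<lambda>z. bump ((1 / \<kappa>) *\<^sub>R z)) has_derivative (\<lambda>h. ?D ((1/\<kappa>) *\<^sub>R h))) (at z)"
    by (rule has_derivative_compose[OF bounded_linear_imp_has_derivative[OF bounded_linear_scaleR_right[of "1/\<kappa>"]]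
        test_fun_has_derivative[OF test_fun_bump]])
  then have "((\<lambda>z. bump ((1 / \<kappa>) *\<^sub>R z) / (\<kappa> ^ DIM('a) * ?I)) has_derivative
      (\<lambda>h. ?D ((1/\<kappa>) *\<^sub>R h) / (\<kappa> ^ DIM('a) * ?I))) (at z)"
    by (rule bounded_linear.has_derivative[OF bounded_linear_divide])
  then have "fderiv (mollifier \<kappa>) z = (\<lambda>h. ?D ((1/\<kappa>) *\<^sub>R h) / (\<kappa> ^ DIM('a) * ?I))"
    unfolding mollifier_def[abs_def] using frechet_derivative_at by metis
  then show ?thesis using \<kappa> by (simp add: linear_cmul[OF lin])
qed

lemma mollifier_deriv_eq_0: "\<kappa> < norm z \<Longrightarrow> fderiv (mollifier \<kappa>) z h = 0"
  by (subst frechet_derivative_outside_support(2)[of "cball 0 \<kappa>"]) (auto intro: mollifier_eq_0)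

lemma test_fun_mollifier_reflect:
  fixes x :: "'a::euclidean_space"
  assumes "cball x \<kappa> \<subseteq> U"
  shows "test_fun U (\<lambda>y. mollifier \<kappa> (x - y))"
    and "fderiv (\<lambda>y. mollifier \<kappa> (x - y)) y h
        = - fderiv (mollifier \<kappa>) (x - y) h"
proof -
  have "Ck_on k UNIV (\<lambda>y. mollifier \<kappa> (x + - y))" for k
    by (intro Ck_on_affine[of uminus] bounded_linear_minus[OF bounded_linear_ident]
        test_fun_Ck[OF test_fun_mollifier])
  moreover have "mollifier \<kappa> (x - y) = 0" if "y \<notin> cball x \<kappa>" for y
    using that by (intro mollifier_eq_0) (simp add: dist_norm)
  ultimately show "test_fun U (\<lambda>y. mollifier \<kappa> (x - y))"
    unfolding test_fun_def smooth_on_def using assms by (intro conjI exI[of _ "cball x \<kappa>"] allI) auto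
  let ?D = "fderiv (mollifier \<kappa>) (x - y)"
  have lin: "linear ?D" using test_fun_has_derivative[OF test_fun_mollifier] has_derivative_linear by blast
  have "((\<lambda>y. x - y) has_derivative (\<lambda>h. - h)) (at y)"
    by (auto intro!: derivative_eq_intros)
  then have "((\<lambda>y. mollifier \<kappa> (x - y)) has_derivative (\<lambda>h. ?D (- h))) (at y)"
    using has_derivative_compose[OF _ test_fun_has_derivative[OF test_fun_mollifier]] by fast
  then have "fderiv (\<lambda>y. mollifier \<kappa> (x - y)) y = (\<lambda>h. ?D (- h))"
    using frechet_derivative_at by metis
  then show "fderiv (\<lambda>y. mollifier \<kappa> (x - y)) y h = - ?D h"
    by (simp add: linear_neg[OF lin])
qed

end

lemma mollifier_deriv_bound:
  "\<exists>C>0. \<forall>\<kappa>>0. \<forall>(z::'a::euclidean_space) h.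
     \<bar>fderiv (mollifier \<kappa>) z h\<bar> \<le> C / \<kappa> ^ (DIM('a) + 1) * norm h"
proof -
  let ?I = "\<integral>x. bump x \<partial>(lborel :: 'a measure)"
  obtain B where B: "0 < B" "\<And>(x::'a) h. \<bar>fderiv bump x h\<bar> \<le> B * norm h"
    using test_fun_deriv_bounded[OF test_fun_bump] by blast
  show ?thesis
  proof (intro exI[of _ "B / ?I"] conjI allI impI)
    show "0 < B / ?I" using B(1) integral_bump_pos[where 'a='a] by simp
    fix \<kappa> :: real and z h :: 'a assume \<kappa>: "0 < \<kappa>"
    show "\<bar>fderiv (mollifier \<kappa>) z h\<bar> \<le> B / ?I / \<kappa> ^ (DIM('a) + 1) * norm h"
      using B(2)[of "(1/\<kappa>) *\<^sub>R z" h] integral_bump_pos[where 'a='a] \<kappa>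
      by (simp add: mollifier_deriv[OF \<kappa>] abs_mult divide_simps mult_ac)
  qed
qed

section \<open>Continuity of translations\<close>

lemma translation_L1_seq:
  fixes f :: "'a::euclidean_space \<Rightarrow> 'b::{banach, second_countable_topology}"
  assumes "integrable lborel f" "Z \<longlonglongrightarrow> 0"
  shows "(\<lambda>n. LBINT x. norm (f (x - Z n) - f x)) \<longlonglongrightarrow> 0"
  using assms(1)
proof (induction f rule: integrable_induct)
  case (base A c)
  have A: "A \<in> sets borel" "emeasure lborel A < \<infinity>" using base by auto
  have iA: "integrable lborel (\<lambda>x. indicator A x :: real)" using base by simp
  have "(\<lambda>n. LBINT x. \<bar>indicator A (x - Z n) - indicator A x :: real\<bar>) \<longlonglongrightarrow> 0"
  proof (rule LIMSEQ_I)
    fix e :: real assume "0 < e"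
    have Al: "A \<in> sets lebesgue" using A by simp
    obtain T where T: "open T" "A \<subseteq> T" "emeasure lebesgue (T - A) < ennreal (e / 4)"
      by (rule sets_lebesgue_outer_open[OF Al, of "e/4"]) (use \<open>0 < e\<close> in simp)
    define D where "D = T - A"
    have D[measurable]: "D \<in> sets borel" "A \<in> sets borel" "T \<in> sets borel" using T A by (auto simp: D_def)
    have De: "emeasure lborel D < ennreal (e / 4)" using T(3) D by (simp add: D_def)
    then have iD: "integrable lborel (\<lambda>x. indicator D x :: real)" using D
      by (intro integrable_real_indicator) (auto intro: less_trans)
    have "emeasure lborel D \<noteq> \<infinity>" using less_trans[OF De ennreal_less_top] by auto
    then have "measure lborel D < e / 4"
      using De by (subst (asm) (2) emeasure_eq_ennreal_measure) (auto simp: ennreal_less_iff)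
    then have Dm: "(LBINT x. indicator D x) < e / 4" by simp
    define I where "I n = (\<integral>x. indicator A x * (1 - indicator T (x - Z n)) \<partial>lborel :: real)" for n
    have "I \<longlonglongrightarrow> (\<integral>x. 0 \<partial>(lborel :: 'a measure))" unfolding I_def
    proof (rule integral_dominated_convergence[OF _ _ iA])
      show "AE x in lborel. (\<lambda>n. indicator A x * (1 - indicator T (x - Z n)) :: real) \<longlonglongrightarrow> 0"
      proof (intro AE_I2)
        fix x
        have "(\<lambda>n. x - Z n) \<longlonglongrightarrow> x" using tendsto_diff[OF tendsto_const assms(2), of x] by simp
        then have "x \<in> T \<Longrightarrow> \<forall>\<^sub>F n in sequentially. x - Z n \<in> T"
          using T(1) topological_tendstoD by blast
        then have "\<forall>\<^sub>F n in sequentially. 0 = (indicator A x * (1 - indicator T (x - Z n)) :: real)"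
          using T(2) by (cases "x \<in> A") (auto simp: indicator_eq_1_iff dest!: subsetD)
        then show "(\<lambda>n. indicator A x * (1 - indicator T (x - Z n)) :: real) \<longlonglongrightarrow> 0"
          by (rule Lim_transform_eventually[OF tendsto_const])
      qed
    qed (auto simp: indicator_def)
    then have "eventually (\<lambda>n. I n < e / 4) sequentially"
      using \<open>0 < e\<close> by (intro order_tendstoD(2)[of _ 0]) auto
    then obtain no where no: "\<And>n. n \<ge> no \<Longrightarrow> I n < e / 4" by (auto simp: eventually_sequentially)
    have "(LBINT x. \<bar>indicator A (x - Z n) - indicator A x :: real\<bar>) < e" if "n \<ge> no" for n
    proof -
      have iP: "integrable lborel (\<lambda>x. indicator A x * (1 - indicator B (x - Z n)) :: real)"
        if [measurable]: "B \<in> sets borel" for B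
        by (rule Bochner_Integration.integrable_bound[OF iA]) (auto simp: indicator_def)
      have "(LBINT x. \<bar>indicator A (x - Z n) - indicator A x :: real\<bar>)
         = (LBINT x. (indicator A (x - Z n) - indicator A x) + 2 * (indicator A x * (1 - indicator A (x - Z n))))"
        by (intro Bochner_Integration.integral_cong) (auto simp: indicator_def)
      also have "\<dots> = 2 * (LBINT x. indicator A x * (1 - indicator A (x - Z n)))" (is "_ = 2 * ?J")
        using iA iP[OF D(2)] lborel_shift(3,4)[OF iA, of "Z n"]
        by (subst Bochner_Integration.integral_add) simp_all
      finally have 1: "(LBINT x. \<bar>indicator A (x - Z n) - indicator A x :: real\<bar>) = 2 * ?J" .
      have "?J \<le> (\<integral>x. indicator A x * (1 - indicator T (x - Z n)) + indicator D (x - Z n) \<partial>(lborel :: 'a measure) :: real)"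
        using iP[OF D(2)] iP[OF D(3)] lborel_shift(3)[OF iD, of "Z n"] T(2)
        by (intro integral_mono) (auto simp: indicator_def D_def)
      also have "\<dots> = I n + (LBINT x. indicator D x)"
        using iP[OF D(3)] lborel_shift(3,4)[OF iD, of "Z n"] by (simp add: I_def)
      finally show ?thesis using no[OF that] Dm 1 by linarith
    qed
    then show "\<exists>no. \<forall>n\<ge>no. norm ((LBINT x. \<bar>indicator A (x - Z n) - indicator A x :: real\<bar>) - 0) < e"
      by auto
  qed
  from tendsto_mult_right[OF this, of "norm c"] show ?case
    by (simp flip: scaleR_diff_left)
next
  case (add f g)
  show ?case
  proof (rule tendsto_sandwich[OF _ _ tendsto_const])
    show "(\<lambda>n. (LBINT x. norm (f (x - Z n) - f x)) + (LBINT x. norm (g (x - Z n) - g x))) \<longlonglongrightarrow> 0"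
      using tendsto_add[OF add(3,4)] by simp
    have "(LBINT x. norm (f (x - Z n) + g (x - Z n) - (f x + g x)))
      \<le> (LBINT x. norm (f (x - Z n) - f x) + norm (g (x - Z n) - g x))" for n
      using add(1,2) lborel_shift(3)[OF add(1)] lborel_shift(3)[OF add(2)]
      by (intro integral_mono) (auto simp: add_diff_add intro!: norm_triangle_ineq)
    then show "\<forall>\<^sub>F n in sequentially. (LBINT x. norm (f (x - Z n) + g (x - Z n) - (f x + g x)))
      \<le> (LBINT x. norm (f (x - Z n) - f x)) + (LBINT x. norm (g (x - Z n) - g x))"
      using add(1,2) lborel_shift(3)[OF add(1)] lborel_shift(3)[OF add(2)] by simp
  qed simp
next
  case (lim f s)
  show ?case
  proof (rule LIMSEQ_I)
    fix e :: real assume "0 < e"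
    have "(\<lambda>i. LBINT x. norm (s i x - f x)) \<longlonglongrightarrow> (\<integral>x. 0 \<partial>(lborel :: 'a measure))"
    proof (rule integral_dominated_convergence)
      show "integrable lborel (\<lambda>x. 3 * norm (f x))" using lim(4) by auto
      show "AE x in lborel. (\<lambda>i. norm (s i x - f x)) \<longlonglongrightarrow> 0"
        using lim(2) by (auto simp: LIM_zero_iff tendsto_norm_zero_iff)
      show "AE x in lborel. norm (norm (s i x - f x)) \<le> 3 * norm (f x)" for i
        using lim(3)[of _ i] norm_triangle_ineq4[of "s i _" "f _"] by (auto intro!: AE_I2) (smt (verit))
    qed (use lim in auto)
    then have "eventually (\<lambda>i. (LBINT x. norm (s i x - f x)) < e / 3) sequentially"
      using \<open>0 < e\<close> by (intro order_tendstoD(2)[of _ 0]) auto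
    then obtain i where i: "(LBINT x. norm (s i x - f x)) < e / 3"
      by (auto simp: eventually_sequentially)
    obtain no where no: "\<And>n. n \<ge> no \<Longrightarrow> (LBINT x. norm (s i (x - Z n) - s i x)) < e / 3"
      using order_tendstoD(2)[OF lim(5)[of i], of "e/3"] \<open>0 < e\<close> by (auto simp: eventually_sequentially)
    have "(LBINT x. norm (f (x - Z n) - f x)) < e" if "n \<ge> no" for n
    proof -
      note sh = lborel_shift(3)[OF lim(4), of "Z n"] lborel_shift(3)[OF lim(1)[of i], of "Z n"]
      have d: "integrable lborel (\<lambda>x. norm (s i x - f x))" using lim(1,4) by auto
      have "(LBINT x. norm (f (x - Z n) - f x))
        \<le> (LBINT x. (norm (s i (x - Z n) - f (x - Z n)) + norm (s i (x - Z n) - s i x)) + norm (s i x - f x))"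
      proof (rule integral_mono)
        show "norm (f (x - Z n) - f x) \<le> norm (s i (x - Z n) - f (x - Z n)) + norm (s i (x - Z n) - s i x) + norm (s i x - f x)" for x
          by norm
      qed (use lim(1,4) sh in auto)
      also have "\<dots> = (LBINT x. norm (s i (x - Z n) - f (x - Z n))) + (LBINT x. norm (s i (x - Z n) - s i x))
          + (LBINT x. norm (s i x - f x))"
        using lim(1,4) sh by simp
      also have "(LBINT x. norm (s i (x - Z n) - f (x - Z n))) = (LBINT x. norm (s i x - f x))"
        by (rule lborel_shift(4)[OF d])
      finally show ?thesis using i no[OF that] by linarith
    qed
    then show "\<exists>no. \<forall>n\<ge>no. norm ((LBINT x. norm (f (x - Z n) - f x)) - 0) < e" by auto
  qed
qed

lemma translation_L1:
  fixes f :: "'a::euclidean_space \<Rightarrow> 'b::{banach, second_countable_topology}"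
  assumes "integrable lborel f" "0 < e"
  shows "\<exists>d>0. \<forall>z. norm z < d \<longrightarrow> (LBINT x. norm (f (x - z) - f x)) < e"
proof (rule ccontr)
  assume "\<not> ?thesis"
  then have "\<exists>z. norm z < inverse (real (Suc n)) \<and> \<not> (LBINT x. norm (f (x - z) - f x)) < e" for n
    by (auto dest!: spec[of _ "inverse (real (Suc n))"])
  then have "\<exists>Z. \<forall>n. norm (Z n) < inverse (real (Suc n)) \<and> \<not> (LBINT x. norm (f (x - Z n) - f x)) < e"
    by (intro choice allI)
  then obtain Z where Z: "\<forall>n. norm (Z n) < inverse (real (Suc n)) \<and> \<not> (LBINT x. norm (f (x - Z n) - f x)) < e" ..
  have "Z \<longlonglongrightarrow> 0"
    by (rule Lim_null_comparison[OF always_eventually LIMSEQ_inverse_real_of_nat])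
      (use Z less_imp_le in blast)
  from order_tendstoD(2)[OF translation_L1_seq[OF assms(1) this] assms(2)]
  show False using Z by (auto simp: eventually_sequentially)
qed

lemma conv_commute:
  fixes f :: "'a::euclidean_space \<Rightarrow> 'b::euclidean_space"
  assumes "test_fun U \<phi>" "integrable lborel f"
  shows "integrable lborel (\<lambda>z. \<phi> z *\<^sub>R f (x - z))"
    and "conv \<phi> f x = (LBINT z. \<phi> z *\<^sub>R f (x - z))"
  using lborel_shift(5,6)[OF conv_integrable[OF assms, of x], of x] by (simp_all add: conv_def)

lemma conv_measurable:
  assumes "test_fun U \<phi>" "integrable lborel f"
  shows "conv \<phi> f \<in> borel_measurable borel"
  using Ck_on_imp_continuous_on[OF Ck_on_conv[OF assms, of 0]] by (rule borel_measurable_continuous_onI)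

lemma conv_diff:
  fixes f g :: "'a::euclidean_space \<Rightarrow> 'b::euclidean_space"
  assumes "test_fun U \<phi>" "integrable lborel f" "integrable lborel g"
  shows "conv \<phi> (\<lambda>x. f x - g x) x = conv \<phi> f x - conv \<phi> g x"
  using conv_integrable[OF assms(1,2)] conv_integrable[OF assms(1,3)]
  by (simp add: conv_def scaleR_diff_right)

lemma conv_norm_bound:
  fixes f :: "'a::euclidean_space \<Rightarrow> 'b::euclidean_space"
  assumes "test_fun U \<phi>" "integrable lborel f" "\<And>z. 0 \<le> \<phi> z" "(LBINT z. \<phi> z) = 1"
    and L: "AE x in lborel. norm (f x) \<le> L"
  shows "norm (conv \<phi> f x) \<le> L"
proof -
  note i = lborel_shift(5,6)[OF test_fun_integrable[OF assms(1)], of x]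
  have "norm (conv \<phi> f x) \<le> (LBINT y. norm (\<phi> (x - y) *\<^sub>R f y))"
    unfolding conv_def by (rule integral_norm_bound)
  also have "\<dots> \<le> (LBINT y. L * \<phi> (x - y))"
  proof (rule integral_mono_AE)
    show "integrable lborel (\<lambda>y. norm (\<phi> (x - y) *\<^sub>R f y))" by (rule integrable_norm[OF conv_integrable[OF assms(1,2)]])
    show "AE y in lborel. norm (\<phi> (x - y) *\<^sub>R f y) \<le> L * \<phi> (x - y)"
      using L by eventually_elim (use assms(3) in \<open>auto intro!: mult_left_mono simp: mult.commute[of L]\<close>)
  qed (use i in auto)
  also have "\<dots> = L" using i assms(4) by simp
  finally show ?thesis .
qed

text \<open>Averages with the weight \<open>\<phi>\<close> deviate from \<open>f\<close> by at most the largest deviation of a translate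
  of \<open>f\<close> by a vector in the support of \<open>\<phi>\<close>.\<close>

lemma conv_L1_deviation:
  fixes f :: "'a::euclidean_space \<Rightarrow> 'b::euclidean_space"
  assumes \<phi>: "test_fun U \<phi>" and f: "integrable lborel f"
    and pos: "\<And>z. 0 \<le> \<phi> z" and one: "(LBINT z. \<phi> z) = 1"
    and dev: "\<And>z. \<phi> z \<noteq> 0 \<Longrightarrow> (LBINT x. norm (f (x - z) - f x)) \<le> e"
  shows "integrable lborel (\<lambda>x. conv \<phi> f x - f x)" "(LBINT x. norm (conv \<phi> f x - f x)) \<le> e"
proof -
  have [measurable]: "\<phi> \<in> borel_measurable borel" "f \<in> borel_measurable borel" "conv \<phi> f \<in> borel_measurable borel"
    using test_fun_measurable[OF \<phi>] conv_measurable[OF \<phi> f] f by auto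
  have i\<phi>: "integrable lborel \<phi>" by (rule test_fun_integrable[OF \<phi>])
  have e: "0 \<le> e"
  proof -
    obtain z where "\<phi> z \<noteq> 0" using one by fastforce
    show ?thesis by (rule order_trans[OF _ dev[OF \<open>\<phi> z \<noteq> 0\<close>]]) simp
  qed
  have p: "ennreal (norm (conv \<phi> f x - f x)) \<le> (\<integral>\<^sup>+z. ennreal (\<phi> z) * ennreal (norm (f (x - z) - f x)) \<partial>lborel)" for x
  proof -
    have i: "integrable lborel (\<lambda>z. \<phi> z *\<^sub>R (f (x - z) - f x))"
      using conv_commute(1)[OF \<phi> f] i\<phi> by (simp add: scaleR_diff_right)
    have "conv \<phi> f x - f x = (LBINT z. \<phi> z *\<^sub>R (f (x - z) - f x))"
      using conv_commute[OF \<phi> f] i\<phi> one by (simp add: scaleR_diff_right)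
    also have "ennreal (norm \<dots>) \<le> (\<integral>\<^sup>+z. norm (\<phi> z *\<^sub>R (f (x - z) - f x)) \<partial>lborel)"
      by (rule integral_norm_bound_ennreal[OF i])
    finally show ?thesis using pos by (simp add: ennreal_mult)
  qed
  have "(\<integral>\<^sup>+x. norm (conv \<phi> f x - f x) \<partial>lborel)
      \<le> (\<integral>\<^sup>+x. (\<integral>\<^sup>+z. ennreal (\<phi> z) * ennreal (norm (f (x - z) - f x)) \<partial>lborel) \<partial>lborel)"
    by (intro nn_integral_mono p)
  also have "\<dots> = (\<integral>\<^sup>+z. (\<integral>\<^sup>+x. ennreal (\<phi> z) * ennreal (norm (f (x - z) - f x)) \<partial>lborel) \<partial>lborel)"
    by (rule lborel_pair.Fubini') measurable
  also have "\<dots> \<le> (\<integral>\<^sup>+z. ennreal (\<phi> z) * ennreal e \<partial>lborel)"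
  proof (rule nn_integral_mono)
    fix z
    show "(\<integral>\<^sup>+x. ennreal (\<phi> z) * ennreal (norm (f (x - z) - f x)) \<partial>lborel) \<le> ennreal (\<phi> z) * ennreal e"
    proof (cases "\<phi> z = 0")
      case False
      have "(\<integral>\<^sup>+x. ennreal (norm (f (x - z) - f x)) \<partial>lborel) = ennreal (LBINT x. norm (f (x - z) - f x))"
        using lborel_shift(3)[OF f, of z] f by (intro nn_integral_eq_integral) auto
      then show ?thesis using dev[OF False]
        by (subst nn_integral_cmult) (auto intro!: mult_left_mono ennreal_leI)
    qed simp
  qed
  also have "\<dots> = ennreal e"
    using one nn_integral_eq_integral[OF i\<phi>] pos by (subst nn_integral_multc) auto
  finally have fin: "(\<integral>\<^sup>+x. norm (conv \<phi> f x - f x) \<partial>lborel) \<le> ennreal e" .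
  then show i: "integrable lborel (\<lambda>x. conv \<phi> f x - f x)"
    by (intro integrableI_bounded) (auto intro: le_less_trans)
  have "ennreal (LBINT x. norm (conv \<phi> f x - f x)) \<le> ennreal e"
    using fin nn_integral_eq_integral[OF integrable_norm[OF i]] by simp
  then show "(LBINT x. norm (conv \<phi> f x - f x)) \<le> e" using e by simp
qed

lemma mollifier_L1:
  fixes f :: "'a::euclidean_space \<Rightarrow> 'b::euclidean_space"
  assumes f: "integrable lborel f" and \<kappa>: "\<And>n. 0 < \<kappa> n" "\<kappa> \<longlonglongrightarrow> 0"
  shows "\<And>n. integrable lborel (\<lambda>x. conv (mollifier (\<kappa> n)) f x - f x)"
    and "(\<lambda>n. LBINT x. norm (conv (mollifier (\<kappa> n)) f x - f x)) \<longlonglongrightarrow> 0"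
proof -
  note m = test_fun_mollifier[OF \<kappa>(1)] mollifier_nonneg[OF \<kappa>(1)] mollifier_integral[OF \<kappa>(1)]
  show "integrable lborel (\<lambda>x. conv (mollifier (\<kappa> n)) f x - f x)" for n
  proof (rule conv_L1_deviation(1)[OF m(1) f m(2,3)])
    fix z
    have "(LBINT x. norm (f (x - z) - f x)) \<le> (LBINT x. norm (f (x - z)) + norm (f x))"
      using f lborel_shift(3)[OF f, of z] by (intro integral_mono) (auto intro: norm_triangle_ineq4)
    also have "\<dots> = 2 * (LBINT x. norm (f x))"
      using f lborel_shift(3)[OF f, of z] lborel_shift(4)[OF integrable_norm[OF f], of z] by simp
    finally show "(LBINT x. norm (f (x - z) - f x)) \<le> 2 * (LBINT x. norm (f x))" .
  qed
  show "(\<lambda>n. LBINT x. norm (conv (mollifier (\<kappa> n)) f x - f x)) \<longlonglongrightarrow> 0"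
  proof (rule LIMSEQ_I)
    fix e :: real assume "0 < e"
    then have "0 < e / 2" by simp
    from translation_L1[OF f this] obtain d where d: "0 < d"
      "\<forall>z. norm z < d \<longrightarrow> (LBINT x. norm (f (x - z) - f x)) < e / 2" by blast
    have "(LBINT x. norm (conv (mollifier (\<kappa> n)) f x - f x)) \<le> e / 2" if "\<kappa> n < d" for n
    proof (rule conv_L1_deviation(2)[OF m(1) f m(2,3)])
      fix z :: 'a assume "mollifier (\<kappa> n) z \<noteq> 0"
      then have "norm z < d" using mollifier_eq_0[OF \<kappa>(1)] that by (metis less_trans not_le)
      then show "(LBINT x. norm (f (x - z) - f x)) \<le> e / 2" using d(2) less_imp_le by blast
    qed
    moreover have "\<forall>\<^sub>F n in sequentially. \<kappa> n < d" using order_tendstoD(2)[OF \<kappa>(2) d(1)] .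
    ultimately have "\<forall>\<^sub>F n in sequentially. norm ((LBINT x. norm (conv (mollifier (\<kappa> n)) f x - f x)) - 0) < e"
      using \<open>0 < e\<close> by (auto elim!: eventually_mono) (smt (verit) field_sum_of_halves)
    then show "\<exists>no. \<forall>n\<ge>no. norm ((LBINT x. norm (conv (mollifier (\<kappa> n)) f x - f x)) - 0) < e"
      by (auto simp: eventually_sequentially)
  qed
qed

lemma mollifier_AE_subseq:
  fixes f :: "'a::euclidean_space \<Rightarrow> 'b::euclidean_space"
  assumes f: "integrable lborel f" and \<kappa>: "\<And>n. 0 < \<kappa> n" "\<kappa> \<longlonglongrightarrow> 0"
  shows "\<exists>r::nat\<Rightarrow>nat. strict_mono r \<and> (AE x in lborel. (\<lambda>n. conv (mollifier (\<kappa> (r n))) f x) \<longlonglongrightarrow> f x)"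
  using tendsto_L1_AE_subseq[OF mollifier_L1[OF assms]] by (simp add: LIM_zero_iff)

text \<open>Mollification does not increase the \<open>L\<^sub>2\<close> norm. Uniform bounds of this kind upgrade the \<open>L\<^sub>1\<close>
  convergence of mollifications when they are multiplied with square integrable functions.\<close>

lemma conv_L2:
  fixes f :: "'a::euclidean_space \<Rightarrow> 'b::euclidean_space"
  assumes \<phi>: "test_fun U \<phi>" and f: "integrable lborel f"
    and pos: "\<And>z. 0 \<le> \<phi> z" and one: "(LBINT z. \<phi> z) = 1"
    and f2: "integrable lborel (\<lambda>x. (norm (f x))\<^sup>2)"
  shows "integrable lborel (\<lambda>x. (norm (conv \<phi> f x))\<^sup>2)"
    and "(LBINT x. (norm (conv \<phi> f x))\<^sup>2) \<le> (LBINT x. (norm (f x))\<^sup>2)"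
proof -
  have [measurable]: "\<phi> \<in> borel_measurable borel" "f \<in> borel_measurable borel" "conv \<phi> f \<in> borel_measurable borel"
    using test_fun_measurable[OF \<phi>] conv_measurable[OF \<phi> f] f by auto
  note i = lborel_shift(5,6)[OF test_fun_integrable[OF \<phi>]]
  have i2: "integrable lborel (\<lambda>y. \<phi> (x - y) * (norm (f y))\<^sup>2)" for x
    using conv_integrable[OF \<phi> f2] by simp
  have i1: "integrable lborel (\<lambda>y. \<phi> (x - y) * norm (f y))" for x
    using conv_integrable[OF \<phi> integrable_norm[OF f]] by simp
  have p: "(norm (conv \<phi> f x))\<^sup>2 \<le> (LBINT y. \<phi> (x - y) * (norm (f y))\<^sup>2)" for x
  proof -
    define m where "m = (LBINT y. \<phi> (x - y) * norm (f y))"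
    have "norm (conv \<phi> f x) \<le> (LBINT y. norm (\<phi> (x - y) *\<^sub>R f y))"
      unfolding conv_def by (rule integral_norm_bound)
    then have m: "norm (conv \<phi> f x) \<le> m" using pos by (simp add: m_def)
    \<comment> \<open>Jensen's inequality, from \<open>0 \<le> (\<bar>f\<bar> - m)\<^sup>2\<close> averaged with the weight.\<close>
    have "(LBINT y. 2 * m * (\<phi> (x - y) * norm (f y)) - m\<^sup>2 * \<phi> (x - y))
        \<le> (LBINT y. \<phi> (x - y) * (norm (f y))\<^sup>2)"
    proof (rule integral_mono)
      fix y
      have "0 \<le> \<phi> (x - y) * (norm (f y) - m)\<^sup>2" using pos by simp
      then show "2 * m * (\<phi> (x - y) * norm (f y)) - m\<^sup>2 * \<phi> (x - y) \<le> \<phi> (x - y) * (norm (f y))\<^sup>2"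
        by (simp add: power2_eq_square algebra_simps)
    qed (use i1 i2 i in auto)
    then have "2 * m * m - m\<^sup>2 \<le> (LBINT y. \<phi> (x - y) * (norm (f y))\<^sup>2)"
      using i1[of x] i[of x] one by (simp add: m_def)
    moreover have "(norm (conv \<phi> f x))\<^sup>2 \<le> m\<^sup>2" using m by (intro power_mono) auto
    ultimately show ?thesis by (simp add: power2_eq_square)
  qed
  have "(\<integral>\<^sup>+x. ennreal ((norm (conv \<phi> f x))\<^sup>2) \<partial>lborel)
      \<le> (\<integral>\<^sup>+x. (\<integral>\<^sup>+y. ennreal (\<phi> (x - y)) * ennreal ((norm (f y))\<^sup>2) \<partial>lborel) \<partial>lborel)"
  proof (rule nn_integral_mono)
    fix x
    have "(\<integral>\<^sup>+y. ennreal (\<phi> (x - y) * (norm (f y))\<^sup>2) \<partial>lborel) = ennreal (LBINT y. \<phi> (x - y) * (norm (f y))\<^sup>2)"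
      using pos by (intro nn_integral_eq_integral i2) auto
    then show "ennreal ((norm (conv \<phi> f x))\<^sup>2) \<le> (\<integral>\<^sup>+y. ennreal (\<phi> (x - y)) * ennreal ((norm (f y))\<^sup>2) \<partial>lborel)"
      using p[of x] pos by (simp add: ennreal_mult ennreal_leI)
  qed
  also have "\<dots> = (\<integral>\<^sup>+y. (\<integral>\<^sup>+x. ennreal (\<phi> (x - y)) * ennreal ((norm (f y))\<^sup>2) \<partial>lborel) \<partial>lborel)"
    by (rule lborel_pair.Fubini') measurable
  also have "\<dots> = (\<integral>\<^sup>+y. ennreal ((norm (f y))\<^sup>2) \<partial>lborel)"
  proof (rule nn_integral_cong)
    fix y
    have "(\<integral>\<^sup>+x. ennreal (\<phi> (x - y)) \<partial>lborel) = 1"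
      using nn_integral_eq_integral[OF lborel_shift(3)[OF test_fun_integrable[OF \<phi>]], of y]
        lborel_shift(4)[OF test_fun_integrable[OF \<phi>]] one pos by simp
    then show "(\<integral>\<^sup>+x. ennreal (\<phi> (x - y)) * ennreal ((norm (f y))\<^sup>2) \<partial>lborel) = ennreal ((norm (f y))\<^sup>2)"
      by (subst nn_integral_multc) auto
  qed
  also have "\<dots> = ennreal (LBINT x. (norm (f x))\<^sup>2)" by (intro nn_integral_eq_integral f2) auto
  finally have fin: "(\<integral>\<^sup>+x. ennreal ((norm (conv \<phi> f x))\<^sup>2) \<partial>lborel) \<le> ennreal (LBINT x. (norm (f x))\<^sup>2)" .
  then show ii: "integrable lborel (\<lambda>x. (norm (conv \<phi> f x))\<^sup>2)"
    by (intro integrableI_bounded) (auto intro: le_less_trans)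
  show "(LBINT x. (norm (conv \<phi> f x))\<^sup>2) \<le> (LBINT x. (norm (f x))\<^sup>2)"
    using fin nn_integral_eq_integral[OF ii] by simp
qed

lemma integral_derivative_eq_0:
  fixes f :: "'a::euclidean_space \<Rightarrow> 'b::euclidean_space"
  assumes d: "\<And>x. (f has_derivative f' x) (at x)" and c: "continuous_on UNIV (\<lambda>x. f' x h)"
    and K: "compact K" "\<And>x. x \<notin> K \<Longrightarrow> f x = 0"
  shows "(LBINT x. f' x h) = 0"
proof -
  have "continuous (at x) f" for x by (rule has_derivative_continuous[OF d])
  then have fc: "continuous_on UNIV f" by (simp add: continuous_on_eq_continuous_at)
  have f: "integrable lborel f" by (rule integrable_compact_support[OF fc K])
  have "f' x h = 0" if "x \<notin> K" for x
    by (simp add: has_derivative_unique[OF d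
          frechet_derivative_outside_support(1)[OF compact_imp_closed[OF K(1)] K(2) that]])
  then obtain B where B: "0 < B" "\<And>x. norm (f' x h) \<le> B"
    using compact_support_bounded[OF c K(1)] by blast
  define t where "t n = inverse (real (Suc n))" for n
  have t: "t \<longlonglongrightarrow> 0" "\<And>n. 0 < t n" "\<And>n. t n \<le> 1"
    using LIMSEQ_inverse_real_of_nat by (auto simp: t_def[abs_def] field_simps)
  define q where "q n x = (1 / t n) *\<^sub>R (f (x + t n *\<^sub>R h) - f x)" for n x
  define K' where "K' = {x + y | x y. x \<in> K \<and> y \<in> cball 0 (norm h)}"
  have K': "compact K'" unfolding K'_def using K by (intro compact_sums) auto
  have g: "((\<lambda>s. f (x + s *\<^sub>R h)) has_derivative (\<lambda>r. r *\<^sub>R f' (x + s *\<^sub>R h) h)) (at s)" for x s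
  proof -
    have "((\<lambda>s. x + s *\<^sub>R h) has_derivative (\<lambda>r. r *\<^sub>R h)) (at s)" by (auto intro!: derivative_eq_intros)
    from has_derivative_compose[OF this d]
    show ?thesis using linear_cmul[OF has_derivative_linear[OF d[of "x + s *\<^sub>R h"]]] by simp
  qed
  have qB: "norm (q n x) \<le> B" for n x
  proof -
    have "norm (f (x + t n *\<^sub>R h) - f (x + 0 *\<^sub>R h)) \<le> B * norm (t n - 0)"
    proof (rule differentiable_bound[where S=UNIV and f'="\<lambda>s r. r *\<^sub>R f' (x + s *\<^sub>R h) h"])
      show "onorm (\<lambda>r. r *\<^sub>R f' (x + s *\<^sub>R h) h) \<le> B" for s
        using B by (intro onorm_le) (auto simp: mult.commute[of B] intro!: mult_left_mono)
    qed (use g in auto)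
    then show ?thesis using t(2)[of n] by (simp add: q_def pos_divide_le_eq)
  qed
  have "(\<lambda>n. LBINT x. q n x) \<longlonglongrightarrow> (LBINT x. f' x h)"
  proof (rule integral_dominated_convergence)
    show "integrable lborel (\<lambda>x. indicator K' x * B)" using emeasure_compact_finite[OF K'] compact_imp_closed[OF K']
      by (intro integrable_mult_left integrable_real_indicator) auto
    show "AE x in lborel. (\<lambda>n. q n x) \<longlonglongrightarrow> f' x h"
    proof (intro AE_I2)
      fix x
      have "((\<lambda>s. norm (f (x + s *\<^sub>R h) - f x - s *\<^sub>R f' x h) / norm s) \<longlongrightarrow> 0) (at 0)"
        using g[of x 0] unfolding has_derivative_iff_norm by simp
      moreover have "filterlim t (at 0) sequentially"
        using t by (auto simp: filterlim_at intro!: always_eventually) (metis less_irrefl)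
      ultimately have "(\<lambda>n. norm (f (x + t n *\<^sub>R h) - f x - t n *\<^sub>R f' x h) / norm (t n)) \<longlonglongrightarrow> 0"
        by (rule filterlim_compose)
      also have "(\<lambda>n. norm (f (x + t n *\<^sub>R h) - f x - t n *\<^sub>R f' x h) / norm (t n)) = (\<lambda>n. norm (q n x - f' x h))"
      proof
        fix n
        have "q n x - f' x h = (1 / t n) *\<^sub>R (f (x + t n *\<^sub>R h) - f x - t n *\<^sub>R f' x h)"
          using t(2)[of n] by (simp add: q_def scaleR_diff_right)
        then show "norm (f (x + t n *\<^sub>R h) - f x - t n *\<^sub>R f' x h) / norm (t n) = norm (q n x - f' x h)"
          by simp
      qed
      finally show "(\<lambda>n. q n x) \<longlonglongrightarrow> f' x h"
        by (simp add: tendsto_norm_zero_iff LIM_zero_iff)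
    qed
    show "AE x in lborel. norm (q n x) \<le> indicator K' x * B" for n
    proof (intro AE_I2)
      fix x
      have "q n x = 0" if "x \<notin> K'"
      proof -
        have "x \<in> K \<Longrightarrow> x \<in> K'" unfolding K'_def mem_Collect_eq
          by (intro exI[of _ x] exI[of _ 0]) auto
        moreover have "x + t n *\<^sub>R h \<in> K \<Longrightarrow> x \<in> K'" unfolding K'_def mem_Collect_eq
          using t(2,3)[of n] by (intro exI[of _ "x + t n *\<^sub>R h"] exI[of _ "- t n *\<^sub>R h"])
            (auto simp: mult_left_le_one_le)
        ultimately have "x \<notin> K" "x + t n *\<^sub>R h \<notin> K" using that by blast+
        then show ?thesis using K(2) by (simp add: q_def)
      qed
      then show "norm (q n x) \<le> indicator K' x * B" using qB[of n x] by (auto simp: indicator_def)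
    qed
    show "q n \<in> borel_measurable lborel" for n
      unfolding q_def using f lborel_shift(1)[OF f] by (auto intro!: borel_measurable_integrable)
    show "(\<lambda>x. f' x h) \<in> borel_measurable lborel" using borel_measurable_continuous_onI[OF c] by simp
  qed
  moreover have "(LBINT x. q n x) = 0" for n
    unfolding q_def using lborel_shift(1,2)[OF f] f by simp
  ultimately show ?thesis using LIMSEQ_unique[OF _ tendsto_const] by fastforce
qed

section \<open>Square integrable functions\<close>

lemma L2_inner:
  fixes f g :: "'a \<Rightarrow> 'b::euclidean_space"
  assumes [measurable]: "f \<in> borel_measurable M" "g \<in> borel_measurable M"
    and f2: "integrable M (\<lambda>x. (norm (f x))\<^sup>2)" and g2: "integrable M (\<lambda>x. (norm (g x))\<^sup>2)"
  shows "integrable M (\<lambda>x. f x \<bullet> g x)" "integrable M (\<lambda>x. norm (f x) * norm (g x))"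
    and "0 < s \<Longrightarrow> (\<integral>x. norm (f x) * norm (g x) \<partial>M)
      \<le> (\<integral>x. (norm (f x))\<^sup>2 \<partial>M) / s + s * (\<integral>x. (norm (g x))\<^sup>2 \<partial>M)"
    and "0 < s \<Longrightarrow> \<bar>\<integral>x. f x \<bullet> g x \<partial>M\<bar>
      \<le> (\<integral>x. (norm (f x))\<^sup>2 \<partial>M) / s + s * (\<integral>x. (norm (g x))\<^sup>2 \<partial>M)"
proof -
  have young: "a * b \<le> a\<^sup>2 / s + s * b\<^sup>2" if "0 < s" "0 \<le> a" "0 \<le> b" for a b s :: real
  proof -
    have "0 \<le> (a - s * b)\<^sup>2 / s" using that by simp
    also have "\<dots> = a\<^sup>2 / s - 2 * (a * b) + s * b\<^sup>2" using that by (simp add: power2_eq_square field_simps)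
    finally show ?thesis using mult_nonneg_nonneg[OF that(2,3)] by linarith
  qed
  show i: "integrable M (\<lambda>x. norm (f x) * norm (g x))"
  proof (rule Bochner_Integration.integrable_bound)
    show "integrable M (\<lambda>x. (norm (f x))\<^sup>2 / 1 + 1 * (norm (g x))\<^sup>2)" using f2 g2 by simp
    show "AE x in M. norm (norm (f x) * norm (g x)) \<le> norm ((norm (f x))\<^sup>2 / 1 + 1 * (norm (g x))\<^sup>2)"
      using young[of 1] by (intro AE_I2) (simp add: abs_mult)
  qed measurable
  show i': "integrable M (\<lambda>x. f x \<bullet> g x)"
    by (rule Bochner_Integration.integrable_bound[OF i]) (auto simp: Cauchy_Schwarz_ineq2 abs_mult)
  assume s: "0 < s"
  have "(\<integral>x. norm (f x) * norm (g x) \<partial>M) \<le> (\<integral>x. (norm (f x))\<^sup>2 / s + s * (norm (g x))\<^sup>2 \<partial>M)"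
    using young[OF s] f2 g2 by (intro integral_mono i) auto
  also have "\<dots> = (\<integral>x. (norm (f x))\<^sup>2 \<partial>M) / s + s * (\<integral>x. (norm (g x))\<^sup>2 \<partial>M)" using f2 g2 by simp
  finally show 1: "(\<integral>x. norm (f x) * norm (g x) \<partial>M)
      \<le> (\<integral>x. (norm (f x))\<^sup>2 \<partial>M) / s + s * (\<integral>x. (norm (g x))\<^sup>2 \<partial>M)" .
  have "\<bar>\<integral>x. f x \<bullet> g x \<partial>M\<bar> \<le> (\<integral>x. \<bar>f x \<bullet> g x\<bar> \<partial>M)" by (rule integral_abs_bound)
  also have "\<dots> \<le> (\<integral>x. norm (f x) * norm (g x) \<partial>M)"
    using i' i by (intro integral_mono) (auto simp: Cauchy_Schwarz_ineq2)
  finally show "\<bar>\<integral>x. f x \<bullet> g x \<partial>M\<bar> \<le> (\<integral>x. (norm (f x))\<^sup>2 \<partial>M) / s + s * (\<integral>x. (norm (g x))\<^sup>2 \<partial>M)"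
    using 1 by linarith
qed

text \<open>A Young inequality with free weight \<open>s\<close> replaces the Cauchy-Schwarz inequality for integrals: first
  \<open>s\<close> is chosen small, then \<open>k\<close> large.\<close>

lemma L2_bound_tendsto:
  fixes b :: real
  assumes a: "(a \<longlongrightarrow> 0) F" and c: "\<And>k s. 0 < s \<Longrightarrow> \<bar>y k\<bar> \<le> a k / s + s * b" and "0 \<le> b"
  shows "(y \<longlongrightarrow> (0::real)) F"
proof (rule tendstoI)
  fix e :: real assume e: "0 < e"
  define s where "s = e / (2 * (b + 1))"
  have s: "0 < s" using e \<open>0 \<le> b\<close> by (simp add: s_def)
  have sb: "s * b \<le> e / 2"
  proof -
    have "s * b = (e / 2) * (b / (b + 1))" by (simp add: s_def)
    also have "\<dots> \<le> (e / 2) * 1" using e \<open>0 \<le> b\<close> by (intro mult_left_mono) auto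
    finally show ?thesis by simp
  qed
  have "((\<lambda>k. a k / s) \<longlongrightarrow> 0) F" using tendsto_divide[OF a tendsto_const[of s]] s by simp
  then have "\<forall>\<^sub>F k in F. a k / s < e / 2" using e by (intro order_tendstoD(2)[of _ 0]) auto
  then show "\<forall>\<^sub>F k in F. dist (y k) 0 < e"
  proof eventually_elim
    case (elim k)
    have "\<bar>y k\<bar> \<le> a k / s + s * b" by (rule c[OF s])
    then show ?case using elim sb unfolding dist_real_def diff_zero by linarith
  qed
qed

lemma norm_diff_square_le: "(norm (a - b))\<^sup>2 \<le> 2 * (norm a)\<^sup>2 + 2 * (norm (b :: 'b::real_normed_vector))\<^sup>2"
proof -
  have "(norm (a - b))\<^sup>2 \<le> (norm a + norm b)\<^sup>2" by (intro power_mono norm_triangle_ineq4) auto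
  also have "\<dots> \<le> 2 * (norm a)\<^sup>2 + 2 * (norm b)\<^sup>2"
    using sum_squares_bound[of "norm a" "norm b"] by (simp add: power2_sum)
  finally show ?thesis .
qed

lemma norm_le_1_square: "norm y \<le> 1 + (norm (y :: 'b::real_normed_vector))\<^sup>2"
proof -
  have "0 \<le> (norm y - 1)\<^sup>2" by simp
  then have "2 * norm y \<le> 1 + (norm y)\<^sup>2" by (simp add: power2_diff)
  then show ?thesis using norm_ge_zero[of y] by linarith
qed

lemma mult_norm_le_squares: "norm a * norm b \<le> (norm a)\<^sup>2 + (norm b)\<^sup>2"
  using sum_squares_bound[of "norm a" "norm b"] mult_nonneg_nonneg[OF norm_ge_zero[of a] norm_ge_zero[of b]] by linarith

lemma L2_diff:
  fixes f g :: "'a \<Rightarrow> 'b::euclidean_space"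
  assumes [measurable]: "f \<in> borel_measurable M" "g \<in> borel_measurable M"
    and f2: "integrable M (\<lambda>x. (norm (f x))\<^sup>2)" and g2: "integrable M (\<lambda>x. (norm (g x))\<^sup>2)"
  shows "integrable M (\<lambda>x. (norm (f x - g x))\<^sup>2)"
proof (rule Bochner_Integration.integrable_bound)
  show "integrable M (\<lambda>x. 2 * (norm (f x))\<^sup>2 + 2 * (norm (g x))\<^sup>2)" using f2 g2 by auto
  show "AE x in M. norm ((norm (f x - g x))\<^sup>2) \<le> norm (2 * (norm (f x))\<^sup>2 + 2 * (norm (g x))\<^sup>2)"
    using norm_diff_square_le[of "f _" "g _"] by (intro AE_I2) simp
qed measurable

lemma L2_tendsto:
  fixes f :: "nat \<Rightarrow> 'a \<Rightarrow> 'b::euclidean_space"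
  assumes [measurable]: "\<And>k. f k \<in> borel_measurable M" "f' \<in> borel_measurable M" "g \<in> borel_measurable M"
    and fk: "\<And>k. integrable M (\<lambda>x. (norm (f k x))\<^sup>2)" and f': "integrable M (\<lambda>x. (norm (f' x))\<^sup>2)"
    and g2: "integrable M (\<lambda>x. (norm (g x))\<^sup>2)"
    and lim: "(\<lambda>k. \<integral>x. (norm (f k x - f' x))\<^sup>2 \<partial>M) \<longlonglongrightarrow> 0"
  shows "(\<lambda>k. \<integral>x. f k x \<bullet> g x \<partial>M) \<longlonglongrightarrow> (\<integral>x. f' x \<bullet> g x \<partial>M)"
proof -
  have "(\<lambda>k. (\<integral>x. (f k x - f' x) \<bullet> g x \<partial>M)) \<longlonglongrightarrow> 0"
  proof (rule L2_bound_tendsto[OF lim])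
    show "\<bar>\<integral>x. (f k x - f' x) \<bullet> g x \<partial>M\<bar>
      \<le> (\<integral>x. (norm (f k x - f' x))\<^sup>2 \<partial>M) / s + s * (\<integral>x. (norm (g x))\<^sup>2 \<partial>M)" if "0 < s" for k s
      by (rule L2_inner(4)[OF _ _ L2_diff g2 that]) (use fk f' in measurable)
  qed simp
  moreover have "(\<integral>x. (f k x - f' x) \<bullet> g x \<partial>M) = (\<integral>x. f k x \<bullet> g x \<partial>M) - (\<integral>x. f' x \<bullet> g x \<partial>M)" for k
    using L2_inner(1)[of "f k" M g] L2_inner(1)[of f' M g] fk f' g2 by (simp add: inner_diff_left)
  ultimately show ?thesis by (simp add: LIM_zero_iff)
qed

section \<open>Borel representatives\<close>

lemma AE_lebesgue_on:
  "S \<in> sets borel \<Longrightarrow> (AE x in lebesgue_on S. P x) \<longleftrightarrow> (AE x in lborel. x \<in> S \<longrightarrow> P x)"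
  by (subst AE_restrict_space_iff) (auto simp: AE_completion_iff)

lemma nn_integral_lebesgue_on:
  "S \<in> sets borel \<Longrightarrow> (\<integral>\<^sup>+x. f x \<partial>lebesgue_on S) = (\<integral>\<^sup>+x. f x * indicator S x \<partial>lborel)"
  by (subst nn_integral_restrict_space) (auto simp: nn_integral_completion)

text \<open>The functions in the equations are Lebesgue measurable, and individual time slices may fail to be
  measurable. Everything is therefore transferred to Borel functions on the whole space that vanish
  off the domain; their slices are Borel and integrals need no domain.\<close>

definition borel_rep :: "'a::euclidean_space set \<Rightarrow> ('a \<Rightarrow> 'b::euclidean_space) \<Rightarrow> ('a \<Rightarrow> 'b) \<Rightarrow> bool" where
  "borel_rep S f f' \<longleftrightarrow> f' \<in> borel_measurable borel \<and> (\<forall>x. x \<notin> S \<longrightarrow> f' x = 0) \<and>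
     (AE x in lborel. x \<in> S \<longrightarrow> f x = f' x)"

lemma borel_rep_exists:
  fixes f :: "'a::euclidean_space \<Rightarrow> 'b::euclidean_space"
  assumes S: "S \<in> sets borel" and f: "f \<in> borel_measurable (lebesgue_on S)"
  shows "\<exists>f'. borel_rep S f f'"
proof -
  have f0: "(\<lambda>x. if x \<in> S then f x else 0) \<in> borel_measurable lebesgue"
    using f S borel_measurable_if_lebesgue_on[of S UNIV f] by (simp add: borel_measurable_if)
  have "\<exists>g. g \<in> borel_measurable lborel \<and> (AE x in lborel. (if x \<in> S then f x else 0) \<bullet> b = g x)" for b
    using completion_ex_borel_measurable_real[of "\<lambda>x. (if x \<in> S then f x else 0) \<bullet> b" lborel] f0 by auto
  then have "\<exists>g. \<forall>b. g b \<in> borel_measurable lborel \<and> (AE x in lborel. (if x \<in> S then f x else 0) \<bullet> b = g b x)"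
    by (intro choice allI)
  then obtain g where "\<forall>b. g b \<in> borel_measurable lborel \<and> (AE x in lborel. (if x \<in> S then f x else 0) \<bullet> b = g b x)" ..
  then have g[measurable]: "\<And>b. g b \<in> borel_measurable borel"
    and ae: "\<And>b. AE x in lborel. (if x \<in> S then f x else 0) \<bullet> b = g b x" by auto
  define f' where "f' x = (if x \<in> S then (\<Sum>b\<in>Basis. g b x *\<^sub>R b) else 0)" for x
  have "f' \<in> borel_measurable borel" unfolding f'_def using S by measurable
  moreover have "AE x in lborel. \<forall>b\<in>Basis. (if x \<in> S then f x else 0) \<bullet> b = g b x"
    using ae by (intro AE_finite_allI) auto
  then have "AE x in lborel. x \<in> S \<longrightarrow> f x = f' x"
  proof eventually_elim
    case (elim x)
    then show ?case using euclidean_representation[of "f x"] by (auto simp: f'_def)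
  qed
  ultimately show ?thesis by (auto simp: borel_rep_def f'_def intro!: exI[of _ f'])
qed

lemma borel_rep_AE: "borel_rep S f f' \<Longrightarrow> AE x in lborel. x \<in> S \<longrightarrow> f x = f' x"
  by (simp add: borel_rep_def)

lemma borel_rep_measurable: "borel_rep S f f' \<Longrightarrow> f' \<in> borel_measurable borel"
  by (simp add: borel_rep_def)

lemma borel_rep_0: "borel_rep S f f' \<Longrightarrow> x \<notin> S \<Longrightarrow> f' x = 0"
  by (simp add: borel_rep_def)

lemma integral_lebesgue_on:
  fixes h :: "'a::euclidean_space \<Rightarrow> 'c::euclidean_space"
  assumes S: "S \<in> sets borel" and h': "h' \<in> borel_measurable borel"
    and ae: "AE x in lborel. x \<in> S \<longrightarrow> h x = h' x" and z: "\<And>x. x \<notin> S \<Longrightarrow> h' x = 0"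
  shows "(\<integral>x. h x \<partial>lebesgue_on S) = (LBINT x. h' x)"
    and "integrable (lebesgue_on S) h \<longleftrightarrow> integrable lborel h'"
    and "h \<in> borel_measurable (lebesgue_on S)"
proof -
  have h'l: "h' \<in> borel_measurable lebesgue" using h' by (simp add: measurable_completion)
  have e: "AE x in lebesgue. indicator S x *\<^sub>R h x = h' x"
    using ae z by (auto simp: AE_completion_iff indicator_def elim!: eventually_mono)
  have m: "(\<lambda>x. indicator S x *\<^sub>R h x) \<in> borel_measurable lebesgue"
    by (rule borel_measurable_AE[OF h'l]) (use e in \<open>auto elim!: eventually_mono\<close>)
  have Sl: "S \<inter> space lebesgue \<in> sets lebesgue" using S by simp
  have "(\<integral>x. h x \<partial>lebesgue_on S) = (\<integral>x. indicator S x *\<^sub>R h x \<partial>lebesgue)"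
    by (rule integral_restrict_space[OF Sl])
  also have "\<dots> = (\<integral>x. h' x \<partial>lebesgue)" by (rule integral_cong_AE[OF m h'l e])
  also have "\<dots> = (LBINT x. h' x)" using h' by (intro integral_completion) simp
  finally show "(\<integral>x. h x \<partial>lebesgue_on S) = (LBINT x. h' x)" .
  have "integrable (lebesgue_on S) h \<longleftrightarrow> integrable lebesgue (\<lambda>x. indicator S x *\<^sub>R h x)"
    by (rule integrable_restrict_space[OF Sl])
  also have "\<dots> \<longleftrightarrow> integrable lebesgue h'" by (rule integrable_cong_AE[OF m h'l e])
  also have "\<dots> \<longleftrightarrow> integrable lborel h'" using h' by (intro integrable_completion) simp
  finally show "integrable (lebesgue_on S) h \<longleftrightarrow> integrable lborel h'" .
  show "h \<in> borel_measurable (lebesgue_on S)"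
    using m by (simp add: borel_measurable_restrict_space_iff[OF Sl])
qed

section \<open>Weak derivatives of Borel functions\<close>

text \<open>The counterpart of \<open>weak_deriv\<close> for Borel representatives.\<close>

definition wderiv :: "'a::euclidean_space set \<Rightarrow> 'a \<Rightarrow> ('a \<Rightarrow> 'b::euclidean_space) \<Rightarrow> ('a \<Rightarrow> 'b) \<Rightarrow> bool" where
  "wderiv U e f g \<longleftrightarrow> f \<in> borel_measurable borel \<and> g \<in> borel_measurable borel \<and>
     (\<forall>K. compact K \<longrightarrow> K \<subseteq> U \<longrightarrow> integrable lborel (\<lambda>x. indicator K x *\<^sub>R f x) \<and>
        integrable lborel (\<lambda>x. indicator K x *\<^sub>R g x)) \<and>
     (\<forall>\<phi> :: 'a \<Rightarrow> real. test_fun U \<phi> \<longrightarrow>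
        (LBINT x. fderiv \<phi> x e *\<^sub>R f x) = - (LBINT x. \<phi> x *\<^sub>R g x))"

lemma absolutely_integrable_rep:
  assumes "borel_rep U f f'" "K \<in> sets borel" "K \<subseteq> U" "f absolutely_integrable_on K"
  shows "integrable lborel (\<lambda>x. indicator K x *\<^sub>R f' x)"
proof -
  have [measurable]: "f' \<in> borel_measurable borel" using assms(1) by (rule borel_rep_measurable)
  have "integrable (lebesgue_on K) f"
    using assms(2,4) by (subst integrable_restrict_space) (auto simp: set_integrable_def)
  moreover have "integrable (lebesgue_on K) f \<longleftrightarrow> integrable lborel (\<lambda>x. indicator K x *\<^sub>R f' x)"
    by (rule integral_lebesgue_on(2)[OF assms(2)])
      (use borel_rep_AE[OF assms(1)] assms(2,3) in \<open>auto elim!: eventually_mono\<close>)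
  ultimately show ?thesis by simp
qed

lemma weak_deriv_imp_wderiv:
  assumes U: "open U" and w: "weak_deriv U e f g" and f: "borel_rep U f f'" and g: "borel_rep U g g'"
  shows "wderiv U e f' g'"
  unfolding wderiv_def
proof (intro conjI allI impI)
  show [measurable]: "f' \<in> borel_measurable borel" "g' \<in> borel_measurable borel"
    using f g borel_rep_measurable by auto
  show "integrable lborel (\<lambda>x. indicator K x *\<^sub>R f' x)" if "compact K" "K \<subseteq> U" for K
    by (rule absolutely_integrable_rep[OF f _ that(2)])
      (use w that in \<open>auto simp: weak_deriv_def locally_integrable_def compact_imp_closed\<close>)
  show "integrable lborel (\<lambda>x. indicator K x *\<^sub>R g' x)" if "compact K" "K \<subseteq> U" for K
    by (rule absolutely_integrable_rep[OF g _ that(2)])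
      (use w that in \<open>auto simp: weak_deriv_def locally_integrable_def compact_imp_closed\<close>)
  fix \<phi> :: "'a \<Rightarrow> real" assume \<phi>: "test_fun U \<phi>"
  have [measurable]: "\<phi> \<in> borel_measurable borel" "(\<lambda>x. fderiv \<phi> x e) \<in> borel_measurable borel"
    using test_fun_measurable[OF \<phi>] test_fun_measurable[OF test_fun_deriv[OF \<phi>]] by auto
  have Ub: "U \<in> sets borel" using U by simp
  have "(\<integral>x. fderiv \<phi> x e *\<^sub>R f x \<partial>lebesgue_on U) = (LBINT x. fderiv \<phi> x e *\<^sub>R f' x)"
    by (rule integral_lebesgue_on(1)[OF Ub])
      (use borel_rep_AE[OF f] borel_rep_0[OF f] in \<open>auto elim!: eventually_mono\<close>)
  moreover have "(\<integral>x. \<phi> x *\<^sub>R g x \<partial>lebesgue_on U) = (LBINT x. \<phi> x *\<^sub>R g' x)"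
    by (rule integral_lebesgue_on(1)[OF Ub])
      (use borel_rep_AE[OF g] borel_rep_0[OF g] in \<open>auto elim!: eventually_mono\<close>)
  ultimately show "(LBINT x. fderiv \<phi> x e *\<^sub>R f' x) = - (LBINT x. \<phi> x *\<^sub>R g' x)"
    using w \<phi> by (simp add: weak_deriv_def)
qed

lemma compact_exhaustion:
  fixes U :: "'a::euclidean_space set"
  assumes "open U"
  shows "\<exists>C :: nat \<Rightarrow> 'a set. (\<forall>n. compact (C n)) \<and> (\<forall>n. C n \<subseteq> U) \<and> (\<forall>n. C n \<subseteq> C (Suc n)) \<and> \<Union> (range C) = U"
proof (rule open_Union_compact_subsets[OF assms])
  fix C :: "nat \<Rightarrow> 'a set"
  assume C: "\<And>n. compact (C n)" "\<And>n. C n \<subseteq> U" "\<And>n. C n \<subseteq> interior (C (Suc n))" "\<Union> (range C) = U"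
  have "C n \<subseteq> C (Suc n)" for n using C(3)[of n] interior_subset by (rule subset_trans)
  then show ?thesis using C(1,2,4) by (intro exI[of _ C]) simp
qed

lemma locally_integrable_measurable:
  fixes f :: "'a::euclidean_space \<Rightarrow> 'b::euclidean_space"
  assumes U: "open U" and f: "locally_integrable U f"
  shows "f \<in> borel_measurable (lebesgue_on U)"
proof -
  obtain C :: "nat \<Rightarrow> 'a set" where C: "\<And>n. compact (C n)" "\<And>n. C n \<subseteq> U" "\<And>n. C n \<subseteq> C (Suc n)"
      "\<Union> (range C) = U"
    using compact_exhaustion[OF U] by blast
  have mono: "C m \<subseteq> C n" if "m \<le> n" for m n
    using C(3) that by (rule lift_Suc_mono_le[of C])
  have "(\<lambda>x. indicator U x *\<^sub>R f x) \<in> borel_measurable lebesgue"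
  proof (rule borel_measurable_LIMSEQ_metric)
    show "(\<lambda>x. indicator (C n) x *\<^sub>R f x) \<in> borel_measurable lebesgue" for n
      using f C(1,2) by (auto simp: locally_integrable_def set_integrable_def intro!: borel_measurable_integrable)
    fix x
    show "(\<lambda>n. indicator (C n) x *\<^sub>R f x) \<longlonglongrightarrow> indicator U x *\<^sub>R f x"
    proof (cases "x \<in> U")
      case True
      then obtain m where "x \<in> C m" using C(4) by blast
      then have "\<forall>\<^sub>F n in sequentially. indicator U x *\<^sub>R f x = indicator (C n) x *\<^sub>R f x"
        using subsetD[OF mono] True unfolding eventually_sequentially
        by (intro exI[of _ m]) (simp add: indicator_def)
      then show ?thesis by (rule Lim_transform_eventually[OF tendsto_const])
    next
      case False
      then have "x \<notin> C n" for n using C(2) by blast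
      then show ?thesis using False by simp
    qed
  qed
  then show ?thesis using U by (subst borel_measurable_restrict_space_iff) auto
qed

lemma compact_thickening:
  fixes K :: "'a::euclidean_space set"
  assumes "compact K" "K \<subseteq> U" "open U"
  shows "\<exists>K' e. compact K' \<and> K' \<subseteq> U \<and> 0 < e \<and> (\<forall>x\<in>K. cball x e \<subseteq> K')"
proof -
  obtain e where e: "0 < e" "(\<Union>x\<in>K. ball x e) \<subseteq> U"
    by (rule compact_subset_open_imp_ball_epsilon_subset[OF assms(1,3,2)])
  define K' where "K' = {x + y | x y. x \<in> K \<and> y \<in> cball 0 (e/2)}"
  show ?thesis
  proof (intro exI[of _ K'] exI[of _ "e/2"] conjI ballI)
    show "compact K'" unfolding K'_def using assms(1) by (intro compact_sums) auto
    show "K' \<subseteq> U"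
    proof
      fix z assume "z \<in> K'"
      then obtain x y where xy: "z = x + y" "x \<in> K" "y \<in> cball 0 (e/2)" by (auto simp: K'_def)
      then have "z \<in> ball x e" using e(1) by (simp add: dist_norm)
      then show "z \<in> U" using e(2) xy(2) by blast
    qed
    show "cball x (e/2) \<subseteq> K'" if "x \<in> K" for x
    proof
      fix z assume "z \<in> cball x (e/2)"
      then show "z \<in> K'" unfolding K'_def mem_Collect_eq using that
        by (intro exI[of _ x] exI[of _ "z - x"]) (auto simp: dist_norm norm_minus_commute)
    qed
  qed (use e in simp)
qed

lemma conv_mollifier_local:
  fixes f :: "'a::euclidean_space \<Rightarrow> 'b::euclidean_space"
  assumes \<kappa>: "0 < \<kappa>" "cball x \<kappa> \<subseteq> K"
  shows "conv (mollifier \<kappa>) (\<lambda>y. indicator K y *\<^sub>R f y) x = (LBINT y. mollifier \<kappa> (x - y) *\<^sub>R f y)"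
    and "conv (\<lambda>z. fderiv (mollifier \<kappa>) z e) (\<lambda>y. indicator K y *\<^sub>R f y) x
      = (LBINT y. fderiv (mollifier \<kappa>) (x - y) e *\<^sub>R f y)"
proof -
  have 1: "y \<in> K" if "mollifier \<kappa> (x - y) \<noteq> 0" for y
    using that mollifier_eq_0[OF \<kappa>(1), of "x - y"] \<kappa>(2) by (force simp: dist_norm)
  have 2: "y \<in> K" if "fderiv (mollifier \<kappa>) (x - y) e \<noteq> 0" for y
    using that mollifier_deriv_eq_0[OF \<kappa>(1), of "x - y" e] \<kappa>(2) by (force simp: dist_norm)
  show "conv (mollifier \<kappa>) (\<lambda>y. indicator K y *\<^sub>R f y) x = (LBINT y. mollifier \<kappa> (x - y) *\<^sub>R f y)"
    unfolding conv_def using 1 by (intro Bochner_Integration.integral_cong) (auto simp: indicator_def)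
  show "conv (\<lambda>z. fderiv (mollifier \<kappa>) z e) (\<lambda>y. indicator K y *\<^sub>R f y) x
      = (LBINT y. fderiv (mollifier \<kappa>) (x - y) e *\<^sub>R f y)"
    unfolding conv_def using 2 by (intro Bochner_Integration.integral_cong) (auto simp: indicator_def)
qed

text \<open>Mollification commutes with weak differentiation at points whose \<open>\<kappa>\<close>-ball stays inside the domain.
  There the function may be replaced by its restriction to a compact set, which is integrable.\<close>

lemma wderiv_conv:
  fixes f g :: "'a::euclidean_space \<Rightarrow> 'b::euclidean_space"
  assumes w: "wderiv U e f g" and K: "compact K" "K \<subseteq> U" and \<kappa>: "0 < \<kappa>" "cball x \<kappa> \<subseteq> K"
  shows "fderiv (conv (mollifier \<kappa>) (\<lambda>y. indicator K y *\<^sub>R f y)) x e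
    = conv (mollifier \<kappa>) (\<lambda>y. indicator K y *\<^sub>R g y) x"
proof -
  have i: "integrable lborel (\<lambda>y. indicator K y *\<^sub>R f y)" using w K by (simp add: wderiv_def)
  have cU: "cball x \<kappa> \<subseteq> U" using \<kappa>(2) K(2) by blast
  have "(LBINT y. - fderiv (mollifier \<kappa>) (x - y) e *\<^sub>R f y) = - (LBINT y. mollifier \<kappa> (x - y) *\<^sub>R g y)"
  proof -
    have "\<forall>\<phi> :: 'a \<Rightarrow> real. test_fun U \<phi> \<longrightarrow>
        (LBINT y. fderiv \<phi> y e *\<^sub>R f y) = - (LBINT y. \<phi> y *\<^sub>R g y)"
      using w by (simp add: wderiv_def)
    from this[rule_format, OF test_fun_mollifier_reflect(1)[OF \<kappa>(1) cU]]
    show ?thesis by (simp only: test_fun_mollifier_reflect(2)[OF \<kappa>(1) cU])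
  qed
  then show ?thesis
    by (simp add: frechet_derivative_conv[OF test_fun_mollifier[OF \<kappa>(1)] i] conv_mollifier_local[OF \<kappa>])
qed

text \<open>The fundamental lemma of the calculus of variations: \<open>h\<close> is the \<open>L\<^sub>1\<close> limit of its
  mollifications, and these vanish.\<close>

lemma vanishing_against_test_funs:
  fixes h :: "'a::euclidean_space \<Rightarrow> 'b::euclidean_space"
  assumes U: "open U" and i: "\<And>K. compact K \<Longrightarrow> K \<subseteq> U \<Longrightarrow> integrable lborel (\<lambda>x. indicator K x *\<^sub>R h x)"
    and z: "\<And>\<phi> :: 'a \<Rightarrow> real. test_fun U \<phi> \<Longrightarrow> (LBINT x. \<phi> x *\<^sub>R h x) = 0"
  shows "AE x in lborel. x \<in> U \<longrightarrow> h x = 0"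
proof -
  obtain C :: "nat \<Rightarrow> 'a set" where C: "\<And>n. compact (C n)" "\<And>n. C n \<subseteq> U" "\<And>n. C n \<subseteq> C (Suc n)"
      "\<Union> (range C) = U"
    using compact_exhaustion[OF U] by blast
  have "AE x in lborel. x \<in> C n \<longrightarrow> h x = 0" for n
  proof -
    obtain K e where K: "compact K" "K \<subseteq> U" "0 < e" "\<And>x. x \<in> C n \<Longrightarrow> cball x e \<subseteq> K"
      using compact_thickening[OF C(1,2) U] by meson
    let ?\<kappa> = "\<lambda>m. inverse (real (Suc m)) * e"
    have \<kappa>: "0 < ?\<kappa> m" "?\<kappa> \<longlonglongrightarrow> 0" for m
      using K(3) tendsto_mult_left_zero[OF LIMSEQ_inverse_real_of_nat] by auto
    obtain r :: "nat \<Rightarrow> nat" where r: "AE x in lborel.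
        (\<lambda>m. conv (mollifier (?\<kappa> (r m))) (\<lambda>x. indicator K x *\<^sub>R h x) x) \<longlonglongrightarrow> indicator K x *\<^sub>R h x"
      using mollifier_AE_subseq[OF i[OF K(1,2)] \<kappa>] by blast
    have zero: "conv (mollifier (?\<kappa> m)) (\<lambda>x. indicator K x *\<^sub>R h x) x = 0" if "x \<in> C n" for m x
    proof -
      have "?\<kappa> m \<le> e" using K(3) by (simp add: field_simps)
      then have c: "cball x (?\<kappa> m) \<subseteq> K" using K(4)[OF that] by (meson cball_subset_cball_iff subset_trans subset_cball)
      then have "cball x (?\<kappa> m) \<subseteq> U" using K(2) by blast
      from z[OF test_fun_mollifier_reflect(1)[OF \<kappa>(1) this]] conv_mollifier_local(1)[OF \<kappa>(1) c, of h]
      show ?thesis by simp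
    qed
    from r show ?thesis
    proof eventually_elim
      case (elim x)
      show ?case
      proof
        assume x: "x \<in> C n"
        then have "indicator K x *\<^sub>R h x = 0" using elim zero[OF x] by (simp add: LIMSEQ_const_iff)
        moreover have "x \<in> K" using K(3) K(4)[OF x] by auto
        ultimately show "h x = 0" by simp
      qed
    qed
  qed
  then have "AE x in lborel. \<forall>n. x \<in> C n \<longrightarrow> h x = 0" unfolding AE_all_countable by blast
  then show ?thesis by eventually_elim (use C(4) in blast)
qed

lemma test_fun_scaleR_integrable:
  fixes g :: "'a::euclidean_space \<Rightarrow> 'b::euclidean_space"
  assumes \<phi>: "test_fun U \<phi>"
    and g: "\<And>K. compact K \<Longrightarrow> K \<subseteq> U \<Longrightarrow> integrable lborel (\<lambda>x. indicator K x *\<^sub>R g x)"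
  shows "integrable lborel (\<lambda>x. \<phi> x *\<^sub>R g x)"
proof -
  obtain K where K: "compact K" "K \<subseteq> U" "\<And>x. x \<notin> K \<Longrightarrow> \<phi> x = 0"
    using \<phi> by (auto simp: test_fun_def)
  obtain B where B: "\<And>x. norm (\<phi> x) \<le> B" using test_fun_bounded[OF \<phi>] by blast
  have "integrable lborel (\<lambda>x. \<phi> x *\<^sub>R indicator K x *\<^sub>R g x)"
    by (rule integrable_bounded_mult[of _ _ _ B]) (use g K B test_fun_measurable[OF \<phi>] in auto)
  moreover have "(\<lambda>x. \<phi> x *\<^sub>R indicator K x *\<^sub>R g x) = (\<lambda>x. \<phi> x *\<^sub>R g x)"
  proof
    fix x show "\<phi> x *\<^sub>R indicator K x *\<^sub>R g x = \<phi> x *\<^sub>R g x" using K(3)[of x] by (cases "x \<in> K") auto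
  qed
  ultimately show ?thesis by simp
qed

lemma wderiv_unique:
  fixes f g :: "'a::euclidean_space \<Rightarrow> 'b::euclidean_space"
  assumes U: "open U" and w: "wderiv U e f g1" "wderiv U e f g2"
  shows "AE x in lborel. x \<in> U \<longrightarrow> g1 x = g2 x"
proof -
  have i: "integrable lborel (\<lambda>x. \<phi> x *\<^sub>R g x)" if g: "wderiv U e f g" and \<phi>: "test_fun U \<phi>" for g :: "'a \<Rightarrow> 'b" and \<phi>
    by (rule test_fun_scaleR_integrable[OF \<phi>]) (use g in \<open>auto simp: wderiv_def\<close>)
  have "AE x in lborel. x \<in> U \<longrightarrow> g1 x - g2 x = 0"
  proof (rule vanishing_against_test_funs[OF U])
    show "integrable lborel (\<lambda>x. indicator K x *\<^sub>R (g1 x - g2 x))" if "compact K" "K \<subseteq> U" for K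
      using w that by (auto simp: wderiv_def scaleR_diff_right)
    show "(LBINT x. \<phi> x *\<^sub>R (g1 x - g2 x)) = 0" if "test_fun U \<phi>" for \<phi> :: "'a \<Rightarrow> real"
      using w i[OF w(1) that] i[OF w(2) that] that by (simp add: wderiv_def scaleR_diff_right)
  qed
  then show ?thesis by simp
qed

section \<open>Square integrable functions with vanishing boundary values\<close>

lemma Ck_on_inner:
  fixes f :: "'a::euclidean_space \<Rightarrow> 'b::euclidean_space"
  shows "Ck_on k UNIV f \<Longrightarrow> Ck_on k UNIV (\<lambda>x. f x \<bullet> b)"
proof (induction k arbitrary: f)
  case 0 then show ?case by (auto intro: continuous_intros)
next
  case (Suc k)
  show ?case
    by (rule Ck_on_SucI[OF has_derivative_inner_left[OF Ck_on_Suc_has_derivative[OF Suc(2)]]])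
      (use Suc in auto)
qed

lemma test_fun_inner:
  fixes \<phi> :: "'a::euclidean_space \<Rightarrow> 'b::euclidean_space"
  assumes "test_fun U \<phi>"
  shows "test_fun U (\<lambda>x. \<phi> x \<bullet> b)"
    and "fderiv (\<lambda>x. \<phi> x \<bullet> b) x h = fderiv \<phi> x h \<bullet> b"
proof -
  obtain K where K: "compact K" "K \<subseteq> U" "\<And>x. x \<notin> K \<Longrightarrow> \<phi> x = 0"
    using assms by (auto simp: test_fun_def)
  then show "test_fun U (\<lambda>x. \<phi> x \<bullet> b)"
    unfolding test_fun_def smooth_on_def using Ck_on_inner[OF test_fun_Ck[OF assms]]
    by (intro conjI exI[of _ K]) auto
  show "fderiv (\<lambda>x. \<phi> x \<bullet> b) x h = fderiv \<phi> x h \<bullet> b"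
    by (simp flip: frechet_derivative_at[OF has_derivative_inner_left[OF test_fun_has_derivative[OF assms]]])
qed

lemma Lp_norm_2_square:
  "Lp_norm 2 M f * Lp_norm 2 M f = (\<integral>\<^sup>+x. ennreal ((norm (f x))\<^sup>2) \<partial>M)"
proof -
  have p: "norm (f x) powr 2 = (norm (f x))\<^sup>2" for x
    by (simp add: powr_numeral)
  have t: "(2::ennreal) \<noteq> \<infinity>" "enn2real 2 = 2" by simp_all
  show ?thesis
  proof (cases "(\<integral>\<^sup>+x. ennreal ((norm (f x))\<^sup>2) \<partial>M) = \<infinity>")
    case True then show ?thesis using t by (simp add: Lp_norm_def p Let_def ennreal_top_mult)
  next
    case False
    define J where "J = enn2real (\<integral>\<^sup>+x. ennreal ((norm (f x))\<^sup>2) \<partial>M)"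
    have J: "0 \<le> J" "(\<integral>\<^sup>+x. ennreal ((norm (f x))\<^sup>2) \<partial>M) = ennreal J"
      using False by (auto simp: J_def less_top)
    have "Lp_norm 2 M f = ennreal (J powr (1/2))" using False t by (simp add: Lp_norm_def p Let_def J)
    moreover have "J powr (1/2) * J powr (1/2) = J" using J(1) by (simp flip: powr_add)
    ultimately show ?thesis using J by (simp flip: ennreal_mult)
  qed
qed

lemma Lp_norm_2_finite: "Lp_norm 2 M f < \<infinity> \<Longrightarrow> (\<integral>\<^sup>+x. ennreal ((norm (f x))\<^sup>2) \<partial>M) < \<infinity>"
  by (simp flip: Lp_norm_2_square add: ennreal_mult_less_top)

lemma nn_integral_rep:
  assumes "S \<in> sets borel" "borel_rep S f f'" "\<And>x. x \<notin> S \<Longrightarrow> \<phi> x = 0"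
  shows "(\<integral>\<^sup>+x. ennreal ((norm (\<phi> x - f x))\<^sup>2) \<partial>lebesgue_on S) = (\<integral>\<^sup>+x. ennreal ((norm (\<phi> x - f' x))\<^sup>2) \<partial>lborel)"
  unfolding nn_integral_lebesgue_on[OF assms(1)]
  by (intro nn_integral_cong_AE)
    (use borel_rep_AE[OF assms(2)] borel_rep_0[OF assms(2)] assms(3) in \<open>auto elim!: eventually_mono simp: indicator_def\<close>)

lemma in_L2_rep:
  assumes "S \<in> sets borel" "borel_rep S f f'" "in_Lp 2 (lebesgue_on S) f"
  shows "integrable lborel (\<lambda>x. (norm (f' x))\<^sup>2)"
    and "Lp_norm 2 (lebesgue_on S) f * Lp_norm 2 (lebesgue_on S) f = ennreal (LBINT x. (norm (f' x))\<^sup>2)"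
proof -
  have [measurable]: "f' \<in> borel_measurable borel" using assms(2) by (rule borel_rep_measurable)
  have e: "(\<integral>\<^sup>+x. ennreal ((norm (f x))\<^sup>2) \<partial>lebesgue_on S) = (\<integral>\<^sup>+x. ennreal ((norm (f' x))\<^sup>2) \<partial>lborel)"
    using nn_integral_rep[OF assms(1,2), of "\<lambda>_. 0"] by simp
  show i: "integrable lborel (\<lambda>x. (norm (f' x))\<^sup>2)"
    using assms(3) Lp_norm_2_finite[of "lebesgue_on S" f]
    by (intro integrableI_bounded) (auto simp: in_Lp_def e)
  show "Lp_norm 2 (lebesgue_on S) f * Lp_norm 2 (lebesgue_on S) f = ennreal (LBINT x. (norm (f' x))\<^sup>2)"
    unfolding Lp_norm_2_square e by (rule nn_integral_eq_integral[OF i]) auto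
qed

text \<open>Membership in \<open>H10\<close> together with the weak gradient, for zero extensions, with squared integrals in
  place of norms.\<close>

definition h10 :: "(real^'n) set \<Rightarrow> (real^'n \<Rightarrow> 'b::euclidean_space) \<Rightarrow> (real^'n \<Rightarrow> 'b^'n) \<Rightarrow> bool" where
  "h10 \<Omega> u D \<longleftrightarrow> u \<in> borel_measurable borel \<and> D \<in> borel_measurable borel \<and>
     (\<forall>x. x \<notin> \<Omega> \<longrightarrow> u x = 0 \<and> D x = 0) \<and>
     integrable lborel (\<lambda>x. (norm (u x))\<^sup>2) \<and> integrable lborel (\<lambda>x. (norm (D x))\<^sup>2) \<and>
     (\<exists>\<phi> :: nat \<Rightarrow> real^'n \<Rightarrow> 'b. (\<forall>k. test_fun \<Omega> (\<phi> k)) \<and>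
        (\<lambda>k. LBINT x. (norm (\<phi> k x - u x))\<^sup>2) \<longlonglongrightarrow> 0 \<and>
        (\<lambda>k. LBINT x. (norm (grad (\<phi> k) x - D x))\<^sup>2) \<longlonglongrightarrow> 0)"

lemma test_fun_grad:
  fixes \<phi> :: "real^'n \<Rightarrow> 'b::euclidean_space"
  assumes "test_fun U \<phi>"
  shows "continuous_on UNIV (grad \<phi>)" "integrable lborel (\<lambda>x. (norm (grad \<phi> x))\<^sup>2)"
    "integrable lborel (\<lambda>x. (norm (\<phi> x))\<^sup>2)" "x \<notin> U \<Longrightarrow> grad \<phi> x = 0"
proof -
  obtain K where K: "compact K" "K \<subseteq> U" "\<And>x. x \<notin> K \<Longrightarrow> \<phi> x = 0"
    using assms by (auto simp: test_fun_def)
  have "continuous_on UNIV (\<lambda>x. fderiv \<phi> x (axis j 1))" for j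
    using test_fun_Ck[OF assms, of "Suc 0"] by (auto simp: Basis_vec_def)
  then show c: "continuous_on UNIV (grad \<phi>)" unfolding grad_def[abs_def] by (intro continuous_on_vec_lambda) simp
  have z: "grad \<phi> x = 0" if "x \<notin> K" for x
    using frechet_derivative_outside_support(2)[OF compact_imp_closed[OF K(1)] K(3) that]
    by (simp add: grad_def vec_eq_iff)
  then show "x \<notin> U \<Longrightarrow> grad \<phi> x = 0" using K(2) by blast
  show "integrable lborel (\<lambda>x. (norm (grad \<phi> x))\<^sup>2)"
    by (rule integrable_compact_support[OF _ K(1)]) (use z c in \<open>auto intro!: continuous_intros\<close>)
  show "integrable lborel (\<lambda>x. (norm (\<phi> x))\<^sup>2)"
    by (rule integrable_compact_support[OF _ K(1)]) (use K test_fun_continuous[OF assms] in \<open>auto intro!: continuous_intros\<close>)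
qed

lemma tendsto_L2_rep:
  assumes S: "S \<in> sets borel" and f: "borel_rep S f f'"
    and \<phi>: "\<And>k x. x \<notin> S \<Longrightarrow> \<phi> k x = 0" "\<And>k. \<phi> k \<in> borel_measurable borel"
    and lim: "(\<lambda>k. Lp_norm 2 (lebesgue_on S) (\<lambda>x. \<phi> k x - f x)) \<longlonglongrightarrow> 0"
  shows "(\<lambda>k. LBINT x. (norm (\<phi> k x - f' x))\<^sup>2) \<longlonglongrightarrow> 0"
proof -
  have [measurable]: "f' \<in> borel_measurable borel" "\<And>k. \<phi> k \<in> borel_measurable borel"
    using borel_rep_measurable[OF f] \<phi>(2) by auto
  let ?L = "\<lambda>k. Lp_norm 2 (lebesgue_on S) (\<lambda>x. \<phi> k x - f x)"
  have "(\<lambda>k. ?L k * ?L k) \<longlonglongrightarrow> 0 * 0" by (intro tendsto_mult_ennreal lim) auto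
  moreover have "?L k * ?L k = (\<integral>\<^sup>+x. ennreal ((norm (\<phi> k x - f' x))\<^sup>2) \<partial>lborel)" for k
    by (simp add: Lp_norm_2_square nn_integral_rep[OF S f \<phi>(1)])
  ultimately have "(\<lambda>k. \<integral>\<^sup>+x. ennreal ((norm (\<phi> k x - f' x))\<^sup>2) \<partial>lborel) \<longlonglongrightarrow> ennreal 0" by simp
  then have "(\<lambda>k. enn2real (\<integral>\<^sup>+x. ennreal ((norm (\<phi> k x - f' x))\<^sup>2) \<partial>lborel)) \<longlonglongrightarrow> 0"
    by (rule tendsto_enn2real) simp
  then show ?thesis by (subst integral_eq_nn_integral) auto
qed

lemma borel_measurable_nth:
  fixes D :: "'a \<Rightarrow> 'b::euclidean_space^'n"
  assumes "D \<in> borel_measurable M"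
  shows "(\<lambda>x. D x $ j) \<in> borel_measurable M"
  by (rule measurable_compose[OF assms borel_measurable_continuous_onI])
    (intro continuous_on_component continuous_on_id)

lemma borel_rep_nth: "borel_rep S D D' \<Longrightarrow> borel_rep S (\<lambda>x. D x $ j) (\<lambda>x. D' x $ j :: 'b::euclidean_space)"
  unfolding borel_rep_def
  by (auto elim!: eventually_mono intro: borel_measurable_nth)

lemma h10I:
  fixes u :: "real^'n \<Rightarrow> 'b::euclidean_space"
  assumes \<Omega>: "open \<Omega>" and u: "u \<in> H10 \<Omega>" and D: "weak_grad \<Omega> u D"
    and ru: "borel_rep \<Omega> u u'" and rD: "borel_rep \<Omega> D D'"
  shows "h10 \<Omega> u' D'"
proof -
  have \<Omega>b: "\<Omega> \<in> sets borel" using \<Omega> by simp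
  from u obtain D0 \<phi> where u2: "in_Lp 2 (lebesgue_on \<Omega>) u" and D0: "weak_grad \<Omega> u D0" "in_Lp 2 (lebesgue_on \<Omega>) D0"
    and \<phi>: "\<And>k::nat. test_fun \<Omega> (\<phi> k)"
      "(\<lambda>k. Lp_norm 2 (lebesgue_on \<Omega>) (\<lambda>x. \<phi> k x - u x)) \<longlonglongrightarrow> 0"
      "(\<lambda>k. Lp_norm 2 (lebesgue_on \<Omega>) (\<lambda>x. grad (\<phi> k) x - D0 x)) \<longlonglongrightarrow> 0"
    unfolding H10_def by blast
  obtain D0' where r0: "borel_rep \<Omega> D0 D0'"
    using borel_rep_exists[OF \<Omega>b] D0(2) by (auto simp: in_Lp_def)
  have "AE x in lborel. x \<in> \<Omega> \<longrightarrow> D' x $ j = D0' x $ j" for j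
    by (rule wderiv_unique[OF \<Omega>, of "axis j 1" u'];
        rule weak_deriv_imp_wderiv[OF \<Omega> _ ru borel_rep_nth[OF rD]] weak_deriv_imp_wderiv[OF \<Omega> _ ru borel_rep_nth[OF r0]];
        use D D0 in \<open>simp add: weak_grad_def\<close>)
  then have "AE x in lborel. \<forall>j. x \<in> \<Omega> \<longrightarrow> D' x $ j = D0' x $ j"
    unfolding AE_all_countable by blast
  then have e: "AE x in lborel. D0' x = D' x"
    by eventually_elim (use borel_rep_0[OF rD] borel_rep_0[OF r0] in \<open>auto simp: vec_eq_iff\<close>)
  have m: "D' \<in> borel_measurable borel" "D0' \<in> borel_measurable borel"
    using borel_rep_measurable[OF rD] borel_rep_measurable[OF r0] by auto
  have g: "grad (\<phi> k) \<in> borel_measurable borel" for k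
    by (rule borel_measurable_continuous_onI[OF test_fun_grad(1)[OF \<phi>(1)]])
  note [measurable] = m g
  have "integrable lborel (\<lambda>x. (norm (D' x))\<^sup>2)"
    by (rule integrable_cong_AE_imp[OF in_L2_rep(1)[OF \<Omega>b r0 D0(2)]])
      (use e in \<open>auto elim!: eventually_mono\<close>)
  moreover have "(\<lambda>k. LBINT x. (norm (grad (\<phi> k) x - D' x))\<^sup>2) \<longlonglongrightarrow> 0"
  proof -
    have "(LBINT x. (norm (grad (\<phi> k) x - D' x))\<^sup>2) = (LBINT x. (norm (grad (\<phi> k) x - D0' x))\<^sup>2)" for k
      by (intro integral_cong_AE) (use e in \<open>auto elim!: eventually_mono\<close>)
    then show ?thesis
      using tendsto_L2_rep[OF \<Omega>b r0 test_fun_grad(4)[OF \<phi>(1)] g \<phi>(3)] by simp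
  qed
  moreover have "(\<lambda>k. LBINT x. (norm (\<phi> k x - u' x))\<^sup>2) \<longlonglongrightarrow> 0"
    by (rule tendsto_L2_rep[OF \<Omega>b ru test_fun_support[OF \<phi>(1)] test_fun_measurable[OF \<phi>(1)] \<phi>(2)])
  ultimately show ?thesis
    unfolding h10_def using in_L2_rep(1)[OF \<Omega>b ru u2] \<phi>(1) borel_rep_0[OF ru] borel_rep_0[OF rD]
      borel_rep_measurable[OF ru] m by (intro conjI exI[of _ \<phi>]) auto
qed

text \<open>Weak convergence of the approximating test functions suffices for identities that are linear in
  \<open>u\<close> and \<open>D\<close>.\<close>

lemma h10_approx:
  assumes "h10 \<Omega> u D"
  shows "\<exists>\<phi>. (\<forall>k::nat. test_fun \<Omega> (\<phi> k)) \<and>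
    (\<forall>g. g \<in> borel_measurable borel \<longrightarrow> integrable lborel (\<lambda>x. (norm (g x))\<^sup>2) \<longrightarrow>
       (\<lambda>k. LBINT x. \<phi> k x \<bullet> g x) \<longlonglongrightarrow> (LBINT x. u x \<bullet> g x)) \<and>
    (\<forall>g. g \<in> borel_measurable borel \<longrightarrow> integrable lborel (\<lambda>x. (norm (g x))\<^sup>2) \<longrightarrow>
       (\<lambda>k. LBINT x. grad (\<phi> k) x \<bullet> g x) \<longlonglongrightarrow> (LBINT x. D x \<bullet> g x))"
proof -
  obtain \<phi> where \<phi>: "\<And>k::nat. test_fun \<Omega> (\<phi> k)"
      "(\<lambda>k. LBINT x. (norm (\<phi> k x - u x))\<^sup>2) \<longlonglongrightarrow> 0"
      "(\<lambda>k. LBINT x. (norm (grad (\<phi> k) x - D x))\<^sup>2) \<longlonglongrightarrow> 0"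
    using assms unfolding h10_def by blast
  have m: "u \<in> borel_measurable lborel" "D \<in> borel_measurable lborel"
      "integrable lborel (\<lambda>x. (norm (u x))\<^sup>2)" "integrable lborel (\<lambda>x. (norm (D x))\<^sup>2)"
    using assms by (auto simp: h10_def)
  show ?thesis
  proof (intro exI[of _ \<phi>] conjI allI impI)
    show "test_fun \<Omega> (\<phi> k)" for k by (rule \<phi>(1))
    fix g :: "real^'a \<Rightarrow> 'b"
    assume "g \<in> borel_measurable borel" "integrable lborel (\<lambda>x. (norm (g x))\<^sup>2)"
    then show "(\<lambda>k. LBINT x. \<phi> k x \<bullet> g x) \<longlonglongrightarrow> (LBINT x. u x \<bullet> g x)"
      by (intro L2_tendsto[OF _ _ _ test_fun_grad(3)[OF \<phi>(1)] m(3) _ \<phi>(2)])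
        (use m test_fun_measurable[OF \<phi>(1)] in auto)
  next
    fix g :: "real^'a \<Rightarrow> 'b^'a"
    assume "g \<in> borel_measurable borel" "integrable lborel (\<lambda>x. (norm (g x))\<^sup>2)"
    then show "(\<lambda>k. LBINT x. grad (\<phi> k) x \<bullet> g x) \<longlonglongrightarrow> (LBINT x. D x \<bullet> g x)"
      by (intro L2_tendsto[OF _ _ _ test_fun_grad(2)[OF \<phi>(1)] m(4) _ \<phi>(3)])
        (use m borel_measurable_continuous_onI[OF test_fun_grad(1)[OF \<phi>(1)]] in auto)
  qed
qed

text \<open>Integration by parts on the whole space: extending by zero creates no boundary term.\<close>

lemma h10_by_parts:
  fixes u :: "real^'n \<Rightarrow> 'b::euclidean_space"
  assumes h: "h10 \<Omega> u D" and b: "bounded \<Omega>"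
    and \<psi>: "\<And>x. (\<psi> has_derivative \<psi>' x) (at x)" "continuous_on UNIV (\<lambda>x. \<psi>' x (axis j 1))"
  shows "(LBINT x. \<psi>' x (axis j 1) * (u x \<bullet> a)) = - (LBINT x. \<psi> x * (D x $ j \<bullet> a))"
proof -
  have "continuous (at x) \<psi>" for x by (rule has_derivative_continuous[OF \<psi>(1)])
  then have \<psi>c: "continuous_on UNIV \<psi>" by (simp add: continuous_on_eq_continuous_at)
  define K where "K = closure \<Omega>"
  have K: "compact K" "\<Omega> \<subseteq> K" using b closure_subset by (auto simp: K_def compact_closure)
  have Kb: "K \<in> sets borel" "emeasure lborel K < \<infinity>"
    using emeasure_compact_finite[OF K(1)] compact_imp_closed[OF K(1)] by auto
  from h10_approx[OF h] obtain \<phi> where "\<forall>k::nat. test_fun \<Omega> (\<phi> k)"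
    "\<forall>g. g \<in> borel_measurable borel \<longrightarrow> integrable lborel (\<lambda>x. (norm (g x))\<^sup>2) \<longrightarrow>
       (\<lambda>k. LBINT x. \<phi> k x \<bullet> g x) \<longlonglongrightarrow> (LBINT x. u x \<bullet> g x)"
    "\<forall>g. g \<in> borel_measurable borel \<longrightarrow> integrable lborel (\<lambda>x. (norm (g x))\<^sup>2) \<longrightarrow>
       (\<lambda>k. LBINT x. grad (\<phi> k) x \<bullet> g x) \<longlonglongrightarrow> (LBINT x. D x \<bullet> g x)"
    by (elim exE conjE) (rule that)
  note \<phi> = this(1)[rule_format] and lim = this(2,3)[rule_format]
  have L2: "g \<in> borel_measurable borel" "integrable lborel (\<lambda>x. (norm (g x))\<^sup>2)"
    if "g = (\<lambda>x. indicator K x *\<^sub>R G x)" "continuous_on UNIV G" for g G :: "real^'n \<Rightarrow> 'c::euclidean_space"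
  proof -
    have [measurable]: "G \<in> borel_measurable borel" by (rule borel_measurable_continuous_onI[OF that(2)])
    show "g \<in> borel_measurable borel" unfolding that(1) using Kb by measurable
    have "integrable lborel (\<lambda>x. indicator K x *\<^sub>R (norm (G x))\<^sup>2)"
      using that(2) by (intro borel_integrable_compact[OF K(1)] continuous_intros) (auto intro: continuous_on_subset)
    moreover have "(\<lambda>x. indicator K x *\<^sub>R (norm (G x))\<^sup>2) = (\<lambda>x. (norm (g x))\<^sup>2)"
      by (auto simp: that(1) indicator_def)
    ultimately show "integrable lborel (\<lambda>x. (norm (g x))\<^sup>2)" by simp
  qed
  define g1 where "g1 x = indicator K x *\<^sub>R (\<psi>' x (axis j 1) *\<^sub>R a)" for x
  define g2 where "g2 x = indicator K x *\<^sub>R (axis j (\<psi> x *\<^sub>R a) :: 'b^'n)" for x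
  have ax: "continuous_on UNIV (\<lambda>x. axis j (\<psi> x *\<^sub>R a) :: 'b^'n)"
    unfolding axis_def
  proof (rule continuous_on_vec_lambda)
    show "continuous_on UNIV (\<lambda>x. if i = j then \<psi> x *\<^sub>R a else 0)" for i
      by (cases "i = j") (auto intro!: continuous_intros \<psi>c)
  qed
  have l1: "(\<lambda>k. LBINT x. \<phi> k x \<bullet> g1 x) \<longlonglongrightarrow> (LBINT x. u x \<bullet> g1 x)"
    by (rule lim(1); rule L2[of g1 "\<lambda>x. \<psi>' x (axis j 1) *\<^sub>R a"]) (auto simp: g1_def[abs_def] intro!: continuous_intros \<psi>(2))
  have l2: "(\<lambda>k. LBINT x. grad (\<phi> k) x \<bullet> g2 x) \<longlonglongrightarrow> (LBINT x. D x \<bullet> g2 x)"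
    by (rule lim(2); rule L2[of g2 "\<lambda>x. axis j (\<psi> x *\<^sub>R a)"]) (auto simp: g2_def[abs_def] ax)
  have p: "(LBINT x. \<phi> k x \<bullet> g1 x) = - (LBINT x. grad (\<phi> k) x \<bullet> g2 x)" for k
  proof -
    note t = test_fun_inner[OF \<phi>, of k a]
    obtain C where C: "compact C" "C \<subseteq> \<Omega>" "\<And>x. x \<notin> C \<Longrightarrow> \<phi> k x = 0"
      using \<phi>[of k] by (auto simp: test_fun_def)
    let ?f = "\<lambda>x. \<psi> x * (\<phi> k x \<bullet> a)"
    let ?f' = "\<lambda>x h. \<psi> x * fderiv (\<lambda>x. \<phi> k x \<bullet> a) x h + \<psi>' x h * (\<phi> k x \<bullet> a)"
    have c1: "continuous_on UNIV (\<lambda>x. \<psi> x * fderiv (\<lambda>x. \<phi> k x \<bullet> a) x (axis j 1))"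
      using \<psi>c test_fun_continuous[OF test_fun_deriv[OF t(1)]] by (intro continuous_intros)
    have c2: "continuous_on UNIV (\<lambda>x. \<psi>' x (axis j 1) * (\<phi> k x \<bullet> a))"
      by (intro continuous_on_mult \<psi>(2) test_fun_continuous[OF t(1)])
    have z: "\<phi> k x \<bullet> a = 0" "fderiv (\<lambda>x. \<phi> k x \<bullet> a) x h = 0" if "x \<notin> C" for x h
      using C(3)[OF that] frechet_derivative_outside_support(2)[OF compact_imp_closed[OF C(1)] _ that, of "\<lambda>x. \<phi> k x \<bullet> a"] C(3)
      by auto
    have i1: "integrable lborel (\<lambda>x. \<psi> x * fderiv (\<lambda>x. \<phi> k x \<bullet> a) x (axis j 1))"
      by (rule integrable_compact_support[OF c1 C(1)]) (simp add: z)
    have i2: "integrable lborel (\<lambda>x. \<psi>' x (axis j 1) * (\<phi> k x \<bullet> a))"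
      by (rule integrable_compact_support[OF c2 C(1)]) (simp add: z)
    have "(LBINT x. ?f' x (axis j 1)) = 0"
    proof (rule integral_derivative_eq_0[where f = ?f])
      show "(?f has_derivative ?f' x) (at x)" for x
        by (rule has_derivative_mult[OF \<psi>(1) test_fun_has_derivative[OF t(1)]])
      show "continuous_on UNIV (\<lambda>x. ?f' x (axis j 1))" using c1 c2 by (intro continuous_on_add)
    qed (use C(1) z in auto)
    then have "(LBINT x. \<psi>' x (axis j 1) * (\<phi> k x \<bullet> a))
        = - (LBINT x. \<psi> x * fderiv (\<lambda>x. \<phi> k x \<bullet> a) x (axis j 1))"
      using i1 i2 by simp
    moreover have "\<psi>' x (axis j 1) * (\<phi> k x \<bullet> a) = \<phi> k x \<bullet> g1 x" for x
      using C(2) C(3)[of x] K(2) by (cases "x \<in> C") (auto simp: g1_def)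
    moreover have "\<psi> x * fderiv (\<lambda>x. \<phi> k x \<bullet> a) x (axis j 1) = grad (\<phi> k) x \<bullet> g2 x" for x
      using C(2) K(2) z(2)[of x "axis j 1"] test_fun_grad(4)[OF \<phi>[of k], of x]
      by (cases "x \<in> K") (auto simp: g2_def inner_axis grad_def t(2))
    ultimately show ?thesis by simp
  qed
  have "(\<lambda>k. LBINT x. \<phi> k x \<bullet> g1 x) \<longlonglongrightarrow> - (LBINT x. D x \<bullet> g2 x)"
    using tendsto_minus[OF l2] by (simp add: p)
  then have "(LBINT x. u x \<bullet> g1 x) = - (LBINT x. D x \<bullet> g2 x)" by (rule LIMSEQ_unique[OF l1])
  moreover have "u x \<bullet> g1 x = \<psi>' x (axis j 1) * (u x \<bullet> a)" for x
    using h K(2) by (cases "x \<in> K") (auto simp: g1_def h10_def)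
  moreover have "D x \<bullet> g2 x = \<psi> x * (D x $ j \<bullet> a)" for x
    using h K(2) by (cases "x \<in> K") (auto simp: g2_def h10_def inner_axis)
  ultimately show ?thesis by simp
qed

text \<open>Here \<open>f\<close> is merely weakly differentiable in \<open>\<Omega>\<close> and arbitrary near the boundary. There is no boundary
  term because \<open>u\<close> is a limit of test functions, to which the weak derivative of \<open>f\<close> may be applied.\<close>

lemma h10_by_parts_weak:
  fixes u :: "real^'n \<Rightarrow> 'b::euclidean_space"
  assumes h: "h10 \<Omega> u D" and w: "wderiv \<Omega> (axis j 1) f g"
    and f2: "integrable lborel (\<lambda>x. (f x)\<^sup>2)" and g2: "integrable lborel (\<lambda>x. (g x)\<^sup>2)"
  shows "(LBINT x. f x * (D x $ j \<bullet> a)) = - (LBINT x. g x * (u x \<bullet> a))"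
proof -
  from h10_approx[OF h] obtain \<phi> where "\<forall>k::nat. test_fun \<Omega> (\<phi> k)"
    "\<forall>g. g \<in> borel_measurable borel \<longrightarrow> integrable lborel (\<lambda>x. (norm (g x))\<^sup>2) \<longrightarrow>
       (\<lambda>k. LBINT x. \<phi> k x \<bullet> g x) \<longlonglongrightarrow> (LBINT x. u x \<bullet> g x)"
    "\<forall>g. g \<in> borel_measurable borel \<longrightarrow> integrable lborel (\<lambda>x. (norm (g x))\<^sup>2) \<longrightarrow>
       (\<lambda>k. LBINT x. grad (\<phi> k) x \<bullet> g x) \<longlonglongrightarrow> (LBINT x. D x \<bullet> g x)"
    by (elim exE conjE) (rule that)
  note \<phi> = this(1)[rule_format] and lim = this(2,3)[rule_format]
  have [measurable]: "f \<in> borel_measurable borel" "g \<in> borel_measurable borel"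
    using w by (auto simp: wderiv_def)
  have [measurable]: "(\<lambda>x. axis j (f x *\<^sub>R a) :: 'b^'n) \<in> borel_measurable borel"
  proof -
    have "bounded_linear (\<lambda>c. axis j (c *\<^sub>R a) :: 'b^'n)"
      by (intro linear_conv_bounded_linear[THEN iffD1] linearI)
        (auto simp: axis_def vec_eq_iff algebra_simps)
    from borel_measurable_continuous_on[OF linear_continuous_on[OF this]] show ?thesis by measurable
  qed
  have l1: "(\<lambda>k. LBINT x. \<phi> k x \<bullet> (g x *\<^sub>R a)) \<longlonglongrightarrow> (LBINT x. u x \<bullet> (g x *\<^sub>R a))"
    using g2 by (intro lim(1)) (auto simp: power_mult_distrib)
  have l2: "(\<lambda>k. LBINT x. grad (\<phi> k) x \<bullet> axis j (f x *\<^sub>R a)) \<longlonglongrightarrow> (LBINT x. D x \<bullet> axis j (f x *\<^sub>R a))"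
    using f2[unfolded power2_eq_square]
    by (intro lim(2)) (auto simp: power2_norm_eq_inner[of "axis _ _"] inner_axis_axis simp flip: mult.assoc)
  have "(LBINT x. grad (\<phi> k) x \<bullet> axis j (f x *\<^sub>R a)) = - (LBINT x. \<phi> k x \<bullet> (g x *\<^sub>R a))" for k
  proof -
    have "\<forall>\<phi>. test_fun \<Omega> \<phi> \<longrightarrow> (LBINT x. fderiv \<phi> x (axis j 1) *\<^sub>R f x) = - (LBINT x. \<phi> x *\<^sub>R g x)"
      using w by (simp add: wderiv_def)
    from this[rule_format, OF test_fun_inner(1)[OF \<phi>[of k], of a]]
    show ?thesis by (simp add: test_fun_inner(2)[OF \<phi>] grad_def inner_axis mult.commute)
  qed
  then have "(\<lambda>k. - (LBINT x. \<phi> k x \<bullet> (g x *\<^sub>R a))) \<longlonglongrightarrow> (LBINT x. D x \<bullet> axis j (f x *\<^sub>R a))"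
    using l2 by simp
  from LIMSEQ_unique[OF this tendsto_minus[OF l1]] show ?thesis by (simp add: inner_axis)
qed

lemma bounded_support_integrable:
  fixes f :: "'a::euclidean_space \<Rightarrow> 'b::euclidean_space"
  assumes [measurable]: "f \<in> borel_measurable borel" and f2: "integrable lborel (\<lambda>x. (norm (f x))\<^sup>2)"
    and b: "bounded \<Omega>" "\<And>x. x \<notin> \<Omega> \<Longrightarrow> f x = 0"
  shows "integrable lborel f"
proof -
  have K: "compact (closure \<Omega>)" using b by (simp add: compact_closure)
  show ?thesis
  proof (rule Bochner_Integration.integrable_bound)
    have "integrable lborel (\<lambda>x. indicator (closure \<Omega>) x :: real)"
      using emeasure_compact_finite[OF K] by (intro integrable_real_indicator) auto
    then show "integrable lborel (\<lambda>x. indicator (closure \<Omega>) x + (norm (f x))\<^sup>2)" using f2 by simp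
    have "norm (f x) \<le> indicator (closure \<Omega>) x + (norm (f x))\<^sup>2" for x
    proof (cases "x \<in> \<Omega>")
      case True
      have "0 \<le> (norm (f x) - 1)\<^sup>2" by simp
      then have "2 * norm (f x) \<le> 1 + (norm (f x))\<^sup>2" by (simp add: power2_diff)
      then have "norm (f x) \<le> 1 + (norm (f x))\<^sup>2" using norm_ge_zero[of "f x"] by linarith
      then show ?thesis using True closure_subset by (auto simp: indicator_def)
    qed (use b in simp)
    then show "AE x in lborel. norm (f x) \<le> norm (indicator (closure \<Omega>) x + (norm (f x))\<^sup>2)"
      by (intro AE_I2) (auto intro: order_trans[OF _ abs_ge_self])
  qed measurable
qed

lemma continuous_mult_integrable:
  fixes f :: "'a::euclidean_space \<Rightarrow> 'b::euclidean_space"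
  assumes f: "integrable lborel f" and b: "bounded \<Omega>" "\<And>x. x \<notin> \<Omega> \<Longrightarrow> f x = 0"
    and G: "continuous_on UNIV (G :: 'a \<Rightarrow> real)"
  shows "integrable lborel (\<lambda>x. G x *\<^sub>R f x)"
proof -
  have [measurable]: "G \<in> borel_measurable borel" by (rule borel_measurable_continuous_onI[OF G])
  have K: "compact (closure \<Omega>)" using b by (simp add: compact_closure)
  then have "compact (G ` closure \<Omega>)" using G by (intro compact_continuous_image) (auto intro: continuous_on_subset)
  then obtain B where B: "\<And>x. x \<in> closure \<Omega> \<Longrightarrow> \<bar>G x\<bar> \<le> B"
    using compact_imp_bounded bounded_iff by (metis imageI real_norm_def)
  have "integrable lborel (\<lambda>x. (indicator (closure \<Omega>) x * G x) *\<^sub>R f x)"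
  proof (rule integrable_bounded_mult[OF f, of _ "max B 0"])
    show "\<bar>indicator (closure \<Omega>) x * G x\<bar> \<le> max B 0" for x
      using B[of x] by (auto simp: indicator_def le_max_iff_disj)
  qed measurable
  moreover have "(indicator (closure \<Omega>) x * G x) *\<^sub>R f x = G x *\<^sub>R f x" for x
    using b(2)[of x] closure_subset[of \<Omega>] by (cases "x \<in> \<Omega>") (auto simp: indicator_def)
  ultimately show ?thesis by simp
qed

lemma h10_integrable:
  assumes "h10 \<Omega> u D" "bounded \<Omega>"
  shows "integrable lborel u" "integrable lborel D"
  using assms by (auto simp: h10_def intro: bounded_support_integrable[of u \<Omega>] bounded_support_integrable[of D \<Omega>])

lemma real_vec_expand: "(h :: real^'n) = (\<Sum>j\<in>UNIV. h $ j *\<^sub>R axis j 1)"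
  by (simp add: vec_eq_iff axis_def if_distrib[of "\<lambda>x. _ * x"] cong: if_cong)

lemma linear_vec_expand:
  assumes "linear (f :: real^'n \<Rightarrow> 'c::real_vector)"
  shows "f h = (\<Sum>j\<in>UNIV. h $ j *\<^sub>R f (axis j 1))"
  by (subst real_vec_expand[of h]) (simp add: linear_sum[OF assms] linear_cmul[OF assms])

lemma h10_divergence_free:
  fixes u :: "real^'n \<Rightarrow> real^'n" and \<psi> :: "real^'n \<Rightarrow> real"
  assumes h: "h10 \<Omega> u D" and b: "bounded \<Omega>" and tr: "AE x in lborel. trace (D x) = 0"
    and \<psi>: "\<And>x. (\<psi> has_derivative \<psi>' x) (at x)" "\<And>h. continuous_on UNIV (\<lambda>x. \<psi>' x h)"
  shows "(LBINT x. \<psi>' x (u x)) = 0"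
proof -
  note i = h10_integrable[OF h b]
  have z: "u x = 0" "D x = 0" if "x \<notin> \<Omega>" for x using h that by (auto simp: h10_def)
  have "continuous (at x) \<psi>" for x by (rule has_derivative_continuous[OF \<psi>(1)])
  then have \<psi>c: "continuous_on UNIV \<psi>" by (simp add: continuous_on_eq_continuous_at)
  have iu: "integrable lborel (\<lambda>x. \<psi>' x (axis j 1) * (u x \<bullet> axis j 1))" for j
    using continuous_mult_integrable[OF integrable_inner_left[OF i(1)] b _ \<psi>(2)] z by simp
  have iD: "integrable lborel (\<lambda>x. \<psi> x * (D x $ j \<bullet> axis j 1))" for j
  proof -
    have "integrable lborel (\<lambda>x. \<psi> x *\<^sub>R (D x \<bullet> axis j (axis j 1)))"
      using continuous_mult_integrable[OF integrable_inner_left[OF i(2)] b _ \<psi>c] z by simp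
    then show ?thesis by (simp add: inner_axis)
  qed
  have "\<psi>' x (u x) = (\<Sum>j\<in>UNIV. \<psi>' x (axis j 1) * (u x \<bullet> axis j 1))" for x
    by (subst linear_vec_expand[OF has_derivative_linear[OF \<psi>(1)]]) (simp add: inner_axis mult.commute)
  then have "(LBINT x. \<psi>' x (u x)) = (\<Sum>j\<in>UNIV. (LBINT x. \<psi>' x (axis j 1) * (u x \<bullet> axis j 1)))"
    using iu by simp
  also have "\<dots> = - (LBINT x. (\<Sum>j\<in>UNIV. \<psi> x * (D x $ j \<bullet> axis j 1)))"
    using iD by (simp add: h10_by_parts[OF h b \<psi>] sum_negf)
  also have "(LBINT x. (\<Sum>j\<in>UNIV. \<psi> x * (D x $ j \<bullet> axis j 1))) = (\<integral>x. 0 \<partial>(lborel :: (real^'n) measure))"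
  proof (rule integral_cong_AE)
    show "AE x in lborel. (\<Sum>j\<in>UNIV. \<psi> x * (D x $ j \<bullet> axis j 1)) = 0"
      using tr by eventually_elim (simp add: inner_axis trace_def flip: sum_distrib_left)
  qed (use iD in \<open>auto intro!: borel_measurable_sum borel_measurable_integrable\<close>)
  finally show ?thesis by simp
qed

lemma norm_sum_scaleR_le:
  fixes D :: "'b::euclidean_space^'n" and h :: "real^'n"
  shows "norm (\<Sum>j\<in>UNIV. h $ j *\<^sub>R D $ j) \<le> norm h * norm D"
proof -
  have "norm (\<Sum>j\<in>UNIV. h $ j *\<^sub>R D $ j) \<le> (\<Sum>j\<in>UNIV. norm (h $ j *\<^sub>R D $ j))" by (rule norm_sum)
  also have "\<dots> = (\<Sum>j\<in>UNIV. \<bar>norm (h $ j)\<bar> * \<bar>norm (D $ j)\<bar>)" by simp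
  also have "\<dots> \<le> L2_set (\<lambda>j. norm (h $ j)) UNIV * L2_set (\<lambda>j. norm (D $ j)) UNIV" by (rule L2_set_mult_ineq)
  finally show ?thesis by (simp add: norm_vec_def)
qed

section \<open>Lipschitz bounds\<close>

text \<open>A function with zero boundary values whose gradient is bounded by \<open>L\<close> is \<open>L\<close>-Lipschitz on the
  whole space, although \<open>\<Omega>\<close> need not be convex: its mollifications have derivatives bounded by
  \<open>L\<close>.\<close>

lemma h10_Lipschitz:
  fixes u :: "real^'n \<Rightarrow> 'b::euclidean_space"
  assumes h: "h10 \<Omega> u D" and b: "bounded \<Omega>" and L: "AE x in lborel. norm (D x) \<le> L"
  shows "\<exists>G. (AE x in lborel. x \<in> G) \<and> (\<forall>x\<in>G. \<forall>y\<in>G. norm (u x - u y) \<le> L * norm (x - y))"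
proof -
  note i = h10_integrable[OF h b]
  have lip: "norm (conv (mollifier \<kappa>) u x - conv (mollifier \<kappa>) u y) \<le> L * norm (x - y)" if \<kappa>: "0 < \<kappa>" for \<kappa> x y
  proof (rule differentiable_bound[where S = UNIV])
    note m = test_fun_mollifier[OF \<kappa>]
    let ?u' = "\<lambda>x h. conv (\<lambda>z. fderiv (mollifier \<kappa>) z h) u x"
    show "(conv (mollifier \<kappa>) u has_derivative ?u' x) (at x within UNIV)" for x
      using conv_has_derivative[OF m i(1)] by simp
    fix x
    show "onorm (?u' x) \<le> L"
    proof (rule onorm_le)
      fix h :: "real^'n"
      let ?g = "\<lambda>y. \<Sum>j\<in>UNIV. h $ j *\<^sub>R D y $ j"
      have iDj: "integrable lborel (\<lambda>y. D y $ j)" for j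
      proof (rule Bochner_Integration.integrable_bound[OF i(2)])
        show "(\<lambda>y. D y $ j) \<in> borel_measurable lborel" using borel_measurable_nth[of D] i(2) by auto
        show "AE y in lborel. norm (D y $ j) \<le> norm (D y)" by (intro AE_I2 Finite_Cartesian_Product.norm_nth_le)
      qed
      have ig: "integrable lborel ?g" using iDj by auto
      have "?u' x h = conv (mollifier \<kappa>) ?g x"
      proof (subst vector_eq_ldot[symmetric], intro allI)
        fix a :: 'b
        have lin: "linear (fderiv (mollifier \<kappa>) z)" for z :: "real^'n"
          using test_fun_has_derivative[OF m] has_derivative_linear by blast
        have d: "((\<lambda>y. mollifier \<kappa> (x - y)) has_derivative (\<lambda>h. - fderiv (mollifier \<kappa>) (x - y) h)) (at y)" for y
        proof -
          have "fderiv (\<lambda>y. mollifier \<kappa> (x - y)) y = (\<lambda>h. - fderiv (mollifier \<kappa>) (x - y) h)"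
            by (rule ext) (rule test_fun_mollifier_reflect(2)[OF \<kappa> subset_UNIV])
          then show ?thesis
            using test_fun_has_derivative[OF test_fun_mollifier_reflect(1)[OF \<kappa> subset_UNIV, of x], of y] by simp
        qed
        have cont: "continuous_on UNIV (\<lambda>y. - fderiv (mollifier \<kappa>) (x - y) h)" for h
          by (intro continuous_intros continuous_on_compose2[OF test_fun_continuous[OF test_fun_deriv[OF m]]]) auto
        have bp: "(LBINT y. fderiv (mollifier \<kappa>) (x - y) (axis j 1) * (u y \<bullet> a))
            = (LBINT y. mollifier \<kappa> (x - y) * (D y $ j \<bullet> a))" for j
          using h10_by_parts[OF h b d cont, where a = a] by simp
        have i1: "integrable lborel (\<lambda>y. fderiv (mollifier \<kappa>) (x - y) (axis j 1) * (u y \<bullet> a))" for j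
          using conv_integrable[OF test_fun_deriv[OF m] integrable_inner_left[OF i(1)]] by simp
        have i2: "integrable lborel (\<lambda>y. mollifier \<kappa> (x - y) * (D y $ j \<bullet> a))" for j
          using conv_integrable[OF m integrable_inner_left[OF iDj]] by simp
        have "a \<bullet> ?u' x h = (LBINT y. fderiv (mollifier \<kappa>) (x - y) h * (u y \<bullet> a))"
          unfolding conv_def inner_commute[of a]
          using integral_inner_left[OF conv_integrable[OF test_fun_deriv[OF m] i(1)], where c = a] by simp
        also have "\<dots> = (LBINT y. (\<Sum>j\<in>UNIV. h $ j * (fderiv (mollifier \<kappa>) (x - y) (axis j 1) * (u y \<bullet> a))))"
          by (subst linear_vec_expand[OF lin, of _ h]) (simp add: sum_distrib_right mult.assoc)
        also have "\<dots> = (\<Sum>j\<in>UNIV. h $ j * (LBINT y. mollifier \<kappa> (x - y) * (D y $ j \<bullet> a)))"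
          using i1 by (simp add: bp)
        also have "\<dots> = (LBINT y. (\<Sum>j\<in>UNIV. h $ j * (mollifier \<kappa> (x - y) * (D y $ j \<bullet> a))))"
          using i2 by simp
        also have "\<dots> = (LBINT y. (mollifier \<kappa> (x - y) *\<^sub>R ?g y) \<bullet> a)"
          by (intro Bochner_Integration.integral_cong) (auto simp: inner_sum_left sum_distrib_left mult_ac)
        also have "\<dots> = a \<bullet> conv (mollifier \<kappa>) ?g x"
          unfolding conv_def inner_commute[of a] using integral_inner_left[OF conv_integrable[OF m ig], where c = a] by simp
        finally show "a \<bullet> ?u' x h = a \<bullet> conv (mollifier \<kappa>) ?g x" .
      qed
      also have "norm \<dots> \<le> L * norm h"
      proof (rule conv_norm_bound[OF m ig mollifier_nonneg[OF \<kappa>] mollifier_integral[OF \<kappa>]])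
        show "AE y in lborel. norm (?g y) \<le> L * norm h"
          using L
        proof eventually_elim
          case (elim y)
          have "norm (?g y) \<le> norm h * norm (D y)" by (rule norm_sum_scaleR_le)
          also have "\<dots> \<le> norm h * L" using elim by (intro mult_left_mono) auto
          finally show ?case by (simp add: mult.commute)
        qed
      qed
      finally show "norm (?u' x h) \<le> L * norm h" .
    qed
  qed auto
  obtain r :: "nat \<Rightarrow> nat" where
    r: "AE x in lborel. (\<lambda>n. conv (mollifier (inverse (real (Suc (r n))))) u x) \<longlonglongrightarrow> u x"
    using mollifier_AE_subseq[OF i(1) _ LIMSEQ_inverse_real_of_nat] by auto
  define G where "G = {x. (\<lambda>n. conv (mollifier (inverse (real (Suc (r n))))) u x) \<longlonglongrightarrow> u x}"
  have "norm (u x - u y) \<le> L * norm (x - y)" if "x \<in> G" "y \<in> G" for x y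
  proof (rule LIMSEQ_le_const2)
    show "(\<lambda>n. norm (conv (mollifier (inverse (real (Suc (r n))))) u x
        - conv (mollifier (inverse (real (Suc (r n))))) u y)) \<longlonglongrightarrow> norm (u x - u y)"
      using that by (intro tendsto_norm tendsto_diff) (auto simp: G_def)
  qed (use lip in auto)
  then show ?thesis using r by (intro exI[of _ G]) (auto simp: G_def)
qed

text \<open>A function that is Lipschitz and vanishes off \<open>\<Omega>\<close> decays linearly at the boundary. Since \<open>u\<close> is only
  known almost everywhere, it is compared with its values on open sets of exterior points, which
  have positive measure and accumulate at every point of the complement.\<close>

lemma h10_boundary_decay:
  fixes u :: "real^'n \<Rightarrow> 'b::euclidean_space"
  assumes h: "h10 \<Omega> u D" and b: "bounded \<Omega>" and o: "open \<Omega>" and L: "AE x in lborel. norm (D x) \<le> L" "0 \<le> L"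
    and ext: "- \<Omega> \<subseteq> closure (interior (- \<Omega>))"
  shows "AE x in lborel. norm (u x) \<le> L * infdist x (- \<Omega>)"
proof -
  obtain G where G: "AE x in lborel. x \<in> G" "\<And>x y. x \<in> G \<Longrightarrow> y \<in> G \<Longrightarrow> norm (u x - u y) \<le> L * norm (x - y)"
    using h10_Lipschitz[OF h b L(1)] by blast
  have ne: "- \<Omega> \<noteq> {}" using b not_bounded_UNIV by (metis Compl_eq_Compl_iff Compl_UNIV_eq double_compl)
  have cl: "closed (- \<Omega>)" using o by (rule closed_Compl)
  have meet: "\<exists>z\<in>V. z \<in> G" if "open V" "V \<noteq> {}" for V
  proof (rule ccontr)
    assume "\<not> ?thesis"
    then have "AE x in lborel. x \<notin> V" using G(1) by (auto elim!: eventually_mono)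
    then have "V \<in> null_sets lborel" using that(1) by (subst (asm) AE_iff_null_sets[symmetric]) auto
    then have "negligible V" by (simp add: negligible_iff_null_sets null_sets_completionI)
    then show False using open_not_negligible[OF that] by blast
  qed
  have "norm (u x) \<le> L * infdist x (- \<Omega>)" if x: "x \<in> G" for x
  proof -
    obtain y where y: "y \<in> - \<Omega>" "infdist x (- \<Omega>) = dist x y" using infdist_attains_inf[OF cl ne] by blast
    have bnd: "norm (u x) \<le> L * dist x y + L * e" if e: "0 < e" for e
    proof -
      have "y \<in> closure (interior (- \<Omega>))" using ext y(1) by (rule subsetD)
      then obtain w where "w \<in> interior (- \<Omega>)" "dist w y < e" using e unfolding closure_approachable by blast
      then have "w \<in> ball y e \<inter> interior (- \<Omega>)" by (simp add: dist_commute)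
      then have "ball y e \<inter> interior (- \<Omega>) \<noteq> {}" by blast
      then obtain z where z: "z \<in> ball y e \<inter> interior (- \<Omega>)" "z \<in> G"
        using meet[of "ball y e \<inter> interior (- \<Omega>)"] by blast
      have "z \<notin> \<Omega>" using z(1) interior_subset[of "- \<Omega>"] by blast
      then have "u z = 0" using h by (simp add: h10_def)
      then have "norm (u x) \<le> L * norm (x - z)" using G(2)[OF x z(2)] by simp
      also have "\<dots> \<le> L * (dist x y + e)"
        using z(1) dist_triangle[of x z y] L(2) by (intro mult_left_mono) (auto simp: dist_norm)
      finally show ?thesis by (simp add: distrib_left)
    qed
    have "norm (u x) \<le> L * dist x y"
    proof (rule field_le_epsilon)
      fix e :: real assume "0 < e"
      have "norm (u x) \<le> L * dist x y + L * (e / (L + 1))" using \<open>0 < e\<close> L(2) by (intro bnd) auto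
      also have "L * (e / (L + 1)) = (L / (L + 1)) * e" by simp
      also have "\<dots> \<le> 1 * e" using \<open>0 < e\<close> L(2) by (intro mult_right_mono) auto
      finally show "norm (u x) \<le> L * dist x y + e" by simp
    qed
    then show ?thesis using y(2) by simp
  qed
  with G(1) show ?thesis by (auto elim!: eventually_mono)
qed

text \<open>At a boundary point the defining function has a direction of increase, and moving in this direction
  leads into the exterior. The condition excludes slits and isolated points.\<close>

lemma smooth_domain_exterior:
  assumes "smooth_bounded_domain \<Omega>"
  shows "- \<Omega> \<subseteq> closure (interior (- \<Omega>))"
proof
  fix p assume p: "p \<in> - \<Omega>"
  show "p \<in> closure (interior (- \<Omega>))"
  proof (cases "p \<in> closure \<Omega>")
    case False
    then have "p \<in> interior (- \<Omega>)" by (simp add: interior_complement)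
    then show ?thesis using closure_subset by blast
  next
    case True
    have o: "open \<Omega>" using assms by (simp add: smooth_bounded_domain_def)
    then have fr: "p \<in> frontier \<Omega>" using p True by (simp add: frontier_def interior_open)
    from assms fr obtain U and g :: "_ \<Rightarrow> real" where U: "open U" "p \<in> U" "smooth_on U g"
        "\<And>y. y \<in> U \<Longrightarrow> fderiv g y \<noteq> (\<lambda>_. 0)" "\<Omega> \<inter> U = {y \<in> U. g y < 0}"
      unfolding smooth_bounded_domain_def by blast
    have gd: "(g has_derivative fderiv g y) (at y)" if "y \<in> U" for y
      using U(3) that unfolding smooth_on_def by (metis Ck_on.simps(2) frechet_derivative_works)
    have gc: "continuous_on U g" using U(3) unfolding smooth_on_def by (metis Ck_on.simps(1))
    have gpos: "open (U \<inter> g -` {0<..})"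
    proof -
      have "open (g -` {0<..} \<inter> U)"
        using iffD1[OF continuous_on_open_vimage[OF U(1)] gc] open_greaterThan[of "0::real"] by blast
      then show ?thesis by (simp only: Int_commute)
    qed
    have gp0: "0 \<le> g p" using U(2,5) p by force
    have gp: "g p = 0"
    proof (rule ccontr)
      assume "g p \<noteq> 0"
      then have "0 < g p" using gp0 by simp
      then have "p \<in> U \<inter> g -` {0<..}" using U(2) by simp
      then obtain y where "y \<in> \<Omega>" "y \<in> U \<inter> g -` {0<..}"
        using True open_Int_closure_eq_empty[OF gpos, of \<Omega>] by blast
      then have "y \<in> \<Omega> \<inter> U" "0 < g y" by auto
      then show False unfolding U(5) by simp
    qed
    obtain h where h: "0 < fderiv g p h"
    proof -
      obtain h where "fderiv g p h \<noteq> 0" using U(4)[OF U(2)] by (auto simp: fun_eq_iff)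
      then show thesis using that[of h] that[of "- h"] linear_neg[OF has_derivative_linear[OF gd[OF U(2)]], of h]
        by fastforce
    qed
    show ?thesis unfolding closure_approachable
    proof (intro allI impI)
      fix e :: real assume e: "0 < e"
      have "((\<lambda>s. p + s *\<^sub>R h) has_derivative (\<lambda>r. r *\<^sub>R h)) (at 0)" by (auto intro!: derivative_eq_intros)
      moreover have "(g has_derivative fderiv g p) (at (p + 0 *\<^sub>R h))" using gd[OF U(2)] by simp
      ultimately have "((\<lambda>s. g (p + s *\<^sub>R h)) has_derivative (\<lambda>r. fderiv g p (r *\<^sub>R h))) (at 0)"
        by (rule has_derivative_compose)
      then have "((\<lambda>s. g (p + s *\<^sub>R h)) has_real_derivative fderiv g p h) (at 0)"
        by (simp add: has_field_derivative_def linear_cmul[OF has_derivative_linear[OF gd[OF U(2)]]] mult.commute[of _ "fderiv g p h"])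
      from DERIV_pos_inc_right[OF this h] obtain d where d: "0 < d" "\<And>s. 0 < s \<Longrightarrow> s < d \<Longrightarrow> g p < g (p + s *\<^sub>R h)"
        by auto
      obtain r where r: "0 < r" "ball p r \<subseteq> U" using U(1,2) open_contains_ball by blast
      define m where "m = min d (min (e / (norm h + 1)) (r / (norm h + 1)))"
      have m: "0 < m" using d(1) e r(1) by (simp add: m_def add_nonneg_pos)
      define s where "s = m / 2"
      have s: "0 < s" "s < m" using m by (auto simp: s_def)
      have "s * norm h < c" if "0 < c" "m \<le> c / (norm h + 1)" for c
      proof -
        have "s * norm h \<le> s * (norm h + 1)" using s by simp
        also have "\<dots> < m * (norm h + 1)" using s by (intro mult_strict_right_mono) (auto simp: add_nonneg_pos)
        also have "\<dots> \<le> c / (norm h + 1) * (norm h + 1)" using that by (intro mult_right_mono) auto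
        also have "\<dots> = c"
        proof -
          have "norm h + 1 \<noteq> 0" using norm_ge_zero[of h] by linarith
          then show ?thesis by simp
        qed
        finally show ?thesis .
      qed
      then have sm: "s * norm h < e" "s * norm h < r" using e r(1) by (auto simp: m_def)
      define y where "y = p + s *\<^sub>R h"
      have yU: "y \<in> U" using r(2) sm(2) s by (auto simp: y_def dist_norm subset_iff)
      have "0 < g y" using d(2)[of s] s gp by (simp add: y_def m_def)
      then have yin: "y \<in> U \<inter> g -` {0<..}" using yU by simp
      have "U \<inter> g -` {0<..} \<subseteq> - \<Omega>"
      proof
        fix z assume z: "z \<in> U \<inter> g -` {0<..}"
        have "z \<in> \<Omega> \<inter> U \<Longrightarrow> g z < 0" unfolding U(5) by simp
        then show "z \<in> - \<Omega>" using z by auto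
      qed
      then have "y \<in> interior (- \<Omega>)" using interiorI[OF gpos yin] by blast
      moreover have "dist y p < e" using sm(1) s by (simp add: y_def dist_norm)
      ultimately show "\<exists>y\<in>interior (- \<Omega>). dist y p < e" by blast
    qed
  qed
qed

section \<open>Cutoff functions\<close>

lemma mollifier_deriv_L1:
  "\<exists>C>0. \<forall>\<kappa>>0. \<forall>h::'a::euclidean_space.
     (LBINT z. \<bar>fderiv (mollifier \<kappa>) z h\<bar>) \<le> C / \<kappa> * norm h"
proof -
  obtain B where B: "0 < B" "\<And>\<kappa> (z::'a) h. 0 < \<kappa> \<Longrightarrow>
      \<bar>fderiv (mollifier \<kappa>) z h\<bar> \<le> B / \<kappa> ^ (DIM('a) + 1) * norm h"
    using mollifier_deriv_bound[where 'a='a] by blast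
  let ?V = "2 ^ DIM('a) * measure lborel (ball (0::'a) 1)"
  have V: "0 < ?V" using content_ball_pos[of 1 "0::'a"] by simp
  show ?thesis
  proof (intro exI[of _ "B * ?V"] conjI allI impI)
    show "0 < B * ?V" using B(1) V by simp
    fix \<kappa> :: real and h :: 'a assume \<kappa>: "0 < \<kappa>"
    let ?b = "B / \<kappa> ^ (DIM('a) + 1) * norm h"
    have i: "integrable lborel (\<lambda>z::'a. indicator (ball 0 (2 * \<kappa>)) z * ?b)"
      using emeasure_lborel_ball_finite[of "0::'a" "2 * \<kappa>"]
      by (intro integrable_mult_left integrable_real_indicator) auto
    have "(LBINT z. \<bar>fderiv (mollifier \<kappa>) (z::'a) h\<bar>) \<le> (LBINT z. indicator (ball (0::'a) (2 * \<kappa>)) z * ?b)"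
    proof (rule integral_mono)
      show "integrable lborel (\<lambda>z::'a. indicator (ball 0 (2 * \<kappa>)) z * ?b)" by (rule i)
      show "integrable lborel (\<lambda>z. \<bar>fderiv (mollifier \<kappa>) (z::'a) h\<bar>)"
        by (rule integrable_abs[OF test_fun_integrable[OF test_fun_deriv[OF test_fun_mollifier[OF \<kappa>]]]])
      show "\<bar>fderiv (mollifier \<kappa>) z h\<bar> \<le> indicator (ball 0 (2 * \<kappa>)) z * ?b" for z
        using B(2)[OF \<kappa>, of z h] mollifier_deriv_eq_0[OF \<kappa>, of z h] \<kappa> by (auto simp: indicator_def)
    qed
    also have "\<dots> = measure lborel (ball (0::'a) (2 * \<kappa>)) * ?b" by simp
    also have "\<dots> = (2 * \<kappa>) ^ DIM('a) * measure lborel (ball (0::'a) 1) * ?b"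
      using content_ball_conv_unit_ball[of "2 * \<kappa>" "0::'a"] \<kappa> by simp
    also have "\<dots> = B * ?V / \<kappa> * norm h" using \<kappa> by (simp add: power_mult_distrib field_simps)
    finally show "(LBINT z. \<bar>fderiv (mollifier \<kappa>) (z::'a) h\<bar>) \<le> B * ?V / \<kappa> * norm h" .
  qed
qed

text \<open>Mollification moves a level set of the distance by at most \<open>\<kappa>\<close>: the cutoff vanishes at distance less
  than \<open>2 \<kappa>\<close> from the complement and equals 1 at distance \<open>4 \<kappa>\<close> and beyond.\<close>

definition cutoff :: "'a::euclidean_space set \<Rightarrow> real \<Rightarrow> 'a \<Rightarrow> real" where
  "cutoff \<Omega> \<kappa> = conv (mollifier \<kappa>) (indicator {x. 3 * \<kappa> \<le> infdist x (- \<Omega>)})"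

context
  fixes \<Omega> :: "'a::euclidean_space set"
  assumes \<Omega>: "open \<Omega>" "bounded \<Omega>"
begin

lemma complement_nonempty: "- \<Omega> \<noteq> {}"
  using \<Omega>(2) not_bounded_UNIV[where 'a='a] by (metis Compl_eq_Compl_iff Compl_UNIV_eq double_compl)

lemma infdist_complement_pos: "x \<in> \<Omega> \<Longrightarrow> 0 < infdist x (- \<Omega>)"
  using infdist_pos_not_in_closed[of "- \<Omega>" x] \<Omega>(1) complement_nonempty by auto

lemma compact_inner_part:
  assumes "0 < a"
  shows "compact {x. a \<le> infdist x (- \<Omega>)}" "{x. a \<le> infdist x (- \<Omega>)} \<subseteq> \<Omega>"
proof -
  show s: "{x. a \<le> infdist x (- \<Omega>)} \<subseteq> \<Omega>"
  proof
    fix x assume "x \<in> {x. a \<le> infdist x (- \<Omega>)}"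
    then show "x \<in> \<Omega>" using assms infdist_zero[of x "- \<Omega>"] by (cases "x \<in> \<Omega>") auto
  qed
  have "closed {x. a \<le> infdist x (- \<Omega>)}" by (intro closed_Collect_le continuous_intros)
  then show "compact {x. a \<le> infdist x (- \<Omega>)}"
    using bounded_subset[OF \<Omega>(2) s] compact_eq_bounded_closed by blast
qed

lemma inner_part_integrable:
  assumes "0 < a"
  shows "integrable lborel (indicator {x. a \<le> infdist x (- \<Omega>)} :: 'a \<Rightarrow> real)"
  using emeasure_compact_finite[OF compact_inner_part(1)[OF assms]] compact_imp_closed[OF compact_inner_part(1)[OF assms]]
  by (intro integrable_real_indicator) auto

lemma cutoff_bounds:
  assumes \<kappa>: "0 < \<kappa>"
  shows "0 \<le> cutoff \<Omega> \<kappa> x" "cutoff \<Omega> \<kappa> x \<le> 1"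
    and "infdist x (- \<Omega>) < 2 * \<kappa> \<Longrightarrow> cutoff \<Omega> \<kappa> x = 0"
    and "4 * \<kappa> \<le> infdist x (- \<Omega>) \<Longrightarrow> cutoff \<Omega> \<kappa> x = 1"
proof -
  let ?A = "{x. 3 * \<kappa> \<le> infdist x (- \<Omega>)}"
  note i = inner_part_integrable[of "3 * \<kappa>"]
  have i: "integrable lborel (indicator ?A :: 'a \<Rightarrow> real)" using \<kappa> by (intro inner_part_integrable) simp
  note m = test_fun_mollifier[OF \<kappa>] and mn = mollifier_nonneg[OF \<kappa>] and m1 = mollifier_integral[OF \<kappa>]
  show "0 \<le> cutoff \<Omega> \<kappa> x" unfolding cutoff_def conv_def by (intro integral_nonneg_AE AE_I2) (simp add: mn indicator_def)
  have "norm (cutoff \<Omega> \<kappa> x) \<le> 1" unfolding cutoff_def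
    by (rule conv_norm_bound[OF m i mn m1]) (auto simp: indicator_def)
  then show "cutoff \<Omega> \<kappa> x \<le> 1" by simp
  show "cutoff \<Omega> \<kappa> x = 0" if "infdist x (- \<Omega>) < 2 * \<kappa>"
  proof -
    have "mollifier \<kappa> (x - y) *\<^sub>R indicator ?A y = (0::real)" for y
    proof (cases "norm (x - y) < \<kappa>")
      case True
      have "infdist y (- \<Omega>) \<le> infdist x (- \<Omega>) + dist y x" by (rule infdist_triangle)
      then show ?thesis using True that by (auto simp: indicator_def dist_norm norm_minus_commute)
    qed (simp add: mollifier_eq_0[OF \<kappa>])
    then show ?thesis unfolding cutoff_def conv_def by (simp only:) simp
  qed
  show "cutoff \<Omega> \<kappa> x = 1" if "4 * \<kappa> \<le> infdist x (- \<Omega>)"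
  proof -
    have "mollifier \<kappa> (x - y) *\<^sub>R indicator ?A y = mollifier \<kappa> (x - y)" for y
    proof (cases "norm (x - y) < \<kappa>")
      case True
      have "infdist x (- \<Omega>) \<le> infdist y (- \<Omega>) + dist x y" by (rule infdist_triangle)
      then show ?thesis using True that by (auto simp: indicator_def dist_norm)
    qed (simp add: mollifier_eq_0[OF \<kappa>])
    then have "cutoff \<Omega> \<kappa> x = (LBINT y. mollifier \<kappa> (x - y))" unfolding cutoff_def conv_def by (simp only:)
    then show ?thesis using lborel_shift(6)[OF test_fun_integrable[OF m], of x] m1 by simp
  qed
qed

lemma test_fun_cutoff:
  assumes \<kappa>: "0 < \<kappa>"
  shows "test_fun \<Omega> (cutoff \<Omega> \<kappa>)"
proof -
  have "Ck_on k UNIV (cutoff \<Omega> \<kappa>)" for k unfolding cutoff_def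
    by (rule Ck_on_conv[OF test_fun_mollifier[OF \<kappa>]]) (use \<kappa> in \<open>simp add: inner_part_integrable\<close>)
  moreover have "cutoff \<Omega> \<kappa> x = 0" if "x \<notin> {x. 2 * \<kappa> \<le> infdist x (- \<Omega>)}" for x
    using cutoff_bounds(3)[OF \<kappa>, of x] that by simp
  ultimately show ?thesis unfolding test_fun_def smooth_on_def
    using compact_inner_part[of "2 * \<kappa>"] \<kappa> by (intro conjI exI[of _ "{x. 2 * \<kappa> \<le> infdist x (- \<Omega>)}"]) auto
qed

lemma cutoff_deriv_0:
  assumes \<kappa>: "0 < \<kappa>" and x: "4 * \<kappa> < infdist x (- \<Omega>)"
  shows "fderiv (cutoff \<Omega> \<kappa>) x h = 0"
proof -
  have "open {x. 4 * \<kappa> < infdist x (- \<Omega>)}" by (intro open_Collect_less continuous_intros)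
  then have "(cutoff \<Omega> \<kappa> has_derivative (\<lambda>h. 0)) (at x)"
    by (rule has_derivative_transform_within_open[OF has_derivative_const[of 1]])
      (use x cutoff_bounds(4)[OF \<kappa>] in auto)
  then show ?thesis by (simp add: frechet_derivative_at[symmetric])
qed

text \<open>The differential of a cutoff at scale \<open>\<kappa>\<close> has size \<open>1 / \<kappa>\<close> and lives at distance at most
  \<open>4 \<kappa>\<close> from the boundary. Paired with a velocity that decays linearly at the boundary it stays
  bounded; this is what removes the cutoff without using any trace theory.\<close>

lemma cutoff_deriv_bound:
  "\<exists>C>0. \<forall>\<kappa>>0. \<forall>x h. \<bar>fderiv (cutoff \<Omega> \<kappa>) x h\<bar> * infdist x (- \<Omega>) \<le> C * norm h"
proof -
  obtain C where C: "0 < C" "\<And>\<kappa> h::'a. 0 < \<kappa> \<Longrightarrow>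
     (LBINT z. \<bar>fderiv (mollifier \<kappa>) z h\<bar>) \<le> C / \<kappa> * norm h"
    using mollifier_deriv_L1[where 'a='a] by blast
  show ?thesis
  proof (intro exI[of _ "4 * C"] conjI allI impI)
    show "0 < 4 * C" using C(1) by simp
    fix \<kappa> :: real and x h :: 'a assume \<kappa>: "0 < \<kappa>"
    let ?A = "{x. 3 * \<kappa> \<le> infdist x (- \<Omega>)}"
    let ?d = "\<lambda>z. fderiv (mollifier \<kappa>) z h"
    have i: "integrable lborel (indicator ?A :: 'a \<Rightarrow> real)" using \<kappa> by (intro inner_part_integrable) simp
    note m = test_fun_mollifier[OF \<kappa>]
    have di: "integrable lborel ?d" using test_fun_integrable[OF test_fun_deriv[OF m]] .
    show "\<bar>fderiv (cutoff \<Omega> \<kappa>) x h\<bar> * infdist x (- \<Omega>) \<le> 4 * C * norm h"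
    proof (cases "4 * \<kappa> < infdist x (- \<Omega>)")
      case False
      have "\<bar>fderiv (cutoff \<Omega> \<kappa>) x h\<bar> = \<bar>\<integral>y. ?d (x - y) *\<^sub>R indicator ?A y \<partial>lborel\<bar>"
        unfolding cutoff_def frechet_derivative_conv[OF m i] by (simp add: conv_def)
      also have "\<dots> \<le> (LBINT y. \<bar>?d (x - y) *\<^sub>R indicator ?A y\<bar>)" by (rule integral_abs_bound)
      also have "\<dots> \<le> (LBINT y. \<bar>?d (x - y)\<bar>)"
        using lborel_shift(5)[OF di, of x] conv_integrable[OF test_fun_deriv[OF m] i, of x h]
        by (intro integral_mono integrable_abs) (auto simp: indicator_def)
      also have "\<dots> = (LBINT y. \<bar>?d y\<bar>)" using lborel_shift(6)[OF integrable_abs[OF di], of x] by simp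
      also have "\<dots> \<le> C / \<kappa> * norm h" by (rule C(2)[OF \<kappa>])
      finally have "\<bar>fderiv (cutoff \<Omega> \<kappa>) x h\<bar> * infdist x (- \<Omega>) \<le> (C / \<kappa> * norm h) * (4 * \<kappa>)"
        using False C(1) \<kappa> by (intro mult_mono infdist_nonneg) auto
      then show ?thesis using \<kappa> by simp
    qed (use cutoff_deriv_0[OF \<kappa>] C(1) in simp)
  qed
qed

lemma cutoff_eventually:
  assumes x: "x \<in> \<Omega>"
  shows "\<forall>\<^sub>F k in sequentially. cutoff \<Omega> (inverse (real (Suc k))) x = 1 \<and>
    frechet_derivative (cutoff \<Omega> (inverse (real (Suc k)))) (at x) = (\<lambda>h. 0)"
proof -
  have "\<forall>\<^sub>F k in sequentially. inverse (real (Suc k)) < infdist x (- \<Omega>) / 4"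
    using infdist_complement_pos[OF x] by (intro order_tendstoD(2)[OF LIMSEQ_inverse_real_of_nat]) simp
  then show ?thesis
  proof eventually_elim
    case (elim k)
    let ?\<kappa> = "inverse (real (Suc k))"
    have k: "0 < ?\<kappa>" "4 * ?\<kappa> < infdist x (- \<Omega>)" using elim by auto
    show ?case using cutoff_bounds(4)[OF k(1), of x] cutoff_deriv_0[OF k] k(2) by (auto simp: fun_eq_iff)
  qed
qed

end

section \<open>Test functions in time\<close>

lemma mollifier_at_point:
  fixes f :: "real \<Rightarrow> real"
  assumes i: "0 < d" "integrable lborel (\<lambda>\<tau>. indicator (cball s d) \<tau> * f \<tau>)"
    and c: "isCont f s" and \<kappa>: "\<And>n. 0 < \<kappa> n" "\<kappa> \<longlonglongrightarrow> 0"
  shows "(\<lambda>n. LBINT \<tau>. mollifier (\<kappa> n) (\<tau> - s) * f \<tau>) \<longlonglongrightarrow> f s"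
proof (rule tendstoI)
  fix e :: real assume e: "0 < e"
  obtain r where r: "0 < r" "\<And>\<tau>. dist \<tau> s < r \<Longrightarrow> dist (f \<tau>) (f s) < e / 2"
    using c e unfolding continuous_at_eps_delta by (metis half_gt_zero)
  have "\<forall>\<^sub>F n in sequentially. \<kappa> n < min r d" using r(1) i(1) by (intro order_tendstoD(2)[OF \<kappa>(2)]) simp
  then show "\<forall>\<^sub>F n in sequentially. dist (LBINT \<tau>. mollifier (\<kappa> n) (\<tau> - s) * f \<tau>) (f s) < e"
  proof eventually_elim
    case (elim n)
    note m = test_fun_mollifier[OF \<kappa>(1)[of n]]
    obtain B where B: "\<And>x. norm (mollifier (\<kappa> n) (x::real)) \<le> B" using test_fun_bounded[OF m] by blast
    note [measurable] = test_fun_measurable[OF m]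
    have z: "mollifier (\<kappa> n) (\<tau> - s) = 0" if "\<not> dist \<tau> s < min r d" for \<tau>
      using that elim by (intro mollifier_eq_0[OF \<kappa>(1)]) (auto simp: dist_real_def)
    have e1: "mollifier (\<kappa> n) (\<tau> - s) * f \<tau> = mollifier (\<kappa> n) (\<tau> - s) *\<^sub>R (indicator (cball s d) \<tau> * f \<tau>)" for \<tau>
      using z[of \<tau>] by (cases "dist \<tau> s < min r d") (auto simp: dist_commute)
    have i1: "integrable lborel (\<lambda>\<tau>. mollifier (\<kappa> n) (\<tau> - s) * f \<tau>)"
      unfolding e1 using B by (intro integrable_bounded_mult[OF i(2), of _ B]) auto
    note i2 = lborel_shift(3,4)[OF test_fun_integrable[OF m], of s]
    have "(LBINT \<tau>. mollifier (\<kappa> n) (\<tau> - s) * f \<tau>) - f s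
        = (LBINT \<tau>. mollifier (\<kappa> n) (\<tau> - s) * f \<tau> - mollifier (\<kappa> n) (\<tau> - s) * f s)"
      using i1 i2 mollifier_integral[OF \<kappa>(1), where 'a=real] by simp
    also have "\<bar>\<dots>\<bar> \<le> (LBINT \<tau>. (e / 2) * mollifier (\<kappa> n) (\<tau> - s))"
    proof (rule order_trans[OF integral_abs_bound], rule integral_mono)
      fix \<tau>
      show "\<bar>mollifier (\<kappa> n) (\<tau> - s) * f \<tau> - mollifier (\<kappa> n) (\<tau> - s) * f s\<bar> \<le> (e / 2) * mollifier (\<kappa> n) (\<tau> - s)"
      proof (cases "dist \<tau> s < min r d")
        case True
        then have "\<bar>f \<tau> - f s\<bar> \<le> e / 2" using r(2)[of \<tau>] by (simp add: dist_real_def)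
        then have "mollifier (\<kappa> n) (\<tau> - s) * \<bar>f \<tau> - f s\<bar> \<le> mollifier (\<kappa> n) (\<tau> - s) * (e / 2)"
          by (intro mult_left_mono mollifier_nonneg[OF \<kappa>(1)])
        moreover have "mollifier (\<kappa> n) (\<tau> - s) * f \<tau> - mollifier (\<kappa> n) (\<tau> - s) * f s
            = mollifier (\<kappa> n) (\<tau> - s) * (f \<tau> - f s)" by (simp only: right_diff_distrib)
        ultimately show ?thesis using mollifier_nonneg[OF \<kappa>(1), of n "\<tau> - s"]
          by (simp only: abs_mult) (simp add: mult.commute)
      qed (simp add: z)
    qed (use i1 i2 in auto)
    also have "\<dots> = e / 2" using i2 mollifier_integral[OF \<kappa>(1), where 'a=real] by simp
    finally show ?case using e by (simp add: dist_real_def)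
  qed
qed

text \<open>Smooth approximations of the indicator of \<open>[s, t]\<close>, whose derivatives approximate the
  difference of two Dirac masses.\<close>

lemma time_test_funs:
  fixes s t :: real
  assumes st: "0 < s" "s < t"
  shows "\<exists>\<theta> :: nat \<Rightarrow> real \<Rightarrow> real. (\<forall>n. test_fun {0<..} (\<theta> n)) \<and> (\<forall>n \<tau>. 0 \<le> \<theta> n \<tau> \<and> \<theta> n \<tau> \<le> 1) \<and>
    (\<forall>n \<tau>. \<tau> \<notin> {0..t + 1} \<longrightarrow> \<theta> n \<tau> = 0) \<and>
    (AE \<tau> in lborel. (\<lambda>n. \<theta> n \<tau>) \<longlonglongrightarrow> indicator {s..t} \<tau>) \<and>
    (\<forall>f. isCont f s \<longrightarrow> isCont f t \<longrightarrow> integrable lborel (\<lambda>\<tau>. indicator {0..t + 1} \<tau> * f \<tau>) \<longrightarrow>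
       (\<lambda>n. LBINT \<tau>. fderiv (\<theta> n) \<tau> 1 * f \<tau>) \<longlonglongrightarrow> f s - f t)"
proof -
  let ?I = "indicator {s..t} :: real \<Rightarrow> real"
  have I: "integrable lborel ?I" using st by (intro integrable_real_indicator) simp_all
  define q where "q = min (s / 2) 1"
  have q: "0 < q" "q \<le> s / 2" "q \<le> 1" using st by (auto simp: q_def)
  let ?k = "\<lambda>n. inverse (real (Suc n)) * q"
  have k: "0 < ?k n" "?k \<longlonglongrightarrow> 0" for n
    using q(1) tendsto_mult_left_zero[OF LIMSEQ_inverse_real_of_nat] by auto
  obtain r where r: "strict_mono (r :: nat \<Rightarrow> nat)" "AE \<tau> in lborel. (\<lambda>n. conv (mollifier (?k (r n))) ?I \<tau>) \<longlonglongrightarrow> ?I \<tau>"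
    using mollifier_AE_subseq[OF I k] by blast
  define \<kappa> where "\<kappa> n = ?k (r n)" for n
  have \<kappa>: "0 < \<kappa> n" "\<kappa> n \<le> q" "\<kappa> \<longlonglongrightarrow> 0" for n
  proof -
    show "0 < \<kappa> n" unfolding \<kappa>_def by (rule k)
    show "\<kappa> n \<le> q" using q(1) by (simp add: \<kappa>_def field_simps)
    show "\<kappa> \<longlonglongrightarrow> 0" using LIMSEQ_subseq_LIMSEQ[OF k(2) r(1)] by (simp add: \<kappa>_def[abs_def] o_def)
  qed
  define \<theta> where "\<theta> n = conv (mollifier (\<kappa> n)) ?I" for n
  have supp: "\<theta> n \<tau> = 0" if "\<tau> \<notin> {s/2..t + 1}" for n \<tau>
  proof -
    have "mollifier (\<kappa> n) (\<tau> - y) *\<^sub>R ?I y = 0" for y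
    proof (cases "y \<in> {s..t}")
      case True
      then have "\<kappa> n \<le> norm (\<tau> - y)" using that \<kappa>(2)[of n] q by (auto simp: real_norm_def abs_if)
      then show ?thesis by (simp add: mollifier_eq_0[OF \<kappa>(1)])
    qed simp
    then show ?thesis unfolding \<theta>_def conv_def by (simp only:) simp
  qed
  have D: "fderiv (\<theta> n) \<tau> 1 = mollifier (\<kappa> n) (\<tau> - s) - mollifier (\<kappa> n) (\<tau> - t)" for n \<tau>
  proof -
    note m = test_fun_mollifier[OF \<kappa>(1)[of n], where 'a=real]
    let ?d = "\<lambda>z. fderiv (mollifier (\<kappa> n)) z (1::real)"
    have lin: "linear (fderiv (mollifier (\<kappa> n)) z)" for z :: real
      using test_fun_has_derivative[OF m] has_derivative_linear by blast
    have md: "(mollifier (\<kappa> n) has_real_derivative ?d z) (at z)" for z :: real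
    proof -
      have "fderiv (mollifier (\<kappa> n)) z = (*) (?d z)"
      proof
        fix h
        have "fderiv (mollifier (\<kappa> n)) z (h *\<^sub>R 1) = h *\<^sub>R ?d z" by (rule linear_cmul[OF lin])
        then show "fderiv (mollifier (\<kappa> n)) z h = ?d z * h" by (simp add: mult.commute)
      qed
      then show ?thesis using test_fun_has_derivative[OF m, of z] unfolding has_field_derivative_def by simp
    qed
    have dv: "((\<lambda>y. - mollifier (\<kappa> n) (\<tau> - y)) has_real_derivative ?d (\<tau> - y)) (at y)" for y
    proof -
      have "((\<lambda>y. mollifier (\<kappa> n) (\<tau> - y)) has_real_derivative ?d (\<tau> - y) * (- 1)) (at y)"
        by (rule DERIV_chain2[OF md]) (auto intro!: derivative_eq_intros)
      from DERIV_minus[OF this] show ?thesis by simp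
    qed
    have "fderiv (\<theta> n) \<tau> 1 = (LBINT y. ?d (\<tau> - y) * indicator {s..t} y)"
      unfolding \<theta>_def frechet_derivative_conv[OF m I] by (simp add: conv_def)
    also have "\<dots> = - mollifier (\<kappa> n) (\<tau> - t) - (- mollifier (\<kappa> n) (\<tau> - s))"
    proof (rule integral_FTC_Icc_real)
      show "isCont (\<lambda>y. ?d (\<tau> - y)) y" for y
        using continuous_on_compose2[OF test_fun_continuous[OF test_fun_deriv[OF m, of 1]], of UNIV "\<lambda>y. \<tau> - y"]
        by (auto simp: continuous_on_eq_continuous_at intro!: continuous_intros)
    qed (use st dv in auto)
    finally show ?thesis by simp
  qed
  have tf: "test_fun {0<..} (\<theta> n)" for n
    unfolding test_fun_def smooth_on_def using supp[of _ n] st Ck_on_conv[OF test_fun_mollifier[OF \<kappa>(1)] I, of _ n]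
    by (intro conjI exI[of _ "{s/2..t+1}"]) (auto simp: \<theta>_def)
  have bd: "0 \<le> \<theta> n \<tau>" "\<theta> n \<tau> \<le> 1" for n \<tau>
  proof -
    show "0 \<le> \<theta> n \<tau>" unfolding \<theta>_def conv_def
      by (intro integral_nonneg_AE AE_I2) (simp add: mollifier_nonneg[OF \<kappa>(1)] indicator_def)
    have "norm (\<theta> n \<tau>) \<le> 1" unfolding \<theta>_def
      by (rule conv_norm_bound[OF test_fun_mollifier[OF \<kappa>(1)] I mollifier_nonneg[OF \<kappa>(1)] mollifier_integral[OF \<kappa>(1)]])
        (auto simp: indicator_def)
    then show "\<theta> n \<tau> \<le> 1" by simp
  qed
  have lim: "(\<lambda>n. LBINT \<tau>. fderiv (\<theta> n) \<tau> 1 * f \<tau>) \<longlonglongrightarrow> f s - f t"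
    if f: "isCont f s" "isCont f t" "integrable lborel (\<lambda>\<tau>. indicator {0..t + 1} \<tau> * f \<tau>)" for f
  proof -
    have fs: "integrable lborel (\<lambda>\<tau>. indicator (cball p q) \<tau> * f \<tau>)" if "p \<in> {s, t}" for p
    proof -
      have "cball p q \<subseteq> {0..t+1}" using that q st by (auto simp: dist_real_def)
      then have "(\<lambda>\<tau>. indicator (cball p q) \<tau> * f \<tau>) = (\<lambda>\<tau>. indicator (cball p q) \<tau> *\<^sub>R (indicator {0..t + 1} \<tau> * f \<tau>))"
        by (auto simp: fun_eq_iff indicator_def)
      then show ?thesis by (simp only:) (rule integrable_bounded_mult[OF f(3), of _ 1], auto simp: indicator_def)
    qed
    have im: "integrable lborel (\<lambda>\<tau>. mollifier (\<kappa> n) (\<tau> - p) * f \<tau>)" if "p \<in> {s, t}" for n p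
    proof -
      note m = test_fun_mollifier[OF \<kappa>(1)[of n], where 'a=real]
      obtain B where B: "\<And>x. norm (mollifier (\<kappa> n) (x::real)) \<le> B" using test_fun_bounded[OF m] by blast
      note [measurable] = test_fun_measurable[OF m]
      have "integrable lborel (\<lambda>\<tau>. mollifier (\<kappa> n) (\<tau> - p) *\<^sub>R (indicator (cball p q) \<tau> * f \<tau>))"
        using B by (intro integrable_bounded_mult[OF fs[OF that], of _ B]) auto
      moreover have "mollifier (\<kappa> n) (\<tau> - p) *\<^sub>R (indicator (cball p q) \<tau> * f \<tau>) = mollifier (\<kappa> n) (\<tau> - p) * f \<tau>" for \<tau>
        using mollifier_eq_0[OF \<kappa>(1), of n "\<tau> - p"] \<kappa>(2)[of n] by (cases "\<tau> \<in> cball p q") (auto simp: dist_real_def)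
      ultimately show ?thesis by (simp only:)
    qed
    show ?thesis
      using tendsto_diff[OF mollifier_at_point[OF q(1) fs f(1) \<kappa>(1,3)] mollifier_at_point[OF q(1) fs f(2) \<kappa>(1,3)]] im
      by (simp add: D left_diff_distrib)
  qed
  show ?thesis
  proof (intro exI[of _ \<theta>] conjI allI impI)
    show "AE \<tau> in lborel. (\<lambda>n. \<theta> n \<tau>) \<longlonglongrightarrow> ?I \<tau>" using r(2) by (simp add: \<theta>_def \<kappa>_def)
    show "\<theta> n \<tau> = 0" if "\<tau> \<notin> {0..t + 1}" for n \<tau> using supp[of \<tau> n] that st by auto
  qed (use tf bd lim in auto)
qed

text \<open>Continuity at the two times makes a distributional inequality \<open>f' \<le> 0\<close> visible at single points.\<close>

lemma decreasing_of_weak_derivative: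
  fixes f :: "real \<Rightarrow> real"
  assumes st: "0 < s" "s < t" and c: "isCont f s" "isCont f t"
    and f: "integrable lborel (\<lambda>\<tau>. indicator {0..t + 1} \<tau> * f \<tau>)"
    and w: "\<And>\<theta> :: real \<Rightarrow> real. test_fun {0<..} \<theta> \<Longrightarrow> (\<And>\<tau>. 0 \<le> \<theta> \<tau>) \<Longrightarrow>
      0 \<le> (LBINT \<tau>. fderiv \<theta> \<tau> 1 * f \<tau>)"
  shows "f t \<le> f s"
proof -
  obtain \<theta> :: "nat \<Rightarrow> real \<Rightarrow> real" where \<theta>: "\<forall>n. test_fun {0<..} (\<theta> n)" "\<forall>n \<tau>. 0 \<le> \<theta> n \<tau> \<and> \<theta> n \<tau> \<le> 1"
    "\<forall>f. isCont f s \<longrightarrow> isCont f t \<longrightarrow> integrable lborel (\<lambda>\<tau>. indicator {0..t + 1} \<tau> * f \<tau>) \<longrightarrow>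
       (\<lambda>n. LBINT \<tau>. fderiv (\<theta> n) \<tau> 1 * f \<tau>) \<longlonglongrightarrow> f s - f t"
    using time_test_funs[OF st] by (elim exE conjE) (rule that)
  have "(\<lambda>n. LBINT \<tau>. fderiv (\<theta> n) \<tau> 1 * f \<tau>) \<longlonglongrightarrow> f s - f t"
    using \<theta>(3) c f by blast
  then have "0 \<le> f s - f t" by (rule LIMSEQ_le_const) (use w \<theta> in auto)
  then show ?thesis by simp
qed

section \<open>The chain rule along weakly differentiable curves\<close>

lemma conv_at_point:
  fixes f :: "real \<Rightarrow> real"
  assumes i: "0 < d" "integrable lborel (\<lambda>\<tau>. indicator (cball s d) \<tau> * f \<tau>)"
    and c: "isCont f s" and \<kappa>: "\<And>n. 0 < \<kappa> n" "\<kappa> \<longlonglongrightarrow> 0"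
  shows "(\<lambda>n. LBINT \<tau>. mollifier (\<kappa> n) (s - \<tau>) * f \<tau>) \<longlonglongrightarrow> f s"
proof -
  have refl: "(LBINT \<tau>. h (0 - \<tau>)) = (LBINT \<tau>. h \<tau>)" for h :: "real \<Rightarrow> real"
    using lborel_integral_real_affine[of "-1" h 0] by simp
  have "integrable lborel (\<lambda>\<tau>. indicator (cball (- s) d) \<tau> * f (- \<tau>))"
  proof -
    have "(\<lambda>\<tau>. indicator (cball (- s) d) \<tau> * f (- \<tau>)) = (\<lambda>\<tau>. (\<lambda>\<tau>. indicator (cball s d) \<tau> * f \<tau>) (0 - \<tau>))"
      by (auto simp: fun_eq_iff indicator_def dist_real_def)
    then show ?thesis using lborel_shift(5)[OF i(2), of 0] by (simp only:)
  qed
  moreover have "isCont (\<lambda>\<tau>. f (- \<tau>)) (- s)"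
  proof -
    have "isCont uminus (- s)" by (intro continuous_intros)
    then show ?thesis using isCont_o2[of "- s" uminus f] c by simp
  qed
  ultimately have "(\<lambda>n. LBINT \<tau>. mollifier (\<kappa> n) (\<tau> - (- s)) * f (- \<tau>)) \<longlonglongrightarrow> f (- (- s))"
    by (rule mollifier_at_point[OF i(1) _ _ \<kappa>])
  moreover have "(LBINT \<tau>. mollifier (\<kappa> n) (\<tau> - (- s)) * f (- \<tau>)) = (LBINT \<tau>. mollifier (\<kappa> n) (s - \<tau>) * f \<tau>)" for n
    using refl[of "\<lambda>\<tau>. mollifier (\<kappa> n) (s - \<tau>) * f \<tau>"] by (simp add: add.commute)
  ultimately show ?thesis by simp
qed

text \<open>Mollification in time reduces this to the classical chain rule. The limit is harmless since \<open>\<beta>'\<close> is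
  bounded and continuous and the mollified derivatives converge in \<open>L\<^sub>1\<close>.\<close>

lemma chain_rule_weak:
  fixes f g \<beta> \<beta>' :: "real \<Rightarrow> real"
  assumes w: "wderiv {0<..} 1 f g" and st: "0 < s" "s < t" and c: "isCont f s" "isCont f t"
    and \<beta>: "\<And>x. (\<beta> has_real_derivative \<beta>' x) (at x)" "continuous_on UNIV \<beta>'" "\<And>x. \<bar>\<beta>' x\<bar> \<le> 1"
  shows "\<beta> (f t) - \<beta> (f s) = (LBINT \<tau>. indicator {s..t} \<tau> * (\<beta>' (f \<tau>) * g \<tau>))"
proof -
  define K where "K = {s / 2..t + 1}"
  have K: "compact K" "K \<subseteq> {0<..}" using st by (auto simp: K_def)
  define q where "q = min (s / 2) 1"
  have q: "0 < q" "q \<le> s / 2" "q \<le> 1" using st by (auto simp: q_def)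
  have cb: "cball \<tau> e \<subseteq> K" if "e \<le> q" "\<tau> \<in> {s..t}" for e \<tau>
    using that q by (auto simp: K_def dist_real_def)
  let ?k = "\<lambda>n. inverse (real (Suc n)) * q"
  have k: "0 < ?k n" "?k \<longlonglongrightarrow> 0" for n
    using q(1) tendsto_mult_left_zero[OF LIMSEQ_inverse_real_of_nat] by auto
  define F where "F \<tau> = indicator K \<tau> *\<^sub>R f \<tau>" for \<tau>
  define G where "G \<tau> = indicator K \<tau> *\<^sub>R g \<tau>" for \<tau>
  have F: "integrable lborel F" and G: "integrable lborel G"
    using w K unfolding wderiv_def F_def G_def by blast+
  have [measurable]: "f \<in> borel_measurable borel" "g \<in> borel_measurable borel" using w by (auto simp: wderiv_def)
  obtain r where r: "strict_mono (r :: nat \<Rightarrow> nat)" "AE \<tau> in lborel. (\<lambda>n. conv (mollifier (?k (r n))) F \<tau>) \<longlonglongrightarrow> F \<tau>"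
    using mollifier_AE_subseq[OF F k] by blast
  define \<kappa> where "\<kappa> n = ?k (r n)" for n
  have \<kappa>: "0 < \<kappa> n" "\<kappa> n \<le> q" "\<kappa> \<longlonglongrightarrow> 0" for n
  proof -
    show "0 < \<kappa> n" unfolding \<kappa>_def by (rule k)
    show "\<kappa> n \<le> q" using q(1) by (simp add: \<kappa>_def field_simps)
    show "\<kappa> \<longlonglongrightarrow> 0" using LIMSEQ_subseq_LIMSEQ[OF k(2) r(1)] by (simp add: \<kappa>_def[abs_def] o_def)
  qed
  define fn where "fn n = conv (mollifier (\<kappa> n)) F" for n
  define gn where "gn n = conv (mollifier (\<kappa> n)) G" for n
  note m = test_fun_mollifier[OF \<kappa>(1), where 'a=real]
  have cfn: "continuous_on UNIV (fn n)" and cgn: "continuous_on UNIV (gn n)" for n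
    unfolding fn_def gn_def using Ck_on_conv[OF m F, of 0 n] Ck_on_conv[OF m G, of 0 n] by auto
  note [measurable] = borel_measurable_continuous_onI[OF cfn] borel_measurable_continuous_onI[OF cgn]
    borel_measurable_continuous_onI[OF \<beta>(2)]
  have mF[measurable]: "F \<in> borel_measurable borel" "G \<in> borel_measurable borel" using F G by auto
  have d: "(fn n has_real_derivative gn n \<tau>) (at \<tau>)" if "\<tau> \<in> {s..t}" for n \<tau>
  proof -
    have "(fn n has_derivative fderiv (fn n) \<tau>) (at \<tau>)"
      unfolding fn_def by (rule Ck_on_Suc_has_derivative[OF Ck_on_conv[OF m F]])
    moreover have "fderiv (fn n) \<tau> = (*) (gn n \<tau>)"
    proof
      fix h :: real
      have "fderiv (fn n) \<tau> (h *\<^sub>R 1) = h *\<^sub>R fderiv (fn n) \<tau> 1"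
        by (rule linear_cmul[OF has_derivative_linear[OF calculation]])
      then show "fderiv (fn n) \<tau> h = gn n \<tau> * h"
        using wderiv_conv[OF w K \<kappa>(1) cb[OF \<kappa>(2) that]]
        by (simp add: fn_def gn_def F_def[abs_def] G_def[abs_def] mult.commute)
    qed
    ultimately show ?thesis by (simp add: has_field_derivative_def)
  qed
  have ftc: "(LBINT \<tau>. \<beta>' (fn n \<tau>) * gn n \<tau> * indicator {s..t} \<tau>) = \<beta> (fn n t) - \<beta> (fn n s)" for n
  proof (rule integral_FTC_Icc_real[where F = "\<lambda>\<tau>. \<beta> (fn n \<tau>)"])
    show "((\<lambda>\<tau>. \<beta> (fn n \<tau>)) has_real_derivative \<beta>' (fn n \<tau>) * gn n \<tau>) (at \<tau>)" if "s \<le> \<tau>" "\<tau> \<le> t" for \<tau>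
      using that by (intro DERIV_chain2[OF \<beta>(1) d]) auto
    have "continuous_on UNIV (\<lambda>\<tau>. \<beta>' (fn n \<tau>) * gn n \<tau>)"
      by (intro continuous_on_mult cgn continuous_on_compose2[OF \<beta>(2) cfn]) auto
    then show "isCont (\<lambda>\<tau>. \<beta>' (fn n \<tau>) * gn n \<tau>) \<tau>" for \<tau> by (simp add: continuous_on_eq_continuous_at)
  qed (use st in simp)
  have end_lim: "(\<lambda>n. fn n p) \<longlonglongrightarrow> f p" if p: "p \<in> {s, t}" for p
  proof -
    have "cball p q \<subseteq> K" by (rule cb) (use p st in auto)
    then have "(\<lambda>\<tau>. indicator (cball p q) \<tau> * f \<tau>) = (\<lambda>\<tau>. indicator (cball p q) \<tau> *\<^sub>R F \<tau>)"
      by (auto simp: F_def fun_eq_iff indicator_def)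
    moreover have "integrable lborel (\<lambda>\<tau>. indicator (cball p q) \<tau> *\<^sub>R F \<tau>)"
      by (rule integrable_bounded_mult[OF F, of _ 1]) (auto simp: indicator_def)
    ultimately have "integrable lborel (\<lambda>\<tau>. indicator (cball p q) \<tau> * f \<tau>)" by simp
    from conv_at_point[OF q(1) this _ \<kappa>(1,3)] c p
    have "(\<lambda>n. LBINT \<tau>. mollifier (\<kappa> n) (p - \<tau>) * f \<tau>) \<longlonglongrightarrow> f p" by auto
    moreover have "fn n p = (LBINT \<tau>. mollifier (\<kappa> n) (p - \<tau>) * f \<tau>)" for n
    proof -
      have "cball p (\<kappa> n) \<subseteq> K" by (rule cb[OF \<kappa>(2)]) (use p st in auto)
      from conv_mollifier_local(1)[OF \<kappa>(1) this, of f] show ?thesis by (simp add: fn_def F_def[abs_def])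
    qed
    ultimately show ?thesis by simp
  qed
  have c\<beta>: "isCont \<beta> x" for x by (rule DERIV_isCont[OF \<beta>(1)])
  have lhs: "(\<lambda>n. \<beta> (fn n t) - \<beta> (fn n s)) \<longlonglongrightarrow> \<beta> (f t) - \<beta> (f s)"
    by (intro tendsto_diff isCont_tendsto_compose[OF c\<beta>] end_lim) auto
  have i1: "integrable lborel (\<lambda>\<tau>. gn n \<tau> - G \<tau>)" for n
    unfolding gn_def by (rule mollifier_L1(1)[OF G \<kappa>(1,3)])
  have b1: "\<bar>indicator {s..t} \<tau> * \<beta>' y\<bar> \<le> 1" for \<tau> y using \<beta>(3) by (auto simp: indicator_def)
  have iA: "integrable lborel (\<lambda>\<tau>. (indicator {s..t} \<tau> * \<beta>' (fn n \<tau>)) *\<^sub>R (gn n \<tau> - G \<tau>))" for n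
    by (rule integrable_bounded_mult[OF i1, of _ 1]) (use b1 in auto)
  have iB: "integrable lborel (\<lambda>\<tau>. (indicator {s..t} \<tau> * \<beta>' (fn n \<tau>)) *\<^sub>R G \<tau>)" for n
    by (rule integrable_bounded_mult[OF G, of _ 1]) (use b1 in auto)
  have A: "(\<lambda>n. LBINT \<tau>. (indicator {s..t} \<tau> * \<beta>' (fn n \<tau>)) *\<^sub>R (gn n \<tau> - G \<tau>)) \<longlonglongrightarrow> 0"
  proof (rule Lim_null_comparison[OF always_eventually])
    show "(\<lambda>n. LBINT \<tau>. norm (gn n \<tau> - G \<tau>)) \<longlonglongrightarrow> 0"
      unfolding gn_def by (rule mollifier_L1(2)[OF G \<kappa>(1,3)])
    show "\<forall>n. norm (LBINT \<tau>. (indicator {s..t} \<tau> * \<beta>' (fn n \<tau>)) *\<^sub>R (gn n \<tau> - G \<tau>)) \<le> (LBINT \<tau>. norm (gn n \<tau> - G \<tau>))"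
    proof
      fix n
      have "norm (LBINT \<tau>. (indicator {s..t} \<tau> * \<beta>' (fn n \<tau>)) *\<^sub>R (gn n \<tau> - G \<tau>))
          \<le> (LBINT \<tau>. norm ((indicator {s..t} \<tau> * \<beta>' (fn n \<tau>)) *\<^sub>R (gn n \<tau> - G \<tau>)))"
        by (rule integral_norm_bound)
      also have "\<dots> \<le> (LBINT \<tau>. norm (gn n \<tau> - G \<tau>))"
      proof (rule integral_mono)
        show "norm ((indicator {s..t} \<tau> * \<beta>' (fn n \<tau>)) *\<^sub>R (gn n \<tau> - G \<tau>)) \<le> norm (gn n \<tau> - G \<tau>)" for \<tau>
          unfolding norm_scaleR using b1 by (intro mult_left_le_one_le) auto
      qed (use integrable_norm[OF iA] integrable_norm[OF i1] in auto)
      finally show "norm (LBINT \<tau>. (indicator {s..t} \<tau> * \<beta>' (fn n \<tau>)) *\<^sub>R (gn n \<tau> - G \<tau>)) \<le> (LBINT \<tau>. norm (gn n \<tau> - G \<tau>))" .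
    qed
  qed
  have B: "(\<lambda>n. LBINT \<tau>. (indicator {s..t} \<tau> * \<beta>' (fn n \<tau>)) *\<^sub>R G \<tau>) \<longlonglongrightarrow> (LBINT \<tau>. (indicator {s..t} \<tau> * \<beta>' (F \<tau>)) *\<^sub>R G \<tau>)"
  proof (rule integral_dominated_convergence[OF _ _ integrable_norm[OF G]])
    show "AE \<tau> in lborel. (\<lambda>n. (indicator {s..t} \<tau> * \<beta>' (fn n \<tau>)) *\<^sub>R G \<tau>) \<longlonglongrightarrow> (indicator {s..t} \<tau> * \<beta>' (F \<tau>)) *\<^sub>R G \<tau>"
      using r(2)
    proof eventually_elim
      case (elim \<tau>)
      have "(\<lambda>n. fn n \<tau>) \<longlonglongrightarrow> F \<tau>" using elim by (simp add: fn_def \<kappa>_def)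
      then have "(\<lambda>n. \<beta>' (fn n \<tau>)) \<longlonglongrightarrow> \<beta>' (F \<tau>)"
        using \<beta>(2) by (intro isCont_tendsto_compose[of _ \<beta>']) (auto simp: continuous_on_eq_continuous_at)
      then show ?case by (intro tendsto_intros)
    qed
    show "AE \<tau> in lborel. norm ((indicator {s..t} \<tau> * \<beta>' (fn n \<tau>)) *\<^sub>R G \<tau>) \<le> norm (G \<tau>)" for n
      unfolding norm_scaleR using b1 by (intro AE_I2 mult_left_le_one_le) auto
  qed measurable
  have "(\<lambda>n. \<beta> (fn n t) - \<beta> (fn n s)) \<longlonglongrightarrow> 0 + (LBINT \<tau>. (indicator {s..t} \<tau> * \<beta>' (F \<tau>)) *\<^sub>R G \<tau>)"
  proof -
    have "\<beta> (fn n t) - \<beta> (fn n s) = (LBINT \<tau>. (indicator {s..t} \<tau> * \<beta>' (fn n \<tau>)) *\<^sub>R (gn n \<tau> - G \<tau>))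
      + (LBINT \<tau>. (indicator {s..t} \<tau> * \<beta>' (fn n \<tau>)) *\<^sub>R G \<tau>)" for n
      unfolding ftc[symmetric] Bochner_Integration.integral_add[OF iA iB, symmetric]
      by (intro Bochner_Integration.integral_cong) (auto simp: algebra_simps)
    then show ?thesis using tendsto_add[OF A B] by simp
  qed
  from LIMSEQ_unique[OF lhs this]
  have "\<beta> (f t) - \<beta> (f s) = (LBINT \<tau>. (indicator {s..t} \<tau> * \<beta>' (F \<tau>)) *\<^sub>R G \<tau>)" by simp
  also have "\<dots> = (LBINT \<tau>. indicator {s..t} \<tau> * (\<beta>' (f \<tau>) * g \<tau>))"
    using st by (intro Bochner_Integration.integral_cong) (auto simp: F_def G_def K_def indicator_def)
  finally show ?thesis .
qed

section \<open>The commutator estimate\<close>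

lemma nn_integral_reflect:
  fixes f :: "'a::euclidean_space \<Rightarrow> ennreal"
  assumes [measurable]: "f \<in> borel_measurable borel"
  shows "(\<integral>\<^sup>+y. f (x - y) \<partial>lborel) = (\<integral>\<^sup>+y. f y \<partial>lborel)"
proof -
  have e: "lborel = density (distr lborel borel (\<lambda>y::'a. x + (-1) *\<^sub>R y)) (\<lambda>_. ennreal (\<bar>-1\<bar> ^ DIM('a)))"
    using lborel_affine[of "-1" x] by simp
  have "(\<integral>\<^sup>+y. f y \<partial>lborel) = (\<integral>\<^sup>+y. f y \<partial>density (distr lborel borel (\<lambda>y::'a. x + (-1) *\<^sub>R y)) (\<lambda>_. ennreal (\<bar>-1\<bar> ^ DIM('a))))"
    using e by (rule arg_cong)
  also have "\<dots> = (\<integral>\<^sup>+y. f (x - y) \<partial>lborel)"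
    by (subst nn_integral_density) (auto simp: nn_integral_distr)
  finally show ?thesis by simp
qed

lemma test_fun_deriv_measurable:
  fixes \<phi> :: "'a::euclidean_space \<Rightarrow> real"
  assumes \<phi>: "test_fun U \<phi>" and [measurable]: "f \<in> borel_measurable M" "u \<in> borel_measurable M"
  shows "(\<lambda>x. fderiv \<phi> (f x) (u x)) \<in> borel_measurable M"
proof -
  note [measurable] = test_fun_measurable[OF test_fun_deriv[OF \<phi>]]
  have "(\<lambda>x. \<Sum>i\<in>Basis. (u x \<bullet> i) *\<^sub>R fderiv \<phi> (f x) i) \<in> borel_measurable M"
    by measurable
  then show ?thesis
    by (subst frechet_derivative_Basis[OF test_fun_has_derivative[OF \<phi>]])
qed

text \<open>Mollifying the transport equation \<open>q\<^sub>t + div (q u) = 0\<close> in space produces the error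
  \<open>\<integral> q(y) \<nabla>\<eta>(x - y) \<bullet> (u(x) - u(y)) dy\<close>. Since \<open>u\<close> is Lipschitz, the factor \<open>u(x) - u(y)\<close> compensates
  the singularity of \<open>\<nabla>\<eta>\<close>; since \<open>div u = 0\<close>, one may replace \<open>q(y)\<close> by \<open>q(y) - q(x)\<close>, which is small
  on average.\<close>

lemma commutator_estimate:
  "\<exists>C>0. \<forall>(\<Omega> :: (real^'n) set) u D L \<kappa> (q :: real^'n \<Rightarrow> real) (\<beta> :: real \<Rightarrow> real) \<beta>' e.
     h10 \<Omega> (u :: real^'n \<Rightarrow> real^'n) D \<longrightarrow> bounded \<Omega> \<longrightarrow> (AE x in lborel. trace (D x) = 0) \<longrightarrow>
     (AE x in lborel. norm (D x) \<le> L) \<longrightarrow> 0 \<le> L \<longrightarrow> 0 < \<kappa> \<longrightarrow>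
     q \<in> borel_measurable borel \<longrightarrow> integrable lborel q \<longrightarrow>
     (\<forall>x. (\<beta> has_real_derivative \<beta>' x) (at x)) \<longrightarrow> continuous_on UNIV \<beta>' \<longrightarrow> (\<forall>x. \<bar>\<beta>' x\<bar> \<le> 1) \<longrightarrow> 0 \<le> e \<longrightarrow>
     (\<forall>z. norm z \<le> \<kappa> \<longrightarrow> (LBINT x. \<bar>q (x - z) - q x\<bar>) \<le> e) \<longrightarrow>
     (\<forall>M. (\<forall>x. \<bar>q x\<bar> \<le> M) \<longrightarrow>
     \<bar>\<integral>x. \<beta>' (conv (mollifier \<kappa>) q x) * (- (LBINT y. q y * fderiv (mollifier \<kappa>) (x - y) (u y))) \<partial>lborel\<bar>
       \<le> C * L * e)"
proof -
  let ?N = "DIM(real^'n)"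
  obtain B where B: "0 < B" "\<And>\<kappa> (z::real^'n) h. 0 < \<kappa> \<Longrightarrow>
      \<bar>fderiv (mollifier \<kappa>) z h\<bar> \<le> B / \<kappa> ^ (?N + 1) * norm h"
    using mollifier_deriv_bound[where 'a="real^'n"] by blast
  define V where "V = measure lborel (cball (0::real^'n) 1)"
  have V: "0 \<le> V" by (simp add: V_def)
  show ?thesis
  proof (intro exI[of _ "B * (V + 1)"] conjI allI impI)
    show "0 < B * (V + 1)" using B(1) V by simp
    fix \<Omega> :: "(real^'n) set" and u D and L \<kappa> e M :: real and q :: "real^'n \<Rightarrow> real" and \<beta> \<beta>' :: "real \<Rightarrow> real"
    assume h: "h10 \<Omega> (u :: real^'n \<Rightarrow> real^'n) D" and b: "bounded \<Omega>" and tr: "AE x in lborel. trace (D x) = 0"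
      and L: "AE x in lborel. norm (D x) \<le> L" "0 \<le> L" and \<kappa>: "0 < \<kappa>"
      and qm[measurable]: "q \<in> borel_measurable borel" and q: "integrable lborel q"
      and \<beta>0: "\<forall>x. (\<beta> has_real_derivative \<beta>' x) (at x)" "continuous_on UNIV \<beta>'" "\<forall>x. \<bar>\<beta>' x\<bar> \<le> 1"
      and e: "0 \<le> e" and osc0: "\<forall>z. norm z \<le> \<kappa> \<longrightarrow> (LBINT x. \<bar>q (x - z) - q x\<bar>) \<le> e"
      and qM: "\<forall>x. \<bar>q x\<bar> \<le> M"
    note \<beta> = \<beta>0(1)[rule_format] \<beta>0(2) \<beta>0(3)[rule_format] and osc = osc0[rule_format]
    note m = test_fun_mollifier[OF \<kappa>, where 'a="real^'n"]
    let ?d = "\<lambda>z h. fderiv (mollifier \<kappa>) (z::real^'n) h"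
    let ?q = "conv (mollifier \<kappa>) q"
    note hd = test_fun_has_derivative[OF m]
    have lin: "linear (?d z)" for z using hd has_derivative_linear by blast
    note iu = h10_integrable(1)[OF h b]
    have u0: "u x = 0" if "x \<notin> \<Omega>" for x using h that by (auto simp: h10_def)
    have [measurable]: "u \<in> borel_measurable borel" using h by (simp add: h10_def)
    note [measurable] = test_fun_deriv_measurable[OF test_fun_mollifier[OF \<kappa>, where 'a = "real^'n"]]
    have [measurable]: "?q \<in> borel_measurable borel" by (rule conv_measurable[OF m q])
    note [measurable] = borel_measurable_continuous_onI[OF \<beta>(2)]
    obtain G where G: "AE x in lborel. x \<in> G" "\<And>x y. x \<in> G \<Longrightarrow> y \<in> G \<Longrightarrow> norm (u x - u y) \<le> L * norm (x - y)"
      using h10_Lipschitz[OF h b L(1)] by blast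
    define g where "g x = - (LBINT y. q y * ?d (x - y) (u y))" for x
    define Dq where "Dq x = conv (\<lambda>z. ?d z (u x)) q x" for x
    have [measurable]: "g \<in> borel_measurable borel" unfolding g_def by measurable
    have iqu: "integrable lborel (\<lambda>y. ?d (x - y) (u y))" for x
    proof (rule Bochner_Integration.integrable_bound)
      show "integrable lborel (\<lambda>y. B / \<kappa> ^ (?N + 1) * norm (u y))" using iu by auto
      show "AE y in lborel. norm (?d (x - y) (u y)) \<le> norm (B / \<kappa> ^ (?N + 1) * norm (u y))"
      proof (intro AE_I2)
        fix y
        have "\<bar>B / \<kappa> ^ (?N + 1) * norm (u y)\<bar> = B / \<kappa> ^ (?N + 1) * norm (u y)"
          using B(1) \<kappa> by (intro abs_of_nonneg mult_nonneg_nonneg) auto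
        then show "norm (?d (x - y) (u y)) \<le> norm (B / \<kappa> ^ (?N + 1) * norm (u y))"
          using B(2)[OF \<kappa>, of "x - y" "u y"] unfolding real_norm_def by simp
      qed
    qed measurable
    have iqu': "integrable lborel (\<lambda>y. q y * ?d (x - y) (u y))" for x
      using integrable_bounded_mult[OF iqu, of q M x] qM by simp
    have iqh: "integrable lborel (\<lambda>y. q y * ?d (x - y) h)" for x h
      using conv_integrable[OF test_fun_deriv[OF m] q, of x h] by (simp add: mult.commute)
    have id: "integrable lborel (\<lambda>y. ?d (x - y) h)" "(LBINT y. ?d (x - y) h) = 0" for x h
    proof -
      note t = test_fun_deriv[OF m, of h]
      obtain K where K: "compact K" "\<And>x::real^'n. x \<notin> K \<Longrightarrow> mollifier \<kappa> x = 0" using m by (auto simp: test_fun_def)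
      have "(LBINT y. ?d y h) = 0"
        by (rule integral_derivative_eq_0[OF hd test_fun_continuous[OF t] K])
      then show "integrable lborel (\<lambda>y. ?d (x - y) h)" "(LBINT y. ?d (x - y) h) = 0"
        using lborel_shift(5,6)[OF test_fun_integrable[OF t], of x] by auto
    qed
    have div0: "(LBINT y. ?d (x - y) (u y)) = 0" for x
    proof -
      have "(LBINT y. fderiv (\<lambda>y. mollifier \<kappa> (x - y)) y (u y)) = 0"
        by (rule h10_divergence_free[OF h b tr])
          (rule test_fun_has_derivative[OF test_fun_mollifier_reflect(1)[OF \<kappa> subset_UNIV]],
           rule test_fun_continuous[OF test_fun_deriv[OF test_fun_mollifier_reflect(1)[OF \<kappa> subset_UNIV]]])
      then show ?thesis by (simp add: test_fun_mollifier_reflect(2)[OF \<kappa> subset_UNIV])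
    qed
    have comm: "g x + Dq x = (LBINT y. (q y - q x) * ?d (x - y) (u x - u y))" for x
    proof -
      have "(LBINT y. (q y - q x) * ?d (x - y) (u x - u y))
          = (LBINT y. (q y * ?d (x - y) (u x) - q y * ?d (x - y) (u y)) - (q x * ?d (x - y) (u x) - q x * ?d (x - y) (u y)))"
        by (intro Bochner_Integration.integral_cong) (auto simp: linear_diff[OF lin] algebra_simps)
      also have "\<dots> = Dq x + g x"
        using iqh[of x "u x"] iqu' iqu id div0 by (simp add: Dq_def g_def conv_def mult.commute)
      finally show ?thesis by simp
    qed
    have Dqi: "integrable lborel (\<lambda>x. \<beta>' (?q x) * Dq x)" "(LBINT x. \<beta>' (?q x) * Dq x) = 0"
    proof -
      let ?D = "\<lambda>x h. conv (\<lambda>z. ?d z h) q x"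
      have qd: "(?q has_derivative ?D x) (at x)" for x by (rule conv_has_derivative[OF m q])
      have qc: "continuous_on UNIV ?q" using Ck_on_conv[OF m q, of 0] by simp
      have Dc: "continuous_on UNIV (\<lambda>x. ?D x h)" for h
        using Ck_on_conv[OF test_fun_deriv[OF m] q, of 0] by simp
      have c: "continuous_on UNIV (\<lambda>x. \<beta>' (?q x) * ?D x h)" for h
        by (intro continuous_on_mult Dc continuous_on_compose2[OF \<beta>(2) qc]) auto
      have bd: "((\<lambda>x. \<beta> (?q x)) has_derivative (\<lambda>h. \<beta>' (?q x) * ?D x h)) (at x)" for x
        using has_derivative_compose[OF qd, of \<beta> "\<lambda>h. \<beta>' (?q x) * h" x] \<beta>(1)[of "?q x"]
        by (simp add: has_field_derivative_def)
      show "(LBINT x. \<beta>' (?q x) * Dq x) = 0"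
        using h10_divergence_free[OF h b tr bd c] by (simp add: Dq_def)
      have "Dq x = (\<Sum>j\<in>UNIV. (u x \<bullet> axis j 1) * ?D x (axis j 1))" for x
        unfolding Dq_def
        by (subst linear_vec_expand[OF has_derivative_linear[OF qd]]) (simp add: inner_axis)
      moreover have "integrable lborel (\<lambda>x. \<Sum>j\<in>UNIV. (\<beta>' (?q x) * ?D x (axis j 1)) *\<^sub>R (u x \<bullet> axis j 1))"
        by (intro Bochner_Integration.integrable_sum, rule continuous_mult_integrable[OF integrable_inner_left[OF iu] b _ c])
          (simp add: u0)
      ultimately show "integrable lborel (\<lambda>x. \<beta>' (?q x) * Dq x)"
        by (simp add: sum_distrib_left mult_ac)
    qed
    have [measurable]: "Dq \<in> borel_measurable borel" unfolding Dq_def conv_def by measurable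
    let ?c = "B / \<kappa> ^ (?N + 1) * (L * \<kappa>)"
    have [measurable]: "cball (0::real^'n) \<kappa> \<in> sets borel" by simp
    have c0: "0 \<le> ?c" using B(1) \<kappa> L(2) by simp
    have pw: "AE x in lborel. ennreal \<bar>g x + Dq x\<bar> \<le> (\<integral>\<^sup>+z. ennreal (?c * indicator (cball 0 \<kappa>) z) * ennreal \<bar>q (x - z) - q x\<bar> \<partial>lborel)"
      using G(1)
    proof eventually_elim
      case (elim x)
      have i: "integrable lborel (\<lambda>y. (q y - q x) * ?d (x - y) (u x - u y))"
      proof -
        have "integrable lborel (\<lambda>y. (q y * ?d (x - y) (u x) - q y * ?d (x - y) (u y)) - (q x * ?d (x - y) (u x) - q x * ?d (x - y) (u y)))"
          using iqh[of x "u x"] iqu' iqu id by auto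
        then show ?thesis by (simp add: linear_diff[OF lin] algebra_simps)
      qed
      have "ennreal \<bar>g x + Dq x\<bar> \<le> (\<integral>\<^sup>+y. ennreal \<bar>(q y - q x) * ?d (x - y) (u x - u y)\<bar> \<partial>lborel)"
        using integral_norm_bound_ennreal[OF i] by (simp add: comm)
      also have "\<dots> \<le> (\<integral>\<^sup>+y. ennreal (?c * indicator (cball 0 \<kappa>) (x - y)) * ennreal \<bar>q (x - (x - y)) - q x\<bar> \<partial>lborel)"
      proof (rule nn_integral_mono_AE)
        show "AE y in lborel. ennreal \<bar>(q y - q x) * ?d (x - y) (u x - u y)\<bar>
            \<le> ennreal (?c * indicator (cball 0 \<kappa>) (x - y)) * ennreal \<bar>q (x - (x - y)) - q x\<bar>"
          using G(1)
        proof eventually_elim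
          case (elim y)
          have "\<bar>?d (x - y) (u x - u y)\<bar> \<le> ?c * indicator (cball 0 \<kappa>) (x - y)"
          proof (cases "norm (x - y) \<le> \<kappa>")
            case True
            have "norm (u x - u y) \<le> L * norm (x - y)" by (rule G(2)) fact+
            also have "\<dots> \<le> L * \<kappa>" using True L(2) by (rule mult_left_mono)
            finally have "B / \<kappa> ^ (?N + 1) * norm (u x - u y) \<le> ?c"
              using B(1) \<kappa> by (intro mult_left_mono) auto
            then show ?thesis using B(2)[OF \<kappa>, of "x - y" "u x - u y"] True by simp
          next
            case False
            then have "\<kappa> < norm (x - y)" by simp
            then show ?thesis using mollifier_deriv_eq_0[OF \<kappa>, of "x - y"] c0 by simp
          qed
          then have "\<bar>q y - q x\<bar> * \<bar>?d (x - y) (u x - u y)\<bar> \<le> \<bar>q y - q x\<bar> * (?c * indicator (cball 0 \<kappa>) (x - y))"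
            by (rule mult_left_mono) simp
          then show ?case using c0 by (simp add: abs_mult mult.commute ennreal_leI flip: ennreal_mult)
        qed
      qed
      also have "\<dots> = (\<integral>\<^sup>+z. ennreal (?c * indicator (cball 0 \<kappa>) z) * ennreal \<bar>q (x - z) - q x\<bar> \<partial>lborel)"
        by (rule nn_integral_reflect) measurable
      finally show ?case .
    qed
    have "(\<integral>\<^sup>+x. ennreal \<bar>g x + Dq x\<bar> \<partial>lborel)
        \<le> (\<integral>\<^sup>+x. (\<integral>\<^sup>+z. ennreal (?c * indicator (cball 0 \<kappa>) z) * ennreal \<bar>q (x - z) - q x\<bar> \<partial>lborel) \<partial>lborel)"
      by (rule nn_integral_mono_AE[OF pw])
    also have "\<dots> = (\<integral>\<^sup>+z. (\<integral>\<^sup>+x. ennreal (?c * indicator (cball 0 \<kappa>) z) * ennreal \<bar>q (x - z) - q x\<bar> \<partial>lborel) \<partial>lborel)"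
      by (rule lborel_pair.Fubini') measurable
    also have "\<dots> \<le> (\<integral>\<^sup>+z. ennreal (?c * e) * indicator (cball (0::real^'n) \<kappa>) z \<partial>lborel)"
    proof (rule nn_integral_mono)
      fix z :: "real^'n"
      have "(\<integral>\<^sup>+x. ennreal \<bar>q (x - z) - q x\<bar> \<partial>lborel) = ennreal (LBINT x. \<bar>q (x - z) - q x\<bar>)"
        using lborel_shift(3)[OF q, of z] q by (intro nn_integral_eq_integral) auto
      then show "(\<integral>\<^sup>+x. ennreal (?c * indicator (cball 0 \<kappa>) z) * ennreal \<bar>q (x - z) - q x\<bar> \<partial>lborel)
          \<le> ennreal (?c * e) * indicator (cball (0::real^'n) \<kappa>) z"
        using osc[of z] c0 e by (subst nn_integral_cmult)
          (auto simp: indicator_def ennreal_mult intro!: mult_left_mono ennreal_leI)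
    qed
    also have "\<dots> = ennreal (?c * e) * emeasure lborel (cball (0::real^'n) \<kappa>)"
      by (subst nn_integral_cmult_indicator) auto
    also have "emeasure lborel (cball (0::real^'n) \<kappa>) = ennreal (\<kappa> ^ ?N * V)"
    proof -
      have "emeasure lborel (cball (0::real^'n) \<kappa>) = ennreal (measure lborel (cball (0::real^'n) \<kappa>))"
        using emeasure_compact_finite[OF compact_cball, of "0::real^'n" \<kappa>] by (intro emeasure_eq_ennreal_measure) auto
      also have "measure lborel (cball (0::real^'n) \<kappa>) = \<kappa> ^ ?N * V"
        using content_cball[of \<kappa> "0::real^'n"] content_cball[of 1 "0::real^'n"] \<kappa> by (simp add: V_def mult.commute)
      finally show ?thesis .
    qed
    also have "ennreal (?c * e) * ennreal (\<kappa> ^ ?N * V) = ennreal (B * V * L * e)"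
    proof -
      have "0 \<le> ?c * e" by (rule mult_nonneg_nonneg[OF c0 e])
      moreover have "0 \<le> \<kappa> ^ ?N * V" by (rule mult_nonneg_nonneg[OF zero_le_power[OF less_imp_le[OF \<kappa>]] V])
      ultimately have "ennreal (?c * e) * ennreal (\<kappa> ^ ?N * V) = ennreal (?c * e * (\<kappa> ^ ?N * V))" by (rule ennreal_mult[symmetric])
      also have "?c * e * (\<kappa> ^ ?N * V) = B * V * L * e" using \<kappa> by (simp add: field_simps)
      finally show ?thesis .
    qed
    finally have fin: "(\<integral>\<^sup>+x. ennreal \<bar>g x + Dq x\<bar> \<partial>lborel) \<le> ennreal (B * V * L * e)" .
    have ic: "integrable lborel (\<lambda>x. g x + Dq x)"
      using fin by (intro integrableI_bounded) (auto intro: le_less_trans)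
    have "ennreal (LBINT x. \<bar>g x + Dq x\<bar>) \<le> ennreal (B * V * L * e)"
      using fin nn_integral_eq_integral[OF integrable_abs[OF ic]] by simp
    then have ic': "(LBINT x. \<bar>g x + Dq x\<bar>) \<le> B * V * L * e"
      using B(1) V L(2) e by simp
    have i3: "integrable lborel (\<lambda>x. \<beta>' (?q x) * (g x + Dq x))"
      using integrable_bounded_mult[OF ic, of "\<lambda>x. \<beta>' (?q x)" 1] \<beta>(3) by simp
    have "(LBINT x. \<beta>' (?q x) * g x) = (LBINT x. \<beta>' (?q x) * (g x + Dq x) - \<beta>' (?q x) * Dq x)"
      by (intro Bochner_Integration.integral_cong) (auto simp: algebra_simps)
    also have "\<dots> = (LBINT x. \<beta>' (?q x) * (g x + Dq x))" using i3 Dqi by simp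
    also have "\<bar>\<dots>\<bar> \<le> (LBINT x. \<bar>\<beta>' (?q x) * (g x + Dq x)\<bar>)" by (rule integral_abs_bound)
    also have "\<dots> \<le> (LBINT x. \<bar>g x + Dq x\<bar>)"
    proof (rule integral_mono)
      show "\<bar>\<beta>' (?q x) * (g x + Dq x)\<bar> \<le> \<bar>g x + Dq x\<bar>" for x
        unfolding abs_mult using \<beta>(3) by (intro mult_left_le_one_le) auto
    qed (use integrable_abs[OF i3] integrable_abs[OF ic] in auto)
    also have "\<dots> \<le> B * (V + 1) * L * e"
    proof -
      have "0 \<le> B * (L * e)" by (rule mult_nonneg_nonneg[OF less_imp_le[OF B(1)] mult_nonneg_nonneg[OF L(2) e]])
      then show ?thesis using ic' by (simp add: algebra_simps)
    qed
    finally show "\<bar>\<integral>x. \<beta>' (?q x) * (- (LBINT y. q y * ?d (x - y) (u y))) \<partial>lborel\<bar> \<le> B * (V + 1) * L * e"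
      by (simp add: g_def)
  qed
qed

section \<open>Integration over space-time\<close>

lemma borel_fst[measurable]: "fst \<in> borel_measurable (borel :: ('a::topological_space \<times> 'b::topological_space) measure)"
  and borel_snd[measurable]: "snd \<in> borel_measurable (borel :: ('a \<times> 'b) measure)"
  by (intro borel_measurable_continuous_onI continuous_intros)+

lemma measurable_uncurry:
  fixes f :: "'s::second_countable_topology \<Rightarrow> 't::second_countable_topology \<Rightarrow> 'c::topological_space"
  assumes "case_prod f \<in> borel_measurable borel" "g \<in> borel_measurable M" "h \<in> borel_measurable M"
  shows "(\<lambda>x. f (g x) (h x)) \<in> borel_measurable M"
proof -
  have "(\<lambda>x. (g x, h x)) \<in> M \<rightarrow>\<^sub>M borel"
    unfolding borel_prod[symmetric] using assms(2,3) by measurable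
  from measurable_compose[OF this assms(1)] show ?thesis by simp
qed

lemma AE_prodI:
  fixes P :: "'a::euclidean_space \<times> 'b::euclidean_space \<Rightarrow> bool"
  assumes "Measurable.pred borel P" "AE t in lborel. AE x in lborel. P (t, x)"
  shows "AE z in lborel. P z"
proof -
  have "{x \<in> space (lborel \<Otimes>\<^sub>M lborel). P x} \<in> sets (lborel \<Otimes>\<^sub>M lborel)"
    using assms(1) unfolding pred_def lborel_prod by simp
  from lborel_pair.AE_pair_measure[OF this assms(2)] show ?thesis unfolding lborel_prod .
qed

lemma AE_prodD:
  fixes P :: "'a::euclidean_space \<times> 'b::euclidean_space \<Rightarrow> bool"
  assumes "AE z in lborel. P z"
  shows "AE t in lborel. AE x in lborel. P (t, x)"
  by (rule lborel_pair.AE_pair) (use assms in \<open>unfold lborel_prod\<close>)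

lemma integral_prod:
  fixes f :: "'a::euclidean_space \<times> 'b::euclidean_space \<Rightarrow> 'c::{banach, second_countable_topology}"
  assumes "integrable lborel f"
  shows "(LBINT z. f z) = (LBINT t. (LBINT x. f (t, x)))"
    and "(LBINT z. f z) = (LBINT x. (LBINT t. f (t, x)))"
    and "AE t in lborel. integrable lborel (\<lambda>x. f (t, x))"
    and "integrable lborel (\<lambda>t. LBINT x. f (t, x))"
proof -
  have f: "integrable (lborel \<Otimes>\<^sub>M lborel) f" using assms by (simp add: lborel_prod)
  show "(LBINT z. f z) = (LBINT t. (LBINT x. f (t, x)))"
    using lborel_pair.integral_fst'[OF f] by (simp add: lborel_prod)
  show "(LBINT z. f z) = (LBINT x. (LBINT t. f (t, x)))"
    using lborel_pair.integral_snd[of "\<lambda>t x. f (t, x)"] f by (simp add: lborel_prod)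
  show "AE t in lborel. integrable lborel (\<lambda>x. f (t, x))"
    by (rule lborel_pair.AE_integrable_fst'[OF f])
  show "integrable lborel (\<lambda>t. LBINT x. f (t, x))" by (rule lborel_pair.integrable_fst'[OF f])
qed

lemma integrable_prodI:
  fixes f :: "'a::euclidean_space \<times> 'b::euclidean_space \<Rightarrow> real"
  assumes [measurable]: "f \<in> borel_measurable borel" and pos: "\<And>z. 0 \<le> f z"
    and s: "AE t in lborel. integrable lborel (\<lambda>x. f (t, x)) \<and> (LBINT x. f (t, x)) \<le> g t"
    and g: "integrable lborel g"
  shows "integrable lborel f"
proof (rule integrableI_bounded)
  have fm: "(\<lambda>z. ennreal (norm (f z))) \<in> borel_measurable (lborel \<Otimes>\<^sub>M lborel)" unfolding lborel_prod by simp
  have "(\<integral>\<^sup>+z. ennreal (norm (f z)) \<partial>lborel) = (\<integral>\<^sup>+t. (\<integral>\<^sup>+x. ennreal (norm (f (t, x))) \<partial>lborel) \<partial>lborel)"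
    using lborel.nn_integral_fst[OF fm] by (simp add: lborel_prod)
  also have "\<dots> \<le> (\<integral>\<^sup>+t. ennreal (g t) \<partial>lborel)"
  proof (rule nn_integral_mono_AE, use s in eventually_elim)
    case (elim t)
    have "(\<integral>\<^sup>+x. ennreal (norm (f (t, x))) \<partial>lborel) = ennreal (LBINT x. f (t, x))"
      using elim pos by (subst nn_integral_eq_integral) auto
    then show ?case using elim by (simp add: ennreal_leI)
  qed
  also have "\<dots> < \<infinity>"
  proof -
    have "(\<integral>\<^sup>+t. ennreal (g t) \<partial>lborel) \<le> (\<integral>\<^sup>+t. ennreal (norm (g t)) \<partial>lborel)"
      by (intro nn_integral_mono ennreal_leI) simp
    then show ?thesis using g unfolding integrable_iff_bounded by (auto intro: le_less_trans)
  qed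
  finally show "(\<integral>\<^sup>+z. ennreal (norm (f z)) \<partial>lborel) < \<infinity>" .
qed simp

lemma test_fun_mult_snd:
  fixes \<phi> :: "'a::euclidean_space \<times> 'b::euclidean_space \<Rightarrow> real"
  assumes \<phi>: "test_fun (A \<times> UNIV) \<phi>" and \<zeta>: "test_fun B \<zeta>"
  shows "test_fun (A \<times> B) (\<lambda>z. \<phi> z * \<zeta> (snd z))"
    and "fderiv (\<lambda>z. \<phi> z * \<zeta> (snd z)) z h
      = \<phi> z * fderiv \<zeta> (snd z) (snd h) + fderiv \<phi> z h * \<zeta> (snd z)"
proof -
  obtain K where K: "compact K" "K \<subseteq> A \<times> UNIV" "\<And>x. x \<notin> K \<Longrightarrow> \<phi> x = 0" using \<phi> by (auto simp: test_fun_def)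
  obtain C where C: "compact C" "C \<subseteq> B" "\<And>x. x \<notin> C \<Longrightarrow> \<zeta> x = 0" using \<zeta> by (auto simp: test_fun_def)
  have "Ck_on k UNIV (\<lambda>z. \<phi> z * \<zeta> (0 + snd z))" for k
    by (intro Ck_on_mult Ck_on_affine test_fun_Ck[OF \<phi>] test_fun_Ck[OF \<zeta>] bounded_linear_snd)
  moreover have "compact (K \<inter> (UNIV \<times> C))"
    using K(1) C(1) by (intro compact_Int_closed closed_Times) (auto simp: compact_imp_closed)
  ultimately show "test_fun (A \<times> B) (\<lambda>z. \<phi> z * \<zeta> (snd z))"
    unfolding test_fun_def smooth_on_def using K C
    by (intro conjI exI[of _ "K \<inter> (UNIV \<times> C)"]) auto
  have "((\<lambda>z. \<zeta> (snd z)) has_derivative (\<lambda>h. fderiv \<zeta> (snd z) (snd h))) (at z)"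
    by (rule has_derivative_compose[OF has_derivative_snd[OF has_derivative_ident] test_fun_has_derivative[OF \<zeta>]])
  from has_derivative_mult[OF test_fun_has_derivative[OF \<phi>] this]
  show "fderiv (\<lambda>z. \<phi> z * \<zeta> (snd z)) z h
      = \<phi> z * fderiv \<zeta> (snd z) (snd h) + fderiv \<phi> z h * \<zeta> (snd z)"
    by (simp flip: frechet_derivative_at)
qed

lemma test_fun_tensor:
  fixes \<theta> :: "'a::euclidean_space \<Rightarrow> real" and \<psi> :: "'b::euclidean_space \<Rightarrow> real"
  assumes \<theta>: "test_fun A \<theta>" and \<psi>: "test_fun B \<psi>"
  shows "test_fun (A \<times> B) (\<lambda>z. \<theta> (fst z) * \<psi> (snd z))"
    and "fderiv (\<lambda>z. \<theta> (fst z) * \<psi> (snd z)) z h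
      = \<theta> (fst z) * fderiv \<psi> (snd z) (snd h) + fderiv \<theta> (fst z) (fst h) * \<psi> (snd z)"
proof -
  obtain K where K: "compact K" "K \<subseteq> A" "\<And>x. x \<notin> K \<Longrightarrow> \<theta> x = 0" using \<theta> by (auto simp: test_fun_def)
  obtain C where C: "compact C" "C \<subseteq> B" "\<And>x. x \<notin> C \<Longrightarrow> \<psi> x = 0" using \<psi> by (auto simp: test_fun_def)
  have "Ck_on k UNIV (\<lambda>z. \<theta> (0 + fst z) * \<psi> (0 + snd z))" for k
    by (intro Ck_on_mult Ck_on_affine test_fun_Ck[OF \<theta>] test_fun_Ck[OF \<psi>] bounded_linear_snd bounded_linear_fst)
  then show "test_fun (A \<times> B) (\<lambda>z. \<theta> (fst z) * \<psi> (snd z))"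
    unfolding test_fun_def smooth_on_def using K C compact_Times[OF K(1) C(1)]
    by (intro conjI exI[of _ "K \<times> C"]) auto
  have "((\<lambda>z. \<theta> (fst z)) has_derivative (\<lambda>h. fderiv \<theta> (fst z) (fst h))) (at z)"
    by (rule has_derivative_compose[OF has_derivative_fst[OF has_derivative_ident] test_fun_has_derivative[OF \<theta>]])
  moreover have "((\<lambda>z. \<psi> (snd z)) has_derivative (\<lambda>h. fderiv \<psi> (snd z) (snd h))) (at z)"
    by (rule has_derivative_compose[OF has_derivative_snd[OF has_derivative_ident] test_fun_has_derivative[OF \<psi>]])
  ultimately have "((\<lambda>z. \<theta> (fst z) * \<psi> (snd z)) has_derivative
      (\<lambda>h. \<theta> (fst z) * fderiv \<psi> (snd z) (snd h) + fderiv \<theta> (fst z) (fst h) * \<psi> (snd z))) (at z)"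
    by (rule has_derivative_mult)
  then show "fderiv (\<lambda>z. \<theta> (fst z) * \<psi> (snd z)) z h
      = \<theta> (fst z) * fderiv \<psi> (snd z) (snd h) + fderiv \<theta> (fst z) (fst h) * \<psi> (snd z)"
    by (simp flip: frechet_derivative_at)
qed

lemma test_fun_time_support:
  fixes \<phi> :: "real \<times> 'b::euclidean_space \<Rightarrow> real"
  assumes "test_fun ({0<..} \<times> B) \<phi>"
  shows "\<exists>T. \<forall>z. (fst z \<notin> {0..T} \<longrightarrow> \<phi> z = 0 \<and> (\<forall>h. fderiv \<phi> z h = 0))"
proof -
  obtain K where K: "compact K" "K \<subseteq> {0<..} \<times> B" "\<And>x. x \<notin> K \<Longrightarrow> \<phi> x = 0" using assms by (auto simp: test_fun_def)
  have "compact (fst ` K)" by (intro compact_continuous_image K continuous_intros)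
  then obtain T where T: "\<And>t. t \<in> fst ` K \<Longrightarrow> \<bar>t\<bar> \<le> T" using compact_imp_bounded bounded_iff by (metis real_norm_def)
  have "\<phi> z = 0 \<and> (\<forall>h. fderiv \<phi> z h = 0)" if "fst z \<notin> {0..T}" for z
  proof -
    have "z \<notin> K" using that K(2) T[of "fst z"] by force
    then show ?thesis
      using K(3)[OF \<open>z \<notin> K\<close>] frechet_derivative_outside_support(2)[OF compact_imp_closed[OF K(1)] K(3) \<open>z \<notin> K\<close>]
      by simp
  qed
  then show ?thesis by blast
qed

section \<open>Transport by a Lipschitz velocity field\<close>

text \<open>The velocity is extended by zero. At almost every time it is Lipschitz with a constant \<open>L t\<close> that is
  integrable over bounded time intervals. The third condition on \<open>\<Omega>\<close> is all that remains of the
  smoothness of the boundary.\<close>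

locale lipschitz_flow =
  fixes \<Omega> :: "(real^'n) set" and w :: "real \<Rightarrow> real^'n \<Rightarrow> real^'n" and D :: "real \<Rightarrow> real^'n \<Rightarrow> real^'n^'n"
    and L :: "real \<Rightarrow> real" and V :: real
  assumes dom: "open \<Omega>" "bounded \<Omega>" "- \<Omega> \<subseteq> closure (interior (- \<Omega>))"
    and w_borel: "case_prod w \<in> borel_measurable borel"
    and w_zero: "\<And>t x. x \<notin> \<Omega> \<Longrightarrow> w t x = 0"
    and w_h10: "AE t in lborel. 0 < t \<longrightarrow> h10 \<Omega> (w t) (D t)"
    and w_div: "AE t in lborel. 0 < t \<longrightarrow> (AE x in lborel. trace (D t x) = 0)"
    and D_bound: "AE t in lborel. 0 < t \<longrightarrow> (AE x in lborel. norm (D t x) \<le> L t)"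
    and L_nonneg: "\<And>t. 0 \<le> L t"
    and L_integrable: "\<And>T. integrable lborel (\<lambda>t. indicator {0..T} t * L t)"
    and L_borel[measurable]: "L \<in> borel_measurable borel"
    and w_bound: "0 \<le> V" "AE t in lborel. 0 < t \<longrightarrow> (LBINT x. (norm (w t x))\<^sup>2) \<le> V"
begin

lemmas w_measurable[measurable (raw)] = measurable_uncurry[OF w_borel]

definition majorant :: "real \<Rightarrow> real \<times> (real^'n) \<Rightarrow> real" where
  "majorant T z = indicator {0..T} (fst z) * (indicator \<Omega> (snd z) * (1 + L (fst z)) + (norm (w (fst z) (snd z)))\<^sup>2)"

lemma \<Omega>_borel[measurable]: "\<Omega> \<in> sets borel" using dom by simp

lemma \<Omega>_integrable: "integrable lborel (indicator \<Omega> :: real^'n \<Rightarrow> real)"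
  using emeasure_bounded_finite[OF dom(2)] by (intro integrable_real_indicator) auto

lemma AE_pos: "AE t in lborel. (t::real) \<noteq> 0"
  using AE_lborel_singleton[of "0::real"] by simp

lemma majorant_integrable: "integrable lborel (majorant T)"
proof (rule integrable_prodI)
  show "majorant T \<in> borel_measurable borel" unfolding majorant_def[abs_def] by measurable
  show "0 \<le> majorant T z" for z using L_nonneg by (simp add: majorant_def)
  define m where "m = (\<integral>x. indicator \<Omega> x \<partial>(lborel :: (real^'n) measure) :: real)"
  define g where "g t = indicator {0..T} t * (m + V) + m * (indicator {0..T} t * L t)" for t
  have "integrable lborel (indicator {0..T} :: real \<Rightarrow> real)"
    using emeasure_compact_finite[OF compact_Icc, of 0 T] by (intro integrable_real_indicator) auto
  then show "integrable lborel g" unfolding g_def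
    by (intro Bochner_Integration.integrable_add integrable_mult_left integrable_mult_right L_integrable)
  show "AE t in lborel. integrable lborel (\<lambda>x. majorant T (t, x)) \<and> (LBINT x. majorant T (t, x)) \<le> g t"
    using w_h10 w_bound(2) AE_pos
  proof eventually_elim
    case (elim t)
    show ?case
    proof (cases "0 < t \<and> t \<le> T")
      case True
      then have i: "integrable lborel (\<lambda>x. (norm (w t x))\<^sup>2)" "(LBINT x. (norm (w t x))\<^sup>2) \<le> V"
        using elim by (auto simp: h10_def)
      have e: "majorant T (t, x) = indicator \<Omega> x * (1 + L t) + (norm (w t x))\<^sup>2" for x
        using True by (simp add: majorant_def)
      show ?thesis using i \<Omega>_integrable True by (simp add: e g_def m_def algebra_simps)
    next
      case False
      then have "majorant T (t, x) = 0" for x using elim by (auto simp: majorant_def indicator_def)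
      moreover have "g t = 0" using False elim by (auto simp: g_def indicator_def)
      ultimately show ?thesis by simp
    qed
  qed
qed

lemma norm_1_w: "norm (1::real, w t x) \<le> 2 + (norm (w t x))\<^sup>2"
proof -
  have "norm (1::real, w t x) \<le> norm (1::real) + norm (w t x)" by (rule norm_Pair_le)
  moreover have "norm (w t x) \<le> 1 + (norm (w t x))\<^sup>2"
  proof -
    have "0 \<le> (norm (w t x) - 1)\<^sup>2" by simp
    then have "2 * norm (w t x) \<le> 1 + (norm (w t x))\<^sup>2" by (simp add: power2_diff)
    then show ?thesis using norm_ge_zero[of "w t x"] by linarith
  qed
  ultimately show ?thesis by simp
qed

lemma w_decay: "AE z in lborel. 0 < fst z \<longrightarrow> norm (w (fst z) (snd z)) \<le> L (fst z) * infdist (snd z) (- \<Omega>)"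
proof (rule AE_prodI)
  have [measurable]: "(\<lambda>x. infdist x (- \<Omega>)) \<in> borel_measurable borel"
    by (intro borel_measurable_continuous_onI continuous_intros)
  show "Measurable.pred borel (\<lambda>z. 0 < fst z \<longrightarrow> norm (w (fst z) (snd z)) \<le> L (fst z) * infdist (snd z) (- \<Omega>))"
    by measurable
  show "AE t in lborel. AE x in lborel. 0 < fst (t, x) \<longrightarrow> norm (w (fst (t, x)) (snd (t, x))) \<le> L (fst (t, x)) * infdist (snd (t, x)) (- \<Omega>)"
    using w_h10 D_bound
  proof eventually_elim
    case (elim t)
    show ?case
    proof (cases "0 < t")
      case True
      then have "AE x in lborel. norm (w t x) \<le> L t * infdist x (- \<Omega>)"
        using elim L_nonneg dom by (intro h10_boundary_decay[of \<Omega> "w t" "D t"]) auto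
      then show ?thesis by (auto elim!: eventually_mono)
    qed simp
  qed
qed

text \<open>The cutoff has a slope of order \<open>1 / \<kappa>\<close>, but only within distance \<open>4 \<kappa>\<close> from the complement,
  where the speed is at most
  \<open>4 \<kappa> L\<close>.\<close>

lemma cutoff_flow_bound:
  "\<exists>C>0. AE z in lborel. \<forall>\<kappa>>0. 0 < fst z \<longrightarrow>
     \<bar>fderiv (cutoff \<Omega> \<kappa>) (snd z) (w (fst z) (snd z))\<bar> \<le> C * L (fst z)"
proof -
  obtain C where C: "0 < C" "\<And>\<kappa> x h. 0 < \<kappa> \<Longrightarrow> \<bar>fderiv (cutoff \<Omega> \<kappa>) x h\<bar> * infdist x (- \<Omega>) \<le> C * norm h"
    using cutoff_deriv_bound[OF dom(1,2)] by blast
  have "AE z in lborel. \<forall>\<kappa>>0. 0 < fst z \<longrightarrow>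
     \<bar>fderiv (cutoff \<Omega> \<kappa>) (snd z) (w (fst z) (snd z))\<bar> \<le> C * L (fst z)"
    using w_decay
  proof eventually_elim
    case (elim z)
    show ?case
    proof (intro allI impI)
      fix \<kappa> :: real assume \<kappa>: "0 < \<kappa>" and t: "0 < fst z"
      let ?d = "infdist (snd z) (- \<Omega>)" and ?D = "fderiv (cutoff \<Omega> \<kappa>) (snd z) (w (fst z) (snd z))"
      show "\<bar>?D\<bar> \<le> C * L (fst z)"
      proof (cases "snd z \<in> \<Omega>")
        case True
        then have d: "0 < ?d" by (rule infdist_complement_pos[OF dom(1,2)])
        have "\<bar>?D\<bar> * ?d \<le> C * norm (w (fst z) (snd z))" by (rule C(2)[OF \<kappa>])
        also have "\<dots> \<le> C * (L (fst z) * ?d)" using elim t C(1) by (intro mult_left_mono) auto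
        finally have "\<bar>?D\<bar> * ?d \<le> (C * L (fst z)) * ?d" by simp
        then show ?thesis using d by simp
      next
        case False
        have "linear (fderiv (cutoff \<Omega> \<kappa>) (snd z))"
          by (rule has_derivative_linear[OF test_fun_has_derivative[OF test_fun_cutoff[OF dom(1,2) \<kappa>]]])
        then show ?thesis using False w_zero C(1) L_nonneg by (simp add: linear_0)
      qed
    qed
  qed
  then show ?thesis using C(1) by blast
qed

end

text \<open>A bounded solution of the mass equation in the sense of distributions. Its sign and its precise
  bounds are inherited from the initial density.\<close>

locale transported = lipschitz_flow \<Omega> w D L V
  for \<Omega> :: "(real^'n) set" and w D L V +
  fixes r :: "real \<Rightarrow> real^'n \<Rightarrow> real" and M :: real
  assumes r_borel: "case_prod r \<in> borel_measurable borel"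
    and r_bound: "\<And>t x. \<bar>r t x\<bar> \<le> M"
    and r_zero: "\<And>t x. x \<notin> \<Omega> \<Longrightarrow> r t x = 0"
    and mass: "\<And>\<phi>. test_fun ({0<..} \<times> \<Omega>) \<phi> \<Longrightarrow>
      (LBINT z. r (fst z) (snd z) * fderiv \<phi> z (1, w (fst z) (snd z))) = 0"
begin

lemmas r_measurable[measurable (raw)] = measurable_uncurry[OF r_borel]

lemma M_nonneg: "0 \<le> M" using r_bound[of 0 0] by simp

text \<open>Bounds of this form give integrability over bounded time intervals.\<close>

lemma majorised_integrable:
  fixes f :: "real \<times> (real^'n) \<Rightarrow> real"
  assumes "f \<in> borel_measurable borel" "AE z in lborel. \<bar>f z\<bar> \<le> C * majorant T z"
  shows "integrable lborel f"
proof (rule Bochner_Integration.integrable_bound)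
  show "integrable lborel (\<lambda>z. C * majorant T z)" using majorant_integrable by simp
  show "AE z in lborel. norm (f z) \<le> norm (C * majorant T z)" using assms(2) by eventually_elim auto
qed (use assms in simp)

lemma flux_bound:
  assumes T: "\<And>z. fst z \<notin> {0..T} \<Longrightarrow> F z = 0" and B: "0 \<le> B" "\<And>z. \<bar>F z\<bar> \<le> B * norm (1::real, w (fst z) (snd z))"
  shows "\<bar>r (fst z) (snd z) * F z\<bar> \<le> (2 * M * B) * majorant T z"
proof (cases "fst z \<in> {0..T} \<and> snd z \<in> \<Omega>")
  case True
  have "\<bar>r (fst z) (snd z) * F z\<bar> \<le> M * (B * (2 + (norm (w (fst z) (snd z)))\<^sup>2))"
    unfolding abs_mult using r_bound M_nonneg B(1) order_trans[OF B(2)[of z] mult_left_mono[OF norm_1_w B(1)]]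
    by (intro mult_mono) auto
  also have "\<dots> \<le> M * (B * (2 * (1 + L (fst z) + (norm (w (fst z) (snd z)))\<^sup>2)))"
    using M_nonneg B(1) L_nonneg[of "fst z"] by (intro mult_left_mono) auto
  finally show ?thesis using True by (simp add: majorant_def mult_ac)
next
  case False
  moreover have "0 \<le> majorant T z" using L_nonneg by (simp add: majorant_def)
  ultimately show ?thesis using T[of z] r_zero[of "snd z"] M_nonneg B(1) by auto
qed

lemma flux_integrable:
  assumes \<phi>: "test_fun ({0<..} \<times> UNIV) \<phi>"
  shows "integrable lborel (\<lambda>z. r (fst z) (snd z) * fderiv \<phi> z (1, w (fst z) (snd z)))"
proof -
  obtain T where T: "\<And>z. fst z \<notin> {0..T} \<Longrightarrow> \<phi> z = 0 \<and> (\<forall>h. fderiv \<phi> z h = 0)"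
    using test_fun_time_support[OF \<phi>] by blast
  obtain B where B: "0 < B" "\<And>z h. \<bar>fderiv \<phi> z h\<bar> \<le> B * norm h"
    using test_fun_deriv_bounded[OF \<phi>] by blast
  note [measurable] = test_fun_deriv_measurable[OF \<phi>]
  show ?thesis
    by (rule majorised_integrable[of _ "2 * M * B" T], measurable)
      (intro AE_I2 flux_bound, use T B in auto)
qed

text \<open>The mass equation holds up to the boundary, hence on the whole space for the zero extensions.\<close>

lemma mass_whole:
  assumes \<phi>: "test_fun ({0<..} \<times> UNIV) \<phi>"
  shows "(LBINT z. r (fst z) (snd z) * fderiv \<phi> z (1, w (fst z) (snd z))) = 0"
proof -
  obtain T where T: "\<And>z. fst z \<notin> {0..T} \<Longrightarrow> \<phi> z = 0 \<and> (\<forall>h. fderiv \<phi> z h = 0)"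
    using test_fun_time_support[OF \<phi>] by blast
  obtain B where B: "0 < B" "\<And>z h. \<bar>fderiv \<phi> z h\<bar> \<le> B * norm h"
    using test_fun_deriv_bounded[OF \<phi>] by blast
  obtain A where A: "0 < A" "\<And>z. \<bar>\<phi> z\<bar> \<le> A" using test_fun_bounded[OF \<phi>] by auto
  obtain C where C: "0 < C" "AE z in lborel. \<forall>\<kappa>>0. 0 < fst z \<longrightarrow>
     \<bar>fderiv (cutoff \<Omega> \<kappa>) (snd z) (w (fst z) (snd z))\<bar> \<le> C * L (fst z)"
    using cutoff_flow_bound by blast
  define \<kappa> where "\<kappa> k = inverse (real (Suc k))" for k
  have \<kappa>: "0 < \<kappa> k" for k by (simp add: \<kappa>_def)
  let ?\<zeta> = "\<lambda>k. cutoff \<Omega> (\<kappa> k)"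
  note t\<zeta> = test_fun_cutoff[OF dom(1,2) \<kappa>]
  let ?w = "\<lambda>z. w (fst z) (snd z)" and ?r = "\<lambda>z. r (fst z) (snd z)"
  define F where "F k z = ?r z * (\<phi> z * fderiv (?\<zeta> k) (snd z) (?w z)
      + fderiv \<phi> z (1, ?w z) * ?\<zeta> k (snd z))" for k z
  have F0: "(LBINT z. F k z) = 0" for k
    using mass[OF test_fun_mult_snd(1)[OF \<phi> t\<zeta>]] by (simp add: F_def test_fun_mult_snd(2)[OF \<phi> t\<zeta>])
  note [measurable] = test_fun_deriv_measurable[OF \<phi>] test_fun_deriv_measurable[OF t\<zeta>]
    test_fun_measurable[OF \<phi>] test_fun_measurable[OF t\<zeta>]
  have "(\<lambda>k. LBINT z. F k z) \<longlonglongrightarrow> (LBINT z. ?r z * fderiv \<phi> z (1, ?w z))"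
  proof (rule integral_dominated_convergence)
    show "integrable lborel (\<lambda>z. (M * A * C + 2 * M * B) * majorant T z)" using majorant_integrable by simp
    show "AE z in lborel. (\<lambda>k. F k z) \<longlonglongrightarrow> ?r z * fderiv \<phi> z (1, ?w z)"
    proof (intro AE_I2)
      fix z
      show "(\<lambda>k. F k z) \<longlonglongrightarrow> ?r z * fderiv \<phi> z (1, ?w z)"
      proof (cases "snd z \<in> \<Omega>")
        case True
        have "\<forall>\<^sub>F k in sequentially. ?r z * fderiv \<phi> z (1, ?w z) = F k z"
          using cutoff_eventually[OF dom(1,2) True] by eventually_elim (simp add: F_def \<kappa>_def)
        then show ?thesis by (rule Lim_transform_eventually[OF tendsto_const])
      qed (simp add: F_def r_zero)
    qed
    show "AE z in lborel. norm (F k z) \<le> (M * A * C + 2 * M * B) * majorant T z" for k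
      using C(2)
    proof eventually_elim
      case (elim z)
      have m0: "0 \<le> majorant T z" using L_nonneg by (simp add: majorant_def)
      show ?case
      proof (cases "fst z \<in> {0..T} \<and> snd z \<in> \<Omega> \<and> 0 < fst z")
        case True
        have "\<bar>?r z * (\<phi> z * fderiv (?\<zeta> k) (snd z) (?w z))\<bar> \<le> M * (A * (C * L (fst z)))"
          unfolding abs_mult using r_bound M_nonneg A elim \<kappa>[of k] True by (intro mult_mono) auto
        also have "\<dots> \<le> M * (A * (C * majorant T z))"
          using M_nonneg A(1) C(1) True by (intro mult_left_mono) (auto simp: majorant_def)
        finally have 1: "\<bar>?r z * (\<phi> z * fderiv (?\<zeta> k) (snd z) (?w z))\<bar> \<le> (M * A * C) * majorant T z"
          by (simp add: mult_ac)
        have 2: "\<bar>?r z * (fderiv \<phi> z (1, ?w z) * ?\<zeta> k (snd z))\<bar> \<le> (2 * M * B) * majorant T z"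
        proof (rule flux_bound)
          show "\<bar>fderiv \<phi> z (1, ?w z) * ?\<zeta> k (snd z)\<bar> \<le> B * norm (1::real, ?w z)" for z
          proof -
            have "\<bar>fderiv \<phi> z (1, ?w z)\<bar> * \<bar>?\<zeta> k (snd z)\<bar> \<le> (B * norm (1::real, ?w z)) * 1"
              using B cutoff_bounds(1,2)[OF dom(1,2) \<kappa>] by (intro mult_mono) auto
            then show ?thesis by (simp add: abs_mult)
          qed
        qed (use T B(1) in auto)
        have "norm (F k z) \<le> \<bar>?r z * (\<phi> z * fderiv (?\<zeta> k) (snd z) (?w z))\<bar>
          + \<bar>?r z * (fderiv \<phi> z (1, ?w z) * ?\<zeta> k (snd z))\<bar>"
          unfolding F_def real_norm_def distrib_left by (rule abs_triangle_ineq)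
        then show ?thesis using 1 2 by (simp add: distrib_right)
      next
        case False
        have "\<phi> z = 0 \<and> (\<forall>h. fderiv \<phi> z h = 0) \<or> ?r z = 0"
        proof (cases "fst z \<in> {0..T} \<and> snd z \<in> \<Omega>")
          case True
          then have "\<phi> z = 0" using False test_fun_support[OF \<phi>, of z] by (auto simp: mem_Times_iff)
          have "fst z = 0" using True False by auto
          then have "z \<notin> {0<..} \<times> UNIV" by (auto simp: mem_Times_iff)
          then show ?thesis using test_fun_support[OF test_fun_deriv[OF \<phi>], of z] test_fun_support[OF \<phi>, of z] by blast
        next
          case False then show ?thesis using T[of z] r_zero by blast
        qed
        then have "F k z = 0" by (auto simp: F_def)
        then show ?thesis using m0 M_nonneg A(1) B(1) C(1) by simp
      qed
    qed
    show "F k \<in> borel_measurable lborel" for k unfolding F_def by measurable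
  qed measurable
  then show ?thesis using LIMSEQ_unique[OF _ tendsto_const] by (simp add: F0)
qed

end

section \<open>Renormalization\<close>

lemma unit_Lipschitz:
  fixes \<beta> \<beta>' :: "real \<Rightarrow> real"
  assumes "\<And>x. (\<beta> has_real_derivative \<beta>' x) (at x)" "\<And>x. \<bar>\<beta>' x\<bar> \<le> 1"
  shows "\<bar>\<beta> a - \<beta> b\<bar> \<le> \<bar>a - b\<bar>"
  using field_differentiable_bound[of UNIV \<beta> \<beta>' 1 a b] assms by auto

lemma test_fun_real_support:
  assumes "test_fun {0<..} (\<theta> :: real \<Rightarrow> real)"
  shows "\<exists>T. \<forall>\<tau>. \<tau> \<notin> {0..T} \<longrightarrow> \<theta> \<tau> = 0 \<and> (\<forall>h. fderiv \<theta> \<tau> h = 0)"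
proof -
  obtain K where K: "compact K" "K \<subseteq> {0<..}" "\<And>x. x \<notin> K \<Longrightarrow> \<theta> x = 0" using assms by (auto simp: test_fun_def)
  obtain T where T: "\<And>t. t \<in> K \<Longrightarrow> \<bar>t\<bar> \<le> T" using compact_imp_bounded[OF K(1)] bounded_iff by (metis real_norm_def)
  have "\<theta> \<tau> = 0 \<and> (\<forall>h. fderiv \<theta> \<tau> h = 0)" if "\<tau> \<notin> {0..T}" for \<tau>
  proof -
    have n: "\<tau> \<notin> K" using that K(2) T[of \<tau>] by force
    show ?thesis
      using K(3)[OF n] frechet_derivative_outside_support(2)[OF compact_imp_closed[OF K(1)] K(3) n] by simp
  qed
  then show ?thesis by blast
qed

text \<open>\<open>R\<close> is the version of the density that is continuous in time with values in \<open>L\<^sub>1\<close>. It is defined at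
  every time and carries the initial value, but it need not be jointly measurable, in contrast to
  \<open>r\<close>.\<close>

locale continuous_density = transported \<Omega> w D L V r M
  for \<Omega> :: "(real^'n) set" and w D L V r M +
  fixes R :: "real \<Rightarrow> real^'n \<Rightarrow> real"
  assumes R_integrable: "\<And>t. 0 \<le> t \<Longrightarrow> integrable lborel (R t)"
    and R_continuous: "\<And>t. 0 \<le> t \<Longrightarrow> ((\<lambda>s. LBINT x. \<bar>R s x - R t x\<bar>) \<longlongrightarrow> 0) (at t within {0..})"
    and R_r: "AE t in lborel. 0 < t \<longrightarrow> (AE x in lborel. R t x = r t x)"
begin

text \<open>This is \<open>- div (r w)\<close> mollified in space, with the derivative moved to the mollifier.\<close>

definition flux :: "real \<Rightarrow> real \<Rightarrow> real^'n \<Rightarrow> real" where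
  "flux \<kappa> \<tau> x = - (LBINT y. r \<tau> y * fderiv (mollifier \<kappa>) (x - y) (w \<tau> y))"

definition vol :: real where "vol = (\<integral>x. indicator \<Omega> x \<partial>(lborel :: (real^'n) measure))"

lemma vol_nonneg: "0 \<le> vol" by (simp add: vol_def)

lemma r_integrable: "integrable lborel (r t)" "(LBINT x. \<bar>r t x\<bar>) \<le> M * vol"
proof -
  have b: "\<bar>r t x\<bar> \<le> M * indicator \<Omega> x" for x using r_bound[of t x] r_zero[of x t] by (auto simp: indicator_def)
  have i: "integrable lborel (\<lambda>x. M * indicator \<Omega> x)" using \<Omega>_integrable by simp
  show r: "integrable lborel (r t)"
    by (rule Bochner_Integration.integrable_bound[OF i]) (use b M_nonneg in \<open>auto simp: abs_mult\<close>)
  have "(LBINT x. \<bar>r t x\<bar>) \<le> (LBINT x. M * indicator \<Omega> x)"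
    using b r i by (intro integral_mono) auto
  then show "(LBINT x. \<bar>r t x\<bar>) \<le> M * vol" by (simp add: vol_def)
qed

lemma norm_w_le: "norm (w t x) \<le> indicator \<Omega> x + (norm (w t x))\<^sup>2"
proof (cases "x \<in> \<Omega>")
  case True
  have "0 \<le> (norm (w t x) - 1)\<^sup>2" by simp
  then have "2 * norm (w t x) \<le> 1 + (norm (w t x))\<^sup>2" by (simp add: power2_diff)
  then have "norm (w t x) \<le> 1 + (norm (w t x))\<^sup>2" using norm_ge_zero[of "w t x"] by linarith
  then show ?thesis using True by simp
qed (simp add: w_zero)

lemma w_L1: "AE t in lborel. 0 < t \<longrightarrow> integrable lborel (w t) \<and> (LBINT x. norm (w t x)) \<le> vol + V"
  using w_h10 w_bound(2)
proof eventually_elim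
  case (elim t)
  show ?case
  proof
    assume t: "0 < t"
    then have h: "h10 \<Omega> (w t) (D t)" and b: "(LBINT x. (norm (w t x))\<^sup>2) \<le> V" using elim by auto
    have i: "integrable lborel (w t)" by (rule h10_integrable(1)[OF h dom(2)])
    have i2: "integrable lborel (\<lambda>x. (norm (w t x))\<^sup>2)" using h by (simp add: h10_def)
    have "(LBINT x. norm (w t x)) \<le> (LBINT x. indicator \<Omega> x + (norm (w t x))\<^sup>2)"
      using i i2 \<Omega>_integrable norm_w_le by (intro integral_mono) auto
    also have "\<dots> \<le> vol + V" using i2 \<Omega>_integrable b by (simp add: vol_def)
    finally show "integrable lborel (w t) \<and> (LBINT x. norm (w t x)) \<le> vol + V" using i by simp
  qed
qed

context
  fixes \<kappa> :: real
  assumes \<kappa>: "0 < \<kappa>"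
begin

lemmas m = test_fun_mollifier[OF \<kappa>, where 'a = "real^'n"]
lemmas [measurable] = test_fun_deriv_measurable[OF m] test_fun_measurable[OF m]

lemma flux_borel: "case_prod (flux \<kappa>) \<in> borel_measurable borel"
proof -
  have "(\<lambda>z. - (LBINT y. r (fst z) y * fderiv (mollifier \<kappa>) (snd z - y) (w (fst z) y))) \<in> borel_measurable borel"
    by measurable
  then show ?thesis by (simp add: flux_def[abs_def] case_prod_beta')
qed

lemmas flux_measurable[measurable (raw)] = measurable_uncurry[OF flux_borel]

lemma conv_r_borel: "case_prod (\<lambda>\<tau> x. conv (mollifier \<kappa>) (r \<tau>) x) \<in> borel_measurable borel"
proof -
  have "(\<lambda>z. (LBINT y. mollifier \<kappa> (snd z - y) *\<^sub>R r (fst z) y)) \<in> borel_measurable borel"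
    by measurable
  then show ?thesis by (simp add: conv_def[abs_def] case_prod_beta')
qed

lemmas conv_r_measurable[measurable (raw)] = measurable_uncurry[OF conv_r_borel]

lemma flux_bounded: "\<exists>G\<ge>0. AE \<tau> in lborel. 0 < \<tau> \<longrightarrow> (\<forall>x. \<bar>flux \<kappa> \<tau> x\<bar> \<le> G)"
proof -
  obtain B where B: "0 < B" "\<And>(z::real^'n) h. \<bar>fderiv (mollifier \<kappa>) z h\<bar> \<le> B * norm h"
    using test_fun_deriv_bounded[OF m] by blast
  have "AE \<tau> in lborel. 0 < \<tau> \<longrightarrow> (\<forall>x. \<bar>flux \<kappa> \<tau> x\<bar> \<le> M * B * (vol + V))"
    using w_L1
  proof eventually_elim
    case (elim \<tau>)
    show ?case
    proof (intro impI allI)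
      fix x assume t: "0 < \<tau>"
      then have i: "integrable lborel (w \<tau>)" "(LBINT x. norm (w \<tau> x)) \<le> vol + V" using elim by auto
      have b: "\<bar>r \<tau> y * fderiv (mollifier \<kappa>) (x - y) (w \<tau> y)\<bar> \<le> M * B * norm (w \<tau> y)" for y
        unfolding abs_mult mult.assoc using r_bound M_nonneg B(2) by (intro mult_mono) auto
      have "\<bar>flux \<kappa> \<tau> x\<bar> \<le> (LBINT y. \<bar>r \<tau> y * fderiv (mollifier \<kappa>) (x - y) (w \<tau> y)\<bar>)"
        unfolding flux_def abs_minus_cancel by (rule integral_abs_bound)
      also have "\<dots> \<le> (LBINT y. M * B * norm (w \<tau> y))"
      proof (rule integral_mono_AE')
        show "integrable lborel (\<lambda>y. M * B * norm (w \<tau> y))" using i by simp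
      qed (use b M_nonneg B(1) in auto)
      also have "\<dots> \<le> M * B * (vol + V)" using i M_nonneg B(1) by (simp add: mult_left_mono)
      finally show "\<bar>flux \<kappa> \<tau> x\<bar> \<le> M * B * (vol + V)" .
    qed
  qed
  moreover have "0 \<le> M * B * (vol + V)" using M_nonneg B(1) vol_nonneg w_bound(1) by simp
  ultimately show ?thesis by blast
qed

lemma flux_support:
  assumes "\<And>y. y \<in> \<Omega> \<Longrightarrow> \<kappa> < norm (x - y)"
  shows "flux \<kappa> \<tau> x = 0"
proof -
  have "r \<tau> y * fderiv (mollifier \<kappa>) (x - y) (w \<tau> y) = 0" for y
    using mollifier_deriv_eq_0[OF \<kappa>, of "x - y"] r_zero[of y \<tau>] assms[of y] by (cases "y \<in> \<Omega>") auto
  then show ?thesis unfolding flux_def by (simp only:) simp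
qed

lemma conv_R_continuous:
  assumes t: "0 \<le> t"
  shows "((\<lambda>s. conv (mollifier \<kappa>) (R s) x) \<longlongrightarrow> conv (mollifier \<kappa>) (R t) x) (at t within {0..})"
proof -
  obtain B where B: "0 < B" "\<And>z::real^'n. norm (mollifier \<kappa> z) \<le> B" using test_fun_bounded[OF m] by blast
  have "((\<lambda>s. conv (mollifier \<kappa>) (R s) x - conv (mollifier \<kappa>) (R t) x) \<longlongrightarrow> 0) (at t within {0..})"
  proof (rule Lim_null_comparison)
    show "((\<lambda>s. B * (LBINT x. \<bar>R s x - R t x\<bar>)) \<longlongrightarrow> 0) (at t within {0..})"
      by (rule tendsto_mult_right_zero[OF R_continuous[OF t]])
    have "norm (conv (mollifier \<kappa>) (R s) x - conv (mollifier \<kappa>) (R t) x) \<le> B * (LBINT x. \<bar>R s x - R t x\<bar>)"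
      if s: "0 \<le> s" for s
    proof -
      have i: "integrable lborel (\<lambda>x. R s x - R t x)" using R_integrable s t by simp
      have "conv (mollifier \<kappa>) (R s) x - conv (mollifier \<kappa>) (R t) x = conv (mollifier \<kappa>) (\<lambda>x. R s x - R t x) x"
        by (rule conv_diff[OF m R_integrable[OF s] R_integrable[OF t], symmetric])
      also have "norm \<dots> \<le> (LBINT y. norm (mollifier \<kappa> (x - y) *\<^sub>R (R s y - R t y)))"
        unfolding conv_def by (rule integral_norm_bound)
      also have "\<dots> \<le> (LBINT y. B * \<bar>R s y - R t y\<bar>)"
        using conv_integrable[OF m i, of x] i B(2)
        by (intro integral_mono integrable_norm) (auto simp: abs_mult intro!: mult_right_mono)
      finally show ?thesis by simp
    qed
    then show "\<forall>\<^sub>F s in at t within {0..}. norm (conv (mollifier \<kappa>) (R s) x - conv (mollifier \<kappa>) (R t) x)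
        \<le> B * (LBINT x. \<bar>R s x - R t x\<bar>)"
      by (auto simp: eventually_at_filter)
  qed
  then show ?thesis by (simp add: LIM_zero_iff)
qed

text \<open>The mollified density at a fixed point, as a function of time. It is built from \<open>R\<close>, so that its
  values at given times have a meaning.\<close>

definition trace_at :: "real^'n \<Rightarrow> real \<Rightarrow> real" where
  "trace_at x \<tau> = indicator {0<..} \<tau> *\<^sub>R conv (mollifier \<kappa>) (R \<tau>) x"

lemma trace_at_continuous: "continuous_on {0<..} (\<lambda>\<tau>. conv (mollifier \<kappa>) (R \<tau>) x)"
  unfolding continuous_on_def
proof
  fix t :: real assume "t \<in> {0<..}"
  then show "((\<lambda>\<tau>. conv (mollifier \<kappa>) (R \<tau>) x) \<longlongrightarrow> conv (mollifier \<kappa>) (R t) x) (at t within {0<..})"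
    by (intro tendsto_within_subset[OF conv_R_continuous[of t x]]) auto
qed

lemma trace_at_isCont:
  assumes "0 < t"
  shows "isCont (trace_at x) t"
proof -
  have "isCont (\<lambda>\<tau>. conv (mollifier \<kappa>) (R \<tau>) x) t"
    using trace_at_continuous[of x] assms by (simp add: continuous_on_eq_continuous_at)
  moreover have "\<forall>\<^sub>F \<tau> in nhds t. trace_at x \<tau> = conv (mollifier \<kappa>) (R \<tau>) x"
    using assms eventually_nhds_in_open[of "{0<..}" t] by (auto simp: trace_at_def elim!: eventually_mono)
  ultimately show ?thesis using isCont_cong by metis
qed

lemma trace_at_borel[measurable]: "trace_at x \<in> borel_measurable borel"
  unfolding trace_at_def[abs_def]
  by (rule borel_measurable_continuous_on_indicator[OF _ trace_at_continuous]) simp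

lemma trace_at_AE: "AE \<tau> in lborel. \<forall>x. 0 < \<tau> \<longrightarrow> trace_at x \<tau> = conv (mollifier \<kappa>) (r \<tau>) x"
  using R_r
proof eventually_elim
  case (elim \<tau>)
  show ?case
  proof (intro allI impI)
    fix x assume t: "0 < \<tau>"
    have [measurable]: "R \<tau> \<in> borel_measurable borel" using R_integrable[of \<tau>] t by auto
    have "conv (mollifier \<kappa>) (R \<tau>) x = conv (mollifier \<kappa>) (r \<tau>) x" unfolding conv_def
      by (rule integral_cong_AE) (use elim t in \<open>auto elim!: eventually_mono\<close>)
    then show "trace_at x \<tau> = conv (mollifier \<kappa>) (r \<tau>) x" using t by (simp add: trace_at_def)
  qed
qed

text \<open>Testing the mass equation with products of a function of time and a translated mollifier.\<close>

lemma mollified_transport: "wderiv {0<..} 1 (trace_at x) (\<lambda>\<tau>. flux \<kappa> \<tau> x)"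
  unfolding wderiv_def
proof (intro conjI allI impI)
  show "trace_at x \<in> borel_measurable borel" by (rule trace_at_borel)
  show [measurable]: "(\<lambda>\<tau>. flux \<kappa> \<tau> x) \<in> borel_measurable borel" by measurable
  show "integrable lborel (\<lambda>\<tau>. indicator K \<tau> *\<^sub>R trace_at x \<tau>)" if "compact K" "K \<subseteq> {0<..}" for K
  proof (rule borel_integrable_compact[OF that(1)])
    have "isCont (trace_at x) \<tau>" if "\<tau> \<in> K" for \<tau>
      by (rule trace_at_isCont) (use that \<open>K \<subseteq> {0<..}\<close> in auto)
    then show "continuous_on K (trace_at x)" by (intro continuous_at_imp_continuous_on) blast
  qed
  show "integrable lborel (\<lambda>\<tau>. indicator K \<tau> *\<^sub>R flux \<kappa> \<tau> x)" if K: "compact K" "K \<subseteq> {0<..}" for K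
  proof -
    obtain G where G: "0 \<le> G" "AE \<tau> in lborel. 0 < \<tau> \<longrightarrow> (\<forall>x. \<bar>flux \<kappa> \<tau> x\<bar> \<le> G)" using flux_bounded by blast
    have [measurable]: "K \<in> sets borel" using compact_imp_closed[OF K(1)] by simp
    show ?thesis
    proof (rule Bochner_Integration.integrable_bound)
      show "integrable lborel (\<lambda>\<tau>. indicator K \<tau> * G)"
        using emeasure_compact_finite[OF K(1)] by (intro integrable_mult_left integrable_real_indicator) auto
      show "AE \<tau> in lborel. norm (indicator K \<tau> *\<^sub>R flux \<kappa> \<tau> x) \<le> norm (indicator K \<tau> * G)"
        using G(2) by eventually_elim (use K(2) G(1) in \<open>auto simp: indicator_def\<close>)
    qed measurable
  qed
  fix \<theta> :: "real \<Rightarrow> real" assume \<theta>: "test_fun {0<..} \<theta>"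
  define \<psi> where "\<psi> y = mollifier \<kappa> (x - y)" for y
  have \<psi>: "test_fun UNIV \<psi>" and d\<psi>: "\<And>y h. fderiv \<psi> y h = - fderiv (mollifier \<kappa>) (x - y) h"
    unfolding \<psi>_def[abs_def] using test_fun_mollifier_reflect[OF \<kappa> subset_UNIV, of x] by auto
  obtain T where T: "\<And>\<tau>. \<tau> \<notin> {0..T} \<Longrightarrow> \<theta> \<tau> = 0 \<and> (\<forall>h. fderiv \<theta> \<tau> h = 0)"
    using test_fun_real_support[OF \<theta>] by blast
  obtain A where A: "0 < A" "\<And>\<tau>. norm (\<theta> \<tau>) \<le> A" using test_fun_bounded[OF \<theta>] by blast
  obtain A' where A': "0 < A'" "\<And>\<tau> h. \<bar>fderiv \<theta> \<tau> h\<bar> \<le> A' * norm h" using test_fun_deriv_bounded[OF \<theta>] by blast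
  obtain B where B: "0 < B" "\<And>y. norm (\<psi> y) \<le> B" using test_fun_bounded[OF \<psi>] by blast
  obtain B' where B': "0 < B'" "\<And>y h. \<bar>fderiv \<psi> y h\<bar> \<le> B' * norm h" using test_fun_deriv_bounded[OF \<psi>] by blast
  note [measurable] = test_fun_measurable[OF \<theta>] test_fun_measurable[OF \<psi>] test_fun_deriv_measurable[OF \<psi>]
    test_fun_measurable[OF test_fun_deriv[OF \<theta>]]
  define F1 where "F1 z = fderiv \<theta> (fst z) 1 * \<psi> (snd z)" for z
  define F2 where "F2 z = \<theta> (fst z) * fderiv \<psi> (snd z) (w (fst z) (snd z))" for z
  have i1: "integrable lborel (\<lambda>z. r (fst z) (snd z) * F1 z)"
  proof (rule majorised_integrable[of _ "2 * M * (A' * B)" T])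
    show "(\<lambda>z. r (fst z) (snd z) * F1 z) \<in> borel_measurable borel" unfolding F1_def by measurable
    have "\<bar>F1 z\<bar> \<le> A' * B * norm (1::real, w (fst z) (snd z))" for z
    proof -
      have "\<bar>F1 z\<bar> \<le> (A' * norm (1::real)) * B" unfolding F1_def abs_mult
        using A'(1) A'(2)[of _ 1] B by (intro mult_mono) auto
      also have "\<dots> = A' * B * norm (1::real)" by simp
      also have "\<dots> \<le> A' * B * norm (1::real, w (fst z) (snd z))"
        using A'(1) B(1) by (intro mult_left_mono norm_fst_le) auto
      finally show ?thesis .
    qed
    then show "AE z in lborel. \<bar>r (fst z) (snd z) * F1 z\<bar> \<le> 2 * M * (A' * B) * majorant T z"
      using A'(1) B(1) T by (intro AE_I2 flux_bound) (auto simp: F1_def)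
  qed
  have i2: "integrable lborel (\<lambda>z. r (fst z) (snd z) * F2 z)"
  proof (rule majorised_integrable[of _ "2 * M * (A * B')" T])
    show "(\<lambda>z. r (fst z) (snd z) * F2 z) \<in> borel_measurable borel" unfolding F2_def by measurable
    have "\<bar>F2 z\<bar> \<le> A * B' * norm (1::real, w (fst z) (snd z))" for z
    proof -
      have "\<bar>F2 z\<bar> \<le> A * (B' * norm (w (fst z) (snd z)))" unfolding F2_def abs_mult using A B' by (intro mult_mono) auto
      also have "\<dots> = A * B' * norm (w (fst z) (snd z))" by simp
      also have "\<dots> \<le> A * B' * norm (1::real, w (fst z) (snd z))"
        using A(1) B'(1) by (intro mult_left_mono norm_snd_le) auto
      finally show ?thesis .
    qed
    then show "AE z in lborel. \<bar>r (fst z) (snd z) * F2 z\<bar> \<le> 2 * M * (A * B') * majorant T z"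
      using A(1) B'(1) T by (intro AE_I2 flux_bound) (auto simp: F2_def)
  qed
  have "(LBINT z. r (fst z) (snd z) * F2 z + r (fst z) (snd z) * F1 z) = 0"
    using mass_whole[OF test_fun_tensor(1)[OF \<theta> \<psi>]] by (simp add: test_fun_tensor(2)[OF \<theta> \<psi>] F1_def F2_def distrib_left)
  then have sum: "(LBINT z. r (fst z) (snd z) * F1 z) = - (LBINT z. r (fst z) (snd z) * F2 z)"
    using i1 i2 by simp
  have e1: "(LBINT y. r \<tau> y * F1 (\<tau>, y)) = fderiv \<theta> \<tau> 1 * conv (mollifier \<kappa>) (r \<tau>) x" for \<tau>
  proof -
    have "(LBINT y. r \<tau> y * F1 (\<tau>, y)) = (LBINT y. fderiv \<theta> \<tau> 1 * (mollifier \<kappa> (x - y) *\<^sub>R r \<tau> y))"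
      by (intro Bochner_Integration.integral_cong) (auto simp: F1_def \<psi>_def)
    then show ?thesis by (simp add: conv_def)
  qed
  have "(LBINT z. r (fst z) (snd z) * F1 z) = (LBINT \<tau>. fderiv \<theta> \<tau> 1 * conv (mollifier \<kappa>) (r \<tau>) x)"
    using integral_prod(1)[OF i1] by (simp add: e1)
  also have "\<dots> = (LBINT \<tau>. fderiv \<theta> \<tau> 1 * trace_at x \<tau>)"
  proof (rule integral_cong_AE)
    show "AE \<tau> in lborel. fderiv \<theta> \<tau> 1 * conv (mollifier \<kappa>) (r \<tau>) x = fderiv \<theta> \<tau> 1 * trace_at x \<tau>"
      using trace_at_AE
    proof eventually_elim
      case (elim \<tau>)
      then show ?case using test_fun_support[OF test_fun_deriv[OF \<theta>], of \<tau> 1] by (cases "0 < \<tau>") auto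
    qed
  qed measurable
  finally have 1: "(LBINT z. r (fst z) (snd z) * F1 z) = (LBINT \<tau>. fderiv \<theta> \<tau> 1 * trace_at x \<tau>)" .
  have e2: "(LBINT y. r \<tau> y * F2 (\<tau>, y)) = \<theta> \<tau> * flux \<kappa> \<tau> x" for \<tau>
  proof -
    have "(LBINT y. r \<tau> y * F2 (\<tau>, y)) = (LBINT y. - \<theta> \<tau> * (r \<tau> y * fderiv (mollifier \<kappa>) (x - y) (w \<tau> y)))"
      by (intro Bochner_Integration.integral_cong) (auto simp: F2_def d\<psi>)
    also have "\<dots> = - \<theta> \<tau> * (LBINT y. r \<tau> y * fderiv (mollifier \<kappa>) (x - y) (w \<tau> y))"
      by (rule integral_mult_right_zero)
    finally show ?thesis by (simp add: flux_def)
  qed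
  have 2: "(LBINT z. r (fst z) (snd z) * F2 z) = (LBINT \<tau>. \<theta> \<tau> * flux \<kappa> \<tau> x)"
    using integral_prod(1)[OF i2] by (simp add: e2)
  show "(LBINT \<tau>. fderiv \<theta> \<tau> 1 *\<^sub>R trace_at x \<tau>) = - (LBINT \<tau>. \<theta> \<tau> *\<^sub>R flux \<kappa> \<tau> x)"
    using sum 1 2 by simp
qed

end

lemma renormalized_R_tendsto:
  assumes \<beta>: "\<And>x. (\<beta> has_real_derivative \<beta>' x) (at x)" "\<And>x. \<bar>\<beta>' x\<bar> \<le> 1" "\<beta> 0 = 0"
    and f: "integrable lborel (f :: real^'n \<Rightarrow> real)"
  shows "integrable lborel (\<lambda>x. \<beta> (f x))"
    and "integrable lborel (g :: real^'n \<Rightarrow> real) \<Longrightarrow>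
      \<bar>(LBINT x. \<beta> (f x)) - (LBINT x. \<beta> (g x))\<bar> \<le> (LBINT x. \<bar>f x - g x\<bar>)"
proof -
  have "continuous_on UNIV \<beta>" using DERIV_isCont[OF \<beta>(1)] by (simp add: continuous_on_eq_continuous_at)
  note [measurable] = borel_measurable_continuous_onI[OF this]
  have i: "integrable lborel (\<lambda>x. \<beta> (h x))" if h: "integrable lborel h" for h :: "real^'n \<Rightarrow> real"
  proof (rule Bochner_Integration.integrable_bound[OF h])
    show "AE x in lborel. norm (\<beta> (h x)) \<le> norm (h x)" using unit_Lipschitz[OF \<beta>(1,2), of _ 0] \<beta>(3) by auto
  qed (use h in measurable)
  show "integrable lborel (\<lambda>x. \<beta> (f x))" by (rule i[OF f])
  assume g: "integrable lborel g"
  have "(LBINT x. \<beta> (f x)) - (LBINT x. \<beta> (g x)) = (LBINT x. \<beta> (f x) - \<beta> (g x))" using i[OF f] i[OF g] by simp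
  also have "\<bar>\<dots>\<bar> \<le> (LBINT x. \<bar>\<beta> (f x) - \<beta> (g x)\<bar>)" by (rule integral_abs_bound)
  also have "\<dots> \<le> (LBINT x. \<bar>f x - g x\<bar>)"
    using i[OF f] i[OF g] f g unit_Lipschitz[OF \<beta>(1,2)] by (intro integral_mono) auto
  finally show "\<bar>(LBINT x. \<beta> (f x)) - (LBINT x. \<beta> (g x))\<bar> \<le> (LBINT x. \<bar>f x - g x\<bar>)" .
qed

text \<open>The chain rule in time at every point, integrated over space.\<close>

lemma mollified_renormalization:
  assumes \<kappa>: "0 < \<kappa>"
    and \<beta>: "\<And>x. (\<beta> has_real_derivative \<beta>' x) (at x)" "continuous_on UNIV \<beta>'" "\<And>x. \<bar>\<beta>' x\<bar> \<le> 1" "\<beta> 0 = 0"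
    and st: "0 < s" "s < t"
  shows "(LBINT x. \<beta> (conv (mollifier \<kappa>) (R t) x)) - (LBINT x. \<beta> (conv (mollifier \<kappa>) (R s) x))
    = (LBINT \<tau>. indicator {s..t} \<tau> * (LBINT x. \<beta>' (conv (mollifier \<kappa>) (r \<tau>) x) * flux \<kappa> \<tau> x))"
proof -
  note m = test_fun_mollifier[OF \<kappa>, where 'a = "real^'n"]
  note [measurable (raw)] = measurable_uncurry[OF flux_borel[OF \<kappa>]] measurable_uncurry[OF conv_r_borel[OF \<kappa>]]
  note [measurable] = borel_measurable_continuous_onI[OF \<beta>(2)]
  define Q where "Q z = indicator {s..t} (fst z) * (\<beta>' (conv (mollifier \<kappa>) (r (fst z)) (snd z)) * flux \<kappa> (fst z) (snd z))" for z
  have Qm[measurable]: "Q \<in> borel_measurable borel" unfolding Q_def by measurable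
  obtain G where G: "0 \<le> G" "AE \<tau> in lborel. 0 < \<tau> \<longrightarrow> (\<forall>x. \<bar>flux \<kappa> \<tau> x\<bar> \<le> G)" using flux_bounded[OF \<kappa>] by blast
  obtain \<rho> where \<rho>: "\<And>y. y \<in> \<Omega> \<Longrightarrow> norm y \<le> \<rho>" using dom(2) by (auto simp: bounded_iff)
  define B where "B = cball (0::real^'n) (\<rho> + \<kappa>)"
  have Bb[measurable]: "B \<in> sets borel" and Bf: "emeasure lborel B < \<infinity>"
    using emeasure_compact_finite[OF compact_cball, of "0::real^'n"] by (auto simp: B_def)
  have fl: "flux \<kappa> \<tau> x = 0" if "x \<notin> B" for \<tau> x
  proof (rule flux_support[OF \<kappa>])
    fix y assume "y \<in> \<Omega>"
    then show "\<kappa> < norm (x - y)" using \<rho>[of y] that norm_triangle_ineq2[of x y] by (simp add: B_def)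
  qed
  have Qi: "integrable lborel Q"
  proof (rule Bochner_Integration.integrable_bound)
    show "integrable lborel (\<lambda>z. G * (indicator {s..t} (fst z) * indicator B (snd z)) :: real)"
    proof (rule integrable_prodI[where g = "\<lambda>\<tau>. (G * measure lborel B) * indicator {s..t} \<tau>"])
      show "AE \<tau> in lborel. integrable lborel (\<lambda>x. G * (indicator {s..t} (fst (\<tau>, x)) * indicator B (snd (\<tau>, x))) :: real) \<and>
          (LBINT x. G * (indicator {s..t} (fst (\<tau>, x)) * indicator B (snd (\<tau>, x)))) \<le> (G * measure lborel B) * indicator {s..t} \<tau>"
        using Bf by (intro AE_I2) (auto simp: integrable_real_indicator)
    qed (use G(1) st in \<open>auto intro!: integrable_mult_right integrable_real_indicator\<close>)
    show "AE z in lborel. norm (Q z) \<le> norm (G * (indicator {s..t} (fst z) * indicator B (snd z)))"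
    proof (rule AE_prodI)
      show "Measurable.pred borel (\<lambda>z. norm (Q z) \<le> norm (G * (indicator {s..t} (fst z) * indicator B (snd z))))"
        by measurable
      show "AE \<tau> in lborel. AE x in lborel. norm (Q (\<tau>, x)) \<le> norm (G * (indicator {s..t} (fst (\<tau>, x)) * indicator B (snd (\<tau>, x))))"
        using G(2)
      proof eventually_elim
      case (elim \<tau>)
      show ?case
      proof (intro AE_I2)
        fix x
        show "norm (Q (\<tau>, x)) \<le> norm (G * (indicator {s..t} (fst (\<tau>, x)) * indicator B (snd (\<tau>, x))))"
        proof (cases "\<tau> \<in> {s..t} \<and> x \<in> B")
          case True
          then have "\<bar>\<beta>' (conv (mollifier \<kappa>) (r \<tau>) x)\<bar> * \<bar>flux \<kappa> \<tau> x\<bar> \<le> 1 * G"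
            using elim st \<beta>(3) by (intro mult_mono) auto
          then show ?thesis using True G(1) by (simp add: Q_def abs_mult)
        qed (auto simp: Q_def fl)
      qed
      qed
    qed
  qed measurable
  have inc: "\<beta> (conv (mollifier \<kappa>) (R t) x) - \<beta> (conv (mollifier \<kappa>) (R s) x) = (LBINT \<tau>. Q (\<tau>, x))" for x
  proof -
    note [measurable] = trace_at_borel[OF \<kappa>]
    have "\<beta> (trace_at \<kappa> x t) - \<beta> (trace_at \<kappa> x s) = (LBINT \<tau>. indicator {s..t} \<tau> * (\<beta>' (trace_at \<kappa> x \<tau>) * flux \<kappa> \<tau> x))"
      using st by (intro chain_rule_weak[OF mollified_transport[OF \<kappa>]] trace_at_isCont[OF \<kappa>] \<beta>) auto
    also have "\<dots> = (LBINT \<tau>. Q (\<tau>, x))"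
    proof (rule integral_cong_AE)
      show "AE \<tau> in lborel. indicator {s..t} \<tau> * (\<beta>' (trace_at \<kappa> x \<tau>) * flux \<kappa> \<tau> x) = Q (\<tau>, x)"
        using trace_at_AE[OF \<kappa>] by eventually_elim (use st in \<open>auto simp: Q_def indicator_def\<close>)
    qed measurable
    finally show ?thesis using st by (simp add: trace_at_def[OF \<kappa>])
  qed
  have ci: "integrable lborel (conv (mollifier \<kappa>) (R p))" if "0 \<le> p" for p
  proof -
    have "integrable lborel (\<lambda>x. (conv (mollifier \<kappa>) (R p) x - R p x) + R p x)"
      using mollifier_L1(1)[OF R_integrable[OF that], of "\<lambda>n. \<kappa> * inverse (real (Suc n))" 0] \<kappa>
        tendsto_mult_right_zero[OF LIMSEQ_inverse_real_of_nat, of \<kappa>] R_integrable[OF that]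
      by (intro Bochner_Integration.integrable_add) auto
    then show ?thesis by simp
  qed
  have "(LBINT x. \<beta> (conv (mollifier \<kappa>) (R t) x)) - (LBINT x. \<beta> (conv (mollifier \<kappa>) (R s) x))
      = (LBINT x. \<beta> (conv (mollifier \<kappa>) (R t) x) - \<beta> (conv (mollifier \<kappa>) (R s) x))"
    using renormalized_R_tendsto(1)[OF \<beta>(1,3,4) ci[of t]] renormalized_R_tendsto(1)[OF \<beta>(1,3,4) ci[of s]] st by simp
  also have "\<dots> = (LBINT x. (LBINT \<tau>. Q (\<tau>, x)))" by (simp add: inc)
  also have "\<dots> = (LBINT \<tau>. (LBINT x. Q (\<tau>, x)))" using integral_prod(1,2)[OF Qi] by simp
  finally show ?thesis by (simp add: Q_def)
qed

text \<open>For the mollified densities the two integrals differ by a time integral of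
  \<open>\<integral> \<beta>'(\<eta> * r) flux\<close>, which the commutator estimate bounds by the modulus of continuity of the translations
  of \<open>r\<close> at scale \<open>\<kappa>\<close>. This tends to zero at almost every time, and \<open>L\<close> is an integrable majorant. So
  \<open>\<integral> \<beta>(R)\<close> is constant at positive times; the continuity of \<open>R\<close> extends this to the initial time.\<close>

theorem renormalization:
  assumes \<beta>: "\<And>x. (\<beta> has_real_derivative \<beta>' x) (at x)" "continuous_on UNIV \<beta>'" "\<And>x. \<bar>\<beta>' x\<bar> \<le> 1" "\<beta> 0 = 0"
    and t: "0 < t"
  shows "(LBINT x. \<beta> (R t x)) = (LBINT x. \<beta> (R 0 x))"
proof -
  define \<kappa> where "\<kappa> n = inverse (real (Suc n))" for n
  have \<kappa>: "0 < \<kappa> n" "\<kappa> \<longlonglongrightarrow> 0" for n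
    using LIMSEQ_inverse_real_of_nat by (auto simp: \<kappa>_def[abs_def])
  obtain C where C: "0 < C" "\<And>(\<Omega> :: (real^'n) set) u D L \<kappa> (q :: real^'n \<Rightarrow> real) (\<beta> :: real \<Rightarrow> real) \<beta>' e M.
     h10 \<Omega> (u :: real^'n \<Rightarrow> real^'n) D \<Longrightarrow> bounded \<Omega> \<Longrightarrow> (AE x in lborel. trace (D x) = 0) \<Longrightarrow>
     (AE x in lborel. norm (D x) \<le> L) \<Longrightarrow> 0 \<le> L \<Longrightarrow> 0 < \<kappa> \<Longrightarrow>
     q \<in> borel_measurable borel \<Longrightarrow> integrable lborel q \<Longrightarrow>
     (\<And>x. (\<beta> has_real_derivative \<beta>' x) (at x)) \<Longrightarrow> continuous_on UNIV \<beta>' \<Longrightarrow> (\<And>x. \<bar>\<beta>' x\<bar> \<le> 1) \<Longrightarrow> 0 \<le> e \<Longrightarrow>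
     (\<And>z. norm z \<le> \<kappa> \<Longrightarrow> (LBINT x. \<bar>q (x - z) - q x\<bar>) \<le> e) \<Longrightarrow> (\<And>x. \<bar>q x\<bar> \<le> M) \<Longrightarrow>
     \<bar>\<integral>x. \<beta>' (conv (mollifier \<kappa>) q x) * (- (LBINT y. q y * fderiv (mollifier \<kappa>) (x - y) (u y))) \<partial>lborel\<bar>
       \<le> C * L * e"
    using commutator_estimate[where 'n='n] by (elim exE conjE) (rule that, simp, blast)
  define h where "h n \<tau> = (LBINT x. \<beta>' (conv (mollifier (\<kappa> n)) (r \<tau>) x) * flux (\<kappa> n) \<tau> x)" for n \<tau>
  have hb: "AE \<tau> in lborel. 0 < \<tau> \<longrightarrow> (\<forall>n e. 0 \<le> e \<longrightarrow> (\<forall>z. norm z \<le> \<kappa> n \<longrightarrow> (LBINT x. \<bar>r \<tau> (x - z) - r \<tau> x\<bar>) \<le> e)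
      \<longrightarrow> \<bar>h n \<tau>\<bar> \<le> C * L \<tau> * e)"
    using w_h10 w_div D_bound
  proof eventually_elim
    case (elim \<tau>)
    show ?case
    proof (intro impI allI)
      fix n and e :: real assume a: "0 < \<tau>" "0 \<le> e" "\<forall>z. norm z \<le> \<kappa> n \<longrightarrow> (LBINT x. \<bar>r \<tau> (x - z) - r \<tau> x\<bar>) \<le> e"
      have ri: "integrable lborel (r \<tau>)" by (rule r_integrable)
      show "\<bar>h n \<tau>\<bar> \<le> C * L \<tau> * e" unfolding h_def flux_def
        by (rule C(2)[OF _ dom(2) _ _ L_nonneg \<kappa>(1) _ ri \<beta>(1,2,3) a(2) _ r_bound])
          (use a elim ri in auto)
    qed
  qed
  have osc: "(LBINT x. \<bar>r \<tau> (x - z) - r \<tau> x\<bar>) \<le> 2 * (M * vol)" for \<tau> z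
  proof -
    note ri = r_integrable(1)[of \<tau>]
    have "(LBINT x. \<bar>r \<tau> (x - z) - r \<tau> x\<bar>) \<le> (LBINT x. \<bar>r \<tau> (x - z)\<bar> + \<bar>r \<tau> x\<bar>)"
      using ri lborel_shift(3)[OF ri, of z] by (intro integral_mono) auto
    also have "\<dots> = 2 * (LBINT x. \<bar>r \<tau> x\<bar>)"
      using ri lborel_shift(3)[OF ri, of z] lborel_shift(4)[OF integrable_abs[OF ri], of z] by simp
    also have "\<dots> \<le> 2 * (M * vol)" using r_integrable(2)[of \<tau>] by simp
    finally show ?thesis .
  qed
  have h_borel[measurable]: "h n \<in> borel_measurable borel" for n
  proof -
    note [measurable (raw)] = measurable_uncurry[OF flux_borel[OF \<kappa>(1)[of n]]] measurable_uncurry[OF conv_r_borel[OF \<kappa>(1)[of n]]]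
    note [measurable] = borel_measurable_continuous_onI[OF \<beta>(2)]
    show ?thesis unfolding h_def[abs_def] by measurable
  qed
  have h_lim: "AE \<tau> in lborel. 0 < \<tau> \<longrightarrow> (\<lambda>n. h n \<tau>) \<longlonglongrightarrow> 0"
    using hb
  proof eventually_elim
    case (elim \<tau>)
    show ?case
    proof (intro impI tendstoI)
      fix \<epsilon> :: real assume \<tau>: "0 < \<tau>" and \<epsilon>: "0 < \<epsilon>"
      define e where "e = \<epsilon> / (C * L \<tau> + 1)"
      have p: "0 < C * L \<tau> + 1" using C(1) L_nonneg[of \<tau>] by (simp add: add_nonneg_pos)
      have e: "0 < e" using \<epsilon> p by (simp add: e_def)
      have ce: "C * L \<tau> * e < \<epsilon>"
      proof -
        have "C * L \<tau> * e < (C * L \<tau> + 1) * e" using e by simp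
        also have "\<dots> = \<epsilon>" using p by (simp add: e_def)
        finally show ?thesis .
      qed
      obtain d where d: "0 < d" "\<forall>z. norm z < d \<longrightarrow> (LBINT x. norm (r \<tau> (x - z) - r \<tau> x)) < e"
        using translation_L1[OF r_integrable(1)[of \<tau>] e] by blast
      have "\<forall>\<^sub>F n in sequentially. \<kappa> n < d" using order_tendstoD(2)[OF \<kappa>(2) d(1)] .
      then show "\<forall>\<^sub>F n in sequentially. dist (h n \<tau>) 0 < \<epsilon>"
      proof eventually_elim
        case k: (elim n)
        have "\<forall>z. norm z \<le> \<kappa> n \<longrightarrow> (LBINT x. \<bar>r \<tau> (x - z) - r \<tau> x\<bar>) \<le> e"
          using d(2) k by (auto intro!: less_imp_le)
        then have "\<bar>h n \<tau>\<bar> \<le> C * L \<tau> * e" using elim \<tau> e by auto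
        then show ?case using ce by (simp add: dist_real_def)
      qed
    qed
  qed
  have step: "(LBINT x. \<beta> (R t x)) = (LBINT x. \<beta> (R s x))" if s: "0 < s" "s < t" for s
  proof -
    have "(\<lambda>n. LBINT \<tau>. indicator {s..t} \<tau> * h n \<tau>) \<longlonglongrightarrow> (\<integral>\<tau>. 0 \<partial>(lborel :: real measure))"
    proof (rule integral_dominated_convergence)
      show "integrable lborel (\<lambda>\<tau>. (C * (2 * (M * vol))) * (indicator {0..t} \<tau> * L \<tau>))" using L_integrable by simp
      show "AE \<tau> in lborel. (\<lambda>n. indicator {s..t} \<tau> * h n \<tau>) \<longlonglongrightarrow> 0"
        using h_lim
      proof eventually_elim
        case (elim \<tau>)
        then show ?case using s by (cases "\<tau> \<in> {s..t}") auto
      qed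
      show "AE \<tau> in lborel. norm (indicator {s..t} \<tau> * h n \<tau>) \<le> (C * (2 * (M * vol))) * (indicator {0..t} \<tau> * L \<tau>)" for n
        using hb
      proof eventually_elim
        case (elim \<tau>)
        have "0 \<le> 2 * (M * vol)" using M_nonneg vol_nonneg by simp
        then have "\<tau> \<in> {s..t} \<Longrightarrow> \<bar>h n \<tau>\<bar> \<le> C * L \<tau> * (2 * (M * vol))" using elim osc s by auto
        then show ?case using C(1) M_nonneg vol_nonneg L_nonneg[of \<tau>] s
          by (cases "\<tau> \<in> {s..t}") (auto simp: mult_ac indicator_def)
      qed
    qed measurable
    then have rhs: "(\<lambda>n. LBINT \<tau>. indicator {s..t} \<tau> * h n \<tau>) \<longlonglongrightarrow> 0" by simp
    have lhs: "(\<lambda>n. LBINT x. \<beta> (conv (mollifier (\<kappa> n)) (R p) x)) \<longlonglongrightarrow> (LBINT x. \<beta> (R p x))" if p: "0 \<le> p" for p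
    proof -
      note Ri = R_integrable[OF p]
      have ci: "integrable lborel (conv (mollifier (\<kappa> n)) (R p))" for n
        using Bochner_Integration.integrable_add[OF mollifier_L1(1)[OF Ri \<kappa>, of n] Ri] by simp
      have "(\<lambda>n. (LBINT x. \<beta> (conv (mollifier (\<kappa> n)) (R p) x)) - (LBINT x. \<beta> (R p x))) \<longlonglongrightarrow> 0"
      proof (rule Lim_null_comparison[OF always_eventually mollifier_L1(2)[OF Ri \<kappa>]], intro allI)
        show "norm ((LBINT x. \<beta> (conv (mollifier (\<kappa> n)) (R p) x)) - (LBINT x. \<beta> (R p x)))
          \<le> (LBINT x. norm (conv (mollifier (\<kappa> n)) (R p) x - R p x))" for n
          using renormalized_R_tendsto(2)[OF \<beta>(1,3,4) ci[of n] Ri] by simp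
      qed
      then show ?thesis by (simp add: LIM_zero_iff)
    qed
    have "(\<lambda>n. LBINT \<tau>. indicator {s..t} \<tau> * h n \<tau>) \<longlonglongrightarrow> (LBINT x. \<beta> (R t x)) - (LBINT x. \<beta> (R s x))"
      using tendsto_diff[OF lhs[of t] lhs[of s]] s
      by (simp add: mollified_renormalization[OF \<kappa>(1) \<beta> s] h_def)
    from LIMSEQ_unique[OF this rhs] show ?thesis by simp
  qed
  have "((\<lambda>s. (LBINT x. \<beta> (R s x)) - (LBINT x. \<beta> (R 0 x))) \<longlongrightarrow> 0) (at 0 within {0..})"
  proof (rule Lim_null_comparison[OF _ R_continuous[of 0]])
    show "\<forall>\<^sub>F s in at 0 within {0..}. norm ((LBINT x. \<beta> (R s x)) - (LBINT x. \<beta> (R 0 x))) \<le> (LBINT x. \<bar>R s x - R 0 x\<bar>)"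
      unfolding eventually_at_filter
      using renormalized_R_tendsto(2)[OF \<beta>(1,3,4) R_integrable R_integrable[of 0]] by auto
  qed simp
  moreover have "\<forall>\<^sub>F s in at 0 within {0..}. (LBINT x. \<beta> (R s x)) - (LBINT x. \<beta> (R 0 x))
      = (LBINT x. \<beta> (R t x)) - (LBINT x. \<beta> (R 0 x))"
    unfolding eventually_at
  proof (intro exI[of _ t] conjI ballI impI t)
    fix s :: real assume "s \<in> {0..}" "s \<noteq> 0 \<and> dist s 0 < t"
    then have "0 < s" "s < t" by auto
    then show "(LBINT x. \<beta> (R s x)) - (LBINT x. \<beta> (R 0 x)) = (LBINT x. \<beta> (R t x)) - (LBINT x. \<beta> (R 0 x))"
      using step[of s] by simp
  qed
  ultimately have "((\<lambda>s. (LBINT x. \<beta> (R t x)) - (LBINT x. \<beta> (R 0 x))) \<longlongrightarrow> 0) (at (0::real) within {0..})"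
    by (rule Lim_transform_eventually)
  moreover have "at (0::real) within {0..} \<noteq> bot"
  proof -
    have "\<exists>y\<in>{0::real..} - {0}. dist y 0 < e" if "0 < e" for e :: real
      using that by (intro bexI[of _ "e / 2"]) auto
    then show ?thesis by (simp add: at_within_eq_bot_iff closure_approachable)
  qed
  ultimately show ?thesis using tendsto_unique[OF _ tendsto_const] by fastforce
qed

end

section \<open>The maximum principle for the density\<close>

lemma DERIV_pos_part_square: "((\<lambda>x::real. (max 0 x)\<^sup>2) has_real_derivative 2 * max 0 x) (at x)"
proof (cases x "0::real" rule: linorder_cases)
  case less
  have "((\<lambda>x. 0) has_real_derivative 2 * max 0 x) (at x)" using less by simp
  then show ?thesis
    by (rule has_field_derivative_transform_within_open[of _ _ _ "{..<0}"]) (use less in auto)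
next
  case greater
  have "((\<lambda>x. x\<^sup>2) has_real_derivative 2 * max 0 x) (at x)" using greater
    by (auto intro!: derivative_eq_intros)
  then show ?thesis
    by (rule has_field_derivative_transform_within_open[of _ _ _ "{0<..}"]) (use greater in auto)
next
  case equal
  have "((\<lambda>y::real. ((max 0 y)\<^sup>2 - (max 0 0)\<^sup>2) / (y - 0)) \<longlongrightarrow> 0) (at 0)"
  proof (rule Lim_null_comparison[OF always_eventually])
    show "\<forall>y::real. norm (((max 0 y)\<^sup>2 - (max 0 0)\<^sup>2) / (y - 0)) \<le> \<bar>y\<bar>"
      by (auto simp: max_def power2_eq_square)
    show "((\<lambda>y::real. \<bar>y\<bar>) \<longlongrightarrow> 0) (at 0)" by (intro tendsto_rabs_zero tendsto_ident_at)
  qed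
  then show ?thesis using equal by (simp add: has_field_derivative_iff)
qed

context continuous_density
begin

text \<open>A smooth function \<open>\<beta> \<ge> 0\<close> that vanishes exactly where \<open>c y \<le> a\<close> satisfies \<open>\<integral> \<beta>(R 0) = 0\<close>, hence
  \<open>\<integral> \<beta>(R t) = 0\<close>. The signs \<open>c = 1\<close> and \<open>c = -1\<close> give upper and lower bounds.\<close>

lemma one_sided_bound:
  assumes c: "\<bar>c\<bar> = 1" and a: "0 \<le> a" and t: "0 < t" and init: "AE x in lborel. c * R 0 x \<le> a"
  shows "AE x in lborel. c * R t x \<le> a"
proof -
  \<comment> \<open>a smooth substitute for the positive part of \<open>c y - a\<close>, with bounded derivative\<close>
  define p where "p y = max 0 (c * y - a)" for y
  define \<beta> where "\<beta> y = sqrt (1 + (p y)\<^sup>2) - 1" for y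
  define \<beta>' where "\<beta>' y = c * p y / sqrt (1 + (p y)\<^sup>2)" for y
  have pos: "0 < 1 + (p y)\<^sup>2" for y by (simp add: add_pos_nonneg)
  have d: "(\<beta> has_real_derivative \<beta>' y) (at y)" for y
  proof -
    have "((\<lambda>y. (max 0 (c * y - a))\<^sup>2) has_real_derivative 2 * max 0 (c * y - a) * c) (at y)"
      by (rule DERIV_chain2[OF DERIV_pos_part_square]) (auto intro!: derivative_eq_intros)
    then have "((\<lambda>y. (p y)\<^sup>2) has_real_derivative 2 * p y * c) (at y)" unfolding p_def[abs_def] .
    from DERIV_add[OF DERIV_const[of 1] this]
    have "((\<lambda>y. 1 + (p y)\<^sup>2) has_real_derivative 2 * p y * c) (at y)" by simp
    from DERIV_diff[OF DERIV_chain2[OF DERIV_real_sqrt[OF pos] this] DERIV_const[of 1]]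
    have h: "((\<lambda>y. sqrt (1 + (p y)\<^sup>2) - 1) has_real_derivative inverse (sqrt (1 + (p y)\<^sup>2)) / 2 * (2 * p y * c) - 0) (at y)" .
    have e: "inverse (sqrt (1 + (p y)\<^sup>2)) / 2 * (2 * p y * c) - 0 = \<beta>' y"
      by (simp add: \<beta>'_def inverse_eq_divide)
    have b: "\<beta> = (\<lambda>y. sqrt (1 + (p y)\<^sup>2) - 1)" by (rule ext) (rule \<beta>_def)
    show ?thesis unfolding b by (rule h[unfolded e])
  qed
  have cont: "continuous_on UNIV \<beta>'" unfolding \<beta>'_def[abs_def] p_def[abs_def] using pos
    by (intro continuous_intros) (auto simp: p_def less_imp_neq[symmetric])
  have le1: "\<bar>\<beta>' y\<bar> \<le> 1" for y
  proof -
    have "p y \<le> sqrt (1 + (p y)\<^sup>2)" by (rule real_le_rsqrt) simp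
    moreover have "0 \<le> p y" by (simp add: p_def)
    ultimately show ?thesis using c pos[of y] by (simp add: \<beta>'_def abs_mult)
  qed
  have z: "\<beta> 0 = 0" using a by (simp add: \<beta>_def p_def)
  have iff: "\<beta> y = 0 \<longleftrightarrow> c * y \<le> a" for y by (auto simp: \<beta>_def p_def max_def)
  have nn: "0 \<le> \<beta> y" for y by (simp add: \<beta>_def)
  have [measurable]: "\<beta> \<in> borel_measurable borel"
    using DERIV_isCont[OF d] by (intro borel_measurable_continuous_onI) (simp add: continuous_on_eq_continuous_at)
  have [measurable]: "R 0 \<in> borel_measurable borel" using R_integrable[of 0] by auto
  have "(LBINT x. \<beta> (R 0 x)) = (\<integral>x. 0 \<partial>(lborel :: (real^'n) measure))"
    by (rule integral_cong_AE) (use init in \<open>auto simp: iff\<close>)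
  then have i0: "(LBINT x. \<beta> (R t x)) = 0" using renormalization[OF d cont le1 z t] by simp
  have i: "integrable lborel (\<lambda>x. \<beta> (R t x))"
    using R_integrable[of t] t by (intro renormalized_R_tendsto(1)[OF d le1 z]) simp
  have "AE x in lborel. \<beta> (R t x) = 0"
    using integral_nonneg_eq_0_iff_AE[OF i AE_I2[OF nn]] i0 by blast
  then show ?thesis by (simp add: iff)
qed

theorem density_bounds:
  assumes "0 \<le> b" "0 < t" "AE x in lborel. 0 \<le> R 0 x \<and> R 0 x \<le> b"
  shows "AE x in lborel. 0 \<le> R t x \<and> R t x \<le> b"
proof -
  have "AE x in lborel. 1 * R t x \<le> b" "AE x in lborel. (-1) * R t x \<le> 0"
    by (rule one_sided_bound; use assms in \<open>auto elim!: eventually_mono\<close>)+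
  then show ?thesis by eventually_elim simp
qed

end

section \<open>The truncated kinetic energy\<close>

text \<open>A factor between 0 and 1 that tends to 1 as \<open>N \<rightarrow> \<infinity>\<close> and tames \<open>\<bar>y\<bar>\<^sup>2\<close>.\<close>

definition damp :: "real \<Rightarrow> 'a::euclidean_space \<Rightarrow> real" where
  "damp N y = N * inverse (N + (y \<bullet> y) / 2)"

text \<open>\<open>trunc N\<close> is a bounded smooth substitute for \<open>y \<mapsto> \<bar>y\<bar>\<^sup>2 / 2\<close> with bounded gradient
  \<open>(damp N y)\<^sup>2 y\<close>.\<close>

definition trunc :: "real \<Rightarrow> 'a::euclidean_space \<Rightarrow> real" where
  "trunc N y = N - N * damp N y"

lemma trunc_facts:
  fixes y :: "'a::euclidean_space"
  assumes N: "1 \<le> N"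
  shows "0 \<le> damp N y" "damp N y \<le> 1" "trunc N y = (y \<bullet> y) / 2 * damp N y"
    "0 \<le> trunc N y" "trunc N y \<le> N" "trunc N y \<le> (y \<bullet> y) / 2" "(damp N y)\<^sup>2 * norm y \<le> N"
    "(damp N y)\<^sup>2 \<le> 1"
proof -
  let ?s = "(y \<bullet> y) / 2"
  have s: "0 \<le> ?s" by simp
  have p: "0 < N + ?s" using N s by linarith
  show d0: "0 \<le> damp N y" using p N by (simp add: damp_def)
  show d1: "damp N y \<le> 1" unfolding damp_def divide_inverse[symmetric] pos_divide_le_eq[OF p] mult_1 using s by linarith
  show t: "trunc N y = ?s * damp N y"
  proof -
    have "(N + ?s) * damp N y = N" using p by (simp add: damp_def)
    then show ?thesis unfolding trunc_def distrib_right by linarith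
  qed
  show "0 \<le> trunc N y" unfolding t by (rule mult_nonneg_nonneg[OF s d0])
  show "trunc N y \<le> N" using N d0 by (simp add: trunc_def)
  show "trunc N y \<le> ?s" unfolding t using mult_left_mono[OF d1 s] by simp
  show sq: "(damp N y)\<^sup>2 \<le> 1" using d0 d1 by (simp add: power_le_one)
  have "norm y \<le> N + ?s"
  proof -
    have "0 \<le> (norm y - 1)\<^sup>2" by simp
    then have "2 * norm y \<le> 1 + (norm y)\<^sup>2" by (simp add: power2_diff)
    then show ?thesis using N by (simp add: power2_norm_eq_inner)
  qed
  then have "damp N y * norm y \<le> damp N y * (N + ?s)" using d0 by (rule mult_left_mono)
  also have "\<dots> = N" using p by (simp add: damp_def)
  finally have "damp N y * (damp N y * norm y) \<le> damp N y * N" using d0 by (rule mult_left_mono)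
  also have "\<dots> \<le> N" using d1 N by (simp add: mult_left_le_one_le d0)
  finally show "(damp N y)\<^sup>2 * norm y \<le> N" by (simp add: power2_eq_square mult.assoc)
qed

lemma trunc_has_derivative:
  fixes y :: "'a::euclidean_space"
  assumes N: "1 \<le> N"
  shows "(trunc N has_derivative (\<lambda>h. (damp N y)\<^sup>2 * (y \<bullet> h))) (at y)"
proof -
  have p: "N + (y \<bullet> y) / 2 \<noteq> 0" using N inner_ge_zero[of y] by (smt (verit) divide_nonneg_pos)
  show ?thesis unfolding trunc_def[abs_def] damp_def[abs_def]
    by (rule derivative_eq_intros refl p | simp add: p inner_commute)+
      (simp add: fun_eq_iff power2_eq_square inner_commute algebra_simps)
qed

lemma Ck_on_trunc:
  fixes W :: "'a::euclidean_space \<Rightarrow> 'b::euclidean_space"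
  assumes N: "1 \<le> N" and W: "Ck_on k UNIV W"
  shows "Ck_on k UNIV (\<lambda>z. trunc N (W z))"
proof -
  have pos: "N + (\<Sum>i\<in>Basis. (W z \<bullet> i) * (W z \<bullet> i)) * (1/2) \<noteq> 0" for z
  proof -
    have "0 \<le> (\<Sum>i\<in>Basis. (W z \<bullet> i) * (W z \<bullet> i))" by (intro sum_nonneg) simp
    then show ?thesis using N by linarith
  qed
  have "Ck_on k UNIV (\<lambda>z. N + (-1) * (N * (N * inverse (N + (\<Sum>i\<in>Basis. (W z \<bullet> i) * (W z \<bullet> i)) * (1/2)))))"
    by (intro Ck_on_add Ck_on_mult Ck_on_const Ck_on_inverse Ck_on_sum Ck_on_inner W pos finite_Basis)
  then show ?thesis
    by (simp add: trunc_def damp_def euclidean_inner[of "W _" "W _"])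
qed

lemma damp_tendsto: "(\<lambda>k. damp (real (Suc k)) y) \<longlonglongrightarrow> 1"
proof -
  let ?s = "(y \<bullet> y) / 2"
  have e: "damp (real (Suc k)) y = inverse (1 + ?s * inverse (real (Suc k)))" for k
  proof -
    have "N * inverse (N + s) = inverse (1 + s * inverse N)" if "0 < N" for N s :: real
      using that by (simp add: field_simps)
    from this[of "real (Suc k)" ?s] show ?thesis unfolding damp_def by simp
  qed
  have "(\<lambda>k. inverse (1 + ?s * inverse (real (Suc k)))) \<longlonglongrightarrow> inverse (1 + ?s * 0)"
    by (intro tendsto_intros LIMSEQ_inverse_real_of_nat) simp
  then show ?thesis by (simp only: e) simp
qed

text \<open>The square integrable factor is split into a bounded part, for which \<open>L\<^sub>1\<close> convergence suffices, and a
  part of small \<open>L\<^sub>2\<close> norm, for which the uniform \<open>L\<^sub>2\<close> bound does.\<close>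

lemma L2_L1_pairing:
  fixes a :: "'a \<Rightarrow> 'b::euclidean_space" and b :: "nat \<Rightarrow> 'a \<Rightarrow> 'c::euclidean_space"
  assumes am[measurable]: "a \<in> borel_measurable M" and a2: "integrable M (\<lambda>x. (norm (a x))\<^sup>2)"
    and b1: "\<And>n. integrable M (b n)" and b2: "\<And>n. integrable M (\<lambda>x. (norm (b n x))\<^sup>2)"
    and bB: "\<And>n. (\<integral>x. (norm (b n x))\<^sup>2 \<partial>M) \<le> B" and lim: "(\<lambda>n. \<integral>x. norm (b n x) \<partial>M) \<longlonglongrightarrow> 0"
  shows "\<And>n. integrable M (\<lambda>x. norm (a x) * norm (b n x))" "(\<lambda>n. \<integral>x. norm (a x) * norm (b n x) \<partial>M) \<longlonglongrightarrow> 0"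
proof -
  have [measurable]: "b n \<in> borel_measurable M" for n using b1 by auto
  have B0: "0 \<le> B" using order_trans[OF integral_nonneg_AE bB] by auto
  have prod: "integrable M (\<lambda>x. norm (f x) * norm (b n x))" "0 < s \<Longrightarrow> (\<integral>x. norm (f x) * norm (b n x) \<partial>M)
      \<le> (\<integral>x. (norm (f x))\<^sup>2 \<partial>M) / s + s * (\<integral>x. (norm (b n x))\<^sup>2 \<partial>M)"
    if "f \<in> borel_measurable M" "integrable M (\<lambda>x. (norm (f x))\<^sup>2)" for f :: "'a \<Rightarrow> 'b" and n s
  proof -
    have [measurable]: "f \<in> borel_measurable M" by fact
    show "integrable M (\<lambda>x. norm (f x) * norm (b n x))" "0 < s \<Longrightarrow> (\<integral>x. norm (f x) * norm (b n x) \<partial>M)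
      \<le> (\<integral>x. (norm (f x))\<^sup>2 \<partial>M) / s + s * (\<integral>x. (norm (b n x))\<^sup>2 \<partial>M)"
      using L2_inner(2)[of "\<lambda>x. norm (f x)" M "\<lambda>x. norm (b n x)"]
        L2_inner(3)[of "\<lambda>x. norm (f x)" M "\<lambda>x. norm (b n x)" s] that b2[of n] by simp_all
  qed
  show i: "integrable M (\<lambda>x. norm (a x) * norm (b n x))" for n by (rule prod(1)[OF am a2])
  show "(\<lambda>n. \<integral>x. norm (a x) * norm (b n x) \<partial>M) \<longlonglongrightarrow> 0"
  proof (rule tendstoI)
    fix e :: real assume e: "0 < e"
    define s where "s = e / (3 * (B + 1))"
    have s: "0 < s" using e B0 by (simp add: s_def)
    have sB: "s * B \<le> e / 3"
    proof -
      have "s * B = (e / 3) * (B / (B + 1))" by (simp add: s_def)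
      also have "\<dots> \<le> (e / 3) * 1" using e B0 by (intro mult_left_mono) auto
      finally show ?thesis by simp
    qed
    define T where "T k x = indicator {y. real k < norm y} (a x) *\<^sub>R a x" for k x
    have [measurable]: "T k \<in> borel_measurable M" for k unfolding T_def by measurable
    have T2: "integrable M (\<lambda>x. (norm (T k x))\<^sup>2)" for k
      by (rule Bochner_Integration.integrable_bound[OF a2]) (auto simp: T_def indicator_def)
    have "(\<lambda>k. \<integral>x. (norm (T k x))\<^sup>2 \<partial>M) \<longlonglongrightarrow> (\<integral>x. 0 \<partial>M)"
    proof (rule integral_dominated_convergence[OF _ _ a2])
      show "AE x in M. (\<lambda>k. (norm (T k x))\<^sup>2) \<longlonglongrightarrow> 0"
      proof (intro AE_I2)
        fix x
        obtain k0 :: nat where "norm (a x) \<le> real k0" using real_arch_simple by blast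
        then have "\<forall>\<^sub>F k in sequentially. 0 = (norm (T k x))\<^sup>2"
          unfolding eventually_sequentially by (intro exI[of _ k0]) (auto simp: T_def)
        then show "(\<lambda>k. (norm (T k x))\<^sup>2) \<longlonglongrightarrow> 0" by (rule Lim_transform_eventually[OF tendsto_const])
      qed
    qed (auto simp: T_def indicator_def)
    then have "\<forall>\<^sub>F k in sequentially. (\<integral>x. (norm (T k x))\<^sup>2 \<partial>M) < s * (e / 3)"
      using s e by (intro order_tendstoD(2)[of _ 0]) auto
    then obtain k where k: "(\<integral>x. (norm (T k x))\<^sup>2 \<partial>M) < s * (e / 3)" by (auto simp: eventually_sequentially)
    have Ts: "(\<integral>x. norm (T k x) * norm (b n x) \<partial>M) < 2 * e / 3" for n
    proof -
      have "(\<integral>x. (norm (T k x))\<^sup>2 \<partial>M) / s < e / 3" using k s by (simp add: pos_divide_less_eq mult.commute)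
      moreover have "s * (\<integral>x. (norm (b n x))\<^sup>2 \<partial>M) \<le> e / 3"
        using mult_left_mono[OF bB[of n], of s] s sB by linarith
      moreover have "(\<integral>x. norm (T k x) * norm (b n x) \<partial>M)
          \<le> (\<integral>x. (norm (T k x))\<^sup>2 \<partial>M) / s + s * (\<integral>x. (norm (b n x))\<^sup>2 \<partial>M)"
        by (rule prod(2)) (use T2 s in auto)
      ultimately show ?thesis by linarith
    qed
    have "(\<lambda>n. real k * (\<integral>x. norm (b n x) \<partial>M)) \<longlonglongrightarrow> 0" using tendsto_mult_right_zero[OF lim] .
    then have "\<forall>\<^sub>F n in sequentially. real k * (\<integral>x. norm (b n x) \<partial>M) < e / 3"
      using e by (intro order_tendstoD(2)[of _ 0]) auto
    then show "\<forall>\<^sub>F n in sequentially. dist (\<integral>x. norm (a x) * norm (b n x) \<partial>M) 0 < e"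
    proof eventually_elim
      case (elim n)
      have "(\<integral>x. norm (a x) * norm (b n x) \<partial>M) \<le> (\<integral>x. norm (T k x) * norm (b n x) + real k * norm (b n x) \<partial>M)"
      proof (rule integral_mono[OF i])
        show "integrable M (\<lambda>x. norm (T k x) * norm (b n x) + real k * norm (b n x))"
          using prod(1)[of "T k" n] T2 b1[of n] by auto
        show "norm (a x) * norm (b n x) \<le> norm (T k x) * norm (b n x) + real k * norm (b n x)" for x
          by (cases "real k < norm (a x)") (auto simp: T_def mult_right_mono)
      qed
      also have "\<dots> = (\<integral>x. norm (T k x) * norm (b n x) \<partial>M) + real k * (\<integral>x. norm (b n x) \<partial>M)"
        using prod(1)[of "T k" n] T2 b1[of n] by simp
      finally have "(\<integral>x. norm (a x) * norm (b n x) \<partial>M) < e" using Ts[of n] elim by linarith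
      moreover have "0 \<le> (\<integral>x. norm (a x) * norm (b n x) \<partial>M)" by simp
      ultimately show ?case by (simp add: dist_real_def)
    qed
  qed
qed

section \<open>The energy identity\<close>

text \<open>The density may vanish, so that the time derivative is square integrable only with the weight
  \<open>r\<close>; without weight it is just locally integrable.\<close>

locale kinetic = transported \<Omega> w D L V r M
  for \<Omega> :: "(real^'n) set" and w D L V r M +
  fixes wt :: "real \<Rightarrow> real^'n \<Rightarrow> real^'n"
  assumes wt_weak: "wderiv ({0<..} \<times> \<Omega>) (1, 0) (case_prod w) (case_prod wt)"
    and D_borel: "case_prod D \<in> borel_measurable borel"
    and D_zero: "\<And>t x. x \<notin> \<Omega> \<Longrightarrow> D t x = 0"
    and D_L2: "AE t in lborel. 0 < t \<longrightarrow> (LBINT x. (norm (D t x))\<^sup>2) \<le> V"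
    and r_wt: "integrable lborel (\<lambda>z. \<bar>r (fst z) (snd z)\<bar> * (norm (wt (fst z) (snd z)))\<^sup>2)"
begin

lemmas D_measurable[measurable (raw)] = measurable_uncurry[OF D_borel]

lemma wt_borel: "case_prod wt \<in> borel_measurable borel"
  using wt_weak by (simp add: wderiv_def)

lemmas wt_measurable[measurable (raw)] = measurable_uncurry[OF wt_borel]

lemma Dj_measurable[measurable (raw)]:
  "g \<in> borel_measurable N \<Longrightarrow> h \<in> borel_measurable N \<Longrightarrow> (\<lambda>x. D (g x) (h x) $ j) \<in> borel_measurable N"
  by (rule borel_measurable_nth[OF D_measurable])

abbreviation "w' z \<equiv> w (fst z) (snd z)"
abbreviation "D' z \<equiv> D (fst z) (snd z)"
abbreviation "wt' z \<equiv> wt (fst z) (snd z)"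
abbreviation "r' z \<equiv> r (fst z) (snd z)"

definition adv :: "real \<times> (real^'n) \<Rightarrow> real^'n" where
  "adv z = (\<Sum>j\<in>UNIV. (w' z $ j) *\<^sub>R (D' z $ j))"

lemma adv_measurable[measurable]: "adv \<in> borel_measurable borel"
proof -
  have "(\<lambda>z. \<Sum>j\<in>UNIV. (w' z \<bullet> axis j 1) *\<^sub>R (D' z $ j)) \<in> borel_measurable borel" by measurable
  then show ?thesis by (simp add: adv_def[abs_def] inner_axis)
qed

lemma norm_adv: "norm (adv z) \<le> norm (w' z) * norm (D' z)"
  unfolding adv_def by (rule norm_sum_scaleR_le)

lemma slab_w: "integrable lborel (\<lambda>z. indicator {0..T} (fst z) * (norm (w' z))\<^sup>2)"
  by (rule majorised_integrable[of _ 1 T]) (use L_nonneg in \<open>auto simp: majorant_def indicator_def\<close>)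

lemma AE_slabI:
  assumes "\<And>t. 0 < t \<Longrightarrow> t \<le> T \<Longrightarrow> h10 \<Omega> (w t) (D t) \<Longrightarrow> (LBINT x. (norm (w t x))\<^sup>2) \<le> V \<Longrightarrow>
      (LBINT x. (norm (D t x))\<^sup>2) \<le> V \<Longrightarrow> P t"
    and "\<And>t. t \<notin> {0..T} \<Longrightarrow> P t"
  shows "AE t in lborel. P t"
  using w_h10 w_bound(2) D_L2 AE_pos
proof eventually_elim
  case (elim t)
  then show ?case using assms by (cases "0 < t \<and> t \<le> T") auto
qed

lemma slab_D: "integrable lborel (\<lambda>z. indicator {0..T} (fst z) * (norm (D' z))\<^sup>2)"
proof (rule integrable_prodI[where g = "\<lambda>t. V * indicator {0..T} t"])
  show "AE t in lborel. integrable lborel (\<lambda>x. indicator {0..T} (fst (t, x)) * (norm (D' (t, x)))\<^sup>2) \<and>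
      (LBINT x. indicator {0..T} (fst (t, x)) * (norm (D' (t, x)))\<^sup>2) \<le> V * indicator {0..T} t"
    by (rule AE_slabI[of T]) (auto simp: h10_def)
  show "integrable lborel (\<lambda>t. V * indicator {0..T} t)"
    using emeasure_compact_finite[OF compact_Icc, of 0 T]
    by (intro integrable_mult_right integrable_real_indicator) auto
qed auto

lemma slab_wL: "integrable lborel (\<lambda>z. indicator {0..T} (fst z) * ((norm (w' z))\<^sup>2 * L (fst z)))"
proof (rule integrable_prodI[where g = "\<lambda>t. V * (indicator {0..T} t * L t)"])
  show "AE t in lborel. integrable lborel (\<lambda>x. indicator {0..T} (fst (t, x)) * ((norm (w' (t, x)))\<^sup>2 * L (fst (t, x)))) \<and>
      (LBINT x. indicator {0..T} (fst (t, x)) * ((norm (w' (t, x)))\<^sup>2 * L (fst (t, x)))) \<le> V * (indicator {0..T} t * L t)"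
    by (rule AE_slabI[of T]) (auto simp: h10_def mult_right_mono L_nonneg)
qed (use L_integrable L_nonneg in auto)

lemma compact_time_bound:
  fixes K :: "(real \<times> (real^'n)) set"
  assumes "compact K" "K \<subseteq> {0<..} \<times> \<Omega>"
  shows "\<exists>T. \<forall>z\<in>K. fst z \<in> {0..T}"
proof -
  have "compact (fst ` K)" by (intro compact_continuous_image assms continuous_intros)
  then obtain T where T: "\<And>t. t \<in> fst ` K \<Longrightarrow> \<bar>t\<bar> \<le> T" using compact_imp_bounded bounded_iff by (metis real_norm_def)
  have "fst z \<in> {0..T}" if "z \<in> K" for z using T[of "fst z"] that assms(2) by auto
  then show ?thesis by blast
qed

lemma locally_L2:
  assumes K: "compact K" "K \<subseteq> {0<..} \<times> \<Omega>"
  shows "integrable lborel (\<lambda>z. (norm (indicator K z *\<^sub>R w' z))\<^sup>2)" "integrable lborel (\<lambda>z. (norm (indicator K z *\<^sub>R D' z))\<^sup>2)"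
    "integrable lborel (\<lambda>z. indicator K z *\<^sub>R w' z)" "integrable lborel (\<lambda>z. indicator K z *\<^sub>R D' z)"
    "integrable lborel (\<lambda>z. indicator K z *\<^sub>R adv z)"
proof -
  obtain T where T: "\<And>z. z \<in> K \<Longrightarrow> fst z \<in> {0..T}" using compact_time_bound[OF K] by blast
  have [measurable]: "K \<in> sets borel" using compact_imp_closed[OF K(1)] by simp
  have iK: "integrable lborel (indicator K :: real \<times> (real^'n) \<Rightarrow> real)"
    using emeasure_compact_finite[OF K(1)] by (intro integrable_real_indicator) auto
  show w2: "integrable lborel (\<lambda>z. (norm (indicator K z *\<^sub>R w' z))\<^sup>2)"
    by (rule Bochner_Integration.integrable_bound[OF slab_w[of T]]) (use T in \<open>auto simp: indicator_def\<close>)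
  show D2: "integrable lborel (\<lambda>z. (norm (indicator K z *\<^sub>R D' z))\<^sup>2)"
    by (rule Bochner_Integration.integrable_bound[OF slab_D[of T]]) (use T in \<open>auto simp: indicator_def\<close>)
  have L1: "integrable lborel (\<lambda>z. indicator K z *\<^sub>R f z)"
    if [measurable]: "f \<in> borel_measurable borel" and f: "integrable lborel (\<lambda>z. (norm (indicator K z *\<^sub>R f z))\<^sup>2)"
    for f :: "real \<times> (real^'n) \<Rightarrow> 'c::euclidean_space"
  proof (rule Bochner_Integration.integrable_bound)
    show "integrable lborel (\<lambda>z. indicator K z + (norm (indicator K z *\<^sub>R f z))\<^sup>2)" using iK f by simp
    have "norm (indicator K z *\<^sub>R f z) \<le> indicator K z + (norm (indicator K z *\<^sub>R f z))\<^sup>2" for z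
      using norm_le_1_square[of "f z"] by (cases "z \<in> K") auto
    then show "AE z in lborel. norm (indicator K z *\<^sub>R f z) \<le> norm (indicator K z + (norm (indicator K z *\<^sub>R f z))\<^sup>2)"
      by (intro AE_I2) (auto intro: order_trans[OF _ abs_ge_self])
  qed measurable
  show "integrable lborel (\<lambda>z. indicator K z *\<^sub>R w' z)" by (rule L1[OF _ w2]) measurable
  show "integrable lborel (\<lambda>z. indicator K z *\<^sub>R D' z)" by (rule L1[OF _ D2]) measurable
  show "integrable lborel (\<lambda>z. indicator K z *\<^sub>R adv z)"
  proof (rule Bochner_Integration.integrable_bound)
    show "integrable lborel (\<lambda>z. (norm (indicator K z *\<^sub>R w' z))\<^sup>2 + (norm (indicator K z *\<^sub>R D' z))\<^sup>2)"
      using w2 D2 by simp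
    have "norm (indicator K z *\<^sub>R adv z) \<le> (norm (indicator K z *\<^sub>R w' z))\<^sup>2 + (norm (indicator K z *\<^sub>R D' z))\<^sup>2" for z
      using order_trans[OF norm_adv mult_norm_le_squares, of z] by (cases "z \<in> K") auto
    then show "AE z in lborel. norm (indicator K z *\<^sub>R adv z) \<le> norm ((norm (indicator K z *\<^sub>R w' z))\<^sup>2 + (norm (indicator K z *\<^sub>R D' z))\<^sup>2)"
      by (intro AE_I2) (auto intro: order_trans[OF _ abs_ge_self])
  qed measurable
qed

lemma Dj_integrable:
  assumes K: "compact K" "K \<subseteq> {0<..} \<times> \<Omega>"
  shows "integrable lborel (\<lambda>z. indicator K z *\<^sub>R D' z $ j)" "integrable lborel (\<lambda>z. (norm (indicator K z *\<^sub>R D' z $ j))\<^sup>2)"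
proof -
  have [measurable]: "K \<in> sets borel" using compact_imp_closed[OF K(1)] by simp
  have le: "norm (D' z $ j) \<le> norm (D' z)" for z by (rule Finite_Cartesian_Product.norm_nth_le)
  show "integrable lborel (\<lambda>z. indicator K z *\<^sub>R D' z $ j)"
    by (rule Bochner_Integration.integrable_bound[OF locally_L2(4)[OF K]]) (auto simp: le indicator_def)
  show "integrable lborel (\<lambda>z. (norm (indicator K z *\<^sub>R D' z $ j))\<^sup>2)"
    by (rule Bochner_Integration.integrable_bound[OF locally_L2(2)[OF K]]) (auto simp: le indicator_def intro!: power_mono)
qed

text \<open>A test function on space-time is a smooth function of \<open>x\<close> at each fixed time, so Fubini's theorem
  turns integration by parts on the slices into a weak derivative on space-time.\<close>

lemma space_wderiv: "wderiv ({0<..} \<times> \<Omega>) (0, axis j 1) (case_prod w) (\<lambda>z. D' z $ j)"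
  unfolding wderiv_def
proof (intro conjI allI impI)
  show "case_prod w \<in> borel_measurable borel" by (rule w_borel)
  show [measurable]: "(\<lambda>z. D' z $ j) \<in> borel_measurable borel" by measurable
  show "integrable lborel (\<lambda>z. indicator K z *\<^sub>R case_prod w z)" if "compact K" "K \<subseteq> {0<..} \<times> \<Omega>" for K
    using locally_L2(3)[OF that] by (simp add: case_prod_beta')
  show "integrable lborel (\<lambda>z. indicator K z *\<^sub>R D' z $ j)" if "compact K" "K \<subseteq> {0<..} \<times> \<Omega>" for K
    by (rule Dj_integrable(1)[OF that])
  fix \<phi> :: "real \<times> (real^'n) \<Rightarrow> real" assume \<phi>: "test_fun ({0<..} \<times> \<Omega>) \<phi>"
  let ?d = "\<lambda>z. fderiv \<phi> z (0, axis j 1)"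
  have d: "test_fun ({0<..} \<times> \<Omega>) ?d" by (rule test_fun_deriv[OF \<phi>])
  have i1: "integrable lborel (\<lambda>z. ?d z *\<^sub>R w' z)"
    by (rule test_fun_scaleR_integrable[OF d]) (use locally_L2(3) in auto)
  have i2: "integrable lborel (\<lambda>z. \<phi> z *\<^sub>R D' z $ j)"
    by (rule test_fun_scaleR_integrable[OF \<phi>]) (use Dj_integrable(1) in auto)
  have "(LBINT z. ?d z *\<^sub>R w' z) = - (LBINT z. \<phi> z *\<^sub>R D' z $ j)"
  proof (subst vector_eq_ldot[symmetric], intro allI)
    fix a :: "real^'n"
    have j1: "integrable lborel (\<lambda>z. ?d z * (w' z \<bullet> a))" using integrable_inner_left[OF i1, of a] by simp
    have j2: "integrable lborel (\<lambda>z. \<phi> z * (D' z $ j \<bullet> a))" using integrable_inner_left[OF i2, of a] by simp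
    have "a \<bullet> (LBINT z. ?d z *\<^sub>R w' z) = (LBINT z. ?d z * (w' z \<bullet> a))"
      using integral_inner_left[OF i1, where c = a] by (simp add: inner_commute[of a])
    also have "\<dots> = (LBINT t. (LBINT x. ?d (t, x) * (w t x \<bullet> a)))" using integral_prod(1)[OF j1] by simp
    also have "\<dots> = (LBINT t. - (LBINT x. \<phi> (t, x) * (D t x $ j \<bullet> a)))"
    proof (rule integral_cong_AE)
      show "AE t in lborel. (LBINT x. ?d (t, x) * (w t x \<bullet> a)) = - (LBINT x. \<phi> (t, x) * (D t x $ j \<bullet> a))"
        using w_h10
      proof eventually_elim
        case (elim t)
        show ?case
        proof (cases "0 < t")
          case True
          have "((\<lambda>x. (t, x)) has_derivative (\<lambda>h. (0, h))) (at x)" for x :: "real^'n"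
            by (auto intro!: derivative_eq_intros)
          from has_derivative_compose[OF this test_fun_has_derivative[OF \<phi>]]
          have h: "((\<lambda>x. \<phi> (t, x)) has_derivative (\<lambda>h. fderiv \<phi> (t, x) (0, h))) (at x)" for x .
          have c: "continuous_on UNIV (\<lambda>x. fderiv \<phi> (t, x) (0, axis j 1))"
            by (intro continuous_on_compose2[OF test_fun_continuous[OF d]] continuous_intros) auto
          show ?thesis using elim True by (intro h10_by_parts[OF _ dom(2) h c]) simp
        next
          case False
          then have n: "(t, x) \<notin> {0<..} \<times> \<Omega>" for x by simp
          show ?thesis using test_fun_support[OF d n] test_fun_support[OF \<phi> n] by simp
        qed
      qed
    qed (use integral_prod(4)[OF j1] integral_prod(4)[OF j2] in auto)
    also have "\<dots> = - (LBINT z. \<phi> z * (D' z $ j \<bullet> a))" using integral_prod(1)[OF j2] by simp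
    also have "\<dots> = a \<bullet> - (LBINT z. \<phi> z *\<^sub>R D' z $ j)"
      using integral_inner_left[OF i2, where c = a] by (simp add: inner_commute[of a])
    finally show "a \<bullet> (LBINT z. ?d z *\<^sub>R w' z) = a \<bullet> - (LBINT z. \<phi> z *\<^sub>R D' z $ j)" .
  qed
  then show "(LBINT z. ?d z *\<^sub>R case_prod w z) = - (LBINT z. \<phi> z *\<^sub>R D' z $ j)"
    by (simp add: case_prod_beta')
qed

end

context kinetic
begin

text \<open>The mass equation tested with a mollified and truncated kinetic energy density. The scale
  of the mollification tends to zero first; only \<open>w\<^sub>t \<in> L\<^sub>1\<^sub>,\<^sub>l\<^sub>o\<^sub>c\<close> is available there, which is why the
  gradient of the truncation has to be bounded.\<close>

lemma localized_balance:
  assumes \<Phi>: "test_fun ({0<..} \<times> \<Omega>) \<Phi>" and N: "1 \<le> N"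
  shows "(LBINT z. r' z * fderiv \<Phi> z (1, w' z) * trunc N (w' z)
      + r' z * \<Phi> z * ((damp N (w' z))\<^sup>2 * (w' z \<bullet> (wt' z + adv z)))) = 0"
proof -
  let ?U = "({0<..} :: real set) \<times> \<Omega>"
  have U: "open ?U" using dom(1) by (intro open_Times open_greaterThan)
  obtain K where K: "compact K" "K \<subseteq> ?U" "\<And>z. z \<notin> K \<Longrightarrow> \<Phi> z = 0" using \<Phi> by (auto simp: test_fun_def)
  have DK: "fderiv \<Phi> z h = 0" if "z \<notin> K" for z h
    using frechet_derivative_outside_support(2)[OF compact_imp_closed[OF K(1)] K(3) that] by simp
  obtain K' e where K': "compact K'" "K' \<subseteq> ?U" "0 < e" "\<forall>z\<in>K. cball z e \<subseteq> K'"
    using compact_thickening[OF K(1,2) U] by blast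
  have KK': "z \<in> K'" if "z \<in> K" for z
    using subsetD[OF bspec[OF K'(4) that], of z] K'(3) by simp
  have K'b[measurable]: "K' \<in> sets borel" using compact_imp_closed[OF K'(1)] by simp
  obtain A where A: "0 < A" "\<And>z. \<bar>\<Phi> z\<bar> \<le> A" using test_fun_bounded[OF \<Phi>] by auto
  define X where "X z = indicator K' z *\<^sub>R case_prod w z" for z
  define Y where "Y z = indicator K' z *\<^sub>R case_prod wt z" for z
  define Z where "Z j z = indicator K' z *\<^sub>R D' z $ j" for j z
  have X: "integrable lborel X" and Y: "integrable lborel Y"
    using wt_weak K'(1,2) unfolding wderiv_def X_def Y_def by blast+
  have X2: "integrable lborel (\<lambda>z. (norm (X z))\<^sup>2)"
    using locally_L2(1)[OF K'(1,2)] by (simp add: X_def case_prod_beta')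
  have Z: "integrable lborel (Z j)" and Z2: "integrable lborel (\<lambda>z. (norm (Z j z))\<^sup>2)" for j
    using Dj_integrable[OF K'(1,2), of j] by (simp_all add: Z_def[abs_def])
  let ?k = "\<lambda>n. inverse (real (Suc n)) * e"
  have k: "0 < ?k n" "?k \<longlonglongrightarrow> 0" for n
    using K'(3) tendsto_mult_left_zero[OF LIMSEQ_inverse_real_of_nat] by auto
  obtain \<sigma> :: "nat \<Rightarrow> nat" where \<sigma>: "strict_mono \<sigma>" "AE z in lborel. (\<lambda>n. conv (mollifier (?k (\<sigma> n))) X z) \<longlonglongrightarrow> X z"
    using mollifier_AE_subseq[OF X k] by blast
  define \<kappa> where "\<kappa> n = ?k (\<sigma> n)" for n
  have \<kappa>: "0 < \<kappa> n" "\<kappa> n \<le> e" "\<kappa> \<longlonglongrightarrow> 0" for n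
  proof -
    show "0 < \<kappa> n" unfolding \<kappa>_def by (rule k)
    show "\<kappa> n \<le> e" using K'(3) by (simp add: \<kappa>_def field_simps)
    show "\<kappa> \<longlonglongrightarrow> 0" using LIMSEQ_subseq_LIMSEQ[OF k(2) \<sigma>(1)] by (simp add: \<kappa>_def[abs_def] o_def)
  qed
  have cb: "cball z (\<kappa> n) \<subseteq> K'" if "z \<in> K" for z n
    using K'(4) that \<kappa>(2)[of n] subset_cball[of "\<kappa> n" e z] by blast
  note m = test_fun_mollifier[OF \<kappa>(1), where 'a = "real \<times> (real^'n)"]
  define W where "W n = conv (mollifier (\<kappa> n)) X" for n
  define Wt where "Wt n = conv (mollifier (\<kappa> n)) Y" for n
  define WD where "WD n j = conv (mollifier (\<kappa> n)) (Z j)" for n j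
  have Wd: "(W n has_derivative fderiv (W n) z) (at z)" for n z
    unfolding W_def by (rule Ck_on_Suc_has_derivative[OF Ck_on_conv[OF m X]])
  have Wdir: "fderiv (W n) z (1, w' z) = Wt n z + (\<Sum>j\<in>UNIV. (w' z $ j) *\<^sub>R WD n j z)"
    if z: "z \<in> K" for n z
  proof -
    have lin: "linear (fderiv (W n) z)" by (rule has_derivative_linear[OF Wd])
    have "(1, w' z) = (1, 0) + (\<Sum>j\<in>UNIV. (w' z $ j) *\<^sub>R (0 :: real, axis j 1 :: real^'n))"
    proof (rule prod_eqI)
      show "snd (1 :: real, w' z) = snd ((1, 0) + (\<Sum>j\<in>UNIV. (w' z $ j) *\<^sub>R (0 :: real, axis j 1 :: real^'n)))"
        using real_vec_expand[of "w' z"] by (simp add: snd_sum)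
    qed (simp add: fst_sum)
    then have "fderiv (W n) z (1, w' z)
      = fderiv (W n) z (1, 0) + (\<Sum>j\<in>UNIV. (w' z $ j) *\<^sub>R fderiv (W n) z (0, axis j 1))"
      by (simp only: linear_add[OF lin] linear_sum[OF lin] linear_cmul[OF lin])
    moreover have "fderiv (W n) z (1, 0) = Wt n z"
      unfolding W_def Wt_def X_def[abs_def] Y_def[abs_def] by (rule wderiv_conv[OF wt_weak K'(1,2) \<kappa>(1) cb[OF z]])
    moreover have "fderiv (W n) z (0, axis j 1) = WD n j z" for j
      unfolding W_def WD_def X_def[abs_def] Z_def[abs_def] by (rule wderiv_conv[OF space_wderiv K'(1,2) \<kappa>(1) cb[OF z]])
    ultimately show ?thesis by simp
  qed
  define \<phi> where "\<phi> n z = \<Phi> z * trunc N (W n z)" for n z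
  have t\<phi>: "test_fun ?U (\<phi> n)" for n
  proof -
    have "Ck_on i UNIV (W n)" for i unfolding W_def by (rule Ck_on_conv[OF m X])
    then have "Ck_on i UNIV (\<phi> n)" for i unfolding \<phi>_def[abs_def]
      by (intro Ck_on_mult test_fun_Ck[OF \<Phi>] Ck_on_trunc[OF N])
    then show ?thesis unfolding test_fun_def smooth_on_def using K
      by (intro conjI exI[of _ K] allI impI) (auto simp: \<phi>_def)
  qed
  have D\<phi>: "fderiv (\<phi> n) z h = \<Phi> z * ((damp N (W n z))\<^sup>2 * (W n z \<bullet> fderiv (W n) z h))
      + fderiv \<Phi> z h * trunc N (W n z)" for n z h
  proof -
    have "((\<lambda>z. trunc N (W n z)) has_derivative (\<lambda>h. (damp N (W n z))\<^sup>2 * (W n z \<bullet> fderiv (W n) z h))) (at z)"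
      by (rule has_derivative_compose[OF Wd trunc_has_derivative[OF N]])
    from has_derivative_mult[OF test_fun_has_derivative[OF \<Phi>] this]
    have "(\<phi> n has_derivative (\<lambda>h. \<Phi> z * ((damp N (W n z))\<^sup>2 * (W n z \<bullet> fderiv (W n) z h))
      + fderiv \<Phi> z h * trunc N (W n z))) (at z)" by (simp only: \<phi>_def[abs_def])
    then show ?thesis by (simp flip: frechet_derivative_at)
  qed
  have Wm[measurable]: "W n \<in> borel_measurable borel" "Wt n \<in> borel_measurable borel" "WD n j \<in> borel_measurable borel" for n j
    unfolding W_def Wt_def WD_def using conv_measurable[OF m X] conv_measurable[OF m Y] conv_measurable[OF m Z] by auto
  have [measurable]: "X \<in> borel_measurable borel" "Y \<in> borel_measurable borel" "Z j \<in> borel_measurable borel" for j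
    using X Y Z by auto
  have [measurable]: "damp N \<in> borel_measurable (borel :: (real^'n) measure)" "trunc N \<in> borel_measurable (borel :: (real^'n) measure)"
    unfolding damp_def[abs_def] trunc_def[abs_def] by measurable
  note [measurable] = test_fun_deriv_measurable[OF \<Phi>] test_fun_measurable[OF \<Phi>]
  define c where "c z = r' z * \<Phi> z" for z
  have c: "\<bar>c z\<bar> \<le> M * A" for z unfolding c_def abs_mult using r_bound A M_nonneg by (intro mult_mono) auto
  have [measurable]: "c \<in> borel_measurable borel" unfolding c_def[abs_def] by measurable
  define Q where "Q z = Y z + indicator K' z *\<^sub>R adv z" for z
  have Q: "integrable lborel Q" unfolding Q_def using Y locally_L2(5)[OF K'(1,2)] by simp
  have [measurable]: "Q \<in> borel_measurable borel" using Q by auto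
  define E where "E n z = (Wt n z - Y z) + (\<Sum>j\<in>UNIV. (X z \<bullet> axis j 1) *\<^sub>R (WD n j z - Z j z))" for n z
  have [measurable]: "E n \<in> borel_measurable borel" for n unfolding E_def[abs_def] by measurable
  define P where "P n z = r' z * fderiv \<Phi> z (1, w' z) * trunc N (W n z)
      + c z * ((damp N (W n z))\<^sup>2 * (W n z \<bullet> Q z))" for n z
  define H where "H n z = c z * ((damp N (W n z))\<^sup>2 * (W n z \<bullet> E n z))" for n z
  have split: "r' z * fderiv (\<phi> n) z (1, w' z) = P n z + H n z" for n z
  proof (cases "z \<in> K")
    case True
    have "Q z + E n z = Wt n z + (\<Sum>j\<in>UNIV. (w' z $ j) *\<^sub>R WD n j z)"
      using KK'[OF True] by (simp add: Q_def E_def X_def Y_def Z_def adv_def case_prod_beta' inner_axis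
          scaleR_diff_right sum_subtractf)
    then have "fderiv (W n) z (1, w' z) = Q z + E n z" by (simp add: Wdir[OF True])
    then show ?thesis by (simp add: D\<phi> P_def H_def c_def inner_add_right algebra_simps)
  qed (simp add: D\<phi> P_def H_def c_def K(3) DK)
  have dW: "\<bar>(damp N y)\<^sup>2 * (y \<bullet> q)\<bar> \<le> N * norm q" for y q :: "real^'n"
  proof -
    have "\<bar>(damp N y)\<^sup>2 * (y \<bullet> q)\<bar> \<le> (damp N y)\<^sup>2 * (norm y * norm q)"
      unfolding abs_mult using Cauchy_Schwarz_ineq2[of y q] by (simp add: mult_left_mono)
    also have "\<dots> = ((damp N y)\<^sup>2 * norm y) * norm q" by simp
    also have "\<dots> \<le> N * norm q" using trunc_facts(7)[OF N] by (intro mult_right_mono) auto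
    finally show ?thesis .
  qed
  have cdW: "\<bar>c z * ((damp N y)\<^sup>2 * (y \<bullet> q))\<bar> \<le> (M * A * N) * norm q" for z and y q :: "real^'n"
  proof -
    have "\<bar>c z\<bar> * \<bar>(damp N y)\<^sup>2 * (y \<bullet> q)\<bar> \<le> (M * A) * (N * norm q)"
      by (rule mult_mono[OF c dW]) (use M_nonneg A(1) in auto)
    then show ?thesis by (simp add: abs_mult mult.assoc)
  qed
  have \<Phi>w: "test_fun ({0<..} \<times> UNIV) \<Phi>" by (rule test_fun_mono[OF \<Phi>]) auto
  note fi = flux_integrable[OF \<Phi>w]
  define G where "G z = N * \<bar>r' z * fderiv \<Phi> z (1, w' z)\<bar> + (M * A * N) * norm (Q z)" for z
  have G: "integrable lborel G" unfolding G_def using fi Q by simp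
  have PG: "norm (P n z) \<le> G z" for n z
  proof -
    have "\<bar>r' z * fderiv \<Phi> z (1, w' z) * trunc N (W n z)\<bar> \<le> \<bar>r' z * fderiv \<Phi> z (1, w' z)\<bar> * N"
      unfolding abs_mult[of _ "trunc N (W n z)"] using trunc_facts(4,5)[OF N, of "W n z"] by (intro mult_left_mono) auto
    then show ?thesis unfolding P_def G_def real_norm_def
      using cdW[of z "W n z" "Q z"] by (simp add: mult.commute[of N])
  qed
  have Pi: "integrable lborel (P n)" for n
  proof (rule Bochner_Integration.integrable_bound[OF G])
    have "norm (P n z) \<le> norm (G z)" for z using order_trans[OF PG[of n z] abs_ge_self] by simp
    then show "AE z in lborel. norm (P n z) \<le> norm (G z)" by simp
  qed (simp add: P_def[abs_def])
  have dc: "continuous_on UNIV (damp N :: real^'n \<Rightarrow> real)"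
  proof -
    have "N + y \<bullet> y / 2 \<noteq> 0" for y :: "real^'n" using N inner_ge_zero[of y] by (smt (verit) divide_nonneg_pos)
    then show ?thesis unfolding damp_def[abs_def] by (intro continuous_intros) auto
  qed
  then have tc: "continuous_on UNIV (trunc N :: real^'n \<Rightarrow> real)" unfolding trunc_def[abs_def] by (intro continuous_intros)
  define P' where "P' z = r' z * fderiv \<Phi> z (1, w' z) * trunc N (w' z)
      + r' z * \<Phi> z * ((damp N (w' z))\<^sup>2 * (w' z \<bullet> (wt' z + adv z)))" for z
  have Plim: "(\<lambda>n. LBINT z. P n z) \<longlonglongrightarrow> (LBINT z. P' z)"
  proof (rule integral_dominated_convergence[OF _ _ G])
    show "AE z in lborel. (\<lambda>n. P n z) \<longlonglongrightarrow> P' z"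
      using \<sigma>(2)
    proof eventually_elim
      case (elim z)
      show ?case
      proof (cases "z \<in> K")
        case True
        have XQ: "X z = w' z" "Q z = wt' z + adv z"
          using KK'[OF True] by (auto simp: X_def Q_def Y_def case_prod_beta')
        have Wl: "(\<lambda>n. W n z) \<longlonglongrightarrow> w' z" using elim XQ(1) by (simp add: W_def \<kappa>_def)
        have d: "(\<lambda>n. damp N (W n z)) \<longlonglongrightarrow> damp N (w' z)"
          by (rule isCont_tendsto_compose[OF _ Wl]) (use dc in \<open>simp add: continuous_on_eq_continuous_at\<close>)
        have t: "(\<lambda>n. trunc N (W n z)) \<longlonglongrightarrow> trunc N (w' z)"
          by (rule isCont_tendsto_compose[OF _ Wl]) (use tc in \<open>simp add: continuous_on_eq_continuous_at\<close>)
        show ?thesis unfolding P_def P'_def c_def XQ(2) by (intro tendsto_intros d t Wl)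
      qed (simp add: P_def P'_def c_def K(3) DK)
    qed
    show "AE z in lborel. norm (P n z) \<le> G z" for n using PG by simp
  qed (auto simp: P'_def[abs_def] P_def[abs_def])
  \<comment> \<open>convergence of the mollified derivatives; the products \<open>w\<^sub>j \<partial>\<^sub>j w\<close> need the uniform square bound\<close>
  have L1t: "(\<lambda>n. LBINT z. norm (Wt n z - Y z)) \<longlonglongrightarrow> 0" and it: "integrable lborel (\<lambda>z. Wt n z - Y z)" for n
    unfolding Wt_def using mollifier_L1[OF Y \<kappa>(1,3)] by auto
  have pair: "integrable lborel (\<lambda>z. norm (X z) * norm (WD n j z - Z j z))"
      "(\<lambda>n. LBINT z. norm (X z) * norm (WD n j z - Z j z)) \<longlonglongrightarrow> 0" for n j
  proof -
    have b1: "integrable lborel (\<lambda>z. WD n j z - Z j z)" for n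
      unfolding WD_def by (rule mollifier_L1(1)[OF Z \<kappa>(1,3)])
    have b1l: "(\<lambda>n. LBINT z. norm (WD n j z - Z j z)) \<longlonglongrightarrow> 0"
      unfolding WD_def by (rule mollifier_L1(2)[OF Z \<kappa>(1,3)])
    have WD2: "integrable lborel (\<lambda>z. (norm (WD n j z))\<^sup>2)" "(LBINT z. (norm (WD n j z))\<^sup>2) \<le> (LBINT z. (norm (Z j z))\<^sup>2)" for n
      unfolding WD_def by (rule conv_L2[OF m Z mollifier_nonneg[OF \<kappa>(1)] mollifier_integral[OF \<kappa>(1)] Z2])+
    have b2: "integrable lborel (\<lambda>z. (norm (WD n j z - Z j z))\<^sup>2)" for n
      by (rule L2_diff[OF _ _ WD2(1) Z2]) auto
    have bB: "(LBINT z. (norm (WD n j z - Z j z))\<^sup>2) \<le> 4 * (LBINT z. (norm (Z j z))\<^sup>2)" for n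
    proof -
      have "(LBINT z. (norm (WD n j z - Z j z))\<^sup>2) \<le> (LBINT z. 2 * (norm (WD n j z))\<^sup>2 + 2 * (norm (Z j z))\<^sup>2)"
        using b2 WD2(1) Z2 norm_diff_square_le by (intro integral_mono) auto
      also have "\<dots> = 2 * (LBINT z. (norm (WD n j z))\<^sup>2) + 2 * (LBINT z. (norm (Z j z))\<^sup>2)" using WD2(1) Z2 by simp
      finally show ?thesis using WD2(2)[of n] by linarith
    qed
    have Xm: "X \<in> borel_measurable lborel" by simp
    show "integrable lborel (\<lambda>z. norm (X z) * norm (WD n j z - Z j z))"
      "(\<lambda>n. LBINT z. norm (X z) * norm (WD n j z - Z j z)) \<longlonglongrightarrow> 0"
      by (rule L2_L1_pairing[OF Xm X2 b1 b2 bB b1l])+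
  qed
  define S where "S n z = norm (Wt n z - Y z) + (\<Sum>j\<in>UNIV. norm (X z) * norm (WD n j z - Z j z))" for n z
  have Si: "integrable lborel (S n)" for n unfolding S_def[abs_def] using it pair(1) by auto
  have ES: "norm (E n z) \<le> S n z" for n z
  proof -
    have "norm (E n z) \<le> norm (Wt n z - Y z) + (\<Sum>j\<in>UNIV. norm ((X z \<bullet> axis j 1) *\<^sub>R (WD n j z - Z j z)))"
      unfolding E_def by (intro order_trans[OF norm_triangle_ineq] add_mono norm_sum order_refl)
    also have "\<dots> \<le> S n z" unfolding S_def norm_scaleR
    proof (intro add_mono sum_mono mult_right_mono order_refl)
      show "\<bar>X z \<bullet> axis j 1\<bar> \<le> norm (X z)" for j using Basis_le_norm[of "axis j 1" "X z"] by simp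
    qed simp
    finally show ?thesis .
  qed
  have HS: "norm (H n z) \<le> (M * A * N) * S n z" for n z
  proof -
    have "norm (H n z) \<le> (M * A * N) * norm (E n z)" unfolding H_def real_norm_def by (rule cdW)
    also have "\<dots> \<le> (M * A * N) * S n z" using ES M_nonneg A(1) N by (intro mult_left_mono) auto
    finally show ?thesis .
  qed
  have Hi: "integrable lborel (H n)" for n
  proof (rule Bochner_Integration.integrable_bound)
    show "integrable lborel (\<lambda>z. (M * A * N) * S n z)" using Si by simp
    have "norm (H n z) \<le> norm ((M * A * N) * S n z)" for z using order_trans[OF HS[of n z] abs_ge_self] by simp
    then show "AE z in lborel. norm (H n z) \<le> norm ((M * A * N) * S n z)" by simp
  qed (simp add: H_def[abs_def])
  have "(\<lambda>n. LBINT z. S n z) \<longlonglongrightarrow> 0 + (\<Sum>j\<in>(UNIV::'n set). 0)"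
  proof -
    have "(LBINT z. S n z) = (LBINT z. norm (Wt n z - Y z)) + (\<Sum>j\<in>UNIV. LBINT z. norm (X z) * norm (WD n j z - Z j z))" for n
      unfolding S_def using it pair(1) by simp
    then show ?thesis by (simp only:) (intro tendsto_add tendsto_sum L1t pair(2))
  qed
  then have Sl: "(\<lambda>n. (M * A * N) * (LBINT z. S n z)) \<longlonglongrightarrow> 0" by (intro tendsto_mult_right_zero) simp
  have Hl: "(\<lambda>n. LBINT z. H n z) \<longlonglongrightarrow> 0"
  proof (rule Lim_null_comparison[OF always_eventually Sl], intro allI)
    fix n
    have "norm (LBINT z. H n z) \<le> (LBINT z. norm (H n z))" by (rule integral_norm_bound)
    also have "\<dots> \<le> (LBINT z. (M * A * N) * S n z)" using Hi Si HS by (intro integral_mono) auto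
    finally show "norm (LBINT z. H n z) \<le> (M * A * N) * (LBINT z. S n z)" by simp
  qed
  have "(LBINT z. P n z) + (LBINT z. H n z) = 0" for n
    using mass[OF t\<phi>[of n]] Pi Hi by (simp add: split)
  then have "(LBINT z. P' z) + 0 = 0"
    using LIMSEQ_unique[OF tendsto_add[OF Plim Hl]] tendsto_const[of "0::real"] by auto
  then show ?thesis by (simp add: P'_def)
qed

text \<open>Removing the cutoff and the truncation at the same time. The boundary layer contributes at
  most \<open>\<bar>w\<bar>\<^sup>2 L\<close>, by the linear decay of \<open>w\<close> at the boundary.\<close>

theorem energy_balance:
  assumes \<eta>: "test_fun {0<..} (\<eta> :: real \<Rightarrow> real)"
  shows "integrable lborel (\<lambda>z. fderiv \<eta> (fst z) 1 * (r' z * (norm (w' z))\<^sup>2))"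
    and "integrable lborel (\<lambda>z. \<eta> (fst z) * (r' z * (w' z \<bullet> (wt' z + adv z))))"
    and "(LBINT z. fderiv \<eta> (fst z) 1 * (r' z * (norm (w' z))\<^sup>2))
      = - 2 * (LBINT z. \<eta> (fst z) * (r' z * (w' z \<bullet> (wt' z + adv z))))"
proof -
  obtain T where T: "\<And>\<tau>. \<tau> \<notin> {0..T} \<Longrightarrow> \<eta> \<tau> = 0 \<and> (\<forall>h. fderiv \<eta> \<tau> h = 0)"
    using test_fun_real_support[OF \<eta>] by blast
  obtain A where A: "0 < A" "\<And>\<tau>. \<bar>\<eta> \<tau>\<bar> \<le> A" using test_fun_bounded[OF \<eta>] by auto
  obtain B where B: "0 < B" "\<And>\<tau>. \<bar>fderiv \<eta> \<tau> 1\<bar> \<le> B"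
    using test_fun_deriv_bounded[OF \<eta>] by (metis abs_1 mult.right_neutral real_norm_def)
  obtain C where C: "0 < C" "AE z in lborel. \<forall>\<kappa>>0. 0 < fst z \<longrightarrow>
     \<bar>fderiv (cutoff \<Omega> \<kappa>) (snd z) (w' z)\<bar> \<le> C * L (fst z)"
    using cutoff_flow_bound by blast
  define \<kappa> where "\<kappa> k = inverse (real (Suc k))" for k
  have \<kappa>: "0 < \<kappa> k" for k by (simp add: \<kappa>_def)
  let ?\<zeta> = "\<lambda>k. cutoff \<Omega> (\<kappa> k)" and ?N = "\<lambda>k. real (Suc k)" and ?d = "\<lambda>\<tau>. fderiv \<eta> \<tau> 1"
  note t\<zeta> = test_fun_cutoff[OF dom(1,2) \<kappa>]
  note [measurable] = test_fun_measurable[OF \<eta>] test_fun_measurable[OF test_fun_deriv[OF \<eta>]]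
    test_fun_measurable[OF t\<zeta>] test_fun_deriv_measurable[OF t\<zeta>]
  have [measurable]: "damp N \<in> borel_measurable (borel :: (real^'n) measure)" "trunc N \<in> borel_measurable (borel :: (real^'n) measure)" for N
    unfolding damp_def[abs_def] trunc_def[abs_def] by measurable
  define G0 where "G0 z = indicator {0..T} (fst z) * (norm (w' z))\<^sup>2" for z
  define G1 where "G1 z = indicator {0..T} (fst z) * ((norm (w' z))\<^sup>2 * L (fst z))" for z
  define G2 where "G2 z = \<bar>r' z\<bar> * (norm (wt' z))\<^sup>2" for z
  have G: "integrable lborel G0" "integrable lborel G1" "integrable lborel G2"
    unfolding G0_def[abs_def] G1_def[abs_def] G2_def[abs_def] by (rule slab_w slab_wL r_wt)+
  have Gp: "0 \<le> G0 z" "0 \<le> G1 z" "0 \<le> G2 z" for z using L_nonneg by (auto simp: G0_def G1_def G2_def)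
  define F0 where "F0 z = ?d (fst z) * (r' z * ((norm (w' z))\<^sup>2))" for z
  define F1 where "F1 z = \<eta> (fst z) * (r' z * (w' z \<bullet> (wt' z + adv z)))" for z
  have DL: "AE z in lborel. 0 < fst z \<longrightarrow> norm (D' z) \<le> L (fst z)"
    by (rule AE_prodI) (use D_bound in \<open>auto elim!: eventually_mono\<close>)
  have b0: "\<bar>?d (fst z) * (r' z * (c * (norm (w' z))\<^sup>2))\<bar> \<le> (B * M) * G0 z" if "0 \<le> c" "c \<le> 1" for z c
  proof (cases "fst z \<in> {0..T}")
    case True
    have "c * (norm (w' z))\<^sup>2 \<le> 1 * (norm (w' z))\<^sup>2" using that by (intro mult_right_mono) auto
    then have "\<bar>?d (fst z)\<bar> * (\<bar>r' z\<bar> * (c * (norm (w' z))\<^sup>2)) \<le> B * (M * (norm (w' z))\<^sup>2)"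
      using B r_bound M_nonneg that by (intro mult_mono) auto
    then show ?thesis using True that by (simp add: G0_def abs_mult mult.assoc)
  qed (use T Gp B(1) M_nonneg in simp)
  have b1: "\<bar>\<eta> (fst z) * (c * (r' z * (w' z \<bullet> (wt' z + adv z))))\<bar> \<le> A * (M * G0 z + G2 z + M * G1 z)"
    if c: "0 \<le> c" "c \<le> 1" and z: "0 < fst z" "norm (D' z) \<le> L (fst z)" for z c
  proof (cases "fst z \<in> {0..T}")
    case True
    have "\<bar>w' z \<bullet> (wt' z + adv z)\<bar> \<le> norm (w' z) * norm (wt' z + adv z)" by (rule Cauchy_Schwarz_ineq2)
    also have "\<dots> \<le> norm (w' z) * (norm (wt' z) + norm (w' z) * L (fst z))"
    proof (rule mult_left_mono)
      have "norm (adv z) \<le> norm (w' z) * L (fst z)"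
        using norm_adv[of z] mult_left_mono[OF z(2) norm_ge_zero[of "w' z"]] by linarith
      then show "norm (wt' z + adv z) \<le> norm (wt' z) + norm (w' z) * L (fst z)"
        using norm_triangle_ineq[of "wt' z" "adv z"] by linarith
    qed simp
    also have "\<dots> \<le> (norm (w' z))\<^sup>2 + (norm (wt' z))\<^sup>2 + (norm (w' z))\<^sup>2 * L (fst z)"
      using mult_norm_le_squares[of "w' z" "wt' z"] by (simp add: distrib_left power2_eq_square)
    finally have 1: "\<bar>w' z \<bullet> (wt' z + adv z)\<bar> \<le> (norm (w' z))\<^sup>2 + (norm (wt' z))\<^sup>2 + (norm (w' z))\<^sup>2 * L (fst z)" .
    have "\<bar>r' z\<bar> * \<bar>w' z \<bullet> (wt' z + adv z)\<bar> \<le> \<bar>r' z\<bar> * ((norm (w' z))\<^sup>2 + (norm (wt' z))\<^sup>2 + (norm (w' z))\<^sup>2 * L (fst z))"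
      using 1 by (rule mult_left_mono) simp
    also have "\<dots> = \<bar>r' z\<bar> * G0 z + G2 z + \<bar>r' z\<bar> * G1 z"
      using True by (simp add: G0_def G1_def G2_def distrib_left)
    also have "\<dots> \<le> M * G0 z + G2 z + M * G1 z"
      using r_bound Gp by (intro add_mono mult_right_mono order_refl) auto
    finally have 2: "\<bar>r' z\<bar> * \<bar>w' z \<bullet> (wt' z + adv z)\<bar> \<le> M * G0 z + G2 z + M * G1 z" .
    then have "c * (\<bar>r' z\<bar> * \<bar>w' z \<bullet> (wt' z + adv z)\<bar>) \<le> 1 * (M * G0 z + G2 z + M * G1 z)"
      using c by (intro mult_mono) auto
    then have "\<bar>\<eta> (fst z)\<bar> * (c * (\<bar>r' z\<bar> * \<bar>w' z \<bullet> (wt' z + adv z)\<bar>)) \<le> A * (M * G0 z + G2 z + M * G1 z)"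
      using A c by (intro mult_mono) auto
    then show ?thesis using c by (simp add: abs_mult)
  qed (use T Gp A(1) M_nonneg in simp)
  have F0m: "F0 \<in> borel_measurable borel" unfolding F0_def[abs_def] by measurable
  have F1m: "F1 \<in> borel_measurable borel" unfolding F1_def[abs_def] by measurable
  have iF0: "integrable lborel F0"
  proof (rule Bochner_Integration.integrable_bound)
    show "integrable lborel (\<lambda>z. (B * M) * G0 z)" using G by simp
    have "norm (F0 z) \<le> norm ((B * M) * G0 z)" for z
      using order_trans[OF b0[of 1 z] abs_ge_self] by (simp only: F0_def real_norm_def mult_1_left order_refl zero_le_one simp_thms)
    then show "AE z in lborel. norm (F0 z) \<le> norm ((B * M) * G0 z)" by simp
  qed (use F0m in simp)
  have posz: "AE z in lborel. fst z \<noteq> (0::real)" for z :: "real \<times> (real^'n)"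
    by (rule AE_prodI) (use AE_pos in \<open>auto elim!: eventually_mono\<close>)
  have neg: "\<eta> \<tau> = 0 \<and> ?d \<tau> = 0" if "\<not> 0 < \<tau>" for \<tau>
    using that test_fun_support[OF \<eta>, of \<tau>] test_fun_support[OF test_fun_deriv[OF \<eta>], of \<tau> 1] by auto
  have iF1: "integrable lborel F1"
  proof (rule Bochner_Integration.integrable_bound[of _ "\<lambda>z. A * (M * G0 z + G2 z + M * G1 z)"])
    show "AE z in lborel. norm (F1 z) \<le> norm (A * (M * G0 z + G2 z + M * G1 z))"
      using DL
    proof eventually_elim
      case (elim z)
      have p: "0 \<le> A * (M * G0 z + G2 z + M * G1 z)" using A(1) M_nonneg Gp by (intro mult_nonneg_nonneg add_nonneg_nonneg) auto
      show ?case using elim neg[of "fst z"] b1[of 1 z] p by (cases "0 < fst z") (auto simp: F1_def)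
    qed
  qed (use G F1m in auto)
  define J where "J k z = r' z * fderiv (\<lambda>z. \<eta> (fst z) * ?\<zeta> k (snd z)) z (1, w' z) * trunc (?N k) (w' z)
      + r' z * (\<eta> (fst z) * ?\<zeta> k (snd z)) * ((damp (?N k) (w' z))\<^sup>2 * (w' z \<bullet> (wt' z + adv z)))" for k z
  have J0: "(LBINT z. J k z) = 0" for k
    unfolding J_def by (rule localized_balance[OF test_fun_tensor(1)[OF \<eta> t\<zeta>]]) simp
  have Je: "J k z = \<eta> (fst z) * (r' z * (fderiv (?\<zeta> k) (snd z) (w' z) * trunc (?N k) (w' z)))
      + ?d (fst z) * (r' z * ((?\<zeta> k (snd z) * damp (?N k) (w' z) / 2) * (norm (w' z))\<^sup>2))
      + \<eta> (fst z) * ((?\<zeta> k (snd z) * (damp (?N k) (w' z))\<^sup>2) * (r' z * (w' z \<bullet> (wt' z + adv z))))" for k z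
    unfolding J_def test_fun_tensor(2)[OF \<eta> t\<zeta>]
    by (simp add: trunc_facts(3) power2_norm_eq_inner algebra_simps)
  have Jm[measurable]: "J k \<in> borel_measurable borel" for k
    unfolding Je[abs_def] by measurable
  have "(\<lambda>k. LBINT z. J k z) \<longlonglongrightarrow> (LBINT z. F0 z / 2 + F1 z)"
  proof (rule integral_dominated_convergence)
    show "integrable lborel (\<lambda>z. (A * M * C) * G1 z + (B * M) * G0 z + A * (M * G0 z + G2 z + M * G1 z))" using G by simp
    show "AE z in lborel. (\<lambda>k. J k z) \<longlonglongrightarrow> F0 z / 2 + F1 z"
    proof (intro AE_I2)
      fix z
      show "(\<lambda>k. J k z) \<longlonglongrightarrow> F0 z / 2 + F1 z"
      proof (cases "snd z \<in> \<Omega>")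
        case True
        have l1: "\<forall>\<^sub>F k in sequentially. 1 = ?\<zeta> k (snd z)"
          using cutoff_eventually[OF dom(1,2) True] by eventually_elim (simp add: \<kappa>_def)
        have l2: "\<forall>\<^sub>F k in sequentially. 0 = fderiv (?\<zeta> k) (snd z) (w' z) * trunc (?N k) (w' z)"
          using cutoff_eventually[OF dom(1,2) True] by eventually_elim (simp add: \<kappa>_def)
        have c1: "(\<lambda>k. ?\<zeta> k (snd z)) \<longlonglongrightarrow> 1" by (rule Lim_transform_eventually[OF tendsto_const l1])
        have c2: "(\<lambda>k. fderiv (?\<zeta> k) (snd z) (w' z) * trunc (?N k) (w' z)) \<longlonglongrightarrow> 0"
          by (rule Lim_transform_eventually[OF tendsto_const l2])
        have "(\<lambda>k. J k z) \<longlonglongrightarrow> \<eta> (fst z) * (r' z * 0) + ?d (fst z) * (r' z * ((1 * 1 / 2) * (norm (w' z))\<^sup>2))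
          + \<eta> (fst z) * ((1 * 1\<^sup>2) * (r' z * (w' z \<bullet> (wt' z + adv z))))"
          unfolding Je by (intro tendsto_intros c1 c2 damp_tendsto) simp
        then show ?thesis by (simp add: F0_def F1_def)
      qed (simp add: Je F0_def F1_def r_zero)
    qed
    show "AE z in lborel. norm (J k z) \<le> (A * M * C) * G1 z + (B * M) * G0 z + A * (M * G0 z + G2 z + M * G1 z)" for k
      using DL C(2)
    proof eventually_elim
      case (elim z)
      have p: "0 \<le> A * (M * G0 z + G2 z + M * G1 z)" "0 \<le> (B * M) * G0 z" "0 \<le> (A * M * C) * G1 z"
        using A(1) B(1) C(1) M_nonneg Gp by (intro mult_nonneg_nonneg add_nonneg_nonneg; auto)+
      show ?case
      proof (cases "0 < fst z")
        case True
        note tf = trunc_facts[of "?N k" "w' z"]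
        have \<zeta>b: "0 \<le> ?\<zeta> k (snd z)" "?\<zeta> k (snd z) \<le> 1" using cutoff_bounds(1,2)[OF dom(1,2) \<kappa>] by auto
        have x1: "\<bar>\<eta> (fst z) * (r' z * (fderiv (?\<zeta> k) (snd z) (w' z) * trunc (?N k) (w' z)))\<bar> \<le> (A * M * C) * G1 z"
        proof (cases "fst z \<in> {0..T}")
          case T': True
          have "trunc (?N k) (w' z) \<le> (norm (w' z))\<^sup>2"
            using tf(6) inner_ge_zero[of "w' z"] unfolding power2_norm_eq_inner by linarith
          then have "\<bar>fderiv (?\<zeta> k) (snd z) (w' z)\<bar> * \<bar>trunc (?N k) (w' z)\<bar> \<le> (C * L (fst z)) * (norm (w' z))\<^sup>2"
            using elim(2) \<kappa> True tf(4) C(1) L_nonneg by (intro mult_mono) auto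
          from mult_mono[OF A(2) mult_mono[OF r_bound this]]
          have "\<bar>\<eta> (fst z)\<bar> * (\<bar>r' z\<bar> * (\<bar>fderiv (?\<zeta> k) (snd z) (w' z)\<bar> * \<bar>trunc (?N k) (w' z)\<bar>))
            \<le> A * (M * ((C * L (fst z)) * (norm (w' z))\<^sup>2))"
            using A(1) M_nonneg by auto
          then show ?thesis using T' by (simp add: G1_def abs_mult mult_ac)
        qed (use T p in simp)
        have "?\<zeta> k (snd z) * damp (?N k) (w' z) \<le> 1 * 1" using \<zeta>b tf(1,2) by (intro mult_mono) auto
        moreover have "0 \<le> ?\<zeta> k (snd z) * damp (?N k) (w' z)" using \<zeta>b tf(1) by simp
        ultimately have x2: "\<bar>?d (fst z) * (r' z * ((?\<zeta> k (snd z) * damp (?N k) (w' z) / 2) * (norm (w' z))\<^sup>2))\<bar> \<le> (B * M) * G0 z"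
          by (intro b0) linarith+
        have "?\<zeta> k (snd z) * (damp (?N k) (w' z))\<^sup>2 \<le> 1 * 1" using \<zeta>b tf(8) by (intro mult_mono) auto
        moreover have "0 \<le> ?\<zeta> k (snd z) * (damp (?N k) (w' z))\<^sup>2" using \<zeta>b by simp
        ultimately have x3: "\<bar>\<eta> (fst z) * ((?\<zeta> k (snd z) * (damp (?N k) (w' z))\<^sup>2) * (r' z * (w' z \<bullet> (wt' z + adv z))))\<bar>
            \<le> A * (M * G0 z + G2 z + M * G1 z)"
          using elim(1) True by (intro b1) auto
        show ?thesis unfolding Je real_norm_def
          by (intro order_trans[OF abs_triangle_ineq] add_mono x1 x2 x3)
      next
        case False
        then have "J k z = 0" using neg[of "fst z"] by (simp add: Je)
        then show ?thesis using p by simp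
      qed
    qed
  qed (use F0m F1m in auto)
  then have "(LBINT z. F0 z / 2 + F1 z) = 0" using LIMSEQ_unique[OF _ tendsto_const] by (simp add: J0)
  then have "(LBINT z. F0 z) / 2 + (LBINT z. F1 z) = 0" using iF0 iF1 by simp
  then show "(LBINT z. ?d (fst z) * (r' z * (norm (w' z))\<^sup>2)) = - 2 * (LBINT z. \<eta> (fst z) * (r' z * (w' z \<bullet> (wt' z + adv z))))"
    unfolding F0_def F1_def by linarith
  show "integrable lborel (\<lambda>z. ?d (fst z) * (r' z * (norm (w' z))\<^sup>2))" using iF0 by (simp add: F0_def[abs_def])
  show "integrable lborel (\<lambda>z. \<eta> (fst z) * (r' z * (w' z \<bullet> (wt' z + adv z))))" using iF1 by (simp add: F1_def[abs_def])
qed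

end

section \<open>Dissipation and exponential decay\<close>

lemma wderiv_inner:
  fixes f :: "'a::euclidean_space \<Rightarrow> 'b::euclidean_space"
  assumes w: "wderiv U e f g"
  shows "wderiv U e (\<lambda>x. f x \<bullet> b) (\<lambda>x. g x \<bullet> b)"
  unfolding wderiv_def
proof (intro conjI allI impI)
  have [measurable]: "f \<in> borel_measurable borel" "g \<in> borel_measurable borel" using w by (auto simp: wderiv_def)
  show "(\<lambda>x. f x \<bullet> b) \<in> borel_measurable borel" "(\<lambda>x. g x \<bullet> b) \<in> borel_measurable borel" by measurable
  have i: "integrable lborel (\<lambda>x. indicator K x *\<^sub>R f x)" "integrable lborel (\<lambda>x. indicator K x *\<^sub>R g x)"
    if "compact K" "K \<subseteq> U" for K using w that by (auto simp: wderiv_def)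
  show "integrable lborel (\<lambda>x. indicator K x *\<^sub>R (f x \<bullet> b))" "integrable lborel (\<lambda>x. indicator K x *\<^sub>R (g x \<bullet> b))"
    if "compact K" "K \<subseteq> U" for K
    using integrable_inner_left[OF i(1)[OF that], of b] integrable_inner_left[OF i(2)[OF that], of b] by simp_all
  fix \<phi> :: "'a \<Rightarrow> real" assume \<phi>: "test_fun U \<phi>"
  have i1: "integrable lborel (\<lambda>x. fderiv \<phi> x e *\<^sub>R f x)"
    by (rule test_fun_scaleR_integrable[OF test_fun_deriv[OF \<phi>]]) (use i in auto)
  have i2: "integrable lborel (\<lambda>x. \<phi> x *\<^sub>R g x)" by (rule test_fun_scaleR_integrable[OF \<phi>]) (use i in auto)
  have "(LBINT x. fderiv \<phi> x e *\<^sub>R f x) = - (LBINT x. \<phi> x *\<^sub>R g x)"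
    using w \<phi> by (simp add: wderiv_def)
  then have "(LBINT x. fderiv \<phi> x e *\<^sub>R f x) \<bullet> b = - ((LBINT x. \<phi> x *\<^sub>R g x) \<bullet> b)" by simp
  then show "(LBINT x. fderiv \<phi> x e *\<^sub>R (f x \<bullet> b)) = - (LBINT x. \<phi> x *\<^sub>R (g x \<bullet> b))"
    using integral_inner_left[OF i1, where c = b] integral_inner_left[OF i2, where c = b] by simp
qed

lemma L2_component:
  fixes f :: "'a \<Rightarrow> 'b::euclidean_space"
  assumes [measurable]: "f \<in> borel_measurable M" and f2: "integrable M (\<lambda>x. (norm (f x))\<^sup>2)" and b: "norm b = 1"
  shows "integrable M (\<lambda>x. (f x \<bullet> b)\<^sup>2)"
proof (rule Bochner_Integration.integrable_bound[OF f2])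
  have "(f x \<bullet> b)\<^sup>2 \<le> (norm (f x))\<^sup>2" for x
    using Cauchy_Schwarz_ineq2[of "f x" b] b by (simp flip: abs_le_square_iff)
  then show "AE x in M. norm ((f x \<bullet> b)\<^sup>2) \<le> norm ((norm (f x))\<^sup>2)" by simp
qed measurable

text \<open>Green's formula, with \<open>H\<close> for the second derivatives. It is applied to one component \<open>\<partial>\<^sub>j u\<^sub>i\<close> at a time:
  this is weakly differentiable, and \<open>u\<^sub>i\<close> has zero boundary values.\<close>

lemma laplacian_pairing:
  fixes u :: "real^'n \<Rightarrow> real^'n"
  assumes h: "h10 \<Omega> u D" and w: "\<And>j. wderiv \<Omega> (axis j 1) D (\<lambda>x. H x $ j)"
    and Hm: "H \<in> borel_measurable borel" and H2: "integrable lborel (\<lambda>x. (norm (H x))\<^sup>2)"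
  shows "integrable lborel (\<lambda>x. (\<Sum>j\<in>UNIV. H x $ j $ j) \<bullet> u x)"
    and "(LBINT x. (\<Sum>j\<in>UNIV. H x $ j $ j) \<bullet> u x) = - (LBINT x. (norm (D x))\<^sup>2)"
proof -
  have um: "u \<in> borel_measurable lborel" and Dm: "D \<in> borel_measurable lborel"
    and u2: "integrable lborel (\<lambda>x. (norm (u x))\<^sup>2)" and D2: "integrable lborel (\<lambda>x. (norm (D x))\<^sup>2)"
    using h by (simp_all add: h10_def)
  have Hm: "H \<in> borel_measurable lborel" using Hm by simp
  have cu: "integrable lborel (\<lambda>x. (u x $ i)\<^sup>2)" for i
    using L2_component[OF um u2, of "axis i 1"] by (simp add: inner_axis)
  have cD: "integrable lborel (\<lambda>x. (D x $ j $ i)\<^sup>2)" for i j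
    using L2_component[OF Dm D2, of "axis j (axis i 1)"] by (simp add: inner_axis)
  have cH: "integrable lborel (\<lambda>x. (H x $ k $ j $ i)\<^sup>2)" for i j k
    using L2_component[OF Hm H2, of "axis k (axis j (axis i 1))"] by (simp add: inner_axis)
  have m: "(\<lambda>x. u x $ i) \<in> borel_measurable lborel" "(\<lambda>x. H x $ k $ j $ i) \<in> borel_measurable lborel" for i j k
    using um Hm by (auto intro!: borel_measurable_nth)
  have iH: "integrable lborel (\<lambda>x. H x $ j $ j $ i * u x $ i)" for i j
    using L2_inner(1)[OF m(2) m(1), of j j i i] cH cu by simp
  have parts: "(LBINT x. (D x $ j $ i)\<^sup>2) = - (LBINT x. H x $ j $ j $ i * u x $ i)" for i j
    using h10_by_parts_weak[OF h wderiv_inner[OF w, of j "axis j (axis i 1)"], of "axis i 1"] cD cH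
    by (simp add: inner_axis power2_eq_square)
  have e: "(\<Sum>j\<in>UNIV. H x $ j $ j) \<bullet> u x = (\<Sum>j\<in>UNIV. \<Sum>i\<in>UNIV. H x $ j $ j $ i * u x $ i)" for x
    unfolding inner_sum_left by (simp add: inner_vec_def)
  show "integrable lborel (\<lambda>x. (\<Sum>j\<in>UNIV. H x $ j $ j) \<bullet> u x)" unfolding e using iH by simp
  have "(norm (D x))\<^sup>2 = (\<Sum>j\<in>UNIV. \<Sum>i\<in>UNIV. (D x $ j $ i)\<^sup>2)" for x
    unfolding power2_norm_eq_inner inner_vec_def by (simp add: power2_eq_square)
  then show "(LBINT x. (\<Sum>j\<in>UNIV. H x $ j $ j) \<bullet> u x) = - (LBINT x. (norm (D x))\<^sup>2)"
    unfolding e using iH cD by (simp add: parts sum_negf)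
qed

text \<open>The gradient \<open>G\<close> of the pressure \<open>p\<close> is orthogonal to divergence free fields with zero boundary
  values.\<close>

lemma pressure_pairing:
  fixes u :: "real^'n \<Rightarrow> real^'n"
  assumes h: "h10 \<Omega> u D" and tr: "AE x in lborel. trace (D x) = 0"
    and w: "\<And>j. wderiv \<Omega> (axis j 1) p (\<lambda>x. G x $ j)" and p2: "integrable lborel (\<lambda>x. (p x)\<^sup>2)"
    and Gm: "G \<in> borel_measurable borel" and G2: "integrable lborel (\<lambda>x. (norm (G x))\<^sup>2)"
  shows "integrable lborel (\<lambda>x. G x \<bullet> u x)" and "(LBINT x. G x \<bullet> u x) = 0"
proof -
  have um: "u \<in> borel_measurable lborel" and Dm: "D \<in> borel_measurable lborel" and pm: "p \<in> borel_measurable lborel"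
    and u2: "integrable lborel (\<lambda>x. (norm (u x))\<^sup>2)" and D2: "integrable lborel (\<lambda>x. (norm (D x))\<^sup>2)"
    using h w by (simp_all add: h10_def wderiv_def)
  have Gm: "G \<in> borel_measurable lborel" using Gm by simp
  have cu: "integrable lborel (\<lambda>x. (u x $ i)\<^sup>2)" for i
    using L2_component[OF um u2, of "axis i 1"] by (simp add: inner_axis)
  have cG: "integrable lborel (\<lambda>x. (G x $ i)\<^sup>2)" for i
    using L2_component[OF Gm G2, of "axis i 1"] by (simp add: inner_axis)
  have cD: "integrable lborel (\<lambda>x. (D x $ j $ i)\<^sup>2)" for i j
    using L2_component[OF Dm D2, of "axis j (axis i 1)"] by (simp add: inner_axis)
  have m: "(\<lambda>x. u x $ i) \<in> borel_measurable lborel" "(\<lambda>x. G x $ i) \<in> borel_measurable lborel"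
    "(\<lambda>x. D x $ i $ i) \<in> borel_measurable lborel" for i
    using um Gm Dm by (auto intro!: borel_measurable_nth)
  have iG: "integrable lborel (\<lambda>x. G x $ j * u x $ j)" for j
    using L2_inner(1)[OF m(2) m(1), of j j] cG cu by simp
  have iD: "integrable lborel (\<lambda>x. p x * D x $ j $ j)" for j
    using L2_inner(1)[OF pm m(3), of j] p2 cD by simp
  have parts: "(LBINT x. G x $ j * u x $ j) = - (LBINT x. p x * D x $ j $ j)" for j
    using h10_by_parts_weak[OF h w p2 cG, of j "axis j 1"] by (simp add: inner_axis)
  show "integrable lborel (\<lambda>x. G x \<bullet> u x)" unfolding inner_vec_def using iG by simp
  have "(LBINT x. G x \<bullet> u x) = - (LBINT x. (\<Sum>j\<in>UNIV. p x * D x $ j $ j))"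
    unfolding inner_vec_def using iG iD by (simp add: parts sum_negf)
  also have "(LBINT x. (\<Sum>j\<in>UNIV. p x * D x $ j $ j)) = (\<integral>x. 0 \<partial>(lborel :: (real^'n) measure))"
  proof (rule integral_cong_AE)
    show "(\<lambda>x. \<Sum>j\<in>UNIV. p x * D x $ j $ j) \<in> borel_measurable lborel"
      by (intro borel_measurable_sum borel_measurable_integrable[OF iD])
    show "AE x in lborel. (\<Sum>j\<in>UNIV. p x * D x $ j $ j) = 0"
      using tr by eventually_elim (simp add: trace_def flip: sum_distrib_left)
  qed simp
  finally show "(LBINT x. G x \<bullet> u x) = 0" by simp
qed

context kinetic
begin

text \<open>The Poincare inequality and the bounds on the density turn the energy balance into \<open>N' \<le> - \<beta> N\<close> in the
  sense of distributions. Using \<open>e\<^sup>\<beta>\<^sup>t \<theta>(t)\<close> as a test function makes this the weak monotonicity of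
  \<open>e\<^sup>\<beta>\<^sup>t N(t)\<close>, which holds pointwise as \<open>N\<close> is continuous.\<close>

theorem energy_decay:
  assumes dissipation: "AE t in lborel. 0 < t \<longrightarrow>
      (LBINT x. r t x * (w t x \<bullet> (wt t x + adv (t, x)))) = - \<mu> * (LBINT x. (norm (D t x))\<^sup>2)"
    and poincare: "AE t in lborel. 0 < t \<longrightarrow> (LBINT x. (norm (w t x))\<^sup>2) \<le> c * (LBINT x. (norm (D t x))\<^sup>2)"
    and density: "AE t in lborel. 0 < t \<longrightarrow> (AE x in lborel. 0 \<le> r t x \<and> r t x \<le> b)"
    and pos: "0 < \<mu>" "0 < b" "0 < c"
    and cN: "continuous_on {0..} N"
    and N: "AE t in lborel. 0 < t \<longrightarrow> N t = (LBINT x. r t x * (norm (w t x))\<^sup>2)"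
    and t: "0 \<le> t"
  shows "N t \<le> exp (- (2 * \<mu> / (b * c)) * t) * N 0"
proof -
  define \<beta> where "\<beta> = 2 * \<mu> / (b * c)"
  define E where "E \<tau> = (LBINT x. r \<tau> x * (norm (w \<tau> x))\<^sup>2)" for \<tau>
  define I where "I \<tau> = (LBINT x. r \<tau> x * (w \<tau> x \<bullet> (wt \<tau> x + adv (\<tau>, x))))" for \<tau>
  have E_slab: "integrable lborel (\<lambda>\<tau>. indicator {0..T} \<tau> * E \<tau>)" for T
  proof -
    have "integrable lborel (\<lambda>z. indicator {0..T} (fst z) * (r' z * (norm (w' z))\<^sup>2))"
    proof (rule Bochner_Integration.integrable_bound)
      show "integrable lborel (\<lambda>z. M * (indicator {0..T} (fst z) * (norm (w' z))\<^sup>2))" using slab_w by simp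
      show "AE z in lborel. norm (indicator {0..T} (fst z) * (r' z * (norm (w' z))\<^sup>2))
          \<le> norm (M * (indicator {0..T} (fst z) * (norm (w' z))\<^sup>2))"
        using r_bound M_nonneg by (intro AE_I2) (auto simp: abs_mult indicator_def intro!: mult_right_mono)
    qed measurable
    from integral_prod(4)[OF this] show ?thesis by (simp add: E_def)
  qed
  have Em[measurable]: "E \<in> borel_measurable borel" unfolding E_def[abs_def] by measurable
  \<comment> \<open>the energy inequality, at almost every time\<close>
  have below: "AE \<tau> in lborel. 0 < \<tau> \<longrightarrow> \<beta> * E \<tau> \<le> - 2 * I \<tau>"
    using dissipation poincare density w_h10
  proof eventually_elim
    case (elim \<tau>)
    show ?case
    proof
      assume \<tau>: "0 < \<tau>"
      have "E \<tau> \<le> (LBINT x. b * (norm (w \<tau> x))\<^sup>2)" unfolding E_def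
      proof (rule integral_mono_AE')
        show "integrable lborel (\<lambda>x. b * (norm (w \<tau> x))\<^sup>2)" using elim(4) \<tau> by (simp add: h10_def)
        show "AE x in lborel. r \<tau> x * (norm (w \<tau> x))\<^sup>2 \<le> b * (norm (w \<tau> x))\<^sup>2"
          using elim(3)[rule_format, OF \<tau>] by eventually_elim (auto intro!: mult_right_mono)
      qed (use pos in simp)
      also have "\<dots> \<le> b * (c * (LBINT x. (norm (D \<tau> x))\<^sup>2))" using elim(2) \<tau> pos by simp
      finally have "\<beta> * E \<tau> \<le> \<beta> * (b * (c * (LBINT x. (norm (D \<tau> x))\<^sup>2)))"
        using pos by (intro mult_left_mono) (auto simp: \<beta>_def)
      also have "\<dots> = 2 * \<mu> * (LBINT x. (norm (D \<tau> x))\<^sup>2)" using pos by (simp add: \<beta>_def)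
      also have "\<dots> = - 2 * I \<tau>" using elim(1) \<tau> by (simp add: I_def)
      finally show "\<beta> * E \<tau> \<le> - 2 * I \<tau>" .
    qed
  qed
  have weak: "0 \<le> (LBINT \<tau>. fderiv \<theta> \<tau> 1 * (exp (\<beta> * \<tau>) * E \<tau>))"
    if \<theta>: "test_fun {0<..} \<theta>" and \<theta>p: "\<And>\<tau>. 0 \<le> \<theta> \<tau>" for \<theta> :: "real \<Rightarrow> real"
  proof -
    define \<eta> where "\<eta> \<tau> = exp (\<beta> * \<tau>) * \<theta> \<tau>" for \<tau>
    obtain K where K: "compact K" "K \<subseteq> {0<..}" "\<And>x. x \<notin> K \<Longrightarrow> \<theta> x = 0" using \<theta> by (auto simp: test_fun_def)
    have "Ck_on k UNIV \<eta>" for k unfolding \<eta>_def[abs_def] by (intro Ck_on_mult Ck_on_exp test_fun_Ck[OF \<theta>])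
    then have \<eta>: "test_fun {0<..} \<eta>"
      unfolding test_fun_def smooth_on_def using K by (intro conjI exI[of _ K] allI impI) (auto simp: \<eta>_def)
    have D\<eta>: "fderiv \<eta> \<tau> 1 = \<beta> * \<eta> \<tau> + exp (\<beta> * \<tau>) * fderiv \<theta> \<tau> 1" for \<tau>
    proof -
      have "((\<lambda>\<tau>. exp (\<beta> * \<tau>)) has_derivative (\<lambda>h. \<beta> * exp (\<beta> * \<tau>) * h)) (at \<tau>)"
        by (auto intro!: derivative_eq_intros)
      from has_derivative_mult[OF this test_fun_has_derivative[OF \<theta>]]
      have "(\<eta> has_derivative (\<lambda>h. exp (\<beta> * \<tau>) * fderiv \<theta> \<tau> h + \<beta> * exp (\<beta> * \<tau>) * h * \<theta> \<tau>)) (at \<tau>)"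
        by (simp only: \<eta>_def[abs_def])
      then show ?thesis by (simp flip: frechet_derivative_at add: \<eta>_def)
    qed
    note eb = energy_balance[OF \<eta>]
    have i1: "integrable lborel (\<lambda>\<tau>. fderiv \<eta> \<tau> 1 * E \<tau>)"
      using integral_prod(4)[OF eb(1)] by (simp add: E_def)
    have i2: "integrable lborel (\<lambda>\<tau>. \<eta> \<tau> * I \<tau>)"
      using integral_prod(4)[OF eb(2)] by (simp add: I_def)
    have bal: "(LBINT \<tau>. fderiv \<eta> \<tau> 1 * E \<tau>) = - 2 * (LBINT \<tau>. \<eta> \<tau> * I \<tau>)"
      using eb(3) integral_prod(1)[OF eb(1)] integral_prod(1)[OF eb(2)] by (simp add: E_def I_def)
    obtain T where T: "\<And>\<tau>. \<tau> \<notin> {0..T} \<Longrightarrow> \<eta> \<tau> = 0 \<and> (\<forall>h. fderiv \<eta> \<tau> h = 0)"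
      using test_fun_real_support[OF \<eta>] by blast
    obtain A where A: "0 < A" "\<And>\<tau>. \<bar>\<eta> \<tau>\<bar> \<le> A" using test_fun_bounded[OF \<eta>] by auto
    note [measurable] = test_fun_measurable[OF \<eta>]
    have i3: "integrable lborel (\<lambda>\<tau>. \<eta> \<tau> * E \<tau>)"
    proof (rule Bochner_Integration.integrable_bound)
      show "integrable lborel (\<lambda>\<tau>. A * (indicator {0..T} \<tau> * E \<tau>))" using E_slab by simp
      have "\<bar>\<eta> \<tau> * E \<tau>\<bar> \<le> \<bar>A * (indicator {0..T} \<tau> * E \<tau>)\<bar>" for \<tau>
        using T[of \<tau>] A(1) A(2)[of \<tau>] by (cases "\<tau> \<in> {0..T}") (auto simp: abs_mult intro!: mult_right_mono)
      then show "AE \<tau> in lborel. norm (\<eta> \<tau> * E \<tau>) \<le> norm (A * (indicator {0..T} \<tau> * E \<tau>))" by simp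
    qed measurable
    have "(LBINT \<tau>. \<beta> * (\<eta> \<tau> * E \<tau>)) \<le> (LBINT \<tau>. - 2 * (\<eta> \<tau> * I \<tau>))"
    proof (rule integral_mono_AE)
      show "AE \<tau> in lborel. \<beta> * (\<eta> \<tau> * E \<tau>) \<le> - 2 * (\<eta> \<tau> * I \<tau>)"
        using below
      proof eventually_elim
        case (elim \<tau>)
        show ?case
        proof (cases "0 < \<tau>")
          case True
          have "0 \<le> \<eta> \<tau>" using \<theta>p by (simp add: \<eta>_def)
          then have "\<eta> \<tau> * (\<beta> * E \<tau>) \<le> \<eta> \<tau> * (- 2 * I \<tau>)" using elim True by (intro mult_left_mono) auto
          then show ?thesis by (simp add: mult_ac)
        qed (use test_fun_support[OF \<eta>, of \<tau>] in simp)
      qed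
    qed (use i2 i3 in simp_all)
    then have "\<beta> * (LBINT \<tau>. \<eta> \<tau> * E \<tau>) \<le> (LBINT \<tau>. fderiv \<eta> \<tau> 1 * E \<tau>)" using bal by simp
    then have "0 \<le> (LBINT \<tau>. fderiv \<eta> \<tau> 1 * E \<tau> - \<beta> * (\<eta> \<tau> * E \<tau>))" using i1 i3 by simp
    also have "\<dots> = (LBINT \<tau>. fderiv \<theta> \<tau> 1 * (exp (\<beta> * \<tau>) * E \<tau>))"
      by (rule Bochner_Integration.integral_cong) (simp_all add: D\<eta> algebra_simps)
    finally show ?thesis .
  qed
  define f where "f \<tau> = indicator {0..} \<tau> *\<^sub>R (exp (\<beta> * \<tau>) * N \<tau>)" for \<tau>
  have ce: "continuous_on {0..} (\<lambda>\<tau>. exp (\<beta> * \<tau>) * N \<tau>)" by (intro continuous_intros cN)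
  have fm[measurable]: "f \<in> borel_measurable borel"
    unfolding f_def[abs_def] by (intro borel_measurable_continuous_on_indicator ce) auto
  have fc: "isCont f s" if "0 < s" for s
  proof -
    have "continuous_on {0<..} f \<longleftrightarrow> continuous_on {0<..} (\<lambda>\<tau>. exp (\<beta> * \<tau>) * N \<tau>)"
      by (rule continuous_on_cong) (auto simp: f_def)
    moreover have "continuous_on {0<..} (\<lambda>\<tau>. exp (\<beta> * \<tau>) * N \<tau>)" by (rule continuous_on_subset[OF ce]) auto
    ultimately have "continuous_on {0<..} f" by blast
    then show ?thesis using that by (simp add: continuous_on_eq_continuous_at open_greaterThan)
  qed
  have f_slab: "integrable lborel (\<lambda>\<tau>. indicator {0..T} \<tau> * f \<tau>)" for T
  proof -
    have "continuous_on {0..T} (\<lambda>\<tau>. exp (\<beta> * \<tau>) * N \<tau>)" by (rule continuous_on_subset[OF ce]) auto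
    from borel_integrable_atLeastAtMost'[OF this]
    have "integrable lborel (\<lambda>\<tau>. indicator {0..T} \<tau> *\<^sub>R (exp (\<beta> * \<tau>) * N \<tau>))" by (simp add: set_integrable_def)
    moreover have "indicator {0..T} \<tau> *\<^sub>R (exp (\<beta> * \<tau>) * N \<tau>) = indicator {0..T} \<tau> * f \<tau>" for \<tau>
      by (auto simp: f_def indicator_def)
    ultimately show ?thesis by (simp only:)
  qed
  have mono: "f t \<le> f s" if s: "0 < s" "s < t" for s
  proof (rule decreasing_of_weak_derivative[OF s fc fc f_slab])
    fix \<theta> :: "real \<Rightarrow> real" assume \<theta>: "test_fun {0<..} \<theta>" and p: "\<And>\<tau>. 0 \<le> \<theta> \<tau>"
    note [measurable] = test_fun_measurable[OF test_fun_deriv[OF \<theta>]]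
    have "(LBINT \<tau>. fderiv \<theta> \<tau> 1 * f \<tau>)
        = (LBINT \<tau>. fderiv \<theta> \<tau> 1 * (exp (\<beta> * \<tau>) * E \<tau>))"
    proof (rule integral_cong_AE)
      show "AE \<tau> in lborel. fderiv \<theta> \<tau> 1 * f \<tau> = fderiv \<theta> \<tau> 1 * (exp (\<beta> * \<tau>) * E \<tau>)"
        using N
      proof eventually_elim
        case (elim \<tau>)
        then show ?case using test_fun_support[OF test_fun_deriv[OF \<theta>], of \<tau> 1]
          by (cases "0 < \<tau>") (auto simp: f_def E_def)
      qed
    qed measurable
    then show "0 \<le> (LBINT \<tau>. fderiv \<theta> \<tau> 1 * f \<tau>)" using weak[OF \<theta> p] by simp
  qed (use s in auto)
  have "exp (\<beta> * t) * N t \<le> N 0"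
  proof (cases "0 < t")
    case True
    have "((\<lambda>\<tau>. exp (\<beta> * \<tau>) * N \<tau>) \<longlongrightarrow> exp (\<beta> * 0) * N 0) (at 0 within {0..})"
      using ce unfolding continuous_on by (rule bspec) simp
    then have lim: "((\<lambda>\<tau>. exp (\<beta> * \<tau>) * N \<tau>) \<longlongrightarrow> exp (\<beta> * 0) * N 0) (at_right 0)"
      by (rule tendsto_within_subset) auto
    have "\<forall>\<^sub>F s in at_right 0. exp (\<beta> * t) * N t \<le> exp (\<beta> * s) * N s"
      using eventually_at_right_real[OF True]
    proof eventually_elim
      case (elim s)
      then show ?case using mono[of s] by (simp add: f_def)
    qed
    from tendsto_lowerbound[OF lim this] show ?thesis by simp
  qed (use t in simp)
  then have "exp (- \<beta> * t) * (exp (\<beta> * t) * N t) \<le> exp (- \<beta> * t) * N 0" by (intro mult_left_mono) auto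
  moreover have "exp (- \<beta> * t) * (exp (\<beta> * t) * N t) = N t" by (simp flip: exp_add mult.assoc)
  ultimately show ?thesis by (simp only: \<beta>_def)
qed

end

section \<open>Borel representatives of the solution\<close>

lemma borel_rep_slice:
  fixes f :: "'s::euclidean_space \<Rightarrow> 't::euclidean_space \<Rightarrow> 'c::euclidean_space"
  assumes r: "borel_rep (I \<times> \<Omega>) (case_prod f) f'"
  shows "AE t in lborel. t \<in> I \<longrightarrow> borel_rep \<Omega> (f t) (\<lambda>x. f' (t, x))"
  using AE_prodD[OF borel_rep_AE[OF r]]
proof eventually_elim
  case (elim t)
  have "(\<lambda>x. f' (t, x)) \<in> borel_measurable borel"
    by (rule measurable_compose[OF _ borel_rep_measurable[OF r]])
      (intro borel_measurable_continuous_onI continuous_intros)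
  then show ?case using elim borel_rep_0[OF r] by (auto simp: borel_rep_def elim!: eventually_mono)
qed

lemma borel_rep_unique:
  assumes "borel_rep S f f'" "borel_rep S f f''"
  shows "AE x in lborel. f' x = f'' x"
  using borel_rep_AE[OF assms(1)] borel_rep_AE[OF assms(2)]
proof eventually_elim
  case (elim x)
  then show ?case using borel_rep_0[OF assms(1), of x] borel_rep_0[OF assms(2), of x] by (cases "x \<in> S") auto
qed

lemma AE_positive_times: "(AE t in lebesgue_on {0..}. Q t) \<Longrightarrow> AE t in lborel. (0::real) < t \<longrightarrow> Q t"
  using AE_lebesgue_on[of "{0::real..}" Q] by (auto elim!: eventually_mono)

lemma in_LqLp_rep:
  fixes f :: "real \<Rightarrow> 'a::euclidean_space \<Rightarrow> 'b::euclidean_space"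
  assumes \<Omega>: "open \<Omega>" and f: "in_LqLp q p {0..} \<Omega> f"
  shows "\<exists>f'. borel_rep ({0<..} \<times> \<Omega>) (case_prod f) f'"
proof (rule borel_rep_exists)
  have "open (({0<..} :: real set) \<times> \<Omega>)" using \<Omega> by (intro open_Times open_greaterThan)
  then show "({0<..} :: real set) \<times> \<Omega> \<in> sets borel" by simp
  have "case_prod f \<in> borel_measurable (lebesgue_on ({0..} \<times> \<Omega>))" using f by (simp add: in_LqLp_def)
  then show "case_prod f \<in> borel_measurable (lebesgue_on ({0<..} \<times> \<Omega>))" by (rule measurable_restrict_mono) auto
qed

lemma in_LqLp_AE: "in_LqLp q p {0..} \<Omega> f \<Longrightarrow> AE t in lborel. 0 < t \<longrightarrow> in_Lp p (lebesgue_on \<Omega>) (f t)"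
  by (rule AE_positive_times) (simp add: in_LqLp_def)

lemma in_LqLp_infinity_bound:
  assumes f: "in_LqLp \<infinity> p {0..} \<Omega> f"
  shows "\<exists>C\<ge>0. AE t in lborel. 0 < t \<longrightarrow> in_Lp p (lebesgue_on \<Omega>) (f t) \<and> Lp_norm p (lebesgue_on \<Omega>) (f t) \<le> ennreal C"
proof -
  let ?g = "\<lambda>t. enn2real (Lp_norm p (lebesgue_on \<Omega>) (f t))"
  define C where "C = enn2real (Lp_norm \<infinity> (lebesgue_on {0..}) ?g)"
  have fin: "Lp_norm \<infinity> (lebesgue_on {0..}) ?g < \<infinity>" using f by (simp add: in_LqLp_def)
  then have C: "Lp_norm \<infinity> (lebesgue_on {0..}) ?g = ennreal C" by (simp add: C_def less_top)
  have "AE t in lebesgue_on {0..}. ennreal (norm (?g t)) \<le> Lp_norm \<infinity> (lebesgue_on {0..}) ?g"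
    unfolding Lp_norm_def if_P[OF refl] by (rule esssup_AE)
  then have "AE t in lborel. 0 < t \<longrightarrow> ennreal (norm (?g t)) \<le> ennreal C" unfolding C by (rule AE_positive_times)
  then have "AE t in lborel. 0 < t \<longrightarrow> in_Lp p (lebesgue_on \<Omega>) (f t) \<and> Lp_norm p (lebesgue_on \<Omega>) (f t) \<le> ennreal C"
    using in_LqLp_AE[OF f]
  proof eventually_elim
    case (elim t)
    then show ?case by (auto simp: in_Lp_def less_top)
  qed
  then show ?thesis by (intro exI[of _ C]) (simp add: C_def)
qed

lemma L2_bound_rep:
  assumes "S \<in> sets borel" "borel_rep S f f'" "in_Lp 2 (lebesgue_on S) f" "Lp_norm 2 (lebesgue_on S) f \<le> ennreal C" "0 \<le> C"
  shows "(LBINT x. (norm (f' x))\<^sup>2) \<le> C\<^sup>2"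
proof -
  have "ennreal (LBINT x. (norm (f' x))\<^sup>2) \<le> ennreal C * ennreal C"
    using mult_mono[OF assms(4,4)] in_L2_rep(2)[OF assms(1-3)] by simp
  then show ?thesis using assms(5) by (simp add: power2_eq_square flip: ennreal_mult)
qed

text \<open>Changing a representative on a null set makes an almost everywhere bound hold everywhere.\<close>

lemma bounded_rep:
  fixes \<rho> :: "real \<Rightarrow> 'a::euclidean_space \<Rightarrow> real"
  assumes \<Omega>: "open \<Omega>" and \<rho>: "in_LqLp \<infinity> \<infinity> {0..} \<Omega> \<rho>"
  shows "\<exists>r M. borel_rep ({0<..} \<times> \<Omega>) (case_prod \<rho>) r \<and> (\<forall>z. \<bar>r z\<bar> \<le> M)"
proof -
  obtain r0 where r0: "borel_rep ({0<..} \<times> \<Omega>) (case_prod \<rho>) r0" using in_LqLp_rep[OF assms] by blast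
  obtain M where M: "0 \<le> M" "AE t in lborel. 0 < t \<longrightarrow> in_Lp \<infinity> (lebesgue_on \<Omega>) (\<rho> t) \<and> Lp_norm \<infinity> (lebesgue_on \<Omega>) (\<rho> t) \<le> ennreal M"
    using in_LqLp_infinity_bound[OF \<rho>] by blast
  note [measurable] = borel_rep_measurable[OF r0]
  have "AE z in lborel. \<bar>r0 z\<bar> \<le> M"
  proof (rule AE_prodI)
    show "AE t in lborel. AE x in lborel. \<bar>r0 (t, x)\<bar> \<le> M"
      using M(2) borel_rep_slice[OF r0]
    proof eventually_elim
      case (elim t)
      show ?case
      proof (cases "0 < t")
        case True
        have "AE x in lebesgue_on \<Omega>. ennreal (norm (\<rho> t x)) \<le> Lp_norm \<infinity> (lebesgue_on \<Omega>) (\<rho> t)"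
          unfolding Lp_norm_def if_P[OF refl] by (rule esssup_AE)
        then have "AE x in lborel. x \<in> \<Omega> \<longrightarrow> ennreal (norm (\<rho> t x)) \<le> Lp_norm \<infinity> (lebesgue_on \<Omega>) (\<rho> t)"
          using AE_lebesgue_on[of \<Omega>] \<Omega> by simp
        moreover have "AE x in lborel. x \<in> \<Omega> \<longrightarrow> \<rho> t x = r0 (t, x)"
          using elim(2) True by (auto simp: borel_rep_def)
        ultimately show ?thesis
        proof eventually_elim
          case (elim x)
          show ?case
          proof (cases "x \<in> \<Omega>")
            case x: True
            have "ennreal \<bar>r0 (t, x)\<bar> \<le> ennreal M" using elim x \<open>0 < t \<longrightarrow> _\<close> True by (metis order_trans real_norm_def)
            then show ?thesis using M(1) by simp
          qed (use borel_rep_0[OF r0] M(1) in simp)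
        qed
      qed (use borel_rep_0[OF r0] M(1) in simp)
    qed
  qed measurable
  then have "AE z in lborel. r0 z = (if \<bar>r0 z\<bar> \<le> M then r0 z else 0)" by (auto elim!: eventually_mono)
  then have "AE z in lborel. z \<in> {0<..} \<times> \<Omega> \<longrightarrow> case_prod \<rho> z = (if \<bar>r0 z\<bar> \<le> M then r0 z else 0)"
    using borel_rep_AE[OF r0] by eventually_elim simp
  then have "borel_rep ({0<..} \<times> \<Omega>) (case_prod \<rho>) (\<lambda>z. if \<bar>r0 z\<bar> \<le> M then r0 z else 0)"
    using borel_rep_0[OF r0] by (auto simp: borel_rep_def)
  then show ?thesis using M(1) by (intro exI[of _ "\<lambda>z. if \<bar>r0 z\<bar> \<le> M then r0 z else 0"] exI[of _ M]) auto
qed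

text \<open>The essential supremum is at most \<open>y\<close> if and only if the indicator of the set where the function exceeds
  \<open>y\<close> has integral zero, and such integrals are measurable in the parameter by Tonelli's theorem.\<close>

lemma esssup_measurable:
  fixes f :: "'s::euclidean_space \<times> 't::euclidean_space \<Rightarrow> 'c::euclidean_space"
  assumes [measurable]: "f \<in> borel_measurable borel"
  shows "(\<lambda>t. esssup lborel (\<lambda>x. ennreal (norm (f (t, x))))) \<in> borel_measurable borel"
proof (rule borel_measurableI_le)
  fix y :: ennreal
  have [measurable]: "(\<lambda>x. f (t, x)) \<in> borel_measurable borel" for t
    by (rule measurable_compose[OF _ assms]) (intro borel_measurable_continuous_onI continuous_intros)
  define g :: "'s \<Rightarrow> 't \<Rightarrow> ennreal" where "g t x = (if ennreal (norm (f (t, x))) \<le> y then 0 else 1)" for t x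
  have gm: "g t \<in> borel_measurable borel" for t unfolding g_def[abs_def] by measurable
  have sets: "sets ((borel :: 's measure) \<Otimes>\<^sub>M (lborel :: 't measure)) = sets borel"
    by (subst borel_prod[symmetric]) (intro sets_pair_measure_cong refl sets_lborel)
  have "(\<lambda>(t, x). g t x) \<in> borel_measurable borel"
    unfolding g_def by (simp add: case_prod_beta')
  then have "(\<lambda>(t, x). g t x) \<in> borel_measurable (borel \<Otimes>\<^sub>M lborel)"
    by (simp only: measurable_cong_sets[OF sets refl])
  then have [measurable]: "(\<lambda>t. \<integral>\<^sup>+x. g t x \<partial>lborel) \<in> borel_measurable borel"
    by (rule lborel.borel_measurable_nn_integral)
  have "esssup lborel (\<lambda>x. ennreal (norm (f (t, x)))) \<le> y \<longleftrightarrow> (\<integral>\<^sup>+x. g t x \<partial>lborel) = 0" for t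
  proof -
    have "esssup lborel (\<lambda>x. ennreal (norm (f (t, x)))) \<le> y \<longleftrightarrow> (AE x in lborel. ennreal (norm (f (t, x))) \<le> y)"
      using esssup_AE[of "\<lambda>x. ennreal (norm (f (t, x)))" lborel]
      by (auto intro!: esssup_I elim!: eventually_mono)
    also have "\<dots> \<longleftrightarrow> (\<integral>\<^sup>+x. g t x \<partial>lborel) = 0"
      by (subst nn_integral_0_iff_AE) (simp_all add: gm, simp add: g_def)
    finally show ?thesis .
  qed
  then show "{t \<in> space borel. esssup lborel (\<lambda>x. ennreal (norm (f (t, x)))) \<le> y} \<in> sets borel" by simp
qed

lemma Lp_norm_1: "Lp_norm 1 M f = (\<integral>\<^sup>+x. ennreal (norm (f x)) \<partial>M)"
proof (cases "(\<integral>\<^sup>+x. ennreal (norm (f x)) \<partial>M) = \<infinity>")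
  case False
  then show ?thesis by (simp add: Lp_norm_def Let_def less_top)
qed (simp add: Lp_norm_def Let_def)

text \<open>The norms \<open>t \<mapsto> \<parallel>f t\<parallel>\<^sub>\<infinity>\<close> need not be Borel; the essential suprema of the slices of the Borel
  representative are, and at almost every time they are bounded by these norms.\<close>

lemma Lipschitz_majorant:
  fixes f :: "real \<Rightarrow> 'a::euclidean_space \<Rightarrow> 'b::euclidean_space"
  assumes \<Omega>: "open \<Omega>" and f: "\<And>T. 0 < T \<Longrightarrow> in_LqLp 1 \<infinity> {0..T} \<Omega> f"
    and r: "borel_rep ({0<..} \<times> \<Omega>) (case_prod f) f'"
  shows "\<exists>L. (\<forall>t. 0 \<le> L t) \<and> L \<in> borel_measurable borel \<and> (\<forall>T. integrable lborel (\<lambda>t. indicator {0..T} t * L t)) \<and>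
    (AE t in lborel. 0 < t \<longrightarrow> (AE x in lborel. norm (f' (t, x)) \<le> L t))"
proof -
  define S where "S t = esssup lborel (\<lambda>x. ennreal (norm (f' (t, x))))" for t
  define L where "L t = enn2real (S t)" for t
  have Sm[measurable]: "S \<in> borel_measurable borel"
    unfolding S_def by (rule esssup_measurable[OF borel_rep_measurable[OF r]])
  have Lm[measurable]: "L \<in> borel_measurable borel" unfolding L_def[abs_def] by measurable
  have \<Omega>b: "\<Omega> \<in> sets borel" using \<Omega> by simp
  have key: "AE t in lborel. 0 < t \<longrightarrow> t \<le> T \<longrightarrow> S t \<le> Lp_norm \<infinity> (lebesgue_on \<Omega>) (f t) \<and> Lp_norm \<infinity> (lebesgue_on \<Omega>) (f t) < \<infinity>"
    if T: "0 < T" for T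
  proof -
    have "AE t in lebesgue_on {0..T}. in_Lp \<infinity> (lebesgue_on \<Omega>) (f t)" using f[OF T] by (simp add: in_LqLp_def)
    then have "AE t in lborel. t \<in> {0..T} \<longrightarrow> in_Lp \<infinity> (lebesgue_on \<Omega>) (f t)" by (subst (asm) AE_lebesgue_on) auto
    then show ?thesis using borel_rep_slice[OF r]
    proof eventually_elim
      case (elim t)
      show ?case
      proof (intro impI conjI)
        assume t: "0 < t" "t \<le> T"
        have rt: "borel_rep \<Omega> (f t) (\<lambda>x. f' (t, x))" using elim t by simp
        have "AE x in lebesgue_on \<Omega>. ennreal (norm (f t x)) \<le> Lp_norm \<infinity> (lebesgue_on \<Omega>) (f t)"
          unfolding Lp_norm_def if_P[OF refl] by (rule esssup_AE)
        then have "AE x in lborel. x \<in> \<Omega> \<longrightarrow> ennreal (norm (f t x)) \<le> Lp_norm \<infinity> (lebesgue_on \<Omega>) (f t)"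
          by (simp add: AE_lebesgue_on[OF \<Omega>b])
        then have ae: "AE x in lborel. ennreal (norm (f' (t, x))) \<le> Lp_norm \<infinity> (lebesgue_on \<Omega>) (f t)"
          using borel_rep_AE[OF rt]
        proof eventually_elim
          case (elim x)
          then show ?case using borel_rep_0[OF rt, of x] by (cases "x \<in> \<Omega>") auto
        qed
        show "S t \<le> Lp_norm \<infinity> (lebesgue_on \<Omega>) (f t)" unfolding S_def
          by (rule esssup_I[OF _ ae]) (use borel_rep_measurable[OF rt] in simp)
        show "Lp_norm \<infinity> (lebesgue_on \<Omega>) (f t) < \<infinity>" using elim t by (simp add: in_Lp_def)
      qed
    qed
  qed
  have int: "integrable lborel (\<lambda>t. indicator {0..T} t * L t)" if T: "0 < T" for T
  proof (rule integrableI_bounded)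
    have "(\<integral>\<^sup>+t. ennreal (norm (indicator {0..T} t * L t)) \<partial>lborel)
        \<le> (\<integral>\<^sup>+t. ennreal (norm (enn2real (Lp_norm \<infinity> (lebesgue_on \<Omega>) (f t)))) * indicator {0..T} t \<partial>lborel)"
    proof (rule nn_integral_mono_AE)
      show "AE t in lborel. ennreal (norm (indicator {0..T} t * L t))
          \<le> ennreal (norm (enn2real (Lp_norm \<infinity> (lebesgue_on \<Omega>) (f t)))) * indicator {0..T} t"
        using key[OF T] AE_lborel_singleton[of "0::real"]
      proof eventually_elim
        case (elim t)
        show ?case
        proof (cases "t \<in> {0..T}")
          case True
          then have "L t \<le> enn2real (Lp_norm \<infinity> (lebesgue_on \<Omega>) (f t))"
            unfolding L_def using elim by (intro enn2real_mono) auto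
          then show ?thesis using True by (simp add: L_def ennreal_leI)
        qed simp
      qed
    qed
    also have "\<dots> = Lp_norm 1 (lebesgue_on {0..T}) (\<lambda>t. enn2real (Lp_norm \<infinity> (lebesgue_on \<Omega>) (f t)))"
      unfolding Lp_norm_1 by (rule nn_integral_lebesgue_on[symmetric]) simp
    also have "\<dots> < \<infinity>" using f[OF T] by (simp add: in_LqLp_def)
    finally show "(\<integral>\<^sup>+t. ennreal (norm (indicator {0..T} t * L t)) \<partial>lborel) < \<infinity>" .
  qed simp
  have "AE t in lborel. \<forall>n::nat. 0 < t \<longrightarrow> t \<le> real (Suc n) \<longrightarrow>
      S t \<le> Lp_norm \<infinity> (lebesgue_on \<Omega>) (f t) \<and> Lp_norm \<infinity> (lebesgue_on \<Omega>) (f t) < \<infinity>"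
    unfolding AE_all_countable by (intro allI key) simp
  then have "AE t in lborel. 0 < t \<longrightarrow> (AE x in lborel. norm (f' (t, x)) \<le> L t)"
  proof eventually_elim
    case (elim t)
    show ?case
    proof
      assume t: "0 < t"
      obtain n :: nat where "t \<le> real n" using real_arch_simple by blast
      then have "t \<le> real (Suc n)" by simp
      then have "S t < \<infinity>" using elim t by (auto intro: le_less_trans)
      then have "S t = ennreal (L t)" by (simp add: L_def less_top)
      moreover have "AE x in lborel. ennreal (norm (f' (t, x))) \<le> S t" unfolding S_def by (rule esssup_AE)
      ultimately have "AE x in lborel. ennreal (norm (f' (t, x))) \<le> ennreal (L t)" by simp
      moreover have "0 \<le> L t" by (simp add: L_def)
      ultimately show "AE x in lborel. norm (f' (t, x)) \<le> L t" by (auto elim!: eventually_mono simp: ennreal_le_iff)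
    qed
  qed
  moreover have "integrable lborel (\<lambda>t. indicator {0..T} t * L t)" for T
    by (rule Bochner_Integration.integrable_bound[OF int[of "max T 1"]]) (auto simp: indicator_def)
  ultimately show ?thesis using Lm by (intro exI[of _ L]) (auto simp: L_def)
qed

lemma cont_L1_rep:
  fixes \<rho> :: "real \<Rightarrow> 'a::euclidean_space \<Rightarrow> real"
  assumes \<Omega>: "open \<Omega>" and c: "cont_Lp 1 {0..} \<Omega> \<rho>"
  shows "\<exists>R. (\<forall>t\<ge>0. borel_rep \<Omega> (\<rho> t) (R t) \<and> integrable lborel (R t)) \<and>
    (\<forall>t\<ge>0. ((\<lambda>s. LBINT x. \<bar>R s x - R t x\<bar>) \<longlongrightarrow> 0) (at t within {0..}))"
proof -
  have \<Omega>b: "\<Omega> \<in> sets borel" using \<Omega> by simp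
  have "\<exists>R. 0 \<le> t \<longrightarrow> borel_rep \<Omega> (\<rho> t) R" for t
    using borel_rep_exists[OF \<Omega>b, of "\<rho> t"] c by (auto simp: cont_Lp_def in_Lp_def)
  then have "\<exists>R. \<forall>t. 0 \<le> t \<longrightarrow> borel_rep \<Omega> (\<rho> t) (R t)" by (intro choice allI)
  then obtain R where R: "\<And>t. 0 \<le> t \<Longrightarrow> borel_rep \<Omega> (\<rho> t) (R t)" by blast
  have int: "integrable lborel (R t)" if t: "0 \<le> t" for t
  proof (rule integrableI_bounded)
    have "(\<integral>\<^sup>+x. ennreal (norm (R t x)) \<partial>lborel) = (\<integral>\<^sup>+x. ennreal (norm (\<rho> t x)) \<partial>lebesgue_on \<Omega>)"
      unfolding nn_integral_lebesgue_on[OF \<Omega>b]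
      by (intro nn_integral_cong_AE)
        (use borel_rep_AE[OF R[OF t]] borel_rep_0[OF R[OF t]] in \<open>auto elim!: eventually_mono simp: indicator_def\<close>)
    also have "\<dots> < \<infinity>" using c t by (simp add: cont_Lp_def in_Lp_def Lp_norm_1)
    finally show "(\<integral>\<^sup>+x. ennreal (norm (R t x)) \<partial>lborel) < \<infinity>" .
  qed (use borel_rep_measurable[OF R[OF t]] in simp)
  have dist: "Lp_norm 1 (lebesgue_on \<Omega>) (\<lambda>x. \<rho> s x - \<rho> t x) = ennreal (LBINT x. \<bar>R s x - R t x\<bar>)"
    if st: "0 \<le> s" "0 \<le> t" for s t
  proof -
    have "Lp_norm 1 (lebesgue_on \<Omega>) (\<lambda>x. \<rho> s x - \<rho> t x) = (\<integral>\<^sup>+x. ennreal \<bar>R s x - R t x\<bar> \<partial>lborel)"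
      unfolding Lp_norm_1 nn_integral_lebesgue_on[OF \<Omega>b]
    proof (rule nn_integral_cong_AE)
      show "AE x in lborel. ennreal (norm (\<rho> s x - \<rho> t x)) * indicator \<Omega> x = ennreal \<bar>R s x - R t x\<bar>"
        using borel_rep_AE[OF R[OF st(1)]] borel_rep_AE[OF R[OF st(2)]]
      proof eventually_elim
        case (elim x)
        then show ?case using borel_rep_0[OF R[OF st(1)], of x] borel_rep_0[OF R[OF st(2)], of x]
          by (cases "x \<in> \<Omega>") auto
      qed
    qed
    also have "\<dots> = ennreal (LBINT x. \<bar>R s x - R t x\<bar>)"
      using int st by (intro nn_integral_eq_integral) auto
    finally show ?thesis .
  qed
  have "((\<lambda>s. LBINT x. \<bar>R s x - R t x\<bar>) \<longlongrightarrow> 0) (at t within {0..})" if t: "0 \<le> t" for t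
  proof (rule tendsto_ennrealD)
    have e: "\<forall>\<^sub>F s in at t within {0..}. Lp_norm 1 (lebesgue_on \<Omega>) (\<lambda>x. \<rho> s x - \<rho> t x) = ennreal (LBINT x. \<bar>R s x - R t x\<bar>)"
      using t by (auto simp: eventually_at_filter dist)
    have "((\<lambda>s. Lp_norm 1 (lebesgue_on \<Omega>) (\<lambda>x. \<rho> s x - \<rho> t x)) \<longlongrightarrow> 0) (at t within {0..})"
      using c t by (simp add: cont_Lp_def)
    from Lim_transform_eventually[OF this e]
    show "((\<lambda>s. ennreal (LBINT x. \<bar>R s x - R t x\<bar>)) \<longlongrightarrow> ennreal 0) (at t within {0..})" by simp
  qed auto
  then show ?thesis using R int by (intro exI[of _ R]) auto
qed

text \<open>Continuity of the squared norm follows from \<open>\<bar>\<bar>a\<bar>\<^sup>2 - \<bar>b\<bar>\<^sup>2\<bar> \<le> \<bar>a - b\<bar>\<^sup>2 + 2 \<bar>a - b\<bar> \<bar>b\<bar>\<close>.\<close>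

lemma cont_L2_rep:
  fixes f :: "real \<Rightarrow> 'a::euclidean_space \<Rightarrow> 'b::euclidean_space"
  assumes \<Omega>: "open \<Omega>" and c: "cont_Lp 2 {0..} \<Omega> f"
  shows "\<exists>S. (\<forall>t\<ge>0. borel_rep \<Omega> (f t) (S t) \<and> integrable lborel (\<lambda>x. (norm (S t x))\<^sup>2)) \<and>
    continuous_on {0..} (\<lambda>t. LBINT x. (norm (S t x))\<^sup>2)"
proof -
  have \<Omega>b: "\<Omega> \<in> sets borel" using \<Omega> by simp
  have "\<exists>S. 0 \<le> t \<longrightarrow> borel_rep \<Omega> (f t) S" for t
    using borel_rep_exists[OF \<Omega>b, of "f t"] c by (auto simp: cont_Lp_def in_Lp_def)
  then have "\<exists>S. \<forall>t. 0 \<le> t \<longrightarrow> borel_rep \<Omega> (f t) (S t)" by (intro choice allI)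
  then obtain S where S: "\<And>t. 0 \<le> t \<Longrightarrow> borel_rep \<Omega> (f t) (S t)" by blast
  have Sm: "S t \<in> borel_measurable lborel" if "0 \<le> t" for t using borel_rep_measurable[OF S[OF that]] by simp
  have S2: "integrable lborel (\<lambda>x. (norm (S t x))\<^sup>2)" if t: "0 \<le> t" for t
    by (rule in_L2_rep(1)[OF \<Omega>b S[OF t]]) (use c t in \<open>simp add: cont_Lp_def\<close>)
  define X where "X s t = (LBINT x. (norm (S s x - S t x))\<^sup>2)" for s t
  define Y where "Y s t = (LBINT x. norm (S s x - S t x) * norm (S t x))" for s t
  define N where "N t = (LBINT x. (norm (S t x))\<^sup>2)" for t
  have D2: "integrable lborel (\<lambda>x. (norm (S s x - S t x))\<^sup>2)" if "0 \<le> s" "0 \<le> t" for s t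
    by (intro L2_diff Sm S2 that)
  have D2m: "(\<lambda>x. S s x - S t x) \<in> borel_measurable lborel" if "0 \<le> s" "0 \<le> t" for s t
    using Sm that by auto
  have Xlim: "((\<lambda>s. X s t) \<longlongrightarrow> 0) (at t within {0..})" if t: "0 \<le> t" for t
  proof (rule tendsto_ennrealD)
    let ?n = "\<lambda>s. Lp_norm 2 (lebesgue_on \<Omega>) (\<lambda>x. f s x - f t x)"
    have e: "?n s * ?n s = ennreal (X s t)" if s: "0 \<le> s" for s
    proof -
      have "?n s * ?n s = (\<integral>\<^sup>+x. ennreal ((norm (S s x - S t x))\<^sup>2) \<partial>lborel)"
        unfolding Lp_norm_2_square nn_integral_lebesgue_on[OF \<Omega>b]
      proof (rule nn_integral_cong_AE)
        show "AE x in lborel. ennreal ((norm (f s x - f t x))\<^sup>2) * indicator \<Omega> x = ennreal ((norm (S s x - S t x))\<^sup>2)"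
          using borel_rep_AE[OF S[OF s]] borel_rep_AE[OF S[OF t]]
        proof eventually_elim
          case (elim x)
          then show ?case using borel_rep_0[OF S[OF s], of x] borel_rep_0[OF S[OF t], of x]
            by (cases "x \<in> \<Omega>") auto
        qed
      qed
      also have "\<dots> = ennreal (X s t)" unfolding X_def by (intro nn_integral_eq_integral D2 s t) auto
      finally show ?thesis .
    qed
    have "(?n \<longlongrightarrow> 0) (at t within {0..})" using c t by (simp add: cont_Lp_def)
    from tendsto_mult_ennreal[OF this this]
    have l: "((\<lambda>s. ?n s * ?n s) \<longlongrightarrow> 0) (at t within {0..})" by simp
    have ev: "\<forall>\<^sub>F s in at t within {0..}. ?n s * ?n s = ennreal (X s t)"
      using t by (auto simp: eventually_at_filter e)
    from Lim_transform_eventually[OF l ev]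
    show "((\<lambda>s. ennreal (X s t)) \<longlongrightarrow> ennreal 0) (at t within {0..})" by simp
  qed (auto simp: X_def)
  have Ylim: "((\<lambda>s. Y (max s 0) t) \<longlongrightarrow> 0) (at t within {0..})" if t: "0 \<le> t" for t
  proof (rule L2_bound_tendsto)
    have ev: "\<forall>\<^sub>F s in at t within {0..}. X s t = X (max s 0) t" using t by (auto simp: eventually_at_filter)
    show "((\<lambda>s. X (max s 0) t) \<longlongrightarrow> 0) (at t within {0..})" by (rule Lim_transform_eventually[OF Xlim[OF t] ev])
    show "\<bar>Y (max s 0) t\<bar> \<le> X (max s 0) t / \<sigma> + \<sigma> * N t" if \<sigma>: "0 < \<sigma>" for s \<sigma> :: real
    proof -
      have "0 \<le> Y (max s 0) t" by (simp add: Y_def)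
      moreover have "Y (max s 0) t \<le> X (max s 0) t / \<sigma> + \<sigma> * N t"
        unfolding X_def Y_def N_def by (rule L2_inner(3)[OF D2m Sm D2 S2 \<sigma>]) (use t in auto)
      ultimately show ?thesis by simp
    qed
  qed (simp add: N_def)
  have "(N \<longlongrightarrow> N t) (at t within {0..})" if t: "0 \<le> t" for t
  proof -
    have "((\<lambda>s. X s t + 2 * Y (max s 0) t) \<longlongrightarrow> 0) (at t within {0..})"
      using tendsto_add[OF Xlim[OF t] tendsto_mult_left[OF Ylim[OF t], of 2]] by simp
    moreover have "norm (N s - N t) \<le> X s t + 2 * Y (max s 0) t" if s: "0 \<le> s" for s
    proof -
      have i: "integrable lborel (\<lambda>x. norm (S s x - S t x) * norm (S t x))"
        by (rule L2_inner(2)[OF D2m Sm D2 S2]) (use s t in auto)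
      have sq: "\<bar>(norm a)\<^sup>2 - (norm b)\<^sup>2\<bar> \<le> (norm (a - b))\<^sup>2 + 2 * (norm (a - b) * norm b)" for a b :: 'b
      proof -
        have "(norm a)\<^sup>2 - (norm b)\<^sup>2 = (norm (a - b))\<^sup>2 + 2 * ((a - b) \<bullet> b)"
          by (simp add: power2_norm_eq_inner algebra_simps inner_commute)
        moreover have "\<bar>(a - b) \<bullet> b\<bar> \<le> norm (a - b) * norm b" by (rule Cauchy_Schwarz_ineq2)
        ultimately show ?thesis using zero_le_power2[of "norm (a - b)"] by linarith
      qed
      have "\<bar>N s - N t\<bar> = \<bar>\<integral>x. (norm (S s x))\<^sup>2 - (norm (S t x))\<^sup>2 \<partial>lborel\<bar>"
        unfolding N_def using S2 s t by simp
      also have "\<dots> \<le> (LBINT x. \<bar>(norm (S s x))\<^sup>2 - (norm (S t x))\<^sup>2\<bar>)" by (rule integral_abs_bound)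
      also have "\<dots> \<le> (LBINT x. (norm (S s x - S t x))\<^sup>2 + 2 * (norm (S s x - S t x) * norm (S t x)))"
        using S2 D2 i s t sq by (intro integral_mono) auto
      also have "\<dots> = X s t + 2 * Y (max s 0) t" unfolding X_def Y_def using D2 i s t by (simp add: max_absorb1)
      finally show ?thesis by simp
    qed
    then have "\<forall>\<^sub>F s in at t within {0..}. norm (N s - N t) \<le> X s t + 2 * Y (max s 0) t"
      by (auto simp: eventually_at_filter)
    ultimately have "((\<lambda>s. N s - N t) \<longlongrightarrow> 0) (at t within {0..})" by (rule Lim_null_comparison[rotated])
    then show ?thesis by (simp add: LIM_zero_iff)
  qed
  then have "continuous_on {0..} N" by (auto simp: continuous_on)
  then show ?thesis using S S2 by (intro exI[of _ S]) (auto simp: N_def[abs_def])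
qed

lemma L2L2_rep:
  fixes f :: "real \<Rightarrow> 'a::euclidean_space \<Rightarrow> 'b::euclidean_space"
  assumes \<Omega>: "open \<Omega>" and f: "in_LqLp 2 2 {0..} \<Omega> f" and r: "borel_rep ({0<..} \<times> \<Omega>) (case_prod f) f'"
  shows "integrable lborel (\<lambda>z. (norm (f' z))\<^sup>2)"
proof -
  have \<Omega>b: "\<Omega> \<in> sets borel" using \<Omega> by simp
  note [measurable] = borel_rep_measurable[OF r]
  define g where "g t = (LBINT x. (norm (f' (t, x)))\<^sup>2)" for t
  have sl: "AE t in lborel. 0 < t \<longrightarrow> integrable lborel (\<lambda>x. (norm (f' (t, x)))\<^sup>2) \<and>
      g t = (enn2real (Lp_norm 2 (lebesgue_on \<Omega>) (f t)))\<^sup>2"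
    using borel_rep_slice[OF r] in_LqLp_AE[OF f]
  proof eventually_elim
    case (elim t)
    show ?case
    proof
      assume t: "0 < t"
      have rt: "borel_rep \<Omega> (f t) (\<lambda>x. f' (t, x))" and ft: "in_Lp 2 (lebesgue_on \<Omega>) (f t)" using elim t by auto
      have "enn2real (Lp_norm 2 (lebesgue_on \<Omega>) (f t) * Lp_norm 2 (lebesgue_on \<Omega>) (f t)) = g t"
        unfolding in_L2_rep(2)[OF \<Omega>b rt ft] g_def by (rule enn2real_ennreal) simp
      then show "integrable lborel (\<lambda>x. (norm (f' (t, x)))\<^sup>2) \<and> g t = (enn2real (Lp_norm 2 (lebesgue_on \<Omega>) (f t)))\<^sup>2"
        using in_L2_rep(1)[OF \<Omega>b rt ft] by (simp add: enn2real_mult power2_eq_square)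
    qed
  qed
  show ?thesis
  proof (rule integrable_prodI)
    show "AE t in lborel. integrable lborel (\<lambda>x. (norm (f' (t, x)))\<^sup>2) \<and> (LBINT x. (norm (f' (t, x)))\<^sup>2) \<le> g t"
      using sl
    proof eventually_elim
      case (elim t)
      then show ?case using borel_rep_0[OF r] by (cases "0 < t") (auto simp: g_def)
    qed
    show "integrable lborel g"
    proof (rule integrableI_bounded)
      show "g \<in> borel_measurable lborel" unfolding g_def[abs_def] by measurable
      have "(\<integral>\<^sup>+t. ennreal (norm (g t)) \<partial>lborel)
          = (\<integral>\<^sup>+t. ennreal ((norm (enn2real (Lp_norm 2 (lebesgue_on \<Omega>) (f t))))\<^sup>2) * indicator {0..} t \<partial>lborel)"
      proof (rule nn_integral_cong_AE)
        show "AE t in lborel. ennreal (norm (g t))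
          = ennreal ((norm (enn2real (Lp_norm 2 (lebesgue_on \<Omega>) (f t))))\<^sup>2) * indicator {0..} t"
          using sl AE_lborel_singleton[of "0::real"]
        proof eventually_elim
          case (elim t)
          then show ?case using borel_rep_0[OF r] by (cases "0 < t") (auto simp: g_def)
        qed
      qed
      also have "\<dots> = (\<integral>\<^sup>+t. ennreal ((norm (enn2real (Lp_norm 2 (lebesgue_on \<Omega>) (f t))))\<^sup>2) \<partial>lebesgue_on {0..})"
        by (rule nn_integral_lebesgue_on[symmetric]) simp
      also have "\<dots> < \<infinity>" by (rule Lp_norm_2_finite) (use f in \<open>simp add: in_LqLp_def\<close>)
      finally show "(\<integral>\<^sup>+t. ennreal (norm (g t)) \<partial>lborel) < \<infinity>" .
    qed
  qed auto
qed

section \<open>Decay of the kinetic energy\<close>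

text \<open>The absolute value accounts for the convention \<open>sqrt (- a) = - sqrt a\<close>.\<close>

lemma norm_sqrt_scaleR_square: "(norm (sqrt a *\<^sub>R y))\<^sup>2 = \<bar>a\<bar> * (norm y)\<^sup>2"
proof -
  have "(sqrt a)\<^sup>2 = \<bar>a\<bar>"
  proof (cases "0 \<le> a")
    case False
    have "(sqrt a)\<^sup>2 = (sqrt (- a))\<^sup>2" by (simp add: real_sqrt_minus)
    then show ?thesis using False by simp
  qed simp
  then show ?thesis by (simp add: power_mult_distrib)
qed

theorem lemma5:
  fixes \<Omega> :: "(real^'n) set"
    and \<mu> \<rho>s C\<^sub>P c \<beta>1 :: real
    and \<rho>0 :: "real^'n \<Rightarrow> real" and v0 :: "real^'n \<Rightarrow> real^'n" and Dv0 :: "real^'n \<Rightarrow> real^'n^'n"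
    and \<rho> :: "real \<Rightarrow> real^'n \<Rightarrow> real" and v :: "real \<Rightarrow> real^'n \<Rightarrow> real^'n"
    and P :: "real \<Rightarrow> real^'n \<Rightarrow> real"
  assumes "CARD('n) = 2 \<or> CARD('n) = 3"
    and "smooth_bounded_domain \<Omega>"
    and "poincare_constant \<Omega> C\<^sub>P"
    and "0 < \<mu>" and "0 < \<rho>s"
    and "INS_data \<Omega> \<rho>s \<rho>0 v0 Dv0"
    and "CARD('n) = 3 \<longrightarrow> well_posedness_constant \<Omega> c \<and> INS_small \<Omega> c \<mu> \<rho>s \<rho>0 v0 Dv0"
    and "INS_solution \<Omega> \<mu> \<rho>0 v0 \<rho> v P"
    and "\<beta>1 = 2 * \<mu> / (\<rho>s * C\<^sub>P\<^sup>2)"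
  shows "\<forall>t\<ge>0. (\<integral>x. \<rho> t x * (norm (v t x))\<^sup>2 \<partial>lebesgue_on \<Omega>)
           \<le> exp (- \<beta>1 * t) * (\<integral>x. \<rho>0 x * (norm (v0 x))\<^sup>2 \<partial>lebesgue_on \<Omega>)"
proof -
  have \<Omega>: "open \<Omega>" "bounded \<Omega>" using assms(2) by (auto simp: smooth_bounded_domain_def)
  have \<Omega>b: "\<Omega> \<in> sets borel" using \<Omega>(1) by simp
  let ?U = "({0<..} :: real set) \<times> \<Omega>"
  have U: "open ?U" using \<Omega>(1) by (intro open_Times open_greaterThan)
  then have Ub: "?U \<in> sets borel" by simp
  have CP: "0 < C\<^sub>P" "\<And>u D. u \<in> H10 \<Omega> \<Longrightarrow> weak_grad \<Omega> u D \<Longrightarrow>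
      Lp_norm 2 (lebesgue_on \<Omega>) u \<le> ennreal C\<^sub>P * Lp_norm 2 (lebesgue_on \<Omega>) (D :: real^'n \<Rightarrow> real^'n^'n)"
    using assms(3) by (auto simp: poincare_constant_def)
  have data: "AE x in lborel. x \<in> \<Omega> \<longrightarrow> 0 \<le> \<rho>0 x \<and> \<rho>0 x \<le> \<rho>s"
    using assms(6) unfolding INS_data_def AE_lebesgue_on[OF \<Omega>b] by blast
  obtain vt Dv D2v DP where
      sW: "weak_deriv ({0<..} \<times> \<Omega>) (1, 0) (\<lambda>(t, x). v t x) (\<lambda>(t, x). vt t x)"
    and sD: "AE t in lebesgue_on {0..}. weak_grad \<Omega> (v t) (Dv t)"
    and sD2: "AE t in lebesgue_on {0..}. weak_grad \<Omega> (Dv t) (D2v t)"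
    and sP: "AE t in lebesgue_on {0..}. in_Lp 2 (lebesgue_on \<Omega>) (P t) \<and> weak_grad \<Omega> (P t) (DP t)"
    and sH: "AE t in lebesgue_on {0..}. v t \<in> H10 \<Omega>"
    and s\<rho>: "in_LqLp \<infinity> \<infinity> {0..} \<Omega> \<rho>"
    and sv: "in_LqLp \<infinity> 2 {0..} \<Omega> v" and sDv: "in_LqLp \<infinity> 2 {0..} \<Omega> Dv"
    and svt: "in_LqLp 2 2 {0..} \<Omega> (\<lambda>t x. sqrt (\<rho> t x) *\<^sub>R vt t x)"
    and sD2v: "in_LqLp 2 2 {0..} \<Omega> D2v" and sDP: "in_LqLp 2 2 {0..} \<Omega> DP"
    and sL: "\<forall>T>0. in_LqLp 1 \<infinity> {0..T} \<Omega> Dv"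
    and s2: "cont_Lp 2 {0..} \<Omega> (\<lambda>t x. sqrt (\<rho> t x) *\<^sub>R v t x)"
    and s1: "\<forall>p. 1 \<le> p \<and> p < \<infinity> \<longrightarrow> cont_Lp p {0..} \<Omega> \<rho>"
    and smass: "\<forall>\<phi> :: real \<times> (real^'n) \<Rightarrow> real. test_fun ({0<..} \<times> \<Omega>) \<phi> \<longrightarrow>
         (\<integral>z. (case z of (t, x) \<Rightarrow> \<rho> t x * fderiv \<phi> (t, x) (1, v t x))
            \<partial>lebesgue_on ({0<..} \<times> \<Omega>)) = 0"
    and smom: "AE z in lebesgue_on ({0<..} \<times> \<Omega>). case z of (t, x) \<Rightarrow>
         \<rho> t x *\<^sub>R vt t x + \<rho> t x *\<^sub>R (\<Sum>j\<in>UNIV. (v t x $ j) *\<^sub>R (Dv t x $ j))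
           - \<mu> *\<^sub>R (\<Sum>j\<in>UNIV. D2v t x $ j $ j) + DP t x = 0"
    and sdiv: "AE z in lebesgue_on ({0<..} \<times> \<Omega>). case z of (t, x) \<Rightarrow> trace (Dv t x) = 0"
    and si: "AE x in lebesgue_on \<Omega>. \<rho> 0 x = \<rho>0 x" "AE x in lebesgue_on \<Omega>. v 0 x = v0 x"
    using assms(8) unfolding INS_solution_def by (elim exE conjE) (rule that; assumption)
  have init: "AE x in lborel. x \<in> \<Omega> \<longrightarrow> \<rho> 0 x = \<rho>0 x" "AE x in lborel. x \<in> \<Omega> \<longrightarrow> v 0 x = v0 x"
    using si by (simp_all add: AE_lebesgue_on[OF \<Omega>b])
  obtain r M where rr: "borel_rep ?U (case_prod \<rho>) (case_prod r)" and M: "\<And>t x. \<bar>r t x\<bar> \<le> M"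
  proof -
    obtain r0 M where "borel_rep ?U (case_prod \<rho>) r0" "\<forall>z. \<bar>r0 z\<bar> \<le> M" using bounded_rep[OF \<Omega>(1) s\<rho>] by blast
    then show ?thesis using that[of "curry r0" M] by simp
  qed
  obtain w where rw: "borel_rep ?U (case_prod v) (case_prod w)" using in_LqLp_rep[OF \<Omega>(1) sv] by (metis case_prod_curry)
  obtain D where rD: "borel_rep ?U (case_prod Dv) (case_prod D)" using in_LqLp_rep[OF \<Omega>(1) sDv] by (metis case_prod_curry)
  obtain H where rH: "borel_rep ?U (case_prod D2v) (case_prod H)" using in_LqLp_rep[OF \<Omega>(1) sD2v] by (metis case_prod_curry)
  obtain G where rG: "borel_rep ?U (case_prod DP) (case_prod G)" using in_LqLp_rep[OF \<Omega>(1) sDP] by (metis case_prod_curry)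
  have "case_prod vt \<in> borel_measurable (lebesgue_on ?U)"
    by (rule locally_integrable_measurable[OF U]) (use sW in \<open>simp add: weak_deriv_def\<close>)
  then obtain wt where rwt: "borel_rep ?U (case_prod vt) (case_prod wt)"
    using borel_rep_exists[OF Ub] by (metis case_prod_curry)
  obtain L where L: "\<And>t. 0 \<le> L t" "L \<in> borel_measurable borel" "\<And>T. integrable lborel (\<lambda>t. indicator {0..T} t * L t)"
      "AE t in lborel. 0 < t \<longrightarrow> (AE x in lborel. norm (case_prod D (t, x)) \<le> L t)"
    using Lipschitz_majorant[OF \<Omega>(1) _ rD] sL by blast
  note slr = borel_rep_slice[OF rr] and slw = borel_rep_slice[OF rw] and slD = borel_rep_slice[OF rD]
    and slH = borel_rep_slice[OF rH] and slG = borel_rep_slice[OF rG]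
  note sl = slr[simplified] slw[simplified] slD[simplified] slH[simplified] slG[simplified]
  obtain C1 where C1: "0 \<le> C1" "AE t in lborel. 0 < t \<longrightarrow> in_Lp 2 (lebesgue_on \<Omega>) (v t) \<and> Lp_norm 2 (lebesgue_on \<Omega>) (v t) \<le> ennreal C1"
    using in_LqLp_infinity_bound[OF sv] by blast
  obtain C2 where C2: "0 \<le> C2" "AE t in lborel. 0 < t \<longrightarrow> in_Lp 2 (lebesgue_on \<Omega>) (Dv t) \<and> Lp_norm 2 (lebesgue_on \<Omega>) (Dv t) \<le> ennreal C2"
    using in_LqLp_infinity_bound[OF sDv] by blast
  \<comment> \<open>one constant bounds both \<open>\<integral> \<bar>w\<bar>\<^sup>2\<close> and \<open>\<integral> \<bar>D\<bar>\<^sup>2\<close>\<close>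
  define V where "V = C1\<^sup>2 + C2\<^sup>2"
  have zero: "case_prod r z = 0" "case_prod w z = 0" "case_prod D z = 0" "case_prod H z = 0" "case_prod G z = 0"
    if "z \<notin> ?U" for z
    using borel_rep_0[OF rr that] borel_rep_0[OF rw that] borel_rep_0[OF rD that] borel_rep_0[OF rH that] borel_rep_0[OF rG that]
    by auto
  have h10: "AE t in lborel. 0 < t \<longrightarrow> h10 \<Omega> (w t) (D t)"
    using sl(2) sl(3) AE_positive_times[OF sH] AE_positive_times[OF sD]
    by eventually_elim (use h10I[OF \<Omega>(1)] in blast)
  have div: "AE t in lborel. AE x in lborel. trace (D t x) = 0"
  proof -
    have "AE z in lborel. z \<in> ?U \<longrightarrow> trace (case_prod Dv z) = 0"
      using sdiv unfolding AE_lebesgue_on[OF Ub] by (simp add: case_prod_beta')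
    then have "AE z in lborel. trace (case_prod D z) = 0"
      using borel_rep_AE[OF rD]
    proof eventually_elim
      case (elim z)
      then show ?case using zero(3)[of z] by (cases "z \<in> ?U") (auto simp: trace_def)
    qed
    from AE_prodD[OF this] show ?thesis by simp
  qed
  have kin: "kinetic \<Omega> w D L V r M wt"
  proof unfold_locales
    show "open \<Omega>" "bounded \<Omega>" "- \<Omega> \<subseteq> closure (interior (- \<Omega>))"
      using \<Omega> smooth_domain_exterior[OF assms(2)] by auto
    show wb: "case_prod w \<in> borel_measurable borel" "case_prod r \<in> borel_measurable borel" "case_prod D \<in> borel_measurable borel"
      using borel_rep_measurable[OF rw] borel_rep_measurable[OF rr] borel_rep_measurable[OF rD] by auto
    show "w t x = 0" "r t x = 0" "D t x = 0" if "x \<notin> \<Omega>" for t x using zero(1-3)[of "(t, x)"] that by auto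
    show "AE t in lborel. 0 < t \<longrightarrow> h10 \<Omega> (w t) (D t)" by (rule h10)
    show "AE t in lborel. 0 < t \<longrightarrow> (AE x in lborel. trace (D t x) = 0)" using div by eventually_elim simp
    show "AE t in lborel. 0 < t \<longrightarrow> (AE x in lborel. norm (D t x) \<le> L t)" using L(4) by simp
    show "0 \<le> L t" "integrable lborel (\<lambda>t. indicator {0..T} t * L t)" "L \<in> borel_measurable borel" for t T
      by (rule L)+
    show "0 \<le> V" by (simp add: V_def)
    show "AE t in lborel. 0 < t \<longrightarrow> (LBINT x. (norm (w t x))\<^sup>2) \<le> V"
      using sl(2) C1(2)
    proof eventually_elim
      case (elim t)
      show ?case
      proof
        assume t: "0 < t"
        have "(LBINT x. (norm (w t x))\<^sup>2) \<le> C1\<^sup>2"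
          by (rule L2_bound_rep[OF \<Omega>b, of "v t"]) (use elim t C1(1) in auto)
        then show "(LBINT x. (norm (w t x))\<^sup>2) \<le> V"
          using zero_le_power2[of C2] unfolding V_def by linarith
      qed
    qed
    show "AE t in lborel. 0 < t \<longrightarrow> (LBINT x. (norm (D t x))\<^sup>2) \<le> V"
      using sl(3) C2(2)
    proof eventually_elim
      case (elim t)
      show ?case
      proof
        assume t: "0 < t"
        have "(LBINT x. (norm (D t x))\<^sup>2) \<le> C2\<^sup>2"
          by (rule L2_bound_rep[OF \<Omega>b, of "Dv t"]) (use elim t C2(1) in auto)
        then show "(LBINT x. (norm (D t x))\<^sup>2) \<le> V"
          using zero_le_power2[of C1] unfolding V_def by linarith
      qed
    qed
    show "\<bar>r t x\<bar> \<le> M" for t x by (rule M)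
    show "(LBINT z. r (fst z) (snd z) * fderiv \<phi> z (1, w (fst z) (snd z))) = 0"
      if \<phi>: "test_fun ?U \<phi>" for \<phi>
    proof -
      note [measurable] = measurable_uncurry[OF wb(1)] measurable_uncurry[OF wb(2)] test_fun_deriv_measurable[OF \<phi>]
      have "(\<integral>z. (case z of (t, x) \<Rightarrow> \<rho> t x * fderiv \<phi> (t, x) (1, v t x)) \<partial>lebesgue_on ?U)
          = (LBINT z. r (fst z) (snd z) * fderiv \<phi> z (1, w (fst z) (snd z)))"
      proof (rule integral_lebesgue_on(1)[OF Ub])
        show "(\<lambda>z. r (fst z) (snd z) * fderiv \<phi> z (1, w (fst z) (snd z))) \<in> borel_measurable borel"
          by measurable
        show "AE z in lborel. z \<in> ?U \<longrightarrow> (case z of (t, x) \<Rightarrow> \<rho> t x * fderiv \<phi> (t, x) (1, v t x))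
            = r (fst z) (snd z) * fderiv \<phi> z (1, w (fst z) (snd z))"
          using borel_rep_AE[OF rr] borel_rep_AE[OF rw] by eventually_elim (auto simp: case_prod_beta')
        show "r (fst z) (snd z) * fderiv \<phi> z (1, w (fst z) (snd z)) = 0" if "z \<notin> ?U" for z
          using zero(1)[OF that] by (simp add: case_prod_beta')
      qed
      then show ?thesis using smass \<phi> by simp
    qed
    show "wderiv ?U (1, 0) (case_prod w) (case_prod wt)" by (rule weak_deriv_imp_wderiv[OF U _ rw rwt]) (use sW in simp)
    have "borel_rep ?U (\<lambda>(t, x). sqrt (\<rho> t x) *\<^sub>R vt t x) (\<lambda>z. sqrt (case_prod r z) *\<^sub>R case_prod wt z)"
      unfolding borel_rep_def
    proof (intro conjI allI impI)
      show "(\<lambda>z. sqrt (case_prod r z) *\<^sub>R case_prod wt z) \<in> borel_measurable borel"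
        using borel_rep_measurable[OF rr] borel_rep_measurable[OF rwt] by measurable
      show "AE z in lborel. z \<in> ?U \<longrightarrow> (case z of (t, x) \<Rightarrow> sqrt (\<rho> t x) *\<^sub>R vt t x) = sqrt (case_prod r z) *\<^sub>R case_prod wt z"
        using borel_rep_AE[OF rr] borel_rep_AE[OF rwt] by eventually_elim (auto simp: case_prod_beta')
    qed (simp add: zero(1))
    from L2L2_rep[OF \<Omega>(1) svt this]
    show "integrable lborel (\<lambda>z. \<bar>r (fst z) (snd z)\<bar> * (norm (wt (fst z) (snd z)))\<^sup>2)"
      by (simp only: norm_sqrt_scaleR_square) (simp add: case_prod_beta')
  qed
  interpret kinetic \<Omega> w D L V r M wt by (rule kin)
  have "cont_Lp 1 {0..} \<Omega> \<rho>" using s1 by simp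
  then obtain R where R: "\<And>t. 0 \<le> t \<Longrightarrow> borel_rep \<Omega> (\<rho> t) (R t)" "\<And>t. 0 \<le> t \<Longrightarrow> integrable lborel (R t)"
      "\<And>t. 0 \<le> t \<Longrightarrow> ((\<lambda>s. LBINT x. \<bar>R s x - R t x\<bar>) \<longlongrightarrow> 0) (at t within {0..})"
    using cont_L1_rep[OF \<Omega>(1)] by blast
  have Rr: "AE t in lborel. 0 < t \<longrightarrow> (AE x in lborel. R t x = r t x)"
    using sl(1)
  proof eventually_elim
    case (elim t)
    then show ?case using borel_rep_unique[OF R(1)[of t]] by simp
  qed
  have cd: "continuous_density \<Omega> w D L V r M R" by unfold_locales (use R(2,3) Rr in auto)
  have R0: "AE x in lborel. 0 \<le> R 0 x \<and> R 0 x \<le> \<rho>s"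
    using borel_rep_AE[OF R(1)[OF order_refl]] init(1) data
  proof eventually_elim
    case (elim x)
    then show ?case using borel_rep_0[OF R(1)[OF order_refl], of x] assms(5) by (cases "x \<in> \<Omega>") auto
  qed
  have density: "AE t in lborel. 0 < t \<longrightarrow> (AE x in lborel. 0 \<le> r t x \<and> r t x \<le> \<rho>s)"
    using Rr
  proof eventually_elim
    case (elim t)
    show ?case
    proof
      assume t: "0 < t"
      have "AE x in lborel. 0 \<le> R t x \<and> R t x \<le> \<rho>s"
        by (rule continuous_density.density_bounds[OF cd _ t R0]) (use assms(5) in simp)
      then show "AE x in lborel. 0 \<le> r t x \<and> r t x \<le> \<rho>s" using elim[rule_format, OF t] by eventually_elim simp
    qed
  qed
  obtain S where S: "\<And>t. 0 \<le> t \<Longrightarrow> borel_rep \<Omega> (\<lambda>x. sqrt (\<rho> t x) *\<^sub>R v t x) (S t)"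
      "\<And>t. 0 \<le> t \<Longrightarrow> integrable lborel (\<lambda>x. (norm (S t x))\<^sup>2)"
      "continuous_on {0..} (\<lambda>t. LBINT x. (norm (S t x))\<^sup>2)"
    using cont_L2_rep[OF \<Omega>(1) s2] by blast
  define N where "N t = (LBINT x. (norm (S t x))\<^sup>2)" for t
  have N: "AE t in lborel. 0 < t \<longrightarrow> N t = (LBINT x. r t x * (norm (w t x))\<^sup>2)"
    using sl(1) sl(2) density
  proof eventually_elim
    case (elim t)
    show ?case
    proof
      assume t: "0 < t"
      have rt: "borel_rep \<Omega> (\<rho> t) (r t)" and wt: "borel_rep \<Omega> (v t) (w t)" and St: "borel_rep \<Omega> (\<lambda>x. sqrt (\<rho> t x) *\<^sub>R v t x) (S t)"
        using elim t S(1)[of t] by auto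
      show "N t = (LBINT x. r t x * (norm (w t x))\<^sup>2)" unfolding N_def
      proof (rule integral_cong_AE)
        show "AE x in lborel. (norm (S t x))\<^sup>2 = r t x * (norm (w t x))\<^sup>2"
          using borel_rep_AE[OF rt] borel_rep_AE[OF wt] borel_rep_AE[OF St] elim(3)[rule_format, OF t]
        proof eventually_elim
          case (elim x)
          show ?case
          proof (cases "x \<in> \<Omega>")
            case True
            then have "S t x = sqrt (r t x) *\<^sub>R w t x" using elim by simp
            then show ?thesis using elim by (simp only: norm_sqrt_scaleR_square) simp
          qed (simp add: borel_rep_0[OF rt] borel_rep_0[OF St])
        qed
      qed (use borel_rep_measurable[OF rt] borel_rep_measurable[OF wt] borel_rep_measurable[OF St] in measurable)
    qed
  qed
  have poincare: "AE t in lborel. 0 < t \<longrightarrow> (LBINT x. (norm (w t x))\<^sup>2) \<le> C\<^sub>P\<^sup>2 * (LBINT x. (norm (D t x))\<^sup>2)"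
    using sl(2) sl(3) C1(2) C2(2) AE_positive_times[OF sH] AE_positive_times[OF sD]
  proof eventually_elim
    case (elim t)
    show ?case
    proof
      assume t: "0 < t"
      let ?a = "Lp_norm 2 (lebesgue_on \<Omega>) (v t)" and ?b = "Lp_norm 2 (lebesgue_on \<Omega>) (Dv t)"
      have ab: "?a \<le> ennreal C\<^sub>P * ?b" using elim t CP(2) by blast
      have a: "?a * ?a = ennreal (LBINT x. (norm (w t x))\<^sup>2)" using elim t by (intro in_L2_rep(2)[OF \<Omega>b]) auto
      have b: "?b * ?b = ennreal (LBINT x. (norm (D t x))\<^sup>2)" using elim t by (intro in_L2_rep(2)[OF \<Omega>b]) auto
      have "?a * ?a \<le> (ennreal C\<^sub>P * ennreal C\<^sub>P) * (?b * ?b)" using mult_mono[OF ab ab] by (simp add: mult_ac)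
      then have "ennreal (LBINT x. (norm (w t x))\<^sup>2) \<le> ennreal (C\<^sub>P\<^sup>2 * (LBINT x. (norm (D t x))\<^sup>2))"
        unfolding a b using CP(1) by (simp add: power2_eq_square flip: ennreal_mult)
      then show "(LBINT x. (norm (w t x))\<^sup>2) \<le> C\<^sub>P\<^sup>2 * (LBINT x. (norm (D t x))\<^sup>2)"
        by (simp add: ennreal_le_iff)
    qed
  qed
  have momentum: "AE t in lborel. AE x in lborel. r t x *\<^sub>R (wt t x + adv (t, x)) = \<mu> *\<^sub>R (\<Sum>j\<in>UNIV. H t x $ j $ j) - G t x"
  proof -
    have "AE z in lborel. z \<in> ?U \<longrightarrow> (case z of (t, x) \<Rightarrow>
         \<rho> t x *\<^sub>R vt t x + \<rho> t x *\<^sub>R (\<Sum>j\<in>UNIV. (v t x $ j) *\<^sub>R (Dv t x $ j))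
           - \<mu> *\<^sub>R (\<Sum>j\<in>UNIV. D2v t x $ j $ j) + DP t x = 0)"
      using smom unfolding AE_lebesgue_on[OF Ub] .
    then have "AE z in lborel. r' z *\<^sub>R (wt' z + adv z)
        = \<mu> *\<^sub>R (\<Sum>j\<in>UNIV. H (fst z) (snd z) $ j $ j) - G (fst z) (snd z)"
      using borel_rep_AE[OF rr] borel_rep_AE[OF rw] borel_rep_AE[OF rD] borel_rep_AE[OF rH] borel_rep_AE[OF rG] borel_rep_AE[OF rwt]
    proof eventually_elim
      case (elim z)
      show ?case
      proof (cases "z \<in> ?U")
        case True
        have "r' z *\<^sub>R wt' z + r' z *\<^sub>R adv z - \<mu> *\<^sub>R (\<Sum>j\<in>UNIV. H (fst z) (snd z) $ j $ j) + G (fst z) (snd z) = 0"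
          using elim True by (simp add: case_prod_beta' adv_def)
        then show ?thesis by (simp add: scaleR_add_right algebra_simps add_eq_0_iff2)
      next
        case False
        then show ?thesis using zero[OF False] by (simp add: case_prod_beta')
      qed
    qed
    from AE_prodD[OF this] show ?thesis by simp
  qed
  have dissipation: "AE t in lborel. 0 < t \<longrightarrow>
      (LBINT x. r t x * (w t x \<bullet> (wt t x + adv (t, x)))) = - \<mu> * (LBINT x. (norm (D t x))\<^sup>2)"
    using sl(3) sl(4) sl(5) AE_positive_times[OF sD2] AE_positive_times[OF sP] in_LqLp_AE[OF sD2v] in_LqLp_AE[OF sDP]
      h10 div momentum
  proof eventually_elim
    case (elim t)
    show ?case
    proof
      assume t: "0 < t"
      have h: "h10 \<Omega> (w t) (D t)" and tr: "AE x in lborel. trace (D t x) = 0"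
        and Dt: "borel_rep \<Omega> (Dv t) (D t)" and Ht: "borel_rep \<Omega> (D2v t) (H t)" and Gt: "borel_rep \<Omega> (DP t) (G t)"
        using elim t by auto
      have "P t \<in> borel_measurable (lebesgue_on \<Omega>)" using elim t by (simp add: in_Lp_def)
      then obtain p where p: "borel_rep \<Omega> (P t) p" using borel_rep_exists[OF \<Omega>b] by blast
      have p2: "integrable lborel (\<lambda>x. (p x)\<^sup>2)" using in_L2_rep(1)[OF \<Omega>b p] elim t by simp
      have H2: "integrable lborel (\<lambda>x. (norm (H t x))\<^sup>2)" and G2: "integrable lborel (\<lambda>x. (norm (G t x))\<^sup>2)"
        using in_L2_rep(1)[OF \<Omega>b Ht] in_L2_rep(1)[OF \<Omega>b Gt] elim t by auto
      have wH: "wderiv \<Omega> (axis j 1) (D t) (\<lambda>x. H t x $ j)" for j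
        by (rule weak_deriv_imp_wderiv[OF \<Omega>(1) _ Dt borel_rep_nth[OF Ht]]) (use elim t in \<open>simp add: weak_grad_def\<close>)
      have wG: "wderiv \<Omega> (axis j 1) p (\<lambda>x. G t x $ j)" for j
        by (rule weak_deriv_imp_wderiv[OF \<Omega>(1) _ p borel_rep_nth[OF Gt]]) (use elim t in \<open>simp add: weak_grad_def\<close>)
      note lap = laplacian_pairing[OF h wH borel_rep_measurable[OF Ht] H2]
      note pre = pressure_pairing[OF h tr wG p2 borel_rep_measurable[OF Gt] G2]
      let ?F = "\<lambda>x. \<mu> * ((\<Sum>j\<in>UNIV. H t x $ j $ j) \<bullet> w t x) - G t x \<bullet> w t x"
      have F: "integrable lborel ?F" using lap(1) pre(1) by simp
      have am: "(\<lambda>x. adv (t, x)) \<in> borel_measurable borel"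
        by (rule measurable_compose[OF _ adv_measurable]) (intro borel_measurable_continuous_onI continuous_intros)
      have "(LBINT x. r t x * (w t x \<bullet> (wt t x + adv (t, x)))) = (LBINT x. ?F x)"
      proof (rule integral_cong_AE)
        show "(\<lambda>x. r t x * (w t x \<bullet> (wt t x + adv (t, x)))) \<in> borel_measurable lborel"
          using am by measurable
        show "?F \<in> borel_measurable lborel" using F by simp
        show "AE x in lborel. r t x * (w t x \<bullet> (wt t x + adv (t, x))) = ?F x"
          using elim(10)
        proof eventually_elim
          case (elim x)
          have "r t x * (w t x \<bullet> (wt t x + adv (t, x))) = (r t x *\<^sub>R (wt t x + adv (t, x))) \<bullet> w t x"
            by (simp add: inner_commute)
          also have "\<dots> = ?F x" unfolding elim by (simp add: inner_diff_left)
          finally show ?case .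
        qed
      qed
      also have "\<dots> = - \<mu> * (LBINT x. (norm (D t x))\<^sup>2)" using lap pre by simp
      finally show "(LBINT x. r t x * (w t x \<bullet> (wt t x + adv (t, x)))) = - \<mu> * (LBINT x. (norm (D t x))\<^sup>2)" .
    qed
  qed
  have decay: "N t \<le> exp (- \<beta>1 * t) * N 0" if t: "0 \<le> t" for t
    unfolding assms(9)
    by (rule energy_decay[OF dissipation poincare density assms(4,5) _ _ N t])
      (use CP(1) S(3) in \<open>simp_all add: N_def[abs_def]\<close>)
  have N0: "(\<integral>x. \<rho>0 x * (norm (v0 x))\<^sup>2 \<partial>lebesgue_on \<Omega>) = N 0" unfolding N_def
  proof (rule integral_lebesgue_on(1)[OF \<Omega>b])
    show "(\<lambda>x. (norm (S 0 x))\<^sup>2) \<in> borel_measurable borel" using borel_rep_measurable[OF S(1)[of 0]] by simp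
    show "AE x in lborel. x \<in> \<Omega> \<longrightarrow> \<rho>0 x * (norm (v0 x))\<^sup>2 = (norm (S 0 x))\<^sup>2"
      using borel_rep_AE[OF S(1)[OF order_refl]] init data
    proof eventually_elim
      case (elim x)
      show ?case
      proof
        assume x: "x \<in> \<Omega>"
        then have "S 0 x = sqrt (\<rho>0 x) *\<^sub>R v0 x" using elim by simp
        then show "\<rho>0 x * (norm (v0 x))\<^sup>2 = (norm (S 0 x))\<^sup>2"
          using elim x by (simp only: norm_sqrt_scaleR_square) simp
      qed
    qed
    show "(norm (S 0 x))\<^sup>2 = 0" if "x \<notin> \<Omega>" for x using borel_rep_0[OF S(1)[of 0] that] by simp
  qed
  \<comment> \<open>\<open>\<rho> \<bar>v\<bar>\<^sup>2 \<le> \<bar>\<rho>\<bar> \<bar>v\<bar>\<^sup>2 = \<bar>\<surd>\<rho> v\<bar>\<^sup>2\<close> \<close>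
  have Nt: "(\<integral>x. \<rho> t x * (norm (v t x))\<^sup>2 \<partial>lebesgue_on \<Omega>) \<le> N t" if t: "0 \<le> t" for t
  proof -
    let ?h = "\<lambda>x. (norm (sqrt (\<rho> t x) *\<^sub>R v t x))\<^sup>2"
    have St: "(\<lambda>x. (norm (S t x))\<^sup>2) \<in> borel_measurable borel" using borel_rep_measurable[OF S(1)[OF t]] by simp
    have ae: "AE x in lborel. x \<in> \<Omega> \<longrightarrow> ?h x = (norm (S t x))\<^sup>2"
      using borel_rep_AE[OF S(1)[OF t]] by eventually_elim (intro impI, drule (1) mp, simp only:)
    have z: "(norm (S t x))\<^sup>2 = 0" if "x \<notin> \<Omega>" for x using borel_rep_0[OF S(1)[OF t] that] by simp
    have "(\<integral>x. \<rho> t x * (norm (v t x))\<^sup>2 \<partial>lebesgue_on \<Omega>) \<le> (\<integral>x. ?h x \<partial>lebesgue_on \<Omega>)"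
    proof (rule integral_mono')
      show "integrable (lebesgue_on \<Omega>) ?h" using integral_lebesgue_on(2)[OF \<Omega>b St ae z] S(2)[OF t] by simp
      show "\<rho> t x * (norm (v t x))\<^sup>2 \<le> ?h x" for x
        unfolding norm_sqrt_scaleR_square by (intro mult_right_mono) auto
    qed simp
    also have "\<dots> = N t" unfolding N_def by (rule integral_lebesgue_on(1)[OF \<Omega>b St ae z])
    finally show ?thesis .
  qed
  show ?thesis unfolding N0 using order_trans[OF Nt decay] by blast
qed

end
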